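(* The derivative $q_{t,\beta}'(\sigma)=\partial_\sigma q_{t,\beta}(\sigma)$ is given by $$q_{t,\beta}'(\sigma)=\frac{1}{\sigma\sqrt{t}}\,e^{\frac{t}{12}(\sigma\partial_{\sigma})^{3}}\Bigg(\sum_{p=0}^{\infty}\bigg(\prod_{j=1}^{p}\frac{e^{\sqrt{t}\,(\sum_{i=0}^{j-1}\sigma_{i}\partial_{\sigma_{i}})(\sum_{i=j}^{p}\sigma_{i}\partial_{\sigma_{i}})\partial_{z_{j}}}-1}{\partial_{z_{j}}}\bigg)\prod_{j=0}^{p}L_{\beta}(\sigma_{j},z_{j},z_{j+1})\Bigg)_{z_{0}=\ldots=z_{p+1}=0,\ \sigma_{0}=\ldots=\sigma_{p}=\sigma}.$$
   Context: Let $t>0$, let $\beta$ be a scalar parameter, and let $g$ be a general function with $g(0)=0$ and $g(-\infty)<0$ (conditions for convergence). Let $\{\mathbf{a}_j\}$ be the Airy point process, i.e. the determinantal point process with the Airy kernel $K_{\mathrm{Ai}}(u,v)=\int_0^\infty dr\,\mathrm{Ai}(r+u)\mathrm{Ai}(r+v)$, and define $$q_{t,\beta}(\sigma)=\log\mathbb{E}_{\mathrm{Ai}}\Big[\exp\Big(\beta\sum_{j=1}^\infty g(\sigma e^{t^{1/3}\mathbf{a}_j})\Big)\Big]=\log\mathrm{Det}\big[I-(1-e^{\beta\hat g_{t,\sigma}})K_{\mathrm{Ai}}\big],\qquad \hat g_{t,\sigma}(a)=g(\sigma e^{t^{1/3}a}).$$ The coefficients $a_{n,\beta}$ are those of the expansion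 $1-\exp(\beta g(\sigma e^{t^{1/3}u}))=-\sum_{n=1}^\infty a_{n,\beta}\,\sigma^n e^{n t^{1/3}u}$, and $$L_{\beta}(\sigma,a,b)=\sum_{k=1}^{\infty}(-1)^{k-1}\int_{0}^{\infty}dz_{1}\cdots dz_{k-1}\prod_{\ell=1}^{k}\Big(\sum_{n=1}^{\infty}\frac{a_{n,\beta}\,\sigma^{n}}{\sqrt{4\pi n}}\,e^{-\frac{(z_{\ell}-z_{\ell-1})^{2}}{4n}}\Big)_{z_0=a,\,z_k=b}.$$ Operator notation: $e^{\frac{t}{12}(\sigma\partial_\sigma)^3}$ acts on $\sigma^n$ as multiplication by $e^{tn^3/12}$; $e^{\varepsilon\partial_z}$ is (formally) the shift $z\mapsto z+\varepsilon$, so that $\frac{1-e^{\varepsilon\partial_z}}{\partial_z}f(z)|_{z=0}=\int_\varepsilon^\infty f-\int_0^\infty f$, with $\frac{e^{\varepsilon\partial_z}-1}{\partial_z}=\sum_{m\ge1}\frac{\varepsilon^m}{m!}\partial_z^{m-1}$ when expanded in $\varepsilon$; here $\varepsilon$ is replaced by $\sqrt t$ times the indicated differential operator in the $\sigma_i$.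
   Formalization: Proved for σ<0 as the full asymptotic expansion of q' as σ→0⁻ (the series diverges in general), for real β, g measurable and bounded above on compact intervals; for β<0, exp(βg) must also grow at most polynomially on (-∞,0], since otherwise the expectation can be infinite (e.g. g(x)=x). *)

theory Defs
  imports "HOL-Probability.Probability" "HOL-Library.Landau_Symbols"
    "HOL-Computational_Algebra.Formal_Power_Series"
begin

text \<open>The defining integral of the Airy function converges only conditionally.\<close>

definition Airy_Ai :: "real \<Rightarrow> real" where
  "Airy_Ai x = Lim at_top (\<lambda>R. integral {0..R} (\<lambda>y. cos (y ^ 3 / 3 + x * y))) / pi"

definition Airy_kernel :: "real \<Rightarrow> real \<Rightarrow> real" where
  "Airy_kernel u v = (LINT r:{0..}|lborel. Airy_Ai (r + u) * Airy_Ai (r + v))"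

definition kernel_det :: "(real \<Rightarrow> real \<Rightarrow> real) \<Rightarrow> nat \<Rightarrow> (nat \<Rightarrow> real) \<Rightarrow> real" where
  "kernel_det K n x =
     (\<Sum>p | p permutes {..<n}. of_int (sign p) * (\<Prod>i<n. K (x i) (x (p i))))"

text \<open>
  The points are enumerated by natural numbers, in an arbitrary order. For every \<open>n\<close> the
  \<open>n\<close>-point correlation function, i.e. the density of the expected number of \<open>n\<close>-tuples of
  points with pairwise distinct indices, is the determinant of the kernel.
\<close>

definition determinantal_process ::
    "(real \<Rightarrow> real \<Rightarrow> real) \<Rightarrow> 'w measure \<Rightarrow> (nat \<Rightarrow> 'w \<Rightarrow> real) \<Rightarrow> bool" where
  "determinantal_process K M X \<longleftrightarrow>
     prob_space M \<and> (\<forall>j. X j \<in> borel_measurable M) \<and>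
     (\<forall>n. \<forall>f :: (nat \<Rightarrow> real) \<Rightarrow> ennreal.
        f \<in> borel_measurable (Pi\<^sub>M {..<n} (\<lambda>_. lborel)) \<longrightarrow>
        (\<integral>\<^sup>+ \<omega>. (\<integral>\<^sup>+ j. f (\<lambda>i\<in>{..<n}. X (j i) \<omega>)
              \<partial>count_space {j \<in> {..<n} \<rightarrow>\<^sub>E UNIV. inj_on j {..<n}}) \<partial>M)
        = (\<integral>\<^sup>+ x. f x * ennreal (kernel_det K n x) \<partial>Pi\<^sub>M {..<n} (\<lambda>_. lborel)))"

definition airy_point_process :: "'w measure \<Rightarrow> (nat \<Rightarrow> 'w \<Rightarrow> real) \<Rightarrow> bool" where
  "airy_point_process M X \<longleftrightarrow> determinantal_process Airy_kernel M X"

definition airy_q ::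
    "'w measure \<Rightarrow> (nat \<Rightarrow> 'w \<Rightarrow> real) \<Rightarrow> (real \<Rightarrow> real) \<Rightarrow> real \<Rightarrow> real \<Rightarrow> real \<Rightarrow> real" where
  "airy_q M X g t \<beta> \<sigma> =
     ln (\<integral>\<omega>. exp (\<beta> * (\<Sum>j. g (\<sigma> * exp (root 3 t * X j \<omega>)))) \<partial>M)"

text \<open>
  The factor \<open>exp (t n^3 / 12)\<close> makes the series below divergent in general, so all
  manipulations take place on formal power series in \<open>\<sigma>\<close>, coefficient by coefficient.
  The argument \<open>a\<close> is the sequence of coefficients \<open>a n\<close>, of which only \<open>n \<ge> 1\<close> is used.
\<close>

definition gauss_series :: "(nat \<Rightarrow> real) \<Rightarrow> real \<Rightarrow> real \<Rightarrow> real fps" where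
  "gauss_series a x y =
     Abs_fps (\<lambda>n. if n = 0 then 0
                  else a n / sqrt (4 * pi * real n) * exp (- ((y - x)\<^sup>2) / (4 * real n)))"

text \<open>
  The \<open>k\<close>-th term of \<open>L\<close> is divisible by \<open>\<sigma>^k\<close>, whence the finite range of \<open>k\<close> in the
  coefficient of \<open>\<sigma>^N\<close>.
\<close>

definition L_series :: "(nat \<Rightarrow> real) \<Rightarrow> real \<Rightarrow> real \<Rightarrow> real fps" where
  "L_series a x y = Abs_fps (\<lambda>N. \<Sum>k=1..N. (-1) ^ (k - 1) *
     (LINT z:({1..<k} \<rightarrow>\<^sub>E {0..})|Pi\<^sub>M {1..<k} (\<lambda>_. lborel).
        fps_nth (\<Prod>l=1..k. gauss_series a ((z(0 := x, k := y)) (l - 1))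
                                          ((z(0 := x, k := y)) l)) N))"

text \<open>
  A formal power series in \<open>\<sigma>\<^sub>0, \<dots>, \<sigma>\<^sub>p\<close> whose coefficients are functions of
  \<open>z\<^sub>0, \<dots>, z\<^sub>p\<^sub>+\<^sub>1\<close>, given as the map from exponents \<open>m\<close> to the coefficient of
  \<open>\<Prod>i\<le>p. \<sigma>\<^sub>i ^ m i\<close>.
\<close>

type_synonym sz_series = "(nat \<Rightarrow> nat) \<Rightarrow> (nat \<Rightarrow> real) \<Rightarrow> real"

definition L_product :: "(nat \<Rightarrow> real) \<Rightarrow> nat \<Rightarrow> sz_series" where
  "L_product a p m z = (\<Prod>j\<le>p. fps_nth (L_series a (z j) (z (Suc j))) (m j))"

text \<open>
  The operator \<open>\<sigma>\<^sub>i \<partial>\<^sub>\<sigma>\<^sub>i\<close> multiplies the monomial with exponents \<open>m\<close> by \<open>m i\<close>; this is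
  the resulting eigenvalue of the \<open>\<sigma>\<close>-part of the exponent belonging to \<open>z\<^sub>j\<close>.
\<close>

definition shift_length :: "real \<Rightarrow> nat \<Rightarrow> nat \<Rightarrow> (nat \<Rightarrow> nat) \<Rightarrow> real" where
  "shift_length t p j m = sqrt t * real (\<Sum>i<j. m i) * real (\<Sum>i=j..p. m i)"

text \<open>
  The operator \<open>(exp (\<epsilon> \<partial>\<^sub>z) - 1) / \<partial>\<^sub>z\<close> in the variable \<open>z = z\<^sub>j\<close>, evaluated at \<open>z\<^sub>j = 0\<close>:
  \<open>exp (\<epsilon> \<partial>\<^sub>z)\<close> is the shift by \<open>\<epsilon>\<close>, and the inverse of \<open>\<partial>\<^sub>z\<close> maps \<open>f\<close> to its primitive
  vanishing at infinity, minus the integral of \<open>f\<close> from \<open>z\<close> to infinity.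
\<close>

definition shift_quotient :: "real \<Rightarrow> nat \<Rightarrow> nat \<Rightarrow> sz_series \<Rightarrow> sz_series" where
  "shift_quotient t p j S m z =
     (LINT w:{0..}|lborel. S m (z(j := w)))
     - (LINT w:{shift_length t p j m..}|lborel. S m (z(j := w)))"

text \<open>Setting all \<open>z\<close> to \<open>0\<close> and all \<open>\<sigma>\<^sub>i\<close> to \<open>\<sigma>\<close>.\<close>

definition diagonal_series :: "nat \<Rightarrow> sz_series \<Rightarrow> real fps" where
  "diagonal_series p S =
     Abs_fps (\<lambda>N. \<Sum>m | m \<in> {..p} \<rightarrow>\<^sub>E UNIV \<and> (\<Sum>i\<le>p. m i) = N. S m (\<lambda>_. 0))"

text \<open>
  Since \<open>L\<close> has no constant term, the \<open>p\<close>-th summand is divisible by \<open>\<sigma>^(p+1)\<close>, whence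
  the finite range of \<open>p\<close> in the coefficient of \<open>\<sigma>^N\<close>.
\<close>

definition bracket_series :: "real \<Rightarrow> (nat \<Rightarrow> real) \<Rightarrow> real fps" where
  "bracket_series t a = Abs_fps (\<lambda>N. \<Sum>p<N.
     fps_nth (diagonal_series p (fold (shift_quotient t p) [1..<Suc p] (L_product a p))) N)"

definition exp_cubic_euler :: "real \<Rightarrow> real fps \<Rightarrow> real fps" where
  "exp_cubic_euler t f = Abs_fps (\<lambda>n. exp (t * real n ^ 3 / 12) * fps_nth f n)"

definition q_deriv_series :: "real \<Rightarrow> (nat \<Rightarrow> real) \<Rightarrow> real fps" where
  "q_deriv_series t a =
     fps_const (1 / sqrt t) * (exp_cubic_euler t (bracket_series t a) / fps_X)"

end

theory Submission
  imports Defs "HOL-Complex_Analysis.Complex_Analysis" "Jordan_Normal_Form.Determinant"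
begin

text \<open>
  Put \<open>c = t^(1/3)\<close>, \<open>p x = exp (\<beta> g x) - 1\<close> and, for \<open>\<sigma> < 0\<close>, \<open>\<sigma> = - exp (- c S)\<close>. The exponential of
  the linear statistic is the product of \<open>1 + h (a j)\<close> over the points \<open>a j\<close>, with
  \<open>h x = p (\<sigma> exp (c x)) = f (x - S)\<close> and \<open>f x = p (- exp (c x))\<close>. The determinantal structure turns its
  expectation into the Fredholm determinant of \<open>1 + h K\<close> (\<open>det_process_expectation\<close>). The Airy
  kernel is \<open>A A\<^sup>T\<close> with \<open>A x r = Ai (x + r)\<close>, \<open>r \<ge> 0\<close>, so by the cyclic invariance of the determinant
  and a translation by \<open>S\<close> this is the determinant of \<open>1 + B\<close> on \<open>[S, \<infinity>)\<close> for the fixed kernel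
  \<open>B r s = \<integral> f x Ai (r + x) Ai (s + x) dx\<close> (\<open>fred_det_Airy_eq\<close>). Hence \<open>\<sigma>\<close> only enters through the end
  point \<open>S\<close>, and the derivative of \<open>log Det\<close> with respect to \<open>S\<close> is minus the resolvent kernel at the
  end point (\<open>fred_det_cut_deriv\<close>). So \<open>q\<close> is differentiable and \<open>q' \<sigma> = \<rho> 0 / (c \<sigma>)\<close>, where
  \<open>\<rho> y = B\<^sub>\<sigma> y 0 - \<integral> B\<^sub>\<sigma> y z \<rho> z dz\<close>, the integral being over \<open>z \<ge> 0\<close>, with
  \<open>B\<^sub>\<sigma> y z = \<integral> p (\<sigma> exp (c x)) Ai (y + x) Ai (z + x) dx\<close>.

  Inserting the power series of \<open>p\<close> gives an asymptotic, in general divergent, expansion of \<open>B\<^sub>\<sigma>\<close> in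
  powers of \<open>\<sigma>\<close>. Its coefficients are explicit (\<open>Airy_product_integral\<close>): the one of degree \<open>n\<close> is
  \<open>a n\<close> times a Gaussian in \<open>y - z\<close> of variance \<open>2 n c\<close>, times \<open>exp ((n c)^3 / 12 - n c (y + z) / 2)\<close>. The
  resolvent equation transfers the expansion to \<open>\<rho>\<close> (\<open>resolvent_asymptotics\<close>), whose coefficients
  solve the same equation in formal power series.

  It remains to compare this formal solution with the bracket. The series \<open>L\<close> is the resolvent of
  the Gaussian series on \<open>[0, \<infinity>)\<close> (\<open>L_coeff_rec\<close>). In total degree \<open>N\<close> the shift quotient at a place
  with degree \<open>j\<close> to its left replaces a composition over \<open>[0, \<infinity>)\<close> by the one over \<open>[0, s]\<close>, with
  \<open>s = sqrt t j (N - j)\<close>; summed over the number of places, this changes the half-line in the resolvent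
  equation from \<open>[0, \<infinity>)\<close> to \<open>[s, \<infinity>)\<close> (\<open>bracket_kernel_eq\<close>). On the other side, rescaling the
  variables by \<open>t^(1/6)\<close>, translating the part of degree \<open>j\<close> of \<open>\<rho>\<close> by the same \<open>s\<close> and multiplying
  it by the exponential of a suitable linear function removes the exponential
  factors of the coefficient kernels (\<open>tilt_step\<close>), with \<open>exp (t N^3 / 12)\<close> as the only
  remainder in degree \<open>N\<close>. The two recursions then coincide (\<open>resolvent_coeff_bracket\<close>).
\<close>

section \<open>Gaussian integrals and Plancherel's identity\<close>

lemma norm_integral_le:
  fixes f :: "'a \<Rightarrow> real"
  assumes "integrable M f" "integrable M g" "\<And>x. x \<in> space M \<Longrightarrow> \<bar>f x\<bar> \<le> g x"
  shows "\<bar>integral\<^sup>L M f\<bar> \<le> integral\<^sup>L M g"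
proof -
  have "norm (integral\<^sup>L M f) \<le> (LINT x|M. norm (f x))" by (rule integral_norm_bound)
  also have "\<dots> \<le> integral\<^sup>L M g" using assms by (intro integral_mono) auto
  finally show ?thesis by simp
qed

lemma gaussian_integral:
  fixes d m :: real
  assumes "d > 0"
  shows integrable_gaussian: "integrable lborel (\<lambda>u. exp (- d * (u - m)\<^sup>2))"
    and "(LINT u|lborel. exp (- d * (u - m)\<^sup>2)) = sqrt (pi / d)"
proof -
  define \<sigma> where "\<sigma> = sqrt (1 / (2 * d))"
  have \<sigma>: "\<sigma> > 0" "\<sigma>\<^sup>2 = 1 / (2 * d)" using assms by (auto simp: \<sigma>_def)
  have eq: "exp (- d * (u - m)\<^sup>2) = sqrt (pi / d) * normal_density m \<sigma> u" for u
  proof -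
    have "2 * pi * \<sigma>\<^sup>2 = pi / d" using \<sigma> assms by simp
    moreover have "- (u - m)\<^sup>2 / (2 * \<sigma>\<^sup>2) = - d * (u - m)\<^sup>2" using \<sigma> assms by simp
    ultimately show ?thesis using assms by (simp add: normal_density_def)
  qed
  show "integrable lborel (\<lambda>u. exp (- d * (u - m)\<^sup>2))"
    unfolding eq using \<sigma> by (intro integrable_mult_right integrable_normal_density) auto
  show "(LINT u|lborel. exp (- d * (u - m)\<^sup>2)) = sqrt (pi / d)"
    unfolding eq using \<sigma> by (simp add: integral_normal_density)
qed

lemma integrable_exp_abs:
  fixes d :: real
  assumes d: "d > 0"
  shows "integrable lborel (\<lambda>x. exp (- d * \<bar>x\<bar>))"
proof -
  interpret prob_space "density lborel (exponential_density d)"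
    using prob_space_exponential_density[OF d] .
  have "integrable (density lborel (exponential_density d)) (\<lambda>x. 1 :: real)" by simp
  then have i: "integrable lborel (exponential_density d)"
    using d by (subst (asm) integrable_real_density) (auto simp: exponential_density_nonneg)
  then have i': "integrable lborel (\<lambda>x. exponential_density d (- x))"
    using lborel_integrable_real_affine[of "exponential_density d" "-1" 0] by simp
  have "integrable lborel (\<lambda>x. (1 / d) * (exponential_density d x + exponential_density d (- x)))"
    using i i' by auto
  then show ?thesis
  proof (rule Bochner_Integration.integrable_bound)
    show "AE x in lborel. norm (exp (- d * \<bar>x\<bar>))
        \<le> norm ((1 / d) * (exponential_density d x + exponential_density d (- x)))"
      using d by (auto simp: exponential_density_def mult.commute abs_if divide_simps)
  qed simp
qed

text \<open>Fubini's condition for functions dominated by a product.\<close>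

lemma integrable_pair_bound:
  fixes f :: "'a \<times> 'b \<Rightarrow> 'c :: {banach, second_countable_topology}"
  assumes M: "sigma_finite_measure M1" "sigma_finite_measure M2"
    and f: "f \<in> borel_measurable (M1 \<Otimes>\<^sub>M M2)"
    and p: "integrable M1 p" and q: "integrable M2 q"
    and b: "\<And>x y. x \<in> space M1 \<Longrightarrow> y \<in> space M2 \<Longrightarrow> norm (f (x, y)) \<le> p x * q y"
  shows "integrable (M1 \<Otimes>\<^sub>M M2) f"
proof -
  interpret M1: sigma_finite_measure M1 by fact
  interpret M2: sigma_finite_measure M2 by fact
  interpret pair_sigma_finite M1 M2 ..
  have sec: "integrable M2 (\<lambda>y. f (x, y))" if x: "x \<in> space M1" for x
  proof (rule Bochner_Integration.integrable_bound)
    show "integrable M2 (\<lambda>y. p x * q y)" using q by simp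
    show "(\<lambda>y. f (x, y)) \<in> borel_measurable M2" using f x by measurable
    show "AE y in M2. norm (f (x, y)) \<le> norm (p x * q y)"
      using b[OF x] by (auto intro!: AE_I2 order_trans[OF b[OF x] abs_ge_self])
  qed
  show ?thesis
  proof (rule Fubini_integrable[OF f])
    show "integrable M1 (\<lambda>x. LINT y|M2. norm (f (x, y)))"
    proof (rule Bochner_Integration.integrable_bound)
      show "integrable M1 (\<lambda>x. p x * (LINT y|M2. q y))" using p by simp
      show "(\<lambda>x. LINT y|M2. norm (f (x, y))) \<in> borel_measurable M1"
        using f by (intro M2.borel_measurable_lebesgue_integral) (simp add: case_prod_beta')
      show "AE x in M1. norm (LINT y|M2. norm (f (x, y))) \<le> norm (p x * (LINT y|M2. q y))"
      proof (rule AE_I2)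
        fix x assume x: "x \<in> space M1"
        have "(LINT y|M2. norm (f (x, y))) \<le> (LINT y|M2. p x * q y)"
          using sec[OF x] q b[OF x] by (intro integral_mono) auto
        moreover have "(LINT y|M2. norm (f (x, y))) \<ge> 0" by simp
        ultimately show "norm (LINT y|M2. norm (f (x, y))) \<le> norm (p x * (LINT y|M2. q y))"
          by simp
      qed
    qed
    show "AE x in M1. integrable M2 (\<lambda>y. f (x, y))" using sec by (auto intro!: AE_I2)
  qed
qed

lemmas lborel_pair_bound =
  integrable_pair_bound[OF lborel.sigma_finite_measure_axioms lborel.sigma_finite_measure_axioms]

lemma gaussian_fourier:
  fixes e y :: real
  assumes e: "e > 0"
  shows "(LINT x|lborel. iexp (x * y) * of_real (exp (- (e * x)\<^sup>2 / 2)))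
     = of_real (sqrt (2 * pi) / e * exp (- (y / e)\<^sup>2 / 2))"
proof -
  have "(LINT x|lborel. iexp (x * y) * of_real (exp (- (e * x)\<^sup>2 / 2)))
     = (1 / e) *\<^sub>R (LINT x|lborel. iexp (x * (y / e)) * of_real (exp (- x\<^sup>2 / 2)))"
    by (subst lborel_integral_real_affine[where c = "1 / e" and t = 0]) (use e in auto)
  also have "(LINT x|lborel. iexp (x * (y / e)) * of_real (exp (- x\<^sup>2 / 2)))
     = (LINT x|lborel. of_real (sqrt (2 * pi)) * (std_normal_density x *\<^sub>R iexp ((y / e) * x)))"
    by (intro Bochner_Integration.integral_cong)
       (auto simp: std_normal_density_def scaleR_conv_of_real mult_ac real_sqrt_mult)
  also have "\<dots> = of_real (sqrt (2 * pi)) * (LINT x|lborel. std_normal_density x *\<^sub>R iexp ((y / e) * x))"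
    by (rule integral_mult_right_zero)
  also have "(LINT x|lborel. std_normal_density x *\<^sub>R iexp ((y / e) * x)) = char std_normal_distribution (y / e)"
    unfolding char_def by (subst integral_density) (auto simp: mult.commute)
  also have "\<dots> = of_real (exp (- (y / e)\<^sup>2 / 2))" by (simp add: char_std_normal_distribution)
  finally show ?thesis using e by (simp add: scaleR_conv_of_real)
qed

text \<open>
  Only the special case is needed in which both sides are absolutely integrable. The proof
  inserts a Gaussian factor, exchanges the integrals and removes the factor by dominated
  convergence.
\<close>

lemma plancherel:
  fixes u v :: "real \<Rightarrow> complex"
  assumes cu: "continuous_on UNIV u"
    and iu: "integrable lborel u" and iv: "integrable lborel v"
    and bu: "\<And>x. norm (u x) \<le> B"
  defines "fu \<equiv> \<lambda>x. LINT \<xi>|lborel. iexp (x * \<xi>) * u \<xi>"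
    and "fv \<equiv> \<lambda>x. LINT \<xi>|lborel. iexp (x * \<xi>) * v \<xi>"
  assumes intf: "integrable lborel (\<lambda>x. fu x * cnj (fv x))"
  shows "(LINT x|lborel. fu x * cnj (fv x)) = 2 * pi * (LINT \<xi>|lborel. u \<xi> * cnj (v \<xi>))"
proof -
  define e where "e n = inverse (real (Suc n))" for n
  have e: "e n > 0" for n by (simp add: e_def)
  have e0: "e \<longlonglongrightarrow> 0" unfolding e_def by (rule LIMSEQ_inverse_real_of_nat)
  \<comment> \<open>The Gaussian factor, which tends to 1; the integrals below lead to Gaussian averages
  \<open>G n\<close> of \<open>u\<close>.\<close>
  define g where "g n x = exp (- (e n * x)\<^sup>2 / 2)" for n x
  have cnjm[measurable]: "cnj \<in> borel_measurable borel"
    by (intro borel_measurable_continuous_onI continuous_intros)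
  have g0: "0 \<le> g n x" for n x by (simp add: g_def)
  have um[measurable]: "u \<in> borel_measurable borel" using iu by auto
  have vm[measurable]: "v \<in> borel_measurable borel" using iv by auto
  have fum[measurable]: "fu \<in> borel_measurable borel"
    unfolding fu_def by (rule lborel.borel_measurable_lebesgue_integral) measurable
  have fvm[measurable]: "fv \<in> borel_measurable borel"
    unfolding fv_def by (rule lborel.borel_measurable_lebesgue_integral) measurable
  have gm[measurable]: "g n \<in> borel_measurable borel" for n unfolding g_def by measurable
  have gint: "integrable lborel (g n)" for n
  proof -
    have "g n = (\<lambda>x. exp (- ((e n)\<^sup>2 / 2) * (x - 0)\<^sup>2))"
      by (auto simp: g_def fun_eq_iff power_mult_distrib)
    then show ?thesis using integrable_gaussian[of "(e n)\<^sup>2 / 2" 0] e[of n] by simp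
  qed
  define U where "U = (LINT \<xi>|lborel. norm (u \<xi>))"
  have fub: "norm (fu x) \<le> U" for x
  proof -
    have "norm (fu x) \<le> (LINT \<xi>|lborel. norm (iexp (x * \<xi>) * u \<xi>))"
      unfolding fu_def by (rule integral_norm_bound)
    then show ?thesis by (simp add: norm_mult U_def)
  qed
  have B0: "0 \<le> B" using bu[of 0] norm_ge_zero[of "u 0"] by linarith
  define G where "G n \<xi>' = (LINT s|lborel. u (\<xi>' + e n * s) * of_real (exp (- s\<^sup>2 / 2)))" for n \<xi>'
  have std: "integrable lborel (\<lambda>s :: real. exp (- s\<^sup>2 / 2))" "(LINT s|lborel. exp (- s\<^sup>2 / 2)) = sqrt (2 * pi)"
    using gaussian_integral[of "1/2" 0] by (simp_all add: mult.commute)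
  have inner: "(LINT x|lborel. fu x * of_real (g n x) * iexp (- (x * \<xi>'))) = sqrt (2 * pi) * G n \<xi>'" for n \<xi>'
  proof -
    have "(LINT x|lborel. fu x * of_real (g n x) * iexp (- (x * \<xi>')))
       = (LINT x|lborel. (LINT \<xi>|lborel. iexp (x * (\<xi> - \<xi>')) * u \<xi> * of_real (g n x)))"
    proof (rule Bochner_Integration.integral_cong[OF refl])
      fix x
      have "fu x * of_real (g n x) * iexp (- (x * \<xi>')) = fu x * (of_real (g n x) * iexp (- (x * \<xi>')))" by simp
      also have "\<dots> = (LINT \<xi>|lborel. iexp (x * \<xi>) * u \<xi> * (of_real (g n x) * iexp (- (x * \<xi>'))))"
        unfolding fu_def by (rule integral_mult_left_zero[symmetric])
      also have "\<dots> = (LINT \<xi>|lborel. iexp (x * (\<xi> - \<xi>')) * u \<xi> * of_real (g n x))"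
        by (intro Bochner_Integration.integral_cong)
           (auto simp: algebra_simps exp_diff exp_minus divide_simps)
      finally show "fu x * of_real (g n x) * iexp (- (x * \<xi>')) = \<dots>" .
    qed
    also have "\<dots> = (LINT \<xi>|lborel. (LINT x|lborel. iexp (x * (\<xi> - \<xi>')) * u \<xi> * of_real (g n x)))"
    proof (rule lborel_pair.Fubini_integral)
      show "integrable (lborel \<Otimes>\<^sub>M lborel) (\<lambda>(\<xi>, x). iexp (x * (\<xi> - \<xi>')) * u \<xi> * of_real (g n x))"
        by (rule lborel_pair_bound[where p = "\<lambda>\<xi>. norm (u \<xi>)" and q = "g n"])
           (use iu gint in \<open>auto simp: norm_mult g_def\<close>)
    qed
    also have "\<dots> = (LINT \<xi>|lborel. u \<xi> * of_real (sqrt (2 * pi) / e n * exp (- ((\<xi> - \<xi>') / e n)\<^sup>2 / 2)))"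
    proof (rule Bochner_Integration.integral_cong[OF refl])
      fix \<xi>
      have "(LINT x|lborel. iexp (x * (\<xi> - \<xi>')) * u \<xi> * of_real (g n x))
          = (LINT x|lborel. u \<xi> * (iexp (x * (\<xi> - \<xi>')) * of_real (g n x)))" by (simp add: mult_ac)
      also have "\<dots> = u \<xi> * (LINT x|lborel. iexp (x * (\<xi> - \<xi>')) * of_real (g n x))"
        by (rule integral_mult_right_zero)
      finally show "(LINT x|lborel. iexp (x * (\<xi> - \<xi>')) * u \<xi> * of_real (g n x)) =
         u \<xi> * of_real (sqrt (2 * pi) / e n * exp (- ((\<xi> - \<xi>') / e n)\<^sup>2 / 2))"
        using gaussian_fourier[OF e[of n], of "\<xi> - \<xi>'"] unfolding g_def by simp
    qed
    also have "\<dots> = e n *\<^sub>R (LINT s|lborel. u (\<xi>' + e n * s) * of_real (sqrt (2 * pi) / e n * exp (- s\<^sup>2 / 2)))"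
      by (subst lborel_integral_real_affine[where c = "e n" and t = \<xi>'])
         (use e[of n] in auto)
    also have "\<dots> = e n *\<^sub>R (LINT s|lborel. of_real (sqrt (2 * pi) / e n) * (u (\<xi>' + e n * s) * of_real (exp (- s\<^sup>2 / 2))))"
      by (simp add: mult_ac)
    also have "\<dots> = e n *\<^sub>R (of_real (sqrt (2 * pi) / e n) * G n \<xi>')"
      unfolding G_def by (subst integral_mult_right_zero) simp
    finally show ?thesis using e[of n] by (simp add: scaleR_conv_of_real)
  qed
  have Gb: "norm (G n \<xi>') \<le> B * sqrt (2 * pi)" for n \<xi>'
  proof -
    have "norm (G n \<xi>') \<le> (LINT s|lborel. B * exp (- s\<^sup>2 / 2))"
      unfolding G_def
    proof (rule Bochner_Integration.integral_norm_bound_integral)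
      show i: "integrable lborel (\<lambda>s. B * exp (- s\<^sup>2 / 2))" using std by simp
      show "integrable lborel (\<lambda>s. u (\<xi>' + e n * s) * of_real (exp (- s\<^sup>2 / 2)))"
        by (rule Bochner_Integration.integrable_bound[OF i]) (use bu B0 in \<open>auto simp: norm_mult intro!: mult_right_mono\<close>)
      show "\<And>s. norm (u (\<xi>' + e n * s) * of_real (exp (- s\<^sup>2 / 2))) \<le> B * exp (- s\<^sup>2 / 2)"
        using bu by (auto simp: norm_mult intro!: mult_right_mono)
    qed
    then show ?thesis using std by simp
  qed
  have Gm[measurable]: "G n \<in> borel_measurable borel" for n
    unfolding G_def by (rule lborel.borel_measurable_lebesgue_integral) measurable
  have Gl: "(\<lambda>n. G n \<xi>') \<longlonglongrightarrow> u \<xi>' * sqrt (2 * pi)" for \<xi>'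
  proof -
    have "(\<lambda>n. G n \<xi>') \<longlonglongrightarrow> (LINT s|lborel. u \<xi>' * of_real (exp (- s\<^sup>2 / 2)))"
      unfolding G_def
    proof (rule integral_dominated_convergence[where w = "\<lambda>s. B * exp (- s\<^sup>2 / 2)"])
      show "integrable lborel (\<lambda>s. B * exp (- s\<^sup>2 / 2))" using std by simp
      show "AE s in lborel. (\<lambda>n. u (\<xi>' + e n * s) * of_real (exp (- s\<^sup>2 / 2))) \<longlonglongrightarrow> u \<xi>' * of_real (exp (- s\<^sup>2 / 2))"
      proof (rule AE_I2, rule tendsto_mult[OF _ tendsto_const])
        fix s
        have "(\<lambda>n. \<xi>' + e n * s) \<longlonglongrightarrow> \<xi>' + 0 * s" by (intro tendsto_intros e0)
        then show "(\<lambda>n. u (\<xi>' + e n * s)) \<longlonglongrightarrow> u \<xi>'"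
          using cu isCont_tendsto_compose[of \<xi>' u] by (simp add: continuous_on_eq_continuous_at)
      qed
      show "AE s in lborel. norm (u (\<xi>' + e n * s) * of_real (exp (- s\<^sup>2 / 2))) \<le> B * exp (- s\<^sup>2 / 2)" for n
        using bu by (auto simp: norm_mult intro!: mult_right_mono)
    qed auto
    also have "(LINT s|lborel. u \<xi>' * of_real (exp (- s\<^sup>2 / 2))) = u \<xi>' * of_real (sqrt (2 * pi))"
      by (subst integral_mult_right_zero, subst integral_complex_of_real, subst std) simp
    finally show ?thesis .
  qed
  have outer: "(LINT x|lborel. fu x * cnj (fv x) * of_real (g n x))
      = (LINT \<xi>'|lborel. cnj (v \<xi>') * (sqrt (2 * pi) * G n \<xi>'))" for n
  proof -
    have "(LINT x|lborel. fu x * cnj (fv x) * of_real (g n x))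
       = (LINT x|lborel. (LINT \<xi>'|lborel. cnj (v \<xi>') * (fu x * of_real (g n x) * iexp (- (x * \<xi>')))))"
    proof (rule Bochner_Integration.integral_cong[OF refl])
      fix x
      have "cnj (fv x) = (LINT \<xi>|lborel. cnj (iexp (x * \<xi>) * v \<xi>))" unfolding fv_def by (rule Bochner_Integration.integral_cnj[symmetric])
      also have "\<dots> = (LINT \<xi>|lborel. iexp (- (x * \<xi>)) * cnj (v \<xi>))" by (simp add: exp_cnj)
      finally have "fu x * cnj (fv x) * of_real (g n x) = (fu x * of_real (g n x)) * (LINT \<xi>|lborel. iexp (- (x * \<xi>)) * cnj (v \<xi>))" by simp
      also have "\<dots> = (LINT \<xi>|lborel. (fu x * of_real (g n x)) * (iexp (- (x * \<xi>)) * cnj (v \<xi>)))"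
        by (rule integral_mult_right_zero[symmetric])
      finally show "fu x * cnj (fv x) * of_real (g n x) = (LINT \<xi>'|lborel. cnj (v \<xi>') * (fu x * of_real (g n x) * iexp (- (x * \<xi>'))))"
        by (simp add: mult_ac)
    qed
    also have "\<dots> = (LINT \<xi>'|lborel. (LINT x|lborel. cnj (v \<xi>') * (fu x * of_real (g n x) * iexp (- (x * \<xi>')))))"
    proof (rule lborel_pair.Fubini_integral)
      show "integrable (lborel \<Otimes>\<^sub>M lborel) (\<lambda>(\<xi>', x). cnj (v \<xi>') * (fu x * of_real (g n x) * iexp (- (x * \<xi>'))))"
        by (rule lborel_pair_bound[where p = "\<lambda>\<xi>. norm (v \<xi>)" and q = "\<lambda>x. U * g n x"])
           (use iv gint[of n] fub g0 in \<open>auto simp: norm_mult intro!: mult_left_mono mult_right_mono\<close>)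
    qed
    also have "\<dots> = (LINT \<xi>'|lborel. cnj (v \<xi>') * (LINT x|lborel. fu x * of_real (g n x) * iexp (- (x * \<xi>'))))"
      by (intro Bochner_Integration.integral_cong integral_mult_right_zero refl)
    finally show ?thesis by (simp only: inner)
  qed
  have lim1: "(\<lambda>n. LINT x|lborel. fu x * cnj (fv x) * of_real (g n x)) \<longlonglongrightarrow> (LINT x|lborel. fu x * cnj (fv x))"
  proof (rule integral_dominated_convergence[where w = "\<lambda>x. norm (fu x * cnj (fv x))"])
    show "integrable lborel (\<lambda>x. norm (fu x * cnj (fv x)))" using intf by (rule integrable_norm)
    show "AE x in lborel. (\<lambda>n. fu x * cnj (fv x) * of_real (g n x)) \<longlonglongrightarrow> fu x * cnj (fv x)"
    proof (rule AE_I2)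
      fix x
      have "(\<lambda>n. g n x) \<longlonglongrightarrow> exp (- (0 * x)\<^sup>2 / 2)" unfolding g_def by (intro tendsto_intros e0) auto
      then have "(\<lambda>n. fu x * cnj (fv x) * of_real (g n x)) \<longlonglongrightarrow> fu x * cnj (fv x) * of_real (exp (- (0 * x)\<^sup>2 / 2))"
        by (intro tendsto_intros)
      then show "(\<lambda>n. fu x * cnj (fv x) * of_real (g n x)) \<longlonglongrightarrow> fu x * cnj (fv x)" by simp
    qed
    show "AE x in lborel. norm (fu x * cnj (fv x) * of_real (g n x)) \<le> norm (fu x * cnj (fv x))" for n
      by (auto simp: norm_mult g_def intro!: mult_left_le)
  qed auto
  have lim2: "(\<lambda>n. LINT \<xi>'|lborel. cnj (v \<xi>') * (sqrt (2 * pi) * G n \<xi>'))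
      \<longlonglongrightarrow> (LINT \<xi>'|lborel. cnj (v \<xi>') * (sqrt (2 * pi) * (u \<xi>' * sqrt (2 * pi))))"
  proof (rule integral_dominated_convergence[where w = "\<lambda>x. norm (v x) * (sqrt (2 * pi) * (B * sqrt (2 * pi)))"])
    show "integrable lborel (\<lambda>x. norm (v x) * (sqrt (2 * pi) * (B * sqrt (2 * pi))))" using iv by auto
    show "AE x in lborel. norm (cnj (v x) * (sqrt (2 * pi) * G n x)) \<le> norm (v x) * (sqrt (2 * pi) * (B * sqrt (2 * pi)))" for n
      using Gb[of n] by (auto simp: norm_mult intro!: mult_left_mono)
  qed (auto intro!: tendsto_intros Gl)
  have "(LINT x|lborel. fu x * cnj (fv x)) = (LINT \<xi>'|lborel. cnj (v \<xi>') * (sqrt (2 * pi) * (u \<xi>' * sqrt (2 * pi))))"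
    using lim1 lim2 unfolding outer by (rule LIMSEQ_unique)
  also have "\<dots> = (LINT \<xi>'|lborel. (2 * pi) * (u \<xi>' * cnj (v \<xi>')))"
    by (intro Bochner_Integration.integral_cong)
       (auto simp: mult_ac simp flip: of_real_mult)
  finally show ?thesis by simp
qed

section \<open>The Airy function on a shifted contour\<close>

text \<open>
  The integrand \<open>exp (i (z^3 / 3 + x z))\<close> of the Airy integral, as an entire function of
  \<open>z\<close>.
\<close>

definition airy_exp :: "real \<Rightarrow> complex \<Rightarrow> complex" where
  "airy_exp x z = exp (\<i> * (z ^ 3 / 3 + of_real x * z))"

lemma norm_airy_exp: "norm (airy_exp x (Complex u v)) = exp (- (u\<^sup>2 * v) + v ^ 3 / 3 - x * v)"
proof -
  have "Im ((Complex u v) ^ 3) = 3 * u\<^sup>2 * v - v ^ 3"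
    by (simp add: power3_eq_cube power2_eq_square algebra_simps)
  then show ?thesis
    unfolding airy_exp_def norm_exp_eq_Re by (simp add: algebra_simps)
qed

lemma continuous_airy_exp: "continuous_on UNIV (\<lambda>u. airy_exp x (Complex u v))"
  unfolding airy_exp_def Complex_eq by (intro continuous_intros) simp_all

text \<open>
  Cauchy's theorem for the rectangle with corners \<open>\<plusminus>R\<close> and \<open>\<plusminus>R + iv\<close>; the two vertical
  sides contribute at most \<open>O(1/R^2)\<close>.
\<close>

lemma airy_exp_shift:
  assumes R: "R > 0" and v: "v \<ge> 0"
  shows "norm (integral {-R..R} (\<lambda>u. airy_exp x (Complex u v)) - integral {-R..R} (\<lambda>u. airy_exp x (of_real u)))
    \<le> 2 * exp (v ^ 3 / 3 + \<bar>x\<bar> * v) / R\<^sup>2"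
proof -
  have "airy_exp x holomorphic_on UNIV" unfolding airy_exp_def by (intro holomorphic_intros) simp_all
  then obtain P where P: "\<And>z. (P has_field_derivative airy_exp x z) (at z)"
    using holomorphic_convex_primitive'[of UNIV "airy_exp x"] by auto
  have hor: "((\<lambda>u. airy_exp x (Complex u w)) has_integral (P (Complex R w) - P (Complex (-R) w))) {-R..R}" for w
  proof (rule fundamental_theorem_of_calculus)
    show "-R \<le> R" using R by simp
    fix u
    have "((\<lambda>u. Complex u w) has_vector_derivative 1) (at u)"
      unfolding Complex_eq by (auto intro!: derivative_eq_intros)
    from field_vector_diff_chain_at[OF this P]
    show "((\<lambda>u. P (Complex u w)) has_vector_derivative airy_exp x (Complex u w)) (at u within {-R..R})"
      by (simp add: o_def has_vector_derivative_at_within)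
  qed
  \<comment> \<open>On the vertical sides the integrand is at most \<open>E exp (- R^2 y)\<close>.\<close>
  have ver: "norm (P (Complex r v) - P (Complex r 0)) \<le> exp (v ^ 3 / 3 + \<bar>x\<bar> * v) / R\<^sup>2" if r: "r\<^sup>2 = R\<^sup>2" for r
  proof -
    have hi: "((\<lambda>y. \<i> * airy_exp x (Complex r y)) has_integral (P (Complex r v) - P (Complex r 0))) {0..v}"
    proof (rule fundamental_theorem_of_calculus)
      show "0 \<le> v" by fact
      fix u
      have "((\<lambda>u. Complex r u) has_vector_derivative \<i>) (at u)"
        unfolding Complex_eq by (auto intro!: derivative_eq_intros)
      from field_vector_diff_chain_at[OF this P]
      show "((\<lambda>u. P (Complex r u)) has_vector_derivative \<i> * airy_exp x (Complex r u)) (at u within {0..v})"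
        by (simp add: o_def has_vector_derivative_at_within mult.commute)
    qed
    define E where "E = exp (v ^ 3 / 3 + \<bar>x\<bar> * v)"
    have hb: "((\<lambda>y. E * exp (- (R\<^sup>2 * y))) has_integral (- (E * exp (- (R\<^sup>2 * v)) / R\<^sup>2) - (- (E * exp (- (R\<^sup>2 * 0)) / R\<^sup>2)))) {0..v}"
    proof (rule fundamental_theorem_of_calculus)
      show "0 \<le> v" by fact
      fix u
      show "((\<lambda>y. - (E * exp (- (R\<^sup>2 * y)) / R\<^sup>2)) has_vector_derivative E * exp (- (R\<^sup>2 * u))) (at u within {0..v})"
        unfolding has_real_derivative_iff_has_vector_derivative[symmetric]
        using R by (auto intro!: derivative_eq_intros simp: field_simps simp flip: power_add)
    qed
    have "norm (integral {0..v} (\<lambda>y. \<i> * airy_exp x (Complex r y))) \<le> integral {0..v} (\<lambda>y. E * exp (- (R\<^sup>2 * y)))"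
    proof (rule integral_norm_bound_integral)
      show "(\<lambda>y. \<i> * airy_exp x (Complex r y)) integrable_on {0..v}" using hi by blast
      show "(\<lambda>y. E * exp (- (R\<^sup>2 * y))) integrable_on {0..v}" using hb by blast
      fix y assume y: "y \<in> {0..v}"
      have "y ^ 3 \<le> v ^ 3" using y by (intro power_mono) auto
      moreover have "- (x * y) \<le> \<bar>x\<bar> * v"
      proof -
        have "- (x * y) \<le> \<bar>x * y\<bar>" by linarith
        also have "\<dots> \<le> \<bar>x\<bar> * v" using y by (auto simp: abs_mult intro!: mult_mono)
        finally show ?thesis .
      qed
      ultimately have "- (R\<^sup>2 * y) + y ^ 3 / 3 - x * y \<le> (v ^ 3 / 3 + \<bar>x\<bar> * v) + - (R\<^sup>2 * y)" by linarith
      then show "norm (\<i> * airy_exp x (Complex r y)) \<le> E * exp (- (R\<^sup>2 * y))"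
        unfolding norm_mult norm_airy_exp r E_def by (simp flip: exp_add)
    qed
    then have "norm (P (Complex r v) - P (Complex r 0)) \<le> E / R\<^sup>2 - E * exp (- (R\<^sup>2 * v)) / R\<^sup>2"
      using integral_unique[OF hi] integral_unique[OF hb] by simp
    also have "\<dots> \<le> E / R\<^sup>2" by (simp add: E_def)
    finally show ?thesis by (simp add: E_def)
  qed
  have r0: "airy_exp x (of_real u) = airy_exp x (Complex u 0)" for u by (simp add: Complex_eq)
  have "integral {-R..R} (\<lambda>u. airy_exp x (Complex u v)) - integral {-R..R} (\<lambda>u. airy_exp x (of_real u))
     = (P (Complex R v) - P (Complex R 0)) - (P (Complex (-R) v) - P (Complex (-R) 0))"
    unfolding r0 integral_unique[OF hor] by simp
  also have "norm \<dots> \<le> norm (P (Complex R v) - P (Complex R 0)) + norm (P (Complex (-R) v) - P (Complex (-R) 0))"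
    by (rule norm_triangle_ineq4)
  also have "\<dots> \<le> exp (v ^ 3 / 3 + \<bar>x\<bar> * v) / R\<^sup>2 + exp (v ^ 3 / 3 + \<bar>x\<bar> * v) / R\<^sup>2"
    by (intro add_mono ver) auto
  finally show ?thesis by simp
qed

lemma integrable_airy_exp:
  assumes v: "v > 0"
  shows "integrable lborel (\<lambda>u. airy_exp x (Complex u v))"
proof (rule Bochner_Integration.integrable_bound)
  show "integrable lborel (\<lambda>u. exp (v ^ 3 / 3 - x * v) * exp (- v * (u - 0)\<^sup>2))"
    by (intro integrable_mult_right integrable_gaussian v)
  show "(\<lambda>u. airy_exp x (Complex u v)) \<in> borel_measurable lborel"
    using continuous_airy_exp[of x v] by (simp add: borel_measurable_continuous_onI)
  show "AE u in lborel. norm (airy_exp x (Complex u v)) \<le> norm (exp (v ^ 3 / 3 - x * v) * exp (- v * (u - 0)\<^sup>2))"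
    unfolding norm_airy_exp by (auto simp flip: exp_add simp: mult.commute)
qed

lemma airy_exp_uminus: "airy_exp x (Complex (- u) v) = cnj (airy_exp x (Complex u v))"
proof -
  have "Complex (- u) v = - cnj (Complex u v)" by (simp add: complex_eq_iff)
  then show ?thesis unfolding airy_exp_def exp_cnj by (simp add: algebra_simps)
qed

lemma cos_integral_eq:
  assumes R: "R > 0"
  shows "integral {0..R} (\<lambda>y. cos (y ^ 3 / 3 + x * y)) = Re (integral {-R..R} (\<lambda>u. airy_exp x (of_real u))) / 2"
proof -
  have c: "continuous_on {-R..R} (\<lambda>u. airy_exp x (of_real u))"
    unfolding airy_exp_def by (intro continuous_intros) simp_all
  have Re: "Re (airy_exp x (of_real u)) = cos (u ^ 3 / 3 + x * u)" for u
  proof -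
    have "airy_exp x (of_real u) = cis (u ^ 3 / 3 + x * u)"
      unfolding airy_exp_def cis_conv_exp by simp
    then show ?thesis by simp
  qed
  have "Re (integral {-R..R} (\<lambda>u. airy_exp x (of_real u))) = integral {-R..R} (\<lambda>u. cos (u ^ 3 / 3 + x * u))"
    using integral_linear[OF integrable_continuous_interval[OF c] bounded_linear_Re]
    by (simp add: o_def Re)
  also have "\<dots> = integral {-R..0} (\<lambda>u. cos (u ^ 3 / 3 + x * u)) + integral {0..R} (\<lambda>u. cos (u ^ 3 / 3 + x * u))"
    using R by (intro Henstock_Kurzweil_Integration.integral_combine[symmetric] integrable_continuous_interval continuous_intros) auto
  also have "integral {-R..0} (\<lambda>u. cos (u ^ 3 / 3 + x * u)) = integral {0..R} (\<lambda>u. cos (u ^ 3 / 3 + x * u))"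
  proof -
    have "integral {-R..-0} (\<lambda>u. cos ((- u) ^ 3 / 3 + x * (- u))) = integral {0..R} (\<lambda>u. cos (u ^ 3 / 3 + x * u))"
      by (rule Henstock_Kurzweil_Integration.integral_reflect_real)
    moreover have "cos ((- u) ^ 3 / 3 + x * (- u)) = cos (u ^ 3 / 3 + x * u)" for u
    proof -
      have "(- u) ^ 3 / 3 + x * (- u) = - (u ^ 3 / 3 + x * u)" by (simp add: power3_eq_cube)
      then show ?thesis by (metis cos_minus)
    qed
    ultimately show ?thesis by simp
  qed
  finally show ?thesis by simp
qed

text \<open>
  On a line above the real axis the Airy integral converges absolutely, with a Gaussian
  bound.
\<close>

lemma Airy_Ai_eq:
  assumes v: "v > 0"
  shows "of_real (Airy_Ai x) = (LINT u|lborel. airy_exp x (Complex u v)) / (2 * pi)"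
proof -
  define I where "I = (LINT u|lborel. airy_exp x (Complex u v))"
  \<comment> \<open>The integral is real because the integrand at \<open>-u\<close> is the conjugate of the one at
  \<open>u\<close>.\<close>
  have "cnj I = (LINT u|lborel. airy_exp x (Complex (- u) v))"
    unfolding I_def airy_exp_uminus by simp
  also have "\<dots> = I"
    unfolding I_def
    using lborel_integral_real_affine[of "-1" "\<lambda>u. airy_exp x (Complex u v)" 0] by simp
  finally have real: "I = of_real (Re I)" by (simp add: complex_eq_iff)
  have "((\<lambda>R. LINT u|lborel. indicat_real {-R..R} u *\<^sub>R airy_exp x (Complex u v)) \<longlongrightarrow> I) at_top"
    unfolding I_def
  proof (rule integral_dominated_convergence_at_top)
    show "integrable lborel (\<lambda>u. norm (airy_exp x (Complex u v)))"
      using integrable_airy_exp[OF v] by (rule integrable_norm)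
    show "AE u in lborel. ((\<lambda>R. indicat_real {-R..R} u *\<^sub>R airy_exp x (Complex u v)) \<longlongrightarrow> airy_exp x (Complex u v)) at_top"
    proof (rule AE_I2)
      fix u
      have "\<forall>\<^sub>F R in at_top. indicat_real {-R..R} u *\<^sub>R airy_exp x (Complex u v) = airy_exp x (Complex u v)"
        using eventually_ge_at_top[of "\<bar>u\<bar>"] by eventually_elim (auto simp: indicator_def)
      then show "((\<lambda>R. indicat_real {-R..R} u *\<^sub>R airy_exp x (Complex u v)) \<longlongrightarrow> airy_exp x (Complex u v)) at_top"
        by (rule tendsto_eventually)
    qed
    show "\<forall>\<^sub>F R in at_top. AE u in lborel. norm (indicat_real {-R..R} u *\<^sub>R airy_exp x (Complex u v)) \<le> norm (airy_exp x (Complex u v))"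
      by (auto simp: indicator_def)
    show "(\<lambda>u. airy_exp x (Complex u v)) \<in> borel_measurable lborel"
      using integrable_airy_exp[OF v] by (rule borel_measurable_integrable)
    then show "(\<lambda>u. indicat_real {-R..R} u *\<^sub>R airy_exp x (Complex u v)) \<in> borel_measurable lborel" for R
      by measurable
  qed
  also have "(\<lambda>R. LINT u|lborel. indicat_real {-R..R} u *\<^sub>R airy_exp x (Complex u v))
     = (\<lambda>R. integral {-R..R} (\<lambda>u. airy_exp x (Complex u v)))"
  proof
    fix R
    have "set_integrable lborel {-R..R} (\<lambda>u. airy_exp x (Complex u v))"
      unfolding set_integrable_def using integrable_airy_exp[OF v] by (intro integrable_mult_indicator) auto
    from set_borel_integral_eq_integral(2)[OF this]
    show "(LINT u|lborel. indicat_real {-R..R} u *\<^sub>R airy_exp x (Complex u v)) = integral {-R..R} (\<lambda>u. airy_exp x (Complex u v))"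
      by (simp add: set_lebesgue_integral_def)
  qed
  finally have l1: "((\<lambda>R. integral {-R..R} (\<lambda>u. airy_exp x (Complex u v))) \<longlongrightarrow> I) at_top" .
  have l2: "((\<lambda>R. integral {-R..R} (\<lambda>u. airy_exp x (Complex u v)) - integral {-R..R} (\<lambda>u. airy_exp x (of_real u))) \<longlongrightarrow> 0) at_top"
  proof (rule Lim_null_comparison)
    show "\<forall>\<^sub>F R in at_top. norm (integral {-R..R} (\<lambda>u. airy_exp x (Complex u v)) - integral {-R..R} (\<lambda>u. airy_exp x (of_real u)))
      \<le> 2 * exp (v ^ 3 / 3 + \<bar>x\<bar> * v) / R\<^sup>2"
      using eventually_gt_at_top[of 0] by eventually_elim (use v in \<open>auto intro!: airy_exp_shift\<close>)
    show "((\<lambda>R :: real. 2 * exp (v ^ 3 / 3 + \<bar>x\<bar> * v) / R\<^sup>2) \<longlongrightarrow> 0) at_top"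
      by (intro tendsto_divide_0[OF tendsto_const] filterlim_at_top_imp_at_infinity filterlim_pow_at_top filterlim_ident) auto
  qed
  have "((\<lambda>R. integral {-R..R} (\<lambda>u. airy_exp x (of_real u))) \<longlongrightarrow> I) at_top"
    using tendsto_diff[OF l1 l2] by simp
  then have "((\<lambda>R. Re (integral {-R..R} (\<lambda>u. airy_exp x (of_real u))) / 2) \<longlongrightarrow> Re I / 2) at_top"
    by (intro tendsto_divide tendsto_Re tendsto_const) simp_all
  moreover have "\<forall>\<^sub>F R in at_top. Re (integral {-R..R} (\<lambda>u. airy_exp x (of_real u))) / 2 = integral {0..R} (\<lambda>y. cos (y ^ 3 / 3 + x * y))"
    using eventually_gt_at_top[of 0] by eventually_elim (simp add: cos_integral_eq)
  ultimately have "((\<lambda>R. integral {0..R} (\<lambda>y. cos (y ^ 3 / 3 + x * y))) \<longlongrightarrow> Re I / 2) at_top"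
    by (rule Lim_transform_eventually)
  then have "Airy_Ai x = Re I / 2 / pi"
    unfolding Airy_Ai_def by (simp only: tendsto_Lim[OF trivial_limit_at_top_linorder])
  then have "complex_of_real (Airy_Ai x) = of_real (Re I) / of_real (2 * pi)" by simp
  then show ?thesis unfolding I_def[symmetric] by (simp only: real[symmetric] of_real_mult of_real_numeral)
qed

lemma airy_exp_split:
  "airy_exp x (Complex u v) = of_real (exp (- (v * x))) * (iexp (x * u) * airy_exp 0 (Complex u v))"
  unfolding airy_exp_def exp_of_real[symmetric] mult_exp_exp
  by (rule arg_cong[where f = exp]) (simp add: Complex_eq algebra_simps)

lemma exp_times_Airy_Ai:
  assumes v: "v > 0"
  shows "(LINT u|lborel. iexp (x * u) * airy_exp 0 (Complex u v)) = of_real (2 * pi * exp (v * x) * Airy_Ai x)"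
proof -
  define J where "J = (LINT u|lborel. iexp (x * u) * airy_exp 0 (Complex u v))"
  have "of_real (Airy_Ai x) = of_real (exp (- (v * x))) * J / (2 * pi)"
    unfolding Airy_Ai_eq[OF v] airy_exp_split[of x _ v] J_def by (subst integral_mult_right_zero) simp
  then have "of_real (2 * pi * exp (v * x) * Airy_Ai x) = of_real (exp (v * x) * exp (- (v * x))) * J"
    by simp
  then show ?thesis unfolding J_def[symmetric] by (simp flip: exp_add)
qed

lemma Airy_Ai_bound:
  assumes v: "v > 0"
  obtains C where "C > 0" "\<And>x. \<bar>Airy_Ai x\<bar> \<le> C * exp (- (v * x))"
proof -
  define C where "C = (LINT u|lborel. norm (airy_exp 0 (Complex u v))) / (2 * pi)"
  have C0: "C \<ge> 0" unfolding C_def by simp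
  have b: "\<bar>Airy_Ai x\<bar> \<le> C * exp (- (v * x))" for x
  proof -
    have "norm (LINT u|lborel. iexp (x * u) * airy_exp 0 (Complex u v)) \<le> (LINT u|lborel. norm (iexp (x * u) * airy_exp 0 (Complex u v)))"
      by (rule integral_norm_bound)
    then have "2 * pi * exp (v * x) * \<bar>Airy_Ai x\<bar> \<le> 2 * pi * C"
      unfolding exp_times_Airy_Ai[OF v] norm_of_real C_def by (simp add: norm_mult abs_mult)
    then have "exp (- (v * x)) * (exp (v * x) * \<bar>Airy_Ai x\<bar>) \<le> exp (- (v * x)) * C"
      by (intro mult_left_mono) auto
    moreover have "exp (- (v * x)) * exp (v * x) = 1" by (simp flip: exp_add)
    ultimately show ?thesis by (simp only: mult.assoc[symmetric] mult_1_left mult.commute[of C])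
  qed
  show thesis
  proof (rule that[of "C + 1"])
    show "\<bar>Airy_Ai x\<bar> \<le> (C + 1) * exp (- (v * x))" for x
      using b[of x] by (simp add: distrib_right add_increasing2)
  qed (use C0 in auto)
qed

lemma continuous_Airy_Ai: "continuous_on UNIV Airy_Ai"
proof -
  have "continuous_on UNIV (\<lambda>x. LINT u|lborel. iexp (x * u) * airy_exp 0 (Complex u 1))"
    unfolding continuous_on_eq_continuous_at[OF open_UNIV] 
  proof
    fix x :: real
    show "isCont (\<lambda>x. LINT u|lborel. iexp (x * u) * airy_exp 0 (Complex u 1)) x"
      unfolding continuous_at_sequentially o_def
    proof (intro allI impI)
      fix X assume X: "X \<longlonglongrightarrow> x"
      show "(\<lambda>n. LINT u|lborel. iexp (X n * u) * airy_exp 0 (Complex u 1)) \<longlonglongrightarrow> (LINT u|lborel. iexp (x * u) * airy_exp 0 (Complex u 1))"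
      proof (rule integral_dominated_convergence[where w = "\<lambda>u. norm (airy_exp 0 (Complex u 1))"])
        show "integrable lborel (\<lambda>u. norm (airy_exp 0 (Complex u 1)))" by (intro integrable_norm integrable_airy_exp) simp
        have [measurable]: "(\<lambda>u. airy_exp 0 (Complex u 1)) \<in> borel_measurable borel" by (intro borel_measurable_continuous_onI continuous_airy_exp)
        show "(\<lambda>u. iexp (x * u) * airy_exp 0 (Complex u 1)) \<in> borel_measurable lborel" by measurable
        show "(\<lambda>u. iexp (X n * u) * airy_exp 0 (Complex u 1)) \<in> borel_measurable lborel" for n by measurable
        show "AE u in lborel. (\<lambda>n. iexp (X n * u) * airy_exp 0 (Complex u 1)) \<longlonglongrightarrow> iexp (x * u) * airy_exp 0 (Complex u 1)"
          by (intro AE_I2 tendsto_intros X)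
      qed (auto simp: norm_mult)
    qed
  qed
  then have "continuous_on UNIV (\<lambda>x. Re ((LINT u|lborel. iexp (x * u) * airy_exp 0 (Complex u 1)) / (2 * pi * exp x)))"
    by (intro continuous_intros) auto
  moreover have z1: "(0 :: real) < 1" by simp
  have "Re ((LINT u|lborel. iexp (x * u) * airy_exp 0 (Complex u 1)) / (2 * pi * exp x)) = Airy_Ai x" for x
    unfolding exp_times_Airy_Ai[of 1, OF z1] by (simp flip: of_real_mult of_real_divide)
  ultimately show ?thesis by simp
qed

lemma borel_measurable_Airy_Ai [measurable]: "Airy_Ai \<in> borel_measurable borel"
  by (intro borel_measurable_continuous_onI continuous_Airy_Ai)

section \<open>Hadamard's inequality\<close>

text \<open>Symmetric positive semidefinite real matrices of size \<open>n\<close>.\<close>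

definition psd_mat :: "nat \<Rightarrow> real mat \<Rightarrow> bool" where
  "psd_mat n A \<longleftrightarrow> A \<in> carrier_mat n n \<and> A\<^sup>T = A \<and> (\<forall>v \<in> carrier_vec n. v \<bullet> (A *\<^sub>v v) \<ge> 0)"

lemma scalar_prod_vCons: "w \<in> carrier_vec n \<Longrightarrow> v \<in> carrier_vec n \<Longrightarrow>
    (vCons a v) \<bullet> (vCons b w) = a * b + v \<bullet> (w :: real vec)"
  by (auto simp: scalar_prod_def sum.atLeast0_lessThan_Suc_shift simp del: sum.op_ivl_Suc)

text \<open>
  Induction on the size, splitting off the first row and column and using the Schur
  complement of the remaining block.
\<close>

lemma psd_det:
  "psd_mat n A \<Longrightarrow> 0 \<le> Determinant.det A \<and> Determinant.det A \<le> (\<Prod>i<n. A $$ (i, i))"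
proof (induction n arbitrary: A)
  case 0
  then have "A \<in> carrier_mat 0 0" by (simp add: psd_mat_def)
  then show ?case by (simp add: Determinant.det_def)
next
  case (Suc n A)
  have A: "A \<in> carrier_mat (Suc n) (Suc n)" and sym: "A\<^sup>T = A"
    and psd: "\<And>v. v \<in> carrier_vec (Suc n) \<Longrightarrow> v \<bullet> (A *\<^sub>v v) \<ge> 0"
    using Suc.prems by (auto simp: psd_mat_def)
  define a where "a = A $$ (0, 0)"
  define b where "b = vec n (\<lambda>i. A $$ (Suc i, 0))"
  define C where "C = mat n n (\<lambda>(i, j). A $$ (Suc i, Suc j))"
  have b: "b \<in> carrier_vec n" and C: "C \<in> carrier_mat n n" by (auto simp: b_def C_def)
  have symA: "A $$ (i, j) = A $$ (j, i)" if "i < Suc n" "j < Suc n" for i j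
    using arg_cong[OF sym, of "\<lambda>M. M $$ (i, j)"] A that by auto
  have quad: "vCons s u \<bullet> (A *\<^sub>v vCons s u) = a * s * s + 2 * s * (b \<bullet> u) + u \<bullet> (C *\<^sub>v u)"
    if u: "u \<in> carrier_vec n" for s u
  proof -
    have "A *\<^sub>v vCons s u = vCons (a * s + b \<bullet> u) (s \<cdot>\<^sub>v b + C *\<^sub>v u)"
    proof (rule eq_vecI)
      show "dim_vec (A *\<^sub>v vCons s u) = dim_vec (vCons (a * s + b \<bullet> u) (s \<cdot>\<^sub>v b + C *\<^sub>v u))"
        using A b C by auto
      fix i assume i: "i < dim_vec (vCons (a * s + b \<bullet> u) (s \<cdot>\<^sub>v b + C *\<^sub>v u))"
      then have i': "i < Suc n" using b C by auto
      show "(A *\<^sub>v vCons s u) $ i = vCons (a * s + b \<bullet> u) (s \<cdot>\<^sub>v b + C *\<^sub>v u) $ i"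
      proof (cases i)
        case 0
        have "(A *\<^sub>v vCons s u) $ 0 = (\<Sum>j = 0..<Suc n. A $$ (0, j) * vCons s u $ j)"
          using A u by (auto simp: scalar_prod_def row_def)
        also have "\<dots> = a * s + (\<Sum>j = 0..<n. A $$ (0, Suc j) * u $ j)"
          by (subst sum.atLeast0_lessThan_Suc_shift) (simp add: a_def)
        also have "(\<Sum>j = 0..<n. A $$ (0, Suc j) * u $ j) = b \<bullet> u"
          using u symA by (auto simp: scalar_prod_def b_def intro!: sum.cong)
        finally show ?thesis using 0 by simp
      next
        case (Suc k)
        then have k: "k < n" using i' by simp
        have "(A *\<^sub>v vCons s u) $ Suc k = (\<Sum>j = 0..<Suc n. A $$ (Suc k, j) * vCons s u $ j)"
          using A u k by (auto simp: scalar_prod_def row_def)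
        also have "\<dots> = A $$ (Suc k, 0) * s + (\<Sum>j = 0..<n. A $$ (Suc k, Suc j) * u $ j)"
          by (subst sum.atLeast0_lessThan_Suc_shift) simp
        also have "\<dots> = (s \<cdot>\<^sub>v b + C *\<^sub>v u) $ k"
          using u k by (auto simp: scalar_prod_def b_def C_def intro!: sum.cong)
        finally show ?thesis using Suc by simp
      qed
    qed
    then have "vCons s u \<bullet> (A *\<^sub>v vCons s u) = s * (a * s + b \<bullet> u) + u \<bullet> (s \<cdot>\<^sub>v b + C *\<^sub>v u)"
      using u b C by (simp add: scalar_prod_vCons[of _ n])
    also have "u \<bullet> (s \<cdot>\<^sub>v b + C *\<^sub>v u) = s * (b \<bullet> u) + u \<bullet> (C *\<^sub>v u)"
      using u b C by (simp add: scalar_prod_add_distrib[of _ n] comm_scalar_prod[of b n u])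
    finally show ?thesis by (simp add: algebra_simps)
  qed
  have carr: "vCons s u \<in> carrier_vec (Suc n)" if "u \<in> carrier_vec n" for s and u :: "real vec"
    using that by simp
  have quad0: "a * s * s + 2 * s * (b \<bullet> u) + u \<bullet> (C *\<^sub>v u) \<ge> 0" if "u \<in> carrier_vec n" for s u
    using psd[OF carr[OF that]] quad[OF that] by metis
  have Cpsd: "psd_mat n C"
    unfolding psd_mat_def
  proof (intro conjI ballI)
    show "C\<^sup>T = C" using symA by (auto simp: C_def)
    show "v \<bullet> (C *\<^sub>v v) \<ge> 0" if "v \<in> carrier_vec n" for v using quad0[OF that, of 0] by simp
  qed (rule C)
  note IH = Suc.IH[OF Cpsd]
  have a0: "a \<ge> 0" using quad0[of "0\<^sub>v n" 1] b C by simp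
  have prodeq: "(\<Prod>i<Suc n. A $$ (i, i)) = a * (\<Prod>i<n. C $$ (i, i))"
    by (subst prod.lessThan_Suc_shift) (auto simp: a_def C_def)
  show ?case
  proof (cases "Determinant.det C = 0")
    case True
    then obtain u where u: "u \<in> carrier_vec n" "u \<noteq> 0\<^sub>v n" "C *\<^sub>v u = 0\<^sub>v n"
      using det_0_iff_vec_prod_zero[OF C] by auto
    \<comment> \<open>The null vector \<open>u\<close> of \<open>C\<close> extends by \<open>0\<close> to a null vector of \<open>A\<close>, because it is
    orthogonal to \<open>b\<close>.\<close>
    have "b \<bullet> u = 0"
    proof (rule ccontr)
      assume nz: "b \<bullet> u \<noteq> 0"
      have ineq: "a * s * s + 2 * s * (b \<bullet> u) \<ge> 0" for s using quad0[OF u(1), of s] u by simp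
      define d where "d = b \<bullet> u"
      \<comment> \<open>The denominator \<open>a + 1\<close> instead of \<open>a\<close> covers the case \<open>a = 0\<close>.\<close>
      have 1: "a * (- d / (a + 1)) * (- d / (a + 1)) + 2 * (- d / (a + 1)) * d = - (d * d * (a + 2)) / ((a + 1) * (a + 1))"
      proof -
        define e where "e = a + 1"
        have e: "e > 0" "a = e - 1" using a0 by (auto simp: e_def)
        show ?thesis unfolding e(2) using e(1) by (simp add: field_simps)
      qed
      have "d * d * (a + 2) > 0" using nz a0 by (auto simp: d_def zero_less_mult_iff linorder_neq_iff)
      then have "- (d * d * (a + 2)) / ((a + 1) * (a + 1)) < 0" using a0 by (auto simp: divide_neg_pos)
      then show False using ineq[of "- d / (a + 1)"] 1 unfolding d_def by linarith
    qed
    have "A *\<^sub>v vCons 0 u = 0\<^sub>v (Suc n)"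
    proof (rule eq_vecI)
      fix i assume "i < dim_vec (0\<^sub>v (Suc n) :: real vec)"
      then have i: "i < Suc n" by simp
      have "(A *\<^sub>v vCons 0 u) $ i = (\<Sum>j = 0..<Suc n. A $$ (i, j) * vCons 0 u $ j)"
        using A u i by (auto simp: scalar_prod_def row_def)
      also have "\<dots> = (\<Sum>j = 0..<n. A $$ (i, Suc j) * u $ j)"
        by (subst sum.atLeast0_lessThan_Suc_shift) simp
      also have "\<dots> = 0"
      proof (cases i)
        case 0
        have "(\<Sum>j = 0..<n. A $$ (0, Suc j) * u $ j) = b \<bullet> u"
          using u symA by (auto simp: scalar_prod_def b_def intro!: sum.cong)
        then show ?thesis using 0 \<open>b \<bullet> u = 0\<close> by simp
      next
        case (Suc k)
        have "(C *\<^sub>v u) $ k = (\<Sum>j = 0..<n. A $$ (i, Suc j) * u $ j)"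
          using u(1) Suc i by (auto simp: scalar_prod_def C_def intro!: sum.cong)
        then show ?thesis using u(3) Suc i by simp
      qed
      finally show "(A *\<^sub>v vCons 0 u) $ i = 0\<^sub>v (Suc n) $ i" using i by simp
    qed (use A in simp)
    moreover have "vCons 0 u \<noteq> 0\<^sub>v (Suc n)"
    proof
      assume "vCons 0 u = 0\<^sub>v (Suc n)"
      then have "vCons 0 u $ Suc i = 0" if "i < n" for i using that by simp
      then have "u = 0\<^sub>v n" using u(1) by (intro eq_vecI) auto
      then show False using u by simp
    qed
    ultimately have "Determinant.det A = 0"
      using det_0_iff_vec_prod_zero[OF A] carr[OF u(1), of 0] by blast
    moreover have "(\<Prod>i<Suc n. A $$ (i, i)) \<ge> 0" unfolding prodeq using a0 IH by auto
    ultimately show ?thesis by simp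
  next
    case False
    then have pos: "Determinant.det C > 0" using IH by simp
    obtain D where D: "D \<in> carrier_mat n n" "C * D = 1\<^sub>m n"
      using det_non_zero_imp_unit[OF C False] by (auto simp: Units_def ring_mat_def)
    define v where "v = D *\<^sub>v b"
    have v: "v \<in> carrier_vec n" using D b by (auto simp: v_def)
    have Cv: "C *\<^sub>v v = b"
      unfolding v_def using assoc_mult_mat_vec[OF C D(1) b] D(2) b by simp
    have q: "b \<bullet> v \<ge> 0"
      using quad0[OF v, of 0] v b Cv comm_scalar_prod[of b n v] by simp
    \<comment> \<open>The column operation that clears the first column below the diagonal.\<close>
    define T where "T = mat (Suc n) (Suc n) (\<lambda>(i, j). if i = j then 1 else if j = 0 then - v $ (i - 1) else 0)"
    have T: "T \<in> carrier_mat (Suc n) (Suc n)" by (simp add: T_def)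
    have detT: "Determinant.det T = 1"
    proof -
      have "Determinant.det T = prod_list (diag_mat T)"
        by (rule det_lower_triangular[OF _ T]) (auto simp: T_def)
      also have "\<dots> = (\<Prod>i = 0..<Suc n. T $$ (i, i))" using T by (simp add: prod_list_diag_prod)
      also have "\<dots> = (\<Prod>i = 0..<Suc n. 1)" by (intro prod.cong) (auto simp: T_def)
      finally show ?thesis by simp
    qed
    have AT: "A * T = four_block_mat (mat 1 1 (\<lambda>_. a - b \<bullet> v)) (mat 1 n (\<lambda>(i, j). b $ j)) (0\<^sub>m n 1) C"
    proof (rule eq_matI)
      fix i j assume "i < dim_row (four_block_mat (mat 1 1 (\<lambda>_. a - b \<bullet> v)) (mat 1 n (\<lambda>(i, j). b $ j)) (0\<^sub>m n 1) C)"
        "j < dim_col (four_block_mat (mat 1 1 (\<lambda>_. a - b \<bullet> v)) (mat 1 n (\<lambda>(i, j). b $ j)) (0\<^sub>m n 1) C)"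
      then have i: "i < Suc n" and j: "j < Suc n" using C by auto
      have 1: "(A * T) $$ (i, j) = (\<Sum>k = 0..<Suc n. A $$ (i, k) * T $$ (k, j))"
        using A T i j by (auto simp: scalar_prod_def)
      show "(A * T) $$ (i, j) = four_block_mat (mat 1 1 (\<lambda>_. a - b \<bullet> v)) (mat 1 n (\<lambda>(i, j). b $ j)) (0\<^sub>m n 1) C $$ (i, j)"
      proof (cases j)
        case 0
        have "(A * T) $$ (i, j) = A $$ (i, 0) - (\<Sum>k = 0..<n. A $$ (i, Suc k) * v $ k)"
          unfolding 1 by (subst sum.atLeast0_lessThan_Suc_shift) (auto simp: T_def 0 sum_negf)
        also have "\<dots> = (if i = 0 then a - b \<bullet> v else 0)"
        proof (cases i)
          case 0
          then show ?thesis using v symA by (auto simp: scalar_prod_def b_def a_def intro!: sum.cong)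
        next
          case (Suc l)
          have "(C *\<^sub>v v) $ l = (\<Sum>k = 0..<n. A $$ (i, Suc k) * v $ k)"
            using v Suc i by (auto simp: scalar_prod_def C_def intro!: sum.cong)
          then show ?thesis using Cv Suc i by (simp add: b_def)
        qed
        finally show ?thesis using 0 i C by auto
      next
        case (Suc m)
        have "(A * T) $$ (i, j) = (\<Sum>k = 0..<Suc n. if k = j then A $$ (i, k) else 0)"
          unfolding 1 using j Suc by (intro sum.cong) (auto simp: T_def)
        also have "\<dots> = A $$ (i, j)" using j by simp
        finally show ?thesis using i j Suc C symA by (auto simp: b_def C_def)
      qed
    qed (use A T C in auto)
    have "Determinant.det A = Determinant.det (A * T)" using det_mult[OF A T] detT by simp
    also have "\<dots> = (a - b \<bullet> v) * Determinant.det C"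
      unfolding AT by (subst det_four_block_mat_lower_left_zero[of _ 1 _ n]) (use C in \<open>auto simp: det_single\<close>)
    finally have det: "Determinant.det A = (a - b \<bullet> v) * Determinant.det C" .
    have "a - b \<bullet> v \<ge> 0"
    proof -
      \<comment> \<open>The quadratic form at the vector with first entry \<open>-1\<close> and remaining entries
      \<open>v\<close>.\<close>
      have "a * (- 1) * (- 1) + 2 * (- 1) * (b \<bullet> v) + v \<bullet> (C *\<^sub>v v) \<ge> 0" by (rule quad0[OF v])
      moreover have "v \<bullet> (C *\<^sub>v v) = b \<bullet> v" unfolding Cv by (rule comm_scalar_prod[OF v b])
      ultimately show ?thesis by simp
    qed
    moreover have "(a - b \<bullet> v) * Determinant.det C \<le> a * (\<Prod>i<n. C $$ (i, i))"
      using q a0 IH by (intro mult_mono) auto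
    ultimately show ?thesis unfolding det prodeq using pos by simp
  qed
qed

text \<open>
  The square of the determinant is the determinant of the Gram matrix of the rows, which
  is at most the product of its diagonal entries.
\<close>

lemma Hadamard_bound:
  fixes B :: "real mat"
  assumes B: "B \<in> carrier_mat n n"
    and b: "\<And>i j. i < n \<Longrightarrow> j < n \<Longrightarrow> \<bar>B $$ (i, j)\<bar> \<le> u i"
  shows "\<bar>Determinant.det B\<bar> \<le> sqrt (real n ^ n) * (\<Prod>i<n. u i)"
proof -
  have BT: "B\<^sup>T \<in> carrier_mat n n" using B by simp
  have psd: "psd_mat n (B * B\<^sup>T)"
    unfolding psd_mat_def
  proof (intro conjI ballI)
    show "B * B\<^sup>T \<in> carrier_mat n n" using B by simp
    show "(B * B\<^sup>T)\<^sup>T = B * B\<^sup>T" using transpose_mult[OF B BT] by simp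
    fix v :: "real vec" assume v: "v \<in> carrier_vec n"
    have "(B * B\<^sup>T) *\<^sub>v v = B *\<^sub>v (B\<^sup>T *\<^sub>v v)" by (rule assoc_mult_mat_vec[OF B BT v])
    moreover have "v \<bullet> (B *\<^sub>v (B\<^sup>T *\<^sub>v v)) = (B\<^sup>T *\<^sub>v v) \<bullet> (B\<^sup>T *\<^sub>v v)"
      using transpose_vec_mult_scalar[OF B, of "B\<^sup>T *\<^sub>v v" v] v BT
      by (metis comm_scalar_prod mult_mat_vec_carrier B)
    ultimately show "v \<bullet> ((B * B\<^sup>T) *\<^sub>v v) \<ge> 0" by (simp add: scalar_prod_def sum_nonneg)
  qed
  have u0: "u i \<ge> 0" if "i < n" for i using b[OF that that] by linarith
  have "(Determinant.det B)\<^sup>2 = Determinant.det (B * B\<^sup>T)"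
    using det_mult[OF B BT] det_transpose[OF B] by (simp add: power2_eq_square)
  also have "\<dots> \<le> (\<Prod>i<n. (B * B\<^sup>T) $$ (i, i))" using psd_det[OF psd] by simp
  also have "\<dots> \<le> (\<Prod>i<n. real n * (u i)\<^sup>2)"
  proof (rule prod_mono)
    fix i assume "i \<in> {..<n}"
    then have i: "i < n" by simp
    have eq: "(B * B\<^sup>T) $$ (i, i) = (\<Sum>j = 0..<n. (B $$ (i, j))\<^sup>2)"
      using B i by (auto simp: scalar_prod_def power2_eq_square)
    also have "\<dots> \<le> (\<Sum>j = 0..<n. (u i)\<^sup>2)"
      using b i by (intro sum_mono) (metis abs_le_square_iff abs_of_nonneg u0 atLeastLessThan_iff)
    finally show "0 \<le> (B * B\<^sup>T) $$ (i, i) \<and> (B * B\<^sup>T) $$ (i, i) \<le> real n * (u i)\<^sup>2"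
      using eq by (simp add: sum_nonneg)
  qed
  also have "\<dots> = real n ^ n * (\<Prod>i<n. u i)\<^sup>2" by (simp add: prod.distrib prod_power_distrib)
  finally have "sqrt ((Determinant.det B)\<^sup>2) \<le> sqrt (real n ^ n * (\<Prod>i<n. u i)\<^sup>2)" by (rule real_sqrt_le_mono)
  moreover have "(\<Prod>i<n. u i) \<ge> 0" using u0 by (intro prod_nonneg) auto
  ultimately show ?thesis by (simp add: real_sqrt_mult)
qed

section \<open>Determinants of kernels\<close>

text \<open>
  The determinant of the matrix with entries \<open>k (r i) (c j)\<close>, for \<open>i\<close> and \<open>j\<close> in the index
  set \<open>J\<close>. Arbitrary finite index sets avoid renumbering when a row and a column are
  removed.
\<close>

definition kdet :: "('a \<Rightarrow> 'b \<Rightarrow> real) \<Rightarrow> nat set \<Rightarrow> (nat \<Rightarrow> 'a) \<Rightarrow> (nat \<Rightarrow> 'b) \<Rightarrow> real" where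
  "kdet k J r c = (\<Sum>q | q permutes J. of_int (sign q) * (\<Prod>i\<in>J. k (r i) (c (q i))))"

lemma kdet_cong:
  assumes "\<And>i. i \<in> J \<Longrightarrow> r i = r' i" "\<And>i. i \<in> J \<Longrightarrow> c i = c' i"
  shows "kdet k J r c = kdet k J r' c'"
  unfolding kdet_def
  by (intro sum.cong refl arg_cong2[where f = "(*)"] prod.cong) (auto simp: assms permutes_in_image)

lemma kdet_reindex:
  assumes t: "t permutes J" and J: "finite J"
  shows "kdet k J (r \<circ> t) (c \<circ> t) = kdet k J r c"
  unfolding kdet_def
proof (rule sum.reindex_bij_witness[of _ "\<lambda>q. inv_into UNIV t \<circ> q \<circ> t" "\<lambda>q. t \<circ> q \<circ> inv_into UNIV t"])
  fix q assume "q \<in> {q. q permutes J}"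
  then have q: "q permutes J" by simp
  note perm = permutes_imp_permutation[OF J]
  show "inv_into UNIV t \<circ> (t \<circ> q \<circ> inv_into UNIV t) \<circ> t = q" using permutes_inv_o[OF t] by (simp add: fun_eq_iff)
  show "t \<circ> (inv_into UNIV t \<circ> q \<circ> t) \<circ> inv_into UNIV t = q" using permutes_inv_o[OF t] by (simp add: fun_eq_iff)
  show "t \<circ> q \<circ> inv_into UNIV t \<in> {q. q permutes J}" using t q by (auto intro!: permutes_compose permutes_inv)
  show "inv_into UNIV t \<circ> q \<circ> t \<in> {q. q permutes J}" using t q by (auto intro!: permutes_compose permutes_inv)
  have "sign (t \<circ> q \<circ> inv_into UNIV t) = sign q"
    using perm[OF t] perm[OF q] perm[OF permutes_inv[OF t]]
    by (simp add: sign_compose permutation_compose sign_inverse)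
  moreover have "(\<Prod>i\<in>J. k (r i) (c ((t \<circ> q \<circ> inv_into UNIV t) i))) = (\<Prod>i\<in>J. k ((r \<circ> t) i) ((c \<circ> t) (q i)))"
    by (subst prod.reindex_bij_betw[OF permutes_imp_bij[OF t], symmetric])
       (simp add: permutes_inverses[OF t])
  ultimately show "of_int (sign (t \<circ> q \<circ> inv_into UNIV t)) * (\<Prod>i\<in>J. k (r i) (c ((t \<circ> q \<circ> inv_into UNIV t) i)))
     = of_int (sign q) * (\<Prod>i\<in>J. k ((r \<circ> t) i) ((c \<circ> t) (q i)))" by simp
qed

lemma kdet_equal_rows:
  assumes J: "finite J" and ij: "i \<in> J" "j \<in> J" "i \<noteq> j" "r i = r j"
  shows "kdet k J r c = 0"
proof -
  define t where "t = Transposition.transpose i j"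
  have t: "t permutes J" unfolding t_def using ij by (intro permutes_swap_id) auto
  note perm = permutes_imp_permutation[OF J]
  have tt: "t (t l) = l" for l by (simp add: t_def)
  have "kdet k J r c = (\<Sum>q | q permutes J. - (of_int (sign q) * (\<Prod>i\<in>J. k (r i) (c (q i)))))"
    unfolding kdet_def
  proof (rule sum.reindex_bij_witness[of _ "\<lambda>q. q \<circ> t" "\<lambda>q. q \<circ> t"])
    fix q assume "q \<in> {q. q permutes J}"
    then have q: "q permutes J" by simp
    show "q \<circ> t \<circ> t = q" "q \<circ> t \<circ> t = q" by (auto simp: fun_eq_iff tt)
    show "q \<circ> t \<in> {q. q permutes J}" "q \<circ> t \<in> {q. q permutes J}" using t q by (auto intro!: permutes_compose)
    have "sign (q \<circ> t) = - sign q"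
      using perm[OF t] perm[OF q] ij by (simp add: sign_compose t_def sign_swap_id)
    moreover have "(\<Prod>l\<in>J. k (r l) (c ((q \<circ> t) l))) = (\<Prod>l\<in>J. k (r l) (c (q l)))"
    proof -
      have "r (t l) = r l" for l unfolding t_def Transposition.transpose_def using ij by auto
      then show ?thesis
        by (subst prod.reindex_bij_betw[OF permutes_imp_bij[OF t], symmetric]) (simp add: tt)
    qed
    ultimately show "- (of_int (sign (q \<circ> t)) * (\<Prod>i\<in>J. k (r i) (c ((q \<circ> t) i))))
      = of_int (sign q) * (\<Prod>i\<in>J. k (r i) (c (q i)))" by simp
  qed
  also have "\<dots> = - kdet k J r c" unfolding kdet_def by (rule sum_negf)
  finally show ?thesis by simp
qed

text \<open>
  Expansion along the row \<open>a\<close>: for \<open>b \<noteq> a\<close> the minor is written as a determinant over \<open>S\<close>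
  in which the column \<open>b\<close> is replaced by the column \<open>a\<close>, which accounts for the sign.
\<close>

lemma kdet_expand:
  assumes S: "finite S" "a \<notin> S"
  shows "kdet k (insert a S) r c = k (r a) (c a) * kdet k S r c
     - (\<Sum>b\<in>S. k (r a) (c b) * kdet k S r (c(b := c a)))"
proof -
  define f where "f p = of_int (sign p) * (\<Prod>i\<in>insert a S. k (r i) (c (p i)))" for p
  note perm = permutes_imp_permutation[OF S(1)]
  have qa: "q a = a" if "q permutes S" for q using that S(2) by (auto simp: permutes_def)
  have 1: "(\<Sum>q | q permutes S. f (Transposition.transpose a a \<circ> q)) = k (r a) (c a) * kdet k S r c"
    unfolding kdet_def sum_distrib_left
  proof (rule sum.cong[OF refl])
    fix q assume "q \<in> {q. q permutes S}"
    then have "q a = a" using qa by simp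
    then show "f (Transposition.transpose a a \<circ> q) = k (r a) (c a) * (of_int (sign q) * (\<Prod>i\<in>S. k (r i) (c (q i))))"
      using S by (simp add: f_def)
  qed
  have 2: "(\<Sum>q | q permutes S. f (Transposition.transpose a b \<circ> q)) = - (k (r a) (c b) * kdet k S r (c(b := c a)))"
    if b: "b \<in> S" for b
    unfolding kdet_def sum_distrib_left sum_negf[symmetric]
  proof (rule sum.cong[OF refl])
    fix q assume "q \<in> {q. q permutes S}"
    then have q: "q permutes S" by simp
    have ab: "a \<noteq> b" using b S by auto
    have "sign (Transposition.transpose a b \<circ> q) = - sign q"
      using perm[OF q] ab by (simp add: sign_compose sign_swap_id permutation_swap_id)
    moreover have "(\<Prod>i\<in>insert a S. k (r i) (c ((Transposition.transpose a b \<circ> q) i)))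
       = k (r a) (c b) * (\<Prod>i\<in>S. k (r i) ((c(b := c a)) (q i)))"
    proof -
      have "c (Transposition.transpose a b (q i)) = (c(b := c a)) (q i)" if "i \<in> S" for i
      proof -
        have "q i \<in> S" using that q by (simp add: permutes_in_image)
        then show ?thesis using S(2) by (auto simp: Transposition.transpose_def)
      qed
      then have "(\<Prod>i\<in>S. k (r i) (c (Transposition.transpose a b (q i)))) = (\<Prod>i\<in>S. k (r i) ((c(b := c a)) (q i)))"
        by (intro prod.cong) auto
      then show ?thesis using S qa[OF q] by simp
    qed
    ultimately show "f (Transposition.transpose a b \<circ> q)
      = - (k (r a) (c b) * (of_int (sign q) * (\<Prod>i\<in>S. k (r i) ((c(b := c a)) (q i)))))"
      by (simp add: f_def)
  qed
  have "kdet k (insert a S) r c = (\<Sum>b\<in>insert a S. \<Sum>q | q permutes S. f (Transposition.transpose a b \<circ> q))"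
    unfolding kdet_def f_def[symmetric] by (rule sum_over_permutations_insert[OF S])
  also have "\<dots> = k (r a) (c a) * kdet k S r c + (\<Sum>b\<in>S. - (k (r a) (c b) * kdet k S r (c(b := c a))))"
    using S 1 2 by simp
  finally show ?thesis by (simp add: sum_negf)
qed

lemma kdet_crude_bound:
  assumes J: "finite J" and b: "\<And>x y. \<bar>k x y\<bar> \<le> u x * w y"
  shows "\<bar>kdet k J r c\<bar> \<le> fact (card J) * ((\<Prod>i\<in>J. u (r i)) * (\<Prod>i\<in>J. w (c i)))"
proof -
  have "\<bar>kdet k J r c\<bar> \<le> (\<Sum>q | q permutes J. \<bar>of_int (sign q) * (\<Prod>i\<in>J. k (r i) (c (q i)))\<bar>)"
    unfolding kdet_def by (rule sum_abs)
  also have "\<dots> \<le> (\<Sum>q | q permutes J. (\<Prod>i\<in>J. u (r i)) * (\<Prod>i\<in>J. w (c i)))"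
  proof (rule sum_mono)
    fix q assume "q \<in> {q. q permutes J}"
    then have q: "q permutes J" by simp
    have "\<bar>of_int (sign q) * (\<Prod>i\<in>J. k (r i) (c (q i)))\<bar> = (\<Prod>i\<in>J. \<bar>k (r i) (c (q i))\<bar>)"
      by (simp add: abs_mult abs_prod sign_def)
    also have "\<dots> \<le> (\<Prod>i\<in>J. u (r i) * w (c (q i)))" using b by (intro prod_mono) auto
    also have "\<dots> = (\<Prod>i\<in>J. u (r i)) * (\<Prod>i\<in>J. w (c i))"
      using prod.reindex_bij_betw[OF permutes_imp_bij[OF q], of "\<lambda>i. w (c i)"] by (simp add: prod.distrib)
    finally show "\<bar>of_int (sign q) * (\<Prod>i\<in>J. k (r i) (c (q i)))\<bar> \<le> \<dots>" .
  qed
  also have "\<dots> = fact (card J) * ((\<Prod>i\<in>J. u (r i)) * (\<Prod>i\<in>J. w (c i)))"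
    using J by (simp add: card_permutations)
  finally show ?thesis .
qed

lemma kdet_eq_det:
  "kdet k {..<n} r c = Determinant.det (mat n n (\<lambda>(i, j). k (r i) (c j)))"
proof -
  have "(\<Prod>i = 0..<n. mat n n (\<lambda>(i, j). k (r i) (c j)) $$ (i, q i)) = (\<Prod>i<n. k (r i) (c (q i)))"
    if "q permutes {0..<n}" for q
    using that by (intro prod.cong) (auto simp: permutes_in_image atLeast0LessThan)
  then show ?thesis
    unfolding kdet_def Determinant.det_def by (auto simp: atLeast0LessThan intro!: sum.cong)
qed

text \<open>Hadamard's inequality after division of the columns by \<open>w\<close>.\<close>

lemma kdet_Hadamard:
  assumes b: "\<And>x y. \<bar>k x y\<bar> \<le> u x * w y" and w: "\<And>x. w x \<ge> 0"
  shows "\<bar>kdet k {..<n} r c\<bar> \<le> sqrt (real n ^ n) * ((\<Prod>i<n. u (r i)) * (\<Prod>i<n. w (c i)))"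
proof -
  define k' where "k' x y = (if w y = 0 then 0 else k x y / w y)" for x y
  have k: "k x y = k' x y * w y" for x y
    using b[of x y] by (auto simp: k'_def)
  have u: "u x \<ge> 0 \<or> (\<forall>y. w y = 0)" for x
    using b[of x] w by (metis abs_ge_zero mult_neg_pos not_le order.trans order_le_less)
  have "kdet k {..<n} r c = kdet k' {..<n} r c * (\<Prod>i<n. w (c i))"
    unfolding kdet_def sum_distrib_right
  proof (rule sum.cong[OF refl])
    fix q assume "q \<in> {q. q permutes {..<n}}"
    then have q: "q permutes {..<n}" by simp
    show "of_int (sign q) * (\<Prod>i<n. k (r i) (c (q i))) = of_int (sign q) * (\<Prod>i<n. k' (r i) (c (q i))) * (\<Prod>i<n. w (c i))"
      unfolding k prod.distrib
      using prod.reindex_bij_betw[OF permutes_imp_bij[OF q], of "\<lambda>i. w (c i)"] by simp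
  qed
  moreover have "\<bar>kdet k' {..<n} r c\<bar> \<le> sqrt (real n ^ n) * (\<Prod>i<n. u (r i))" if "\<forall>i<n. w (c i) \<noteq> 0"
    unfolding kdet_eq_det
  proof (rule Hadamard_bound)
    show "mat n n (\<lambda>(i, j). k' (r i) (c j)) \<in> carrier_mat n n" by simp
    fix i j assume ij: "i < n" "j < n"
    have "\<bar>k' (r i) (c j)\<bar> \<le> u (r i)"
    proof -
      have "w (c j) > 0" using that ij w[of "c j"] by auto
      then show ?thesis using b[of "r i" "c j"] by (simp add: k'_def divide_simps)
    qed
    then show "\<bar>mat n n (\<lambda>(i, j). k' (r i) (c j)) $$ (i, j)\<bar> \<le> u (r i)" using ij by simp
  qed
  moreover have "(\<Prod>i<n. w (c i)) \<ge> 0" using w by (intro prod_nonneg) auto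
  ultimately show ?thesis
  proof (cases "\<forall>i<n. w (c i) \<noteq> 0")
    case True
    then have "\<bar>kdet k' {..<n} r c\<bar> * (\<Prod>i<n. w (c i)) \<le> sqrt (real n ^ n) * (\<Prod>i<n. u (r i)) * (\<Prod>i<n. w (c i))"
      using \<open>\<forall>i<n. w (c i) \<noteq> 0 \<Longrightarrow> _\<close> \<open>(\<Prod>i<n. w (c i)) \<ge> 0\<close> by (intro mult_right_mono) auto
    then show ?thesis
      using \<open>kdet k {..<n} r c = _\<close> \<open>(\<Prod>i<n. w (c i)) \<ge> 0\<close> by (simp add: abs_mult mult.assoc)
  next
    case False
    then have 0: "(\<Prod>i<n. w (c i)) = 0" by auto
    show ?thesis unfolding \<open>kdet k {..<n} r c = _\<close> 0 by simp
  qed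
qed

lemma kdet_psd:
  assumes sym: "\<And>x y. K x y = K y x"
    and psd: "\<And>v. (\<Sum>i<n. \<Sum>j<n. v i * v j * K (x i) (x j)) \<ge> 0"
  shows "0 \<le> kdet K {..<n} x x" "kdet K {..<n} x x \<le> (\<Prod>i<n. K (x i) (x i))"
proof -
  define A where "A = mat n n (\<lambda>(i, j). K (x i) (x j))"
  have "psd_mat n A"
    unfolding psd_mat_def
  proof (intro conjI ballI)
    show "A \<in> carrier_mat n n" by (simp add: A_def)
    show "A\<^sup>T = A" using sym by (auto simp: A_def)
    fix v :: "real vec" assume v: "v \<in> carrier_vec n"
    have "v \<bullet> (A *\<^sub>v v) = (\<Sum>i<n. \<Sum>j<n. v $ i * v $ j * K (x i) (x j))"
      using v by (auto simp: A_def scalar_prod_def atLeast0LessThan sum_distrib_left mult_ac intro!: sum.cong)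
    then show "v \<bullet> (A *\<^sub>v v) \<ge> 0" using psd by simp
  qed
  from psd_det[OF this]
  show "0 \<le> kdet K {..<n} x x" "kdet K {..<n} x x \<le> (\<Prod>i<n. K (x i) (x i))"
    by (auto simp: kdet_eq_det A_def)
qed

lemma kdet_measurable:
  assumes k: "(\<lambda>(x, y). k x y) \<in> borel_measurable (N1 \<Otimes>\<^sub>M N2)"
    and f: "\<And>i. i \<in> J \<Longrightarrow> f i \<in> measurable M N1"
    and g: "\<And>i. i \<in> J \<Longrightarrow> g i \<in> measurable M N2"
  shows "(\<lambda>\<omega>. kdet k J (\<lambda>i. f i \<omega>) (\<lambda>i. g i \<omega>)) \<in> borel_measurable M"
  unfolding kdet_def
proof (intro borel_measurable_sum borel_measurable_times borel_measurable_const borel_measurable_prod)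
  fix q i assume "q \<in> {q. q permutes J}" and i: "i \<in> J"
  then have "q i \<in> J" by (simp add: permutes_in_image)
  then have "(\<lambda>\<omega>. (f i \<omega>, g (q i) \<omega>)) \<in> measurable M (N1 \<Otimes>\<^sub>M N2)" using f g i by (intro measurable_Pair) auto
  from measurable_compose[OF this k]
  show "(\<lambda>\<omega>. k (f i \<omega>) (g (q i) \<omega>)) \<in> borel_measurable M" by simp
qed

section \<open>Lebesgue measure on finite powers of the line\<close>

text \<open>Lebesgue measure on the functions from \<open>J\<close> to the reals.\<close>

abbreviation LB :: "nat set \<Rightarrow> (nat \<Rightarrow> real) measure" where
  "LB J \<equiv> Pi\<^sub>M J (\<lambda>_. lborel)"

interpretation LB: product_sigma_finite "\<lambda>_ :: nat. lborel :: real measure"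
  by standard

lemma LB_sigma_finite: "finite J \<Longrightarrow> sigma_finite_measure (LB J)"
  by (rule LB.sigma_finite)

lemma LB_prod:
  fixes h :: "real \<Rightarrow> real"
  assumes "finite J" "integrable lborel h"
  shows "integrable (LB J) (\<lambda>r. C * (\<Prod>i\<in>J. h (r i)))"
    "(LINT r|LB J. C * (\<Prod>i\<in>J. h (r i))) = C * (LINT x|lborel. h x) ^ card J"
  using LB.product_integrable_prod[OF assms(1), of "\<lambda>_. h"] LB.product_integral_prod[OF assms(1), of "\<lambda>_. h"] assms
  by simp_all

text \<open>
  Integration over the coordinate \<open>i\<close> last; integrability on the product is the only
  hypothesis.
\<close>

lemma LB_integral_insert:
  fixes f :: "(nat \<Rightarrow> real) \<Rightarrow> real"
  assumes I: "finite I" "i \<notin> I" and int: "integrable (LB (insert i I)) f"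
  shows "integral\<^sup>L (LB (insert i I)) f = (LINT z|lborel. LINT x|LB I. f (x(i := z)))"
proof -
  interpret S: sigma_finite_measure "LB I" by (rule LB_sigma_finite[OF I(1)])
  interpret P: pair_sigma_finite "LB I" lborel ..
  have f: "f \<in> borel_measurable (LB (insert i I))" using int by (rule borel_measurable_integrable)
  have m: "(\<lambda>(x, z). f (x(i := z))) \<in> borel_measurable (LB I \<Otimes>\<^sub>M lborel)"
    using measurable_compose[OF measurable_add_dim f] by (simp add: case_prod_beta')
  have "integrable (LB I \<Otimes>\<^sub>M lborel) (\<lambda>(x, z). f (x(i := z)))"
  proof (rule integrableI_bounded[OF m])
    have m': "(\<lambda>p. ennreal (norm (case p of (x, z) \<Rightarrow> f (x(i := z))))) \<in> borel_measurable (LB I \<Otimes>\<^sub>M lborel)"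
      by (rule measurable_compose[OF measurable_compose[OF m borel_measurable_norm] measurable_ennreal])
    have "(\<integral>\<^sup>+ p. ennreal (norm (case p of (x, z) \<Rightarrow> f (x(i := z)))) \<partial>(LB I \<Otimes>\<^sub>M lborel))
       = (\<integral>\<^sup>+ x. \<integral>\<^sup>+ z. ennreal (norm (f (x(i := z)))) \<partial>lborel \<partial>LB I)"
      by (subst lborel.nn_integral_fst[OF m', symmetric]) simp
    also have "\<dots> = (\<integral>\<^sup>+ x. ennreal (norm (f x)) \<partial>LB (insert i I))"
      by (intro LB.product_nn_integral_insert[OF I, symmetric] measurable_compose[OF measurable_compose[OF f borel_measurable_norm] measurable_ennreal])
    also have "\<dots> < \<infinity>" using int by (simp add: integrable_iff_bounded)
    finally show "(\<integral>\<^sup>+ p. ennreal (norm (case p of (x, z) \<Rightarrow> f (x(i := z)))) \<partial>(LB I \<Otimes>\<^sub>M lborel)) < \<infinity>" .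
  qed
  then have "(LINT z|lborel. LINT x|LB I. f (x(i := z))) = (LINT x|LB I. LINT z|lborel. f (x(i := z)))"
    by (rule P.Fubini_integral)
  then show ?thesis using LB.product_integral_insert[OF I int] by simp
qed

lemma LB_reindex:
  assumes J: "finite J" and t: "bij_betw t J J'"
  shows "distr (LB J') (LB J) (\<lambda>r. \<lambda>i\<in>J. r (t i)) = LB J"
proof (rule LB.PiM_eqI[OF J])
  have J': "finite J'" using t J bij_betw_finite by blast
  have meas: "(\<lambda>r. \<lambda>i\<in>J. r (t i)) \<in> measurable (LB J') (LB J)"
    using t by (intro measurable_restrict measurable_component_singleton) (auto simp: bij_betw_def)
  show "sets (distr (LB J') (LB J) (\<lambda>r. \<lambda>i\<in>J. r (t i))) = sets (LB J)" by simp
  fix A :: "nat \<Rightarrow> real set" assume A: "\<And>i. i \<in> J \<Longrightarrow> A i \<in> sets lborel"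
  define B where "B j = A (the_inv_into J t j)" for j
  have inj: "inj_on t J" and im: "t ` J = J'" using t by (auto simp: bij_betw_def)
  have Bt: "B (t i) = A i" if "i \<in> J" for i using that inj by (simp add: B_def the_inv_into_f_f)
  have BM: "B j \<in> sets lborel" if "j \<in> J'" for j using that im Bt A by auto
  have "(\<lambda>r. \<lambda>i\<in>J. r (t i)) -` Pi\<^sub>E J A \<inter> space (LB J') = Pi\<^sub>E J' B"
    using im Bt by (auto simp: space_PiM PiE_iff)
  then have "emeasure (distr (LB J') (LB J) (\<lambda>r. \<lambda>i\<in>J. r (t i))) (Pi\<^sub>E J A) = emeasure (LB J') (Pi\<^sub>E J' B)"
    using A J by (subst emeasure_distr[OF meas]) (auto intro!: sets_PiM_I_finite)
  also have "\<dots> = (\<Prod>j\<in>J'. emeasure lborel (B j))" using BM by (intro LB.emeasure_PiM[OF J']) auto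
  also have "\<dots> = (\<Prod>i\<in>J. emeasure lborel (B (t i)))" by (rule prod.reindex_bij_betw[OF t, symmetric])
  also have "\<dots> = (\<Prod>i\<in>J. emeasure lborel (A i))" using Bt by (intro prod.cong) auto
  finally show "emeasure (distr (LB J') (LB J) (\<lambda>r. \<lambda>i\<in>J. r (t i))) (Pi\<^sub>E J A) = (\<Prod>i\<in>J. emeasure lborel (A i))" .
qed

lemma LB_integral_reindex:
  fixes f :: "(nat \<Rightarrow> real) \<Rightarrow> real"
  assumes J: "finite J" and t: "bij_betw t J J'" and f: "f \<in> borel_measurable (LB J)"
  shows "integral\<^sup>L (LB J) f = (LINT r|LB J'. f (\<lambda>i\<in>J. r (t i)))"
proof -
  have meas: "(\<lambda>r. \<lambda>i\<in>J. r (t i)) \<in> measurable (LB J') (LB J)"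
    using t by (intro measurable_restrict measurable_component_singleton) (auto simp: bij_betw_def)
  show ?thesis
    by (subst LB_reindex[OF J t, symmetric]) (rule integral_distr[OF meas f])
qed

section \<open>Fredholm determinants and minors\<close>

text \<open>
  A measurable kernel bounded by a rank one kernel \<open>u x * w y\<close> of finite trace. Under this
  condition the Fredholm series of the kernel converges absolutely.
\<close>

definition dominated :: "(real \<Rightarrow> real \<Rightarrow> real) \<Rightarrow> (real \<Rightarrow> real) \<Rightarrow> (real \<Rightarrow> real) \<Rightarrow> bool" where
  "dominated k u w \<longleftrightarrow> (\<lambda>(x, y). k x y) \<in> borel_measurable (borel \<Otimes>\<^sub>M borel) \<and>
     integrable lborel (\<lambda>x. u x * w x) \<and> (\<forall>x. 0 \<le> u x) \<and> (\<forall>x. 0 \<le> w x) \<and> (\<forall>x y. \<bar>k x y\<bar> \<le> u x * w y)"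

lemma dominatedD:
  assumes "dominated k u w"
  shows "(\<lambda>(x, y). k x y) \<in> borel_measurable (borel \<Otimes>\<^sub>M borel)"
    "integrable lborel (\<lambda>x. u x * w x)" "0 \<le> u x" "0 \<le> w x" "\<bar>k x y\<bar> \<le> u x * w y"
  using assms by (auto simp: dominated_def)

text \<open>
  The integrals in the Fredholm series, over the variables indexed by \<open>J\<close>.
\<close>

definition fred_det_term :: "(real \<Rightarrow> real \<Rightarrow> real) \<Rightarrow> nat set \<Rightarrow> real" where
  "fred_det_term k J = (LINT r|LB J. kdet k J r r)"

text \<open>
  The integrals in the series of the first Fredholm minor. The index \<open>a\<close>, which is not in
  \<open>J\<close>, carries the row \<open>x\<close> and the column \<open>y\<close>.
\<close>

definition fred_minor_term :: "(real \<Rightarrow> real \<Rightarrow> real) \<Rightarrow> nat set \<Rightarrow> nat \<Rightarrow> real \<Rightarrow> real \<Rightarrow> real" where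
  "fred_minor_term k J a x y = (LINT r|LB J. kdet k (insert a J) (r(a := x)) (r(a := y)))"

lemma LB_component [simp]: "i \<in> J \<Longrightarrow> (\<lambda>r. r i) \<in> borel_measurable (LB J)"
  using measurable_component_singleton[of i J "\<lambda>_. lborel :: real measure"] by simp

lemma measurable_section2: "(\<lambda>(x, y). k x y) \<in> borel_measurable (borel \<Otimes>\<^sub>M borel) \<Longrightarrow> f \<in> borel_measurable M \<Longrightarrow>
   g \<in> borel_measurable M \<Longrightarrow> (\<lambda>z. k (f z) (g z)) \<in> borel_measurable M" for k :: "real \<Rightarrow> real \<Rightarrow> real"
  using measurable_compose[OF measurable_Pair, of f M borel g borel "\<lambda>(x, y). k x y"] by simp

lemma kdet_diag_measurable:
  "dominated k u w \<Longrightarrow> (\<lambda>r. kdet k J r r) \<in> borel_measurable (LB J)"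
  by (rule kdet_measurable[OF dominatedD(1), where f = "\<lambda>i r. r i" and g = "\<lambda>i r. r i"]) auto

lemma kdet_border_bound:
  assumes k: "dominated k u w" and J: "finite J" "a \<notin> J"
  shows "\<bar>kdet k (insert a J) (r(a := x)) (r(a := y))\<bar> \<le> (fact (Suc (card J)) * u x * w y) * (\<Prod>i\<in>J. u (r i) * w (r i))"
proof -
  have "(\<Prod>i\<in>insert a J. u ((r(a := x)) i)) = u x * (\<Prod>i\<in>J. u (r i))"
    "(\<Prod>i\<in>insert a J. w ((r(a := y)) i)) = w y * (\<Prod>i\<in>J. w (r i))"
    using J by (auto intro!: prod.cong arg_cong2[where f = "(*)"])
  with kdet_crude_bound[of "insert a J" k u w "r(a := x)" "r(a := y)", OF _ dominatedD(5)[OF k]] J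
  have "\<bar>kdet k (insert a J) (r(a := x)) (r(a := y))\<bar> \<le> fact (card (insert a J)) * ((u x * (\<Prod>i\<in>J. u (r i))) * (w y * (\<Prod>i\<in>J. w (r i))))"
    by (simp only: finite_insert)
  then show ?thesis using J by (simp add: prod.distrib mult_ac)
qed

lemma kdet_border_Hadamard:
  assumes k: "dominated k u w"
  shows "\<bar>kdet k {..<Suc n} (r(n := x)) (r(n := y))\<bar> \<le> (sqrt (real (Suc n) ^ Suc n) * u x * w y) * (\<Prod>i<n. u (r i) * w (r i))"
proof -
  have "(\<Prod>i<Suc n. u ((r(n := x)) i)) = u x * (\<Prod>i<n. u (r i))"
    "(\<Prod>i<Suc n. w ((r(n := y)) i)) = w y * (\<Prod>i<n. w (r i))"
    by (auto intro!: prod.cong)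
  with kdet_Hadamard[of k u w "Suc n" "r(n := x)" "r(n := y)"] dominatedD(4,5)[OF k]
  show ?thesis by (simp add: prod.distrib mult_ac)
qed

lemma fun_upd_component_measurable:
  "a \<notin> J \<Longrightarrow> i \<in> insert a J \<Longrightarrow> (\<lambda>r. (r(a := x)) i) \<in> borel_measurable (LB J)"
  by (cases "i = a") auto

lemma kdet_border_measurable:
  "dominated k u w \<Longrightarrow> a \<notin> J \<Longrightarrow> (\<lambda>r. kdet k (insert a J) (r(a := x)) (r(a := y))) \<in> borel_measurable (LB J)"
  by (rule kdet_measurable[OF dominatedD(1), where f = "\<lambda>i r. (r(a := x)) i" and g = "\<lambda>i r. (r(a := y)) i"])
     (auto simp del: fun_upd_apply intro: fun_upd_component_measurable)

lemma integrable_kdet_diag: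
  assumes k: "dominated k u w" and J: "finite J"
  shows "integrable (LB J) (\<lambda>r. kdet k J r r)"
proof (rule Bochner_Integration.integrable_bound)
  show "integrable (LB J) (\<lambda>r. fact (card J) * (\<Prod>i\<in>J. u (r i) * w (r i)))"
    by (rule LB_prod(1)[OF J dominatedD(2)[OF k]])
  show "AE r in LB J. norm (kdet k J r r) \<le> norm (fact (card J) * (\<Prod>i\<in>J. u (r i) * w (r i)))"
    using order_trans[OF kdet_crude_bound[of J k u w, OF J dominatedD(5)[OF k]] abs_ge_self]
    by (intro AE_I2) (simp add: prod.distrib)
qed (rule kdet_diag_measurable[OF k])

lemma integrable_kdet_border:
  assumes k: "dominated k u w" and J: "finite J" "a \<notin> J"
  shows "integrable (LB J) (\<lambda>r. kdet k (insert a J) (r(a := x)) (r(a := y)))"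
proof (rule Bochner_Integration.integrable_bound)
  show "integrable (LB J) (\<lambda>r. (fact (Suc (card J)) * u x * w y) * (\<Prod>i\<in>J. u (r i) * w (r i)))"
    by (rule LB_prod(1)[OF J(1) dominatedD(2)[OF k]])
  show "AE r in LB J. norm (kdet k (insert a J) (r(a := x)) (r(a := y))) \<le> norm ((fact (Suc (card J)) * u x * w y) * (\<Prod>i\<in>J. u (r i) * w (r i)))"
    using order_trans[OF kdet_border_bound[OF k J] abs_ge_self] by (intro AE_I2) simp
qed (rule kdet_border_measurable[OF k J(2)])

lemma fred_minor_term_reindex:
  assumes k: "dominated k u w" and b: "b < Suc m"
  shows "fred_minor_term k ({..<Suc m} - {b}) b x y = fred_minor_term k {..<m} m x y"
proof -
  define t where "t = Transposition.transpose b m"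
  have t: "t permutes {..<Suc m}" unfolding t_def using b by (intro permutes_swap_id) auto
  have bij: "bij_betw t {..<m} ({..<Suc m} - {b})"
  proof (rule bij_betw_byWitness[where f' = t])
    show "t ` {..<m} \<subseteq> {..<Suc m} - {b}" "t ` ({..<Suc m} - {b}) \<subseteq> {..<m}"
      using b by (auto simp: t_def Transposition.transpose_def split: if_splits)
  qed (auto simp: t_def)
  have m1: "(\<lambda>r. kdet k (insert m {..<m}) (r(m := x)) (r(m := y))) \<in> borel_measurable (LB {..<m})"
    by (rule kdet_border_measurable[OF k]) simp
  have "fred_minor_term k {..<m} m x y = (LINT r|LB ({..<Suc m} - {b}).
     kdet k (insert m {..<m}) ((\<lambda>i\<in>{..<m}. r (t i))(m := x)) ((\<lambda>i\<in>{..<m}. r (t i))(m := y)))"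
    unfolding fred_minor_term_def by (rule LB_integral_reindex[OF _ bij m1]) simp
  also have "\<dots> = (LINT r|LB ({..<Suc m} - {b}). kdet k (insert b ({..<Suc m} - {b})) (r(b := x)) (r(b := y)))"
  proof (rule Bochner_Integration.integral_cong[OF refl])
    fix r :: "nat \<Rightarrow> real"
    have "((\<lambda>i\<in>{..<m}. r (t i))(m := z)) i = (r(b := z) \<circ> t) i" if "i \<in> {..<Suc m}" for z i
      using that b by (auto simp: t_def Transposition.transpose_def)
    then have "kdet k {..<Suc m} ((\<lambda>i\<in>{..<m}. r (t i))(m := x)) ((\<lambda>i\<in>{..<m}. r (t i))(m := y))
      = kdet k {..<Suc m} (r(b := x) \<circ> t) (r(b := y) \<circ> t)" by (intro kdet_cong)
    also have "\<dots> = kdet k {..<Suc m} (r(b := x)) (r(b := y))" by (rule kdet_reindex[OF t]) simp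
    finally have e: "kdet k {..<Suc m} ((\<lambda>i\<in>{..<m}. r (t i))(m := x)) ((\<lambda>i\<in>{..<m}. r (t i))(m := y)) = kdet k {..<Suc m} (r(b := x)) (r(b := y))" .
    have "insert b ({..<Suc m} - {b}) = {..<Suc m}" "insert m {..<m} = {..<Suc m}" using b by auto
    with e show "kdet k (insert m {..<m}) ((\<lambda>i\<in>{..<m}. r (t i))(m := x)) ((\<lambda>i\<in>{..<m}. r (t i))(m := y))
      = kdet k (insert b ({..<Suc m} - {b})) (r(b := x)) (r(b := y))" by (simp only:)
  qed
  finally show ?thesis unfolding fred_minor_term_def by simp
qed

text \<open>Expansion of the bordered determinant along the row of \<open>x\<close>.\<close>

lemma fred_minor_term_expand:
  assumes k: "dominated k u w"
  shows "fred_minor_term k {..<n} n x y = k x y * fred_det_term k {..<n}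
     - (\<Sum>b<n. LINT z|lborel. k x z * fred_minor_term k ({..<n} - {b}) b z y)"
proof -
  have e: "kdet k (insert n {..<n}) (r(n := x)) (r(n := y))
     = k x y * kdet k {..<n} r r - (\<Sum>b<n. k x (r b) * kdet k {..<n} r (r(b := y)))" for r :: "nat \<Rightarrow> real"
  proof -
    have 1: "kdet k {..<n} (r(n := x)) (r(n := y)) = kdet k {..<n} r r" by (rule kdet_cong) auto
    have 2: "kdet k {..<n} (r(n := x)) ((r(n := y))(b := y)) = kdet k {..<n} r (r(b := y))" for b by (rule kdet_cong) auto
    show ?thesis
      by (subst kdet_expand) (auto simp: 1 2 intro!: sum.cong)
  qed
  have m: "(\<lambda>r. k x (r b) * kdet k {..<n} r (r(b := y))) \<in> borel_measurable (LB {..<n})" if "b < n" for b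
  proof (rule borel_measurable_times)
    show "(\<lambda>r. k x (r b)) \<in> borel_measurable (LB {..<n})"
      using that by (intro measurable_section2[OF dominatedD(1)[OF k]]) auto
    show "(\<lambda>r. kdet k {..<n} r (r(b := y))) \<in> borel_measurable (LB {..<n})"
      by (rule kdet_measurable[OF dominatedD(1)[OF k], where f = "\<lambda>i r. r i" and g = "\<lambda>i r. (r(b := y)) i"]) auto
  qed
  have bd: "\<bar>k x (r b) * kdet k {..<n} r (r(b := y))\<bar>
    \<le> (fact n * u x * w y) * (\<Prod>i\<in>{..<n}. u (r i) * w (r i))" if b: "b < n" for b r
  proof -
    have ins: "{..<n} = insert b ({..<n} - {b})" using b by auto
    have p: "(\<Prod>i<n. f i) = f b * (\<Prod>i\<in>{..<n} - {b}. f i)" for f :: "nat \<Rightarrow> real"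
      using b by (subst prod.remove[of _ b]) auto
    have "(\<Prod>i<n. w ((r(b := y)) i)) = w y * (\<Prod>i\<in>{..<n} - {b}. w (r i))"
      unfolding p by (auto intro!: prod.cong)
    then have "\<bar>kdet k {..<n} r (r(b := y))\<bar> \<le> fact n * ((\<Prod>i<n. u (r i)) * (w y * (\<Prod>i\<in>{..<n} - {b}. w (r i))))"
      using kdet_crude_bound[of "{..<n}" k u w r "r(b := y)"] dominatedD(5)[OF k] by simp
    then have "\<bar>k x (r b) * kdet k {..<n} r (r(b := y))\<bar>
      \<le> (u x * w (r b)) * (fact n * ((\<Prod>i<n. u (r i)) * (w y * (\<Prod>i\<in>{..<n} - {b}. w (r i)))))"
      unfolding abs_mult using dominatedD(5)[OF k] dominatedD(3,4)[OF k] by (intro mult_mono) auto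
    also have "\<dots> = (fact n * u x * w y) * ((\<Prod>i<n. u (r i)) * (\<Prod>i<n. w (r i)))"
      unfolding p[of "\<lambda>i. w (r i)"] by (simp add: mult_ac)
    finally show ?thesis by (simp add: prod.distrib)
  qed
  have int: "integrable (LB {..<n}) (\<lambda>r. k x (r b) * kdet k {..<n} r (r(b := y)))" if b: "b < n" for b
  proof (rule Bochner_Integration.integrable_bound)
    show "integrable (LB {..<n}) (\<lambda>r. (fact n * u x * w y) * (\<Prod>i\<in>{..<n}. u (r i) * w (r i)))"
      by (rule LB_prod(1)[OF _ dominatedD(2)[OF k]]) simp
    show "AE r in LB {..<n}. norm (k x (r b) * kdet k {..<n} r (r(b := y))) \<le> norm ((fact n * u x * w y) * (\<Prod>i\<in>{..<n}. u (r i) * w (r i)))"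
      using order_trans[OF bd[OF b] abs_ge_self] by (intro AE_I2) simp
  qed (rule m[OF b])
  have trm: "(LINT r|LB {..<n}. k x (r b) * kdet k {..<n} r (r(b := y)))
     = (LINT z|lborel. k x z * fred_minor_term k ({..<n} - {b}) b z y)" if b: "b < n" for b
  proof -
    define I where "I = {..<n} - {b}"
    have ins: "{..<n} = insert b I" and bI: "finite I" "b \<notin> I" using b by (auto simp: I_def)
    have "(LINT r|LB {..<n}. k x (r b) * kdet k {..<n} r (r(b := y)))
      = (LINT z|lborel. LINT r|LB I. k x ((r(b := z)) b) * kdet k {..<n} (r(b := z)) ((r(b := z))(b := y)))"
      unfolding ins
      by (rule LB_integral_insert[OF bI]) (use int[OF b] in \<open>simp add: ins\<close>)
    also have "\<dots> = (LINT z|lborel. LINT r|LB I. k x z * kdet k (insert b I) (r(b := z)) (r(b := y)))"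
      by (simp add: ins)
    also have "\<dots> = (LINT z|lborel. k x z * fred_minor_term k I b z y)"
      unfolding fred_minor_term_def by simp
    finally show ?thesis unfolding I_def .
  qed
  have "fred_minor_term k {..<n} n x y = (LINT r|LB {..<n}. k x y * kdet k {..<n} r r - (\<Sum>b<n. k x (r b) * kdet k {..<n} r (r(b := y))))"
    unfolding fred_minor_term_def e ..
  also have "\<dots> = (LINT r|LB {..<n}. k x y * kdet k {..<n} r r) - (LINT r|LB {..<n}. (\<Sum>b<n. k x (r b) * kdet k {..<n} r (r(b := y))))"
    using int by (intro Bochner_Integration.integral_diff Bochner_Integration.integrable_sum integrable_mult_right integrable_kdet_diag[OF k]) auto
  also have "(LINT r|LB {..<n}. (\<Sum>b<n. k x (r b) * kdet k {..<n} r (r(b := y)))) = (\<Sum>b<n. LINT r|LB {..<n}. k x (r b) * kdet k {..<n} r (r(b := y)))"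
    using int by (intro Bochner_Integration.integral_sum) auto
  finally show ?thesis using trm by (simp add: fred_det_term_def)
qed

text \<open>
  The series form of the resolvent equation: by symmetry all terms in the previous
  expansion are equal.
\<close>

lemma fred_minor_term_Suc:
  assumes k: "dominated k u w"
  shows "fred_minor_term k {..<Suc m} (Suc m) x y = k x y * fred_det_term k {..<Suc m}
     - real (Suc m) * (LINT z|lborel. k x z * fred_minor_term k {..<m} m z y)"
  unfolding fred_minor_term_expand[OF k, of "Suc m"] by (simp add: fred_minor_term_reindex[OF k])

lemma kdet_empty: "kdet k {} r c = 1"
  by (simp add: kdet_def)

lemma fred_det_term_0: "fred_det_term k {} = 1"
  unfolding fred_det_term_def kdet_empty
  using LB_prod(2)[of "{}" "\<lambda>_. 0" 1] by simp

lemma fred_minor_term_0: assumes k: "dominated k u w" shows "fred_minor_term k {} 0 x y = k x y"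
  using fred_minor_term_expand[OF k, of 0 x y] by (simp add: fred_det_term_0)

lemma kdet_diag_Hadamard:
  assumes k: "dominated k u w"
  shows "\<bar>kdet k {..<n} r r\<bar> \<le> sqrt (real n ^ n) * (\<Prod>i<n. u (r i) * w (r i))"
  using kdet_Hadamard[of k u w n r r] dominatedD(4,5)[OF k] by (simp add: prod.distrib)

lemma fred_det_term_bound:
  assumes k: "dominated k u w"
  shows "\<bar>fred_det_term k {..<n}\<bar> \<le> sqrt (real n ^ n) * (LINT x|lborel. u x * w x) ^ n"
proof -
  have "\<bar>fred_det_term k {..<n}\<bar> \<le> (LINT r|LB {..<n}. sqrt (real n ^ n) * (\<Prod>i<n. u (r i) * w (r i)))"
    unfolding fred_det_term_def
  proof (rule norm_integral_le)
    show "integrable (LB {..<n}) (\<lambda>r. kdet k {..<n} r r)" by (rule integrable_kdet_diag[OF k]) simp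
    show "integrable (LB {..<n}) (\<lambda>r. sqrt (real n ^ n) * (\<Prod>i<n. u (r i) * w (r i)))"
      by (rule LB_prod(1)[OF _ dominatedD(2)[OF k]]) simp
  qed (rule kdet_diag_Hadamard[OF k])
  then show ?thesis by (subst (asm) LB_prod(2)[OF _ dominatedD(2)[OF k]]) auto
qed

lemma fred_minor_term_bound:
  assumes k: "dominated k u w"
  shows "\<bar>fred_minor_term k {..<n} n x y\<bar> \<le> u x * w y * (sqrt (real (Suc n) ^ Suc n) * (LINT x|lborel. u x * w x) ^ n)"
proof -
  have "\<bar>fred_minor_term k {..<n} n x y\<bar> \<le> (LINT r|LB {..<n}. (sqrt (real (Suc n) ^ Suc n) * u x * w y) * (\<Prod>i<n. u (r i) * w (r i)))"
    unfolding fred_minor_term_def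
  proof (rule norm_integral_le)
    show "integrable (LB {..<n}) (\<lambda>r. kdet k (insert n {..<n}) (r(n := x)) (r(n := y)))"
      by (rule integrable_kdet_border[OF k]) auto
    show "integrable (LB {..<n}) (\<lambda>r. (sqrt (real (Suc n) ^ Suc n) * u x * w y) * (\<Prod>i<n. u (r i) * w (r i)))"
      by (rule LB_prod(1)[OF _ dominatedD(2)[OF k]]) simp
    show "\<bar>kdet k (insert n {..<n}) (r(n := x)) (r(n := y))\<bar> \<le> (sqrt (real (Suc n) ^ Suc n) * u x * w y) * (\<Prod>i<n. u (r i) * w (r i))" for r
      using kdet_border_Hadamard[OF k, of n r x y] by (simp add: lessThan_Suc)
  qed
  then show ?thesis by (subst (asm) LB_prod(2)[OF _ dominatedD(2)[OF k]]) (auto simp: mult_ac)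
qed

text \<open>
  The bound that Hadamard's inequality gives for the \<open>n\<close>-th term of the first Fredholm
  minor of a kernel with trace bound \<open>\<kappa>\<close>, up to the factor \<open>u x * w y\<close>.
\<close>

definition hadamard_term :: "real \<Rightarrow> nat \<Rightarrow> real" where
  "hadamard_term \<kappa> n = sqrt (real (Suc n) ^ Suc n) * \<kappa> ^ n / fact n"

lemma power_le_fact_exp: "real n ^ n \<le> fact n * exp (real n)"
proof -
  have s: "(\<lambda>k. real n ^ k / fact k) sums exp (real n)"
    using exp_converges[of "real n"] by (simp add: divide_inverse mult.commute)
  have "(\<Sum>k\<in>{n}. real n ^ k / fact k) \<le> (\<Sum>k. real n ^ k / fact k)"
    using s by (intro sum_le_suminf) (auto simp: sums_iff)
  then have "real n ^ n / fact n \<le> exp (real n)" using s by (simp add: sums_iff)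
  then show ?thesis by (simp add: divide_le_eq mult.commute)
qed

lemma hadamard_term_nonneg: "\<kappa> \<ge> 0 \<Longrightarrow> hadamard_term \<kappa> n \<ge> 0"
  by (simp add: hadamard_term_def)

lemma hadamard_term_mono: "0 \<le> \<kappa> \<Longrightarrow> \<kappa> \<le> \<kappa>' \<Longrightarrow> hadamard_term \<kappa> n \<le> hadamard_term \<kappa>' n"
  unfolding hadamard_term_def by (intro divide_right_mono mult_left_mono power_mono) auto

text \<open>
  Since \<open>n^n \<le> n! e^n\<close>, the terms decay like \<open>X^n / sqrt (n!)\<close>.
\<close>

lemma summable_hadamard_term:
  assumes \<kappa>: "\<kappa> \<ge> 0"
  shows "summable (hadamard_term \<kappa>)"
proof -
  define X where "X = 2 * exp (1 / 2) * \<kappa>"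
  define Y where "Y n = exp (1 / 2) * ((2 * X\<^sup>2) ^ n / fact n + (1 / 2) ^ n)" for n
  have X: "X \<ge> 0" using \<kappa> by (simp add: X_def)
  have "summable Y"
    unfolding Y_def
  proof (intro summable_mult summable_add)
    show "summable (\<lambda>n. (2 * X\<^sup>2) ^ n / fact n)" using summable_exp[of "2 * X\<^sup>2"] by (simp add: divide_inverse mult.commute)
    show "summable (\<lambda>n. (1 / 2 :: real) ^ n)" by (rule summable_geometric) simp
  qed
  then show ?thesis
  proof (rule summable_comparison_test_ev[rotated], intro always_eventually allI)
    fix n
    have "sqrt (real (Suc n) ^ Suc n) \<le> sqrt (fact (Suc n) * exp (real (Suc n)))"
      by (intro real_sqrt_le_mono power_le_fact_exp)
    also have "\<dots> = sqrt (real (Suc n)) * sqrt (fact n) * (exp (1 / 2) * exp (1 / 2) ^ n)"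
    proof -
      have "exp (real (Suc n)) = (exp (1 / 2) * exp (1 / 2) ^ n)\<^sup>2"
        by (simp add: power2_eq_square flip: exp_of_nat_mult exp_add)
      then have "sqrt (exp (real (Suc n))) = exp (1 / 2) * exp (1 / 2) ^ n" by simp
      then show ?thesis by (simp add: real_sqrt_mult)
    qed
    also have "\<dots> \<le> 2 ^ n * sqrt (fact n) * (exp (1 / 2) * exp (1 / 2) ^ n)"
    proof (intro mult_right_mono)
      have "real (Suc n) \<le> 2 ^ n" by (metis Suc_leI less_exp of_nat_le_iff of_nat_numeral of_nat_power)
      moreover have "sqrt (real (Suc n)) \<le> real (Suc n)" by (simp add: sqrt_le_D real_sqrt_le_iff real_le_lsqrt power2_eq_square)
      ultimately show "sqrt (real (Suc n)) \<le> 2 ^ n" by linarith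
    qed auto
    finally have "hadamard_term \<kappa> n \<le> (2 ^ n * sqrt (fact n) * (exp (1 / 2) * exp (1 / 2) ^ n)) * \<kappa> ^ n / fact n"
      unfolding hadamard_term_def using \<kappa> by (intro divide_right_mono mult_right_mono) auto
    also have "\<dots> = exp (1 / 2) * (X ^ n / sqrt (fact n))"
    proof -
      have "fact n = sqrt (fact n) * sqrt (fact n :: real)" by simp
      then have "sqrt (fact n) / fact n = 1 / sqrt (fact n :: real)"
        by (metis nonzero_divide_mult_cancel_left real_sqrt_eq_zero_cancel_iff fact_nonzero)
      then show ?thesis by (simp add: X_def power_mult_distrib field_simps)
    qed
    \<comment> \<open>The left-hand side is the geometric mean of the two terms on the right.\<close>
    also have "X ^ n / sqrt (fact n) \<le> (2 * X\<^sup>2) ^ n / fact n + (1 / 2) ^ n"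
    proof -
      define A where "A = sqrt ((2 * X\<^sup>2) ^ n / fact n)"
      define B where "B = sqrt ((1 / 2 :: real) ^ n)"
      have "X ^ n / sqrt (fact n) = A * B"
      proof -
        have "A * B = sqrt ((2 * X\<^sup>2) ^ n / fact n * (1 / 2) ^ n)" by (simp only: A_def B_def real_sqrt_mult)
        also have "(2 * X\<^sup>2) ^ n / fact n * (1 / 2) ^ n = (X ^ n)\<^sup>2 / fact n"
          by (simp add: power_mult_distrib power_divide power_mult[symmetric] mult.commute)
        also have "sqrt \<dots> = X ^ n / sqrt (fact n)" using X by (simp add: real_sqrt_divide)
        finally show ?thesis by simp
      qed
      also have "A * B \<le> A\<^sup>2 + B\<^sup>2"
      proof -
        have "A * B \<ge> 0" using X by (simp add: A_def B_def)
        then show ?thesis using zero_le_power2[of "A - B"] by (simp add: power2_eq_square algebra_simps)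
      qed
      also have "\<dots> = (2 * X\<^sup>2) ^ n / fact n + (1 / 2) ^ n" by (simp add: A_def B_def)
      finally show ?thesis .
    qed
    finally show "norm (hadamard_term \<kappa> n) \<le> Y n" using hadamard_term_nonneg[OF \<kappa>, of n] by (simp add: Y_def)
  qed
qed

text \<open>The Fredholm determinant of \<open>1 + k\<close> on the line.\<close>

definition fred_det :: "(real \<Rightarrow> real \<Rightarrow> real) \<Rightarrow> real" where
  "fred_det k = (\<Sum>n. fred_det_term k {..<n} / fact n)"

text \<open>
  The first Fredholm minor of \<open>1 + k\<close>, i.e. the determinant times the resolvent kernel
  \<open>k (1 + k)^(-1)\<close>.
\<close>

definition fred_minor :: "(real \<Rightarrow> real \<Rightarrow> real) \<Rightarrow> real \<Rightarrow> real \<Rightarrow> real" where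
  "fred_minor k x y = (\<Sum>n. fred_minor_term k {..<n} n x y / fact n)"

lemma dominated_integral_nonneg: "dominated k u w \<Longrightarrow> (LINT x|lborel. u x * w x) \<ge> 0"
  by (rule Bochner_Integration.integral_nonneg) (simp add: dominatedD(3,4))

lemma fred_minor_term_le:
  assumes k: "dominated k u w"
  shows "\<bar>fred_minor_term k {..<n} n x y / fact n\<bar> \<le> u x * w y * hadamard_term (LINT x|lborel. u x * w x) n"
  using divide_right_mono[OF fred_minor_term_bound[OF k, of n x y], of "fact n"] by (simp add: hadamard_term_def abs_divide)

lemma fred_det_term_le:
  assumes k: "dominated k u w"
  shows "\<bar>fred_det_term k {..<Suc n} / fact (Suc n)\<bar> \<le> (LINT x|lborel. u x * w x) * hadamard_term (LINT x|lborel. u x * w x) n"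
proof -
  define \<kappa> where "\<kappa> = (LINT x|lborel. u x * w x)"
  have \<kappa>: "\<kappa> \<ge> 0" using dominated_integral_nonneg[OF k] by (simp add: \<kappa>_def)
  have "\<bar>fred_det_term k {..<Suc n} / fact (Suc n)\<bar> \<le> (sqrt (real (Suc n) ^ Suc n) * \<kappa> ^ Suc n) / fact (Suc n)"
    using divide_right_mono[OF fred_det_term_bound[OF k, of "Suc n"], of "fact (Suc n)"] by (simp add: \<kappa>_def abs_divide)
  also have "\<dots> \<le> (sqrt (real (Suc n) ^ Suc n) * \<kappa> ^ Suc n) / fact n"
    using \<kappa> by (intro divide_left_mono mult_nonneg_nonneg fact_mono) auto
  also have "\<dots> = \<kappa> * hadamard_term \<kappa> n" by (simp add: hadamard_term_def)
  finally show ?thesis by (simp add: \<kappa>_def)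
qed

lemma summable_fred_minor_term:
  assumes k: "dominated k u w"
  shows "summable (\<lambda>n. fred_minor_term k {..<n} n x y / fact n)"
  by (rule summable_comparison_test_ev[where g = "\<lambda>n. u x * w y * hadamard_term (LINT x|lborel. u x * w x) n"])
     (use fred_minor_term_le[OF k] in \<open>auto intro!: summable_mult summable_hadamard_term dominated_integral_nonneg[OF k]\<close>)

lemma fred_minor_bound:
  assumes k: "dominated k u w"
  shows "\<bar>fred_minor k x y\<bar> \<le> u x * w y * (\<Sum>n. hadamard_term (LINT x|lborel. u x * w x) n)"
proof -
  have s: "summable (\<lambda>n. u x * w y * hadamard_term (LINT x|lborel. u x * w x) n)"
    by (intro summable_mult summable_hadamard_term dominated_integral_nonneg[OF k])
  have "norm (fred_minor k x y) \<le> (\<Sum>n. u x * w y * hadamard_term (LINT x|lborel. u x * w x) n)"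
    unfolding fred_minor_def using fred_minor_term_le[OF k] s by (intro norm_suminf_le) auto
  then show ?thesis by (subst (asm) suminf_mult) (auto intro!: summable_hadamard_term dominated_integral_nonneg[OF k])
qed

lemma summable_fred_det_term:
  assumes k: "dominated k u w"
  shows "summable (\<lambda>n. fred_det_term k {..<n} / fact n)"
proof -
  have "summable (\<lambda>n. fred_det_term k {..<Suc n} / fact (Suc n))"
    by (rule summable_comparison_test_ev[where g = "\<lambda>n. (LINT x|lborel. u x * w x) * hadamard_term (LINT x|lborel. u x * w x) n"])
       (use fred_det_term_le[OF k] in \<open>auto intro!: summable_mult summable_hadamard_term dominated_integral_nonneg[OF k] simp del: fact_Suc\<close>)
  then show ?thesis by (subst (asm) summable_Suc_iff)
qed

lemma fred_det_minus_1:
  assumes k: "dominated k u w"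
  shows "\<bar>fred_det k - 1\<bar> \<le> (LINT x|lborel. u x * w x) * (\<Sum>n. hadamard_term (LINT x|lborel. u x * w x) n)"
proof -
  have "fred_det k = (\<Sum>n. fred_det_term k {..<Suc n} / fact (Suc n)) + 1"
    unfolding fred_det_def using suminf_split_head[OF summable_fred_det_term[OF k]] by (simp add: fred_det_term_0)
  moreover have "norm (\<Sum>n. fred_det_term k {..<Suc n} / fact (Suc n)) \<le> (\<Sum>n. (LINT x|lborel. u x * w x) * hadamard_term (LINT x|lborel. u x * w x) n)"
    using fred_det_term_le[OF k] by (intro norm_suminf_le) (auto intro!: summable_mult summable_hadamard_term dominated_integral_nonneg[OF k] simp del: fact_Suc)
  ultimately show ?thesis by (subst (asm) suminf_mult) (auto intro!: summable_hadamard_term dominated_integral_nonneg[OF k] simp del: fact_Suc)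
qed

lemma fred_minor_term_measurable:
  assumes k: "dominated k u w"
  shows "(\<lambda>z. fred_minor_term k {..<n} n z y) \<in> borel_measurable borel"
proof -
  interpret S: sigma_finite_measure "LB {..<n}" by (rule LB_sigma_finite) simp
  have "(\<lambda>(z, r). kdet k (insert n {..<n}) (r(n := z)) (r(n := y))) \<in> borel_measurable (borel \<Otimes>\<^sub>M LB {..<n})"
  proof -
    have "(\<lambda>p. kdet k (insert n {..<n}) (\<lambda>i. (if i = n then fst p else snd p i)) (\<lambda>i. (if i = n then y else snd p i))) \<in> borel_measurable (borel \<Otimes>\<^sub>M LB {..<n})"
    proof (rule kdet_measurable[OF dominatedD(1)[OF k]])
      fix i assume i: "i \<in> insert n {..<n}"
      show "(\<lambda>p. if i = n then fst p else snd p i) \<in> borel_measurable (borel \<Otimes>\<^sub>M LB {..<n})"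
        using i by (cases "i = n") (auto intro!: measurable_compose[OF measurable_snd])
      show "(\<lambda>p. if i = n then y else snd p i) \<in> borel_measurable (borel \<Otimes>\<^sub>M LB {..<n})"
        using i by (cases "i = n") (auto intro!: measurable_compose[OF measurable_snd])
    qed
    then show ?thesis by (simp add: fun_upd_def case_prod_beta')
  qed
  then show ?thesis unfolding fred_minor_term_def by (rule S.borel_measurable_lebesgue_integral)
qed

text \<open>The resolvent equation in division-free form.\<close>

lemma fred_minor_eq:
  assumes k: "dominated k u w"
  shows "fred_minor k x y = k x y * fred_det k - (LINT z|lborel. k x z * fred_minor k z y)"
    and "integrable lborel (\<lambda>z. k x z * fred_minor k z y)"
proof -
  define \<kappa> where "\<kappa> = (LINT x|lborel. u x * w x)"
  define R where "R n z = fred_minor_term k {..<n} n z y / fact n" for n z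
  define T where "T n = (LINT z|lborel. k x z * R n z)" for n
  have mk: "(\<lambda>z. k x z) \<in> borel_measurable borel" by (rule measurable_section2[OF dominatedD(1)[OF k]]) auto
  have mR: "R n \<in> borel_measurable borel" for n unfolding R_def using fred_minor_term_measurable[OF k] by (intro borel_measurable_divide) auto
  have b: "\<bar>k x z * R n z\<bar> \<le> (u x * w y * hadamard_term \<kappa> n) * (u z * w z)" for n z
  proof -
    have "\<bar>k x z * R n z\<bar> \<le> (u x * w z) * (u z * w y * hadamard_term \<kappa> n)"
      unfolding abs_mult R_def \<kappa>_def using fred_minor_term_le[OF k] dominatedD(3,4,5)[OF k] by (intro mult_mono) auto
    then show ?thesis by (simp add: mult_ac)
  qed
  have hs: "summable (hadamard_term \<kappa>)" unfolding \<kappa>_def by (intro summable_hadamard_term dominated_integral_nonneg[OF k])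
  have int: "integrable lborel (\<lambda>z. k x z * R n z)" for n
  proof (rule Bochner_Integration.integrable_bound)
    show "integrable lborel (\<lambda>z. (u x * w y * hadamard_term \<kappa> n) * (u z * w z))" by (intro integrable_mult_right dominatedD(2)[OF k])
    show "AE z in lborel. norm (k x z * R n z) \<le> norm ((u x * w y * hadamard_term \<kappa> n) * (u z * w z))"
      using order_trans[OF b abs_ge_self] by (intro AE_I2) simp
  qed (use mk mR in auto)
  have sumz: "summable (\<lambda>n. norm (k x z * R n z))" for z
    by (rule summable_comparison_test_ev[where g = "\<lambda>n. (u x * w y * hadamard_term \<kappa> n) * (u z * w z)"])
       (use b hs in \<open>auto intro!: summable_mult summable_mult2\<close>)
  have sumi: "summable (\<lambda>n. LINT z|lborel. norm (k x z * R n z))"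
  proof (rule summable_comparison_test_ev[where g = "\<lambda>n. (u x * w y * \<kappa>) * hadamard_term \<kappa> n"])
    show "\<forall>\<^sub>F n in sequentially. norm (LINT z|lborel. norm (k x z * R n z)) \<le> (u x * w y * \<kappa>) * hadamard_term \<kappa> n"
    proof (intro always_eventually allI)
      fix n
      have "(LINT z|lborel. norm (k x z * R n z)) \<le> (LINT z|lborel. (u x * w y * hadamard_term \<kappa> n) * (u z * w z))"
        using b int by (intro integral_mono integrable_norm integrable_mult_right dominatedD(2)[OF k]) auto
      also have "\<dots> = (u x * w y * hadamard_term \<kappa> n) * \<kappa>" unfolding \<kappa>_def by (rule integral_mult_right_zero)
      finally show "norm (LINT z|lborel. norm (k x z * R n z)) \<le> (u x * w y * \<kappa>) * hadamard_term \<kappa> n" by (simp add: mult_ac)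
    qed
  qed (intro summable_mult hs)
  have eq: "(\<Sum>n. k x z * R n z) = k x z * fred_minor k z y" for z
    unfolding fred_minor_def R_def by (rule suminf_mult[OF summable_fred_minor_term[OF k]])
  have "integrable lborel (\<lambda>z. \<Sum>n. k x z * R n z)" using int sumz sumi by (intro integrable_suminf) auto
  then show "integrable lborel (\<lambda>z. k x z * fred_minor k z y)" unfolding eq .
  have TS: "T sums (LINT z|lborel. k x z * fred_minor k z y)"
    unfolding T_def eq[symmetric] using int sumz sumi by (intro sums_integral) auto
  have Rn: "R n x = k x y * (fred_det_term k {..<n} / fact n) - (if n = 0 then 0 else T (n - 1))" for n
  proof (cases n)
    case 0
    then show ?thesis using fred_minor_term_0[OF k] by (simp add: R_def fred_det_term_0)
  next
    case (Suc m)
    have "(LINT z|lborel. k x z * fred_minor_term k {..<m} m z y) = fact m * T m" by (simp add: T_def R_def)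
    then have "R n x = k x y * (fred_det_term k {..<n} / fact n) - real (Suc m) * (fact m * T m) / fact (Suc m)"
      unfolding R_def Suc fred_minor_term_Suc[OF k] by (simp add: diff_divide_distrib del: fact_Suc of_nat_Suc)
    also have "real (Suc m) * (fact m * T m) / fact (Suc m) = T m" by simp
    finally show ?thesis using Suc by simp
  qed
  have "(\<lambda>n. if n = 0 then 0 else T (n - 1)) sums (LINT z|lborel. k x z * fred_minor k z y)"
    using sums_Suc_iff[of "\<lambda>n. if n = 0 then 0 else T (n - 1)"] TS by simp
  then have "(\<lambda>n. R n x) sums (k x y * fred_det k - (LINT z|lborel. k x z * fred_minor k z y))"
    unfolding Rn fred_det_def by (intro sums_diff sums_mult summable_sums[OF summable_fred_det_term[OF k]])
  then show "fred_minor k x y = k x y * fred_det k - (LINT z|lborel. k x z * fred_minor k z y)"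
    unfolding fred_minor_def R_def by (simp add: sums_iff)
qed

text \<open>
  The term as a sum over permutations, hence a polynomial in the traces of the powers of
  \<open>k\<close>.
\<close>

lemma fred_det_term_perm_sum:
  assumes k: "dominated k u w" and J: "finite J"
  shows "fred_det_term k J = (\<Sum>q | q permutes J. of_int (sign q) * (LINT r|LB J. (\<Prod>i\<in>J. k (r i) (r (q i)))))"
proof -
  have int: "integrable (LB J) (\<lambda>r. \<Prod>i\<in>J. k (r i) (r (q i)))" if q: "q permutes J" for q
  proof (rule Bochner_Integration.integrable_bound)
    show "integrable (LB J) (\<lambda>r. 1 * (\<Prod>i\<in>J. u (r i) * w (r i)))" by (rule LB_prod(1)[OF J dominatedD(2)[OF k]])
    show "(\<lambda>r. \<Prod>i\<in>J. k (r i) (r (q i))) \<in> borel_measurable (LB J)"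
      using q by (intro borel_measurable_prod measurable_section2[OF dominatedD(1)[OF k]]) (auto simp: permutes_in_image)
    show "AE r in LB J. norm (\<Prod>i\<in>J. k (r i) (r (q i))) \<le> norm (1 * (\<Prod>i\<in>J. u (r i) * w (r i)))"
    proof (rule AE_I2)
      fix r
      have "\<bar>\<Prod>i\<in>J. k (r i) (r (q i))\<bar> \<le> (\<Prod>i\<in>J. u (r i) * w (r (q i)))"
        unfolding abs_prod using dominatedD(5)[OF k] by (intro prod_mono) auto
      also have "\<dots> = (\<Prod>i\<in>J. u (r i) * w (r i))"
        using prod.reindex_bij_betw[OF permutes_imp_bij[OF q], of "\<lambda>i. w (r i)"] by (simp add: prod.distrib)
      finally show "norm (\<Prod>i\<in>J. k (r i) (r (q i))) \<le> norm (1 * (\<Prod>i\<in>J. u (r i) * w (r i)))" by simp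
    qed
  qed
  show ?thesis
    unfolding fred_det_term_def kdet_def using int by (subst Bochner_Integration.integral_sum) auto
qed

text \<open>
  The identity \<open>Det (1 + P Q) = Det (1 + Q P)\<close>, term by term in the Fredholm series. For
  each permutation \<open>q\<close> both integrals equal the integral of
  \<open>\<Prod>i. P (x i) (r i) * Q (r i) (x (q i))\<close>.
\<close>

lemma fred_det_term_commute:
  fixes P Q :: "real \<Rightarrow> real \<Rightarrow> real"
  assumes P: "(\<lambda>(x, r). P x r) \<in> borel_measurable (borel \<Otimes>\<^sub>M borel)"
    and Q: "(\<lambda>(r, x). Q r x) \<in> borel_measurable (borel \<Otimes>\<^sub>M borel)"
    and Pb: "\<And>x r. \<bar>P x r\<bar> \<le> p x * w r" and Qb: "\<And>r x. \<bar>Q r x\<bar> \<le> v r * s x"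
    and nn: "\<And>x. 0 \<le> p x" "\<And>x. 0 \<le> w x" "\<And>x. 0 \<le> v x" "\<And>x. 0 \<le> s x"
    and ps: "integrable lborel (\<lambda>x. p x * s x)" and wv: "integrable lborel (\<lambda>r. w r * v r)"
  defines "k1 \<equiv> \<lambda>x y. LINT r|lborel. P x r * Q r y" and "k2 \<equiv> \<lambda>r r'. LINT x|lborel. Q r x * P x r'"
  shows "dominated k1 (\<lambda>x. p x * (LINT r|lborel. w r * v r)) s" "dominated k2 (\<lambda>x. v x * (LINT r|lborel. p r * s r)) w"
    and "finite J \<Longrightarrow> fred_det_term k1 J = fred_det_term k2 J"
proof -
  note [measurable] = measurable_section2[OF P] measurable_section2[OF Q]
  have i1: "integrable lborel (\<lambda>r. P x r * Q r y)" and b1: "\<bar>k1 x y\<bar> \<le> p x * (LINT r|lborel. w r * v r) * s y" for x y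
  proof -
    have b: "\<bar>P x r * Q r y\<bar> \<le> (p x * s y) * (w r * v r)" for r
    proof -
      have "\<bar>P x r * Q r y\<bar> \<le> (p x * w r) * (v r * s y)" unfolding abs_mult using Pb Qb nn by (intro mult_mono) auto
      then show ?thesis by (simp add: mult_ac)
    qed
    show i: "integrable lborel (\<lambda>r. P x r * Q r y)"
      by (rule Bochner_Integration.integrable_bound[OF integrable_mult_right[OF wv, of "p x * s y"]])
         (use order_trans[OF b abs_ge_self] in \<open>auto intro!: AE_I2\<close>)
    have "norm (k1 x y) \<le> (LINT r|lborel. (p x * s y) * (w r * v r))"
      unfolding k1_def real_norm_def by (rule norm_integral_le[OF i]) (use b wv in auto)
    also have "\<dots> = (p x * s y) * (LINT r|lborel. w r * v r)" by (rule integral_mult_right_zero)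
    finally show "\<bar>k1 x y\<bar> \<le> p x * (LINT r|lborel. w r * v r) * s y" by (simp add: mult_ac)
  qed
  have i2: "integrable lborel (\<lambda>x. Q r x * P x r')" and b2: "\<bar>k2 r r'\<bar> \<le> v r * (LINT x|lborel. p x * s x) * w r'" for r r'
  proof -
    have b: "\<bar>Q r x * P x r'\<bar> \<le> (v r * w r') * (p x * s x)" for x
    proof -
      have "\<bar>Q r x * P x r'\<bar> \<le> (v r * s x) * (p x * w r')" unfolding abs_mult using Pb Qb nn by (intro mult_mono) auto
      then show ?thesis by (simp add: mult_ac)
    qed
    show i: "integrable lborel (\<lambda>x. Q r x * P x r')"
      by (rule Bochner_Integration.integrable_bound[OF integrable_mult_right[OF ps, of "v r * w r'"]])
         (use order_trans[OF b abs_ge_self] in \<open>auto intro!: AE_I2\<close>)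
    have "norm (k2 r r') \<le> (LINT x|lborel. (v r * w r') * (p x * s x))"
      unfolding k2_def real_norm_def by (rule norm_integral_le[OF i]) (use b ps in auto)
    also have "\<dots> = (v r * w r') * (LINT x|lborel. p x * s x)" by (rule integral_mult_right_zero)
    finally show "\<bar>k2 r r'\<bar> \<le> v r * (LINT x|lborel. p x * s x) * w r'" by (simp add: mult_ac)
  qed
  have wv0: "(LINT r|lborel. w r * v r) \<ge> 0" and ps0: "(LINT x|lborel. p x * s x) \<ge> 0"
    using nn by (auto intro!: Bochner_Integration.integral_nonneg)
  have m1: "(\<lambda>(x, y). k1 x y) \<in> borel_measurable (borel \<Otimes>\<^sub>M borel)"
    unfolding k1_def case_prod_beta' by (rule lborel.borel_measurable_lebesgue_integral) measurable
  have m2: "(\<lambda>(x, y). k2 x y) \<in> borel_measurable (borel \<Otimes>\<^sub>M borel)"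
    unfolding k2_def case_prod_beta' by (rule lborel.borel_measurable_lebesgue_integral) measurable
  show k1: "dominated k1 (\<lambda>x. p x * (LINT r|lborel. w r * v r)) s"
    unfolding dominated_def using m1 b1 nn wv0 integrable_mult_right[OF ps, of "LINT r|lborel. w r * v r"] by (auto simp: mult_ac)
  show k2: "dominated k2 (\<lambda>x. v x * (LINT r|lborel. p r * s r)) w"
    unfolding dominated_def using m2 b2 nn ps0 integrable_mult_right[OF wv, of "LINT r|lborel. p r * s r"] by (auto simp: mult_ac)
  assume J: "finite J"
  have trm: "(LINT x|LB J. (\<Prod>i\<in>J. k1 (x i) (x (q i)))) = (LINT r|LB J. (\<Prod>i\<in>J. k2 (r i) (r (q i))))"
    if q: "q permutes J" for q
  proof -
    interpret S: sigma_finite_measure "LB J" by (rule LB_sigma_finite[OF J])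
    interpret PP: pair_sigma_finite "LB J" "LB J" ..
    define f where "f x r = (\<Prod>i\<in>J. P (x i) (r i) * Q (r i) (x (q i)))" for x r :: "nat \<Rightarrow> real"
    have qi: "q i \<in> J" if "i \<in> J" for i using q that by (simp add: permutes_in_image)
    have "(LINT x|LB J. (\<Prod>i\<in>J. k1 (x i) (x (q i)))) = (LINT x|LB J. LINT r|LB J. f x r)"
      unfolding k1_def f_def
      by (intro Bochner_Integration.integral_cong refl LB.product_integral_prod[OF J, symmetric] i1)
    also have "\<dots> = (LINT r|LB J. LINT x|LB J. f x r)"
    proof (rule PP.Fubini_integral[symmetric])
      show "integrable (LB J \<Otimes>\<^sub>M LB J) (\<lambda>(x, r). f x r)"
      proof (rule integrable_pair_bound[OF S.sigma_finite_measure_axioms S.sigma_finite_measure_axioms])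
        show "(\<lambda>(x, r). f x r) \<in> borel_measurable (LB J \<Otimes>\<^sub>M LB J)"
          unfolding f_def case_prod_beta'
          by (intro borel_measurable_prod borel_measurable_times measurable_section2[OF P] measurable_section2[OF Q]
              measurable_compose[OF measurable_fst LB_component] measurable_compose[OF measurable_snd LB_component] qi)
        show "integrable (LB J) (\<lambda>x. 1 * (\<Prod>i\<in>J. p (x i) * s (x i)))" by (rule LB_prod(1)[OF J ps])
        show "integrable (LB J) (\<lambda>r. 1 * (\<Prod>i\<in>J. w (r i) * v (r i)))" by (rule LB_prod(1)[OF J wv])
        fix x r :: "nat \<Rightarrow> real"
        have "\<bar>f x r\<bar> \<le> (\<Prod>i\<in>J. (p (x i) * w (r i)) * (v (r i) * s (x (q i))))"
          unfolding f_def abs_prod abs_mult using Pb Qb nn by (intro prod_mono conjI mult_mono) auto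
        also have "\<dots> = (\<Prod>i\<in>J. p (x i)) * (\<Prod>i\<in>J. w (r i)) * (\<Prod>i\<in>J. v (r i)) * (\<Prod>i\<in>J. s (x (q i)))"
          by (simp add: prod.distrib mult_ac)
        also have "(\<Prod>i\<in>J. s (x (q i))) = (\<Prod>i\<in>J. s (x i))"
          using prod.reindex_bij_betw[OF permutes_imp_bij[OF q], of "\<lambda>i. s (x i)"] by simp
        finally show "norm (case (x, r) of (x, r) \<Rightarrow> f x r) \<le> (1 * (\<Prod>i\<in>J. p (x i) * s (x i))) * (1 * (\<Prod>i\<in>J. w (r i) * v (r i)))"
          by (simp add: prod.distrib mult_ac)
      qed
    qed
    also have "\<dots> = (LINT r|LB J. (\<Prod>i\<in>J. k2 (r i) (r (q i))))"
    proof (rule Bochner_Integration.integral_cong[OF refl])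
      fix r :: "nat \<Rightarrow> real"
      define r' where "r' i = r (inv_into UNIV q i)" for i
      have r'q: "r' (q i) = r i" for i by (simp add: r'_def permutes_inverses[OF q])
      have "f x r = (\<Prod>i\<in>J. Q (r' i) (x i) * P (x i) (r i))" for x
      proof -
        have "(\<Prod>i\<in>J. Q (r i) (x (q i))) = (\<Prod>i\<in>J. Q (r' i) (x i))"
          using prod.reindex_bij_betw[OF permutes_imp_bij[OF q], of "\<lambda>i. Q (r' i) (x i)"] by (simp add: r'q)
        then show ?thesis by (simp add: f_def prod.distrib)
      qed
      then have "(LINT x|LB J. f x r) = (LINT x|LB J. (\<Prod>i\<in>J. Q (r' i) (x i) * P (x i) (r i)))" by simp
      also have "\<dots> = (\<Prod>i\<in>J. k2 (r' i) (r i))"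
        unfolding k2_def by (rule LB.product_integral_prod[OF J]) (rule i2)
      also have "\<dots> = (\<Prod>i\<in>J. k2 (r i) (r (q i)))"
        using prod.reindex_bij_betw[OF permutes_imp_bij[OF q], of "\<lambda>i. k2 (r' i) (r i)"] by (simp add: r'q)
      finally show "(LINT x|LB J. f x r) = (\<Prod>i\<in>J. k2 (r i) (r (q i)))" .
    qed
    finally show ?thesis .
  qed
  show "fred_det_term k1 J = fred_det_term k2 J"
    unfolding fred_det_term_perm_sum[OF k1 J] fred_det_term_perm_sum[OF k2 J] using trm by (intro sum.cong) auto
qed

section \<open>Kernels cut off at a threshold\<close>

text \<open>
  The kernel of \<open>B\<close> composed with the restriction to \<open>[S, \<infinity>)\<close>. Cutting one of the two
  arguments suffices for determinants.
\<close>

definition cut :: "(real \<Rightarrow> real \<Rightarrow> real) \<Rightarrow> real \<Rightarrow> real \<Rightarrow> real \<Rightarrow> real" where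
  "cut B S r s = indicator {S..} r * B r s"

text \<open>
  A continuous kernel with a continuous majorant \<open>w x * w y\<close> that has finite trace on
  every half-line \<open>[S, \<infinity>)\<close>; nothing is required near \<open>-\<infinity>\<close>.
\<close>

definition good_kernel :: "(real \<Rightarrow> real \<Rightarrow> real) \<Rightarrow> (real \<Rightarrow> real) \<Rightarrow> bool" where
  "good_kernel B w \<longleftrightarrow> continuous_on UNIV (\<lambda>(x, y). B x y) \<and> continuous_on UNIV w \<and> (\<forall>x. 0 \<le> w x) \<and>
     (\<forall>S. integrable lborel (\<lambda>x. indicator {S..} x * (w x)\<^sup>2)) \<and> (\<forall>x y. \<bar>B x y\<bar> \<le> w x * w y)"

text \<open>The trace of the majorant on \<open>[S, \<infinity>)\<close>.\<close>

definition tail_mass :: "(real \<Rightarrow> real) \<Rightarrow> real \<Rightarrow> real" where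
  "tail_mass w S = (LINT x|lborel. indicator {S..} x * (w x)\<^sup>2)"

lemma good_kernelD:
  assumes "good_kernel B w"
  shows "continuous_on UNIV (\<lambda>(x, y). B x y)" "continuous_on UNIV w" "0 \<le> w x"
    "integrable lborel (\<lambda>x. indicator {S..} x * (w x)\<^sup>2)" "\<bar>B x y\<bar> \<le> w x * w y"
  using assms by (auto simp: good_kernel_def)

lemma tail_mass_eq: "(LINT x|lborel. (indicator {S..} x * w x) * w x) = tail_mass w S"
  by (simp add: tail_mass_def power2_eq_square mult.assoc)

lemma tail_mass_antimono:
  assumes g: "good_kernel B w" and "S \<le> S'"
  shows "tail_mass w S' \<le> tail_mass w S"
  unfolding tail_mass_def using assms(2)
  by (intro integral_mono good_kernelD(4)[OF g]) (auto simp: indicator_def)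

lemma tail_mass_nonneg: "0 \<le> tail_mass w S"
  unfolding tail_mass_def by (intro Bochner_Integration.integral_nonneg) auto

lemma dominated_cut:
  assumes g: "good_kernel B w"
  shows "dominated (cut B S) (\<lambda>x. indicator {S..} x * w x) w"
proof -
  have B: "(\<lambda>(x, y). B x y) \<in> borel_measurable (borel \<Otimes>\<^sub>M borel)"
    using borel_measurable_continuous_onI[OF good_kernelD(1)[OF g]] by (simp add: borel_prod)
  have "(\<lambda>p. indicator {S..} (fst p) * (\<lambda>(x, y). B x y) p) \<in> borel_measurable (borel \<Otimes>\<^sub>M borel)"
    by (intro borel_measurable_times B measurable_compose[OF measurable_fst]) measurable
  moreover have "(\<lambda>p. indicator {S..} (fst p) * (\<lambda>(x, y). B x y) p) = (\<lambda>(x, y). cut B S x y)"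
    by (auto simp: cut_def)
  ultimately have "(\<lambda>(x, y). cut B S x y) \<in> borel_measurable (borel \<Otimes>\<^sub>M borel)" by simp
  moreover have "integrable lborel (\<lambda>x. (indicator {S..} x * w x) * w x)"
    using good_kernelD(4)[OF g, of S] by (simp add: power2_eq_square mult.assoc)
  moreover have "\<bar>cut B S x y\<bar> \<le> indicator {S..} x * w x * w y" for x y
    using good_kernelD(3,5)[OF g] by (auto simp: cut_def indicator_def)
  ultimately show ?thesis
    unfolding dominated_def using good_kernelD(3)[OF g] by (intro conjI allI) auto
qed

lemma kdet_cut:
  assumes "finite J"
  shows "kdet (cut B S) J r c = (\<Prod>i\<in>J. indicator {S..} (r i)) * kdet B J r c"
  unfolding kdet_def cut_def sum_distrib_left
  by (intro sum.cong refl) (simp add: prod.distrib mult_ac)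

text \<open>
  The tuples above \<open>S\<close> are sorted by the index of their smallest entry.
\<close>

lemma argmin_partition:
  fixes r :: "nat \<Rightarrow> real"
  assumes J: "finite J" "J \<noteq> {}" and inj: "inj_on r J"
  shows "(\<Prod>j\<in>J. indicator {S..} (r j)) = (\<Sum>i\<in>J. indicator {S..} (r i) * (\<Prod>j\<in>J - {i}. indicat_real {r i..} (r j)))"
proof -
  obtain i0 where i0: "i0 \<in> J" "\<And>j. j \<in> J \<Longrightarrow> r i0 \<le> r j"
  proof -
    have "Min (r ` J) \<in> r ` J" using J by (intro Min_in) auto
    then obtain i where i: "i \<in> J" "r i = Min (r ` J)" by auto
    then have "r i \<le> r j" if "j \<in> J" for j using that J by simp
    then show thesis using that i by blast
  qed
  have zero: "(\<Prod>j\<in>J - {i}. indicat_real {r i..} (r j)) = 0" if "i \<in> J" "i \<noteq> i0" for i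
  proof -
    have "r i0 \<noteq> r i" using inj that i0 by (auto simp: inj_on_def)
    then have "indicat_real {r i..} (r i0) = 0" using i0(2)[OF that(1)] by (auto simp: indicator_def)
    then show ?thesis using J i0 that by (intro prod_zero) auto
  qed
  have "(\<Sum>i\<in>J. indicator {S..} (r i) * (\<Prod>j\<in>J - {i}. indicat_real {r i..} (r j)))
      = indicator {S..} (r i0) * (\<Prod>j\<in>J - {i0}. indicat_real {r i0..} (r j))"
  proof -
    have "(\<Sum>i\<in>J - {i0}. indicator {S..} (r i) * (\<Prod>j\<in>J - {i}. indicat_real {r i..} (r j))) = 0"
      using zero by (intro sum.neutral ballI) simp
    then show ?thesis using J(1) i0(1) by (subst sum.remove[of _ i0]) simp_all
  qed
  also have "(\<Prod>j\<in>J - {i0}. indicat_real {r i0..} (r j)) = 1"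
    using i0 by (intro prod.neutral) (auto simp: indicator_def)
  also have "indicator {S..} (r i0) * 1 = (\<Prod>j\<in>J. indicat_real {S..} (r j))"
  proof (cases "S \<le> r i0")
    case True
    then have "(\<Prod>j\<in>J. indicat_real {S..} (r j)) = 1" using i0 by (intro prod.neutral) (force simp: indicator_def)
    then show ?thesis using True by (simp add: indicator_def)
  next
    case False
    then have "(\<Prod>j\<in>J. indicat_real {S..} (r j)) = 0" using i0 J by (intro prod_zero) (auto simp: indicator_def intro!: bexI[of _ i0])
    then show ?thesis using False by (simp add: indicator_def)
  qed
  finally show ?thesis by simp
qed

text \<open>
  Integration of a Fredholm term over the position of the smallest variable: given that it
  equals \<open>x\<close>, the others range over \<open>[x, \<infinity>)\<close>. This makes the dependence on the threshold
  explicit.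
\<close>

lemma fred_det_term_cut_eq:
  assumes g: "good_kernel B w"
  shows "fred_det_term (cut B S) {..<Suc n} = real (Suc n) * (LINT x|lborel. indicator {S..} x * fred_minor_term (cut B x) {..<n} n x x)"
proof -
  define J where "J = {..<Suc n}"
  have J: "finite J" "J \<noteq> {}" by (auto simp: J_def)
  define f where "f i r = indicator {S..} (r i) * (\<Prod>j\<in>J - {i}. indicat_real {r i..} (r j)) * kdet B J r r" for i and r :: "nat \<Rightarrow> real"
  define h where "h x = indicat_real {S..} x * (w x)\<^sup>2" for x
  have hi: "integrable lborel h" unfolding h_def by (rule good_kernelD(4)[OF g])
  have B: "(\<lambda>(x, y). B x y) \<in> borel_measurable (borel \<Otimes>\<^sub>M borel)"
    using borel_measurable_continuous_onI[OF good_kernelD(1)[OF g]] by (simp add: borel_prod)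
  have mdet: "(\<lambda>r. kdet B J r r) \<in> borel_measurable (LB J)"
    by (rule kdet_measurable[OF B, where f = "\<lambda>i r. r i" and g = "\<lambda>i r. r i"]) auto
  have mf: "f i \<in> borel_measurable (LB J)" if i: "i \<in> J" for i
  proof -
    have "(\<lambda>r. indicat_real {r i..} (r j)) \<in> borel_measurable (LB J)" if j: "j \<in> J" for j
    proof -
      have "(\<lambda>r. indicat_real {0..} (r j - r i)) \<in> borel_measurable (LB J)"
        using i j by (intro measurable_compose[OF borel_measurable_diff]) auto
      then show ?thesis by (simp add: indicator_def)
    qed
    moreover have "(\<lambda>r. indicat_real {S..} (r i)) \<in> borel_measurable (LB J)"
      by (rule measurable_compose[OF LB_component[OF i]]) measurable
    ultimately show ?thesis unfolding f_def using mdet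
      by (intro borel_measurable_times borel_measurable_prod) auto
  qed
  have bf: "\<bar>f i r\<bar> \<le> fact (card J) * (\<Prod>j\<in>J. h (r j))" if i: "i \<in> J" for i r
  proof -
    have "\<bar>kdet B J r r\<bar> \<le> fact (card J) * (\<Prod>j\<in>J. (w (r j))\<^sup>2)"
      using kdet_crude_bound[of J B w w r r, OF J(1) good_kernelD(5)[OF g]] by (simp add: prod.distrib power2_eq_square)
    moreover have "indicator {S..} (r i) * (\<Prod>j\<in>J - {i}. indicat_real {r i..} (r j)) \<le> (\<Prod>j\<in>J. indicat_real {S..} (r j))"
    proof (cases "S \<le> r i \<and> (\<forall>j\<in>J - {i}. r i \<le> r j)")
      case True
      then have "(\<Prod>j\<in>J. indicat_real {S..} (r j)) = 1" by (intro prod.neutral) (force simp: indicator_def)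
      moreover have "(\<Prod>j\<in>J - {i}. indicat_real {r i..} (r j)) \<le> 1" by (intro prod_le_1) (auto simp: indicator_def)
      ultimately show ?thesis by (auto simp: indicator_def)
    next
      case False
      then have "indicator {S..} (r i) * (\<Prod>j\<in>J - {i}. indicat_real {r i..} (r j)) = 0"
        using J by (auto simp: indicator_def)
      moreover have "(\<Prod>j\<in>J. indicat_real {S..} (r j)) \<ge> 0" by (intro prod_nonneg) auto
      ultimately show ?thesis by linarith
    qed
    moreover have "indicator {S..} (r i) * (\<Prod>j\<in>J - {i}. indicat_real {r i..} (r j)) \<ge> 0" by (intro mult_nonneg_nonneg prod_nonneg) auto
    ultimately have "\<bar>f i r\<bar> \<le> (\<Prod>j\<in>J. indicat_real {S..} (r j)) * (fact (card J) * (\<Prod>j\<in>J. (w (r j))\<^sup>2))"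
      unfolding f_def abs_mult by (intro mult_mono) (auto intro: prod_nonneg simp: abs_prod)
    also have "\<dots> = fact (card J) * (\<Prod>j\<in>J. h (r j))" unfolding h_def prod.distrib by simp
    finally show ?thesis .
  qed
  have intf: "integrable (LB J) (f i)" if i: "i \<in> J" for i
  proof (rule Bochner_Integration.integrable_bound[OF LB_prod(1)[OF J(1) hi]])
    show "AE r in LB J. norm (f i r) \<le> norm (fact (card J) * (\<Prod>j\<in>J. h (r j)))"
      using order_trans[OF bf[OF i] abs_ge_self] by (intro AE_I2) simp
  qed (rule mf[OF i])
  \<comment> \<open>Tuples with two equal entries do not contribute, since the determinant vanishes.\<close>
  have pt: "kdet (cut B S) J r r = (\<Sum>i\<in>J. f i r)" for r :: "nat \<Rightarrow> real"
  proof (cases "inj_on r J")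
    case True
    show ?thesis unfolding kdet_cut[OF J(1)] argmin_partition[OF J True] f_def by (simp add: sum_distrib_right)
  next
    case False
    then obtain i j where "i \<in> J" "j \<in> J" "i \<noteq> j" "r i = r j" by (auto simp: inj_on_def)
    then have "kdet B J r r = 0" by (rule kdet_equal_rows[OF J(1)])
    then show ?thesis unfolding kdet_cut[OF J(1)] f_def by simp
  qed
  have trm: "integral\<^sup>L (LB J) (f i) = (LINT x|lborel. indicator {S..} x * fred_minor_term (cut B x) {..<n} n x x)" if i: "i \<in> J" for i
  proof -
    define I where "I = J - {i}"
    have I: "finite I" "i \<notin> I" "J = insert i I" using J i by (auto simp: I_def)
    have "integral\<^sup>L (LB (insert i I)) (f i) = (LINT z|lborel. LINT r|LB I. f i (r(i := z)))"
      by (rule LB_integral_insert[OF I(1,2)]) (use intf[OF i] I(3) in simp)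
    also have "\<dots> = (LINT z|lborel. indicator {S..} z * fred_minor_term (cut B z) I i z z)"
    proof (rule Bochner_Integration.integral_cong[OF refl])
      fix z
      have "f i (r(i := z)) = indicator {S..} z * kdet (cut B z) (insert i I) (r(i := z)) (r(i := z))" for r
      proof -
        have "(\<Prod>j\<in>insert i I. indicat_real {z..} ((r(i := z)) j)) = (\<Prod>j\<in>I. indicat_real {z..} ((r(i := z)) j))"
          using I by (subst prod.insert) auto
        then show ?thesis unfolding f_def using I by (simp add: kdet_cut I_def[symmetric])
      qed
      then show "(LINT r|LB I. f i (r(i := z))) = indicator {S..} z * fred_minor_term (cut B z) I i z z"
        unfolding fred_minor_term_def by simp
    qed
    also have "\<dots> = (LINT x|lborel. indicator {S..} x * fred_minor_term (cut B x) {..<n} n x x)"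
      unfolding I_def J_def using i by (simp add: fred_minor_term_reindex[OF dominated_cut[OF g]] J_def)
    finally show ?thesis using I by simp
  qed
  have "fred_det_term (cut B S) J = (\<Sum>i\<in>J. integral\<^sup>L (LB J) (f i))"
    unfolding fred_det_term_def pt using intf by (rule Bochner_Integration.integral_sum)
  also have "\<dots> = real (Suc n) * (LINT x|lborel. indicator {S..} x * fred_minor_term (cut B x) {..<n} n x x)"
    using trm by (simp add: J_def)
  finally show ?thesis unfolding J_def .
qed

lemma AE_LB_neq:
  assumes J: "finite J" and j: "j \<in> J"
  shows "AE r in LB J. r j \<noteq> (x :: real)"
proof -
  define A where "A i = (if i = j then {x} else UNIV)" for i
  have "emeasure (LB J) (Pi\<^sub>E J A) = (\<Prod>i\<in>J. emeasure lborel (A i))"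
    by (rule LB.emeasure_PiM[OF J]) (auto simp: A_def)
  also have "\<dots> = 0" using J j by (intro prod_zero) (auto simp: A_def intro!: bexI[of _ j])
  finally have "Pi\<^sub>E J A \<in> null_sets (LB J)"
    using J by (intro null_setsI sets_PiM_I_finite) (auto simp: A_def)
  moreover have "{r \<in> space (LB J). \<not> r j \<noteq> x} \<subseteq> Pi\<^sub>E J A"
    by (auto simp: A_def space_PiM PiE_iff extensional_def)
  ultimately show ?thesis by (rule AE_I')
qed

text \<open>
  The threshold enters through indicator functions, which are continuous in \<open>x\<close> except
  when one of the variables equals \<open>x\<close>, a null set.
\<close>

lemma continuous_fred_minor_term_cut:
  assumes g: "good_kernel B w"
  shows "continuous_on UNIV (\<lambda>x. fred_minor_term (cut B x) {..<n} n x x)"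
  unfolding continuous_on_eq_continuous_at[OF open_UNIV]
proof
  fix x :: real
  show "isCont (\<lambda>x. fred_minor_term (cut B x) {..<n} n x x) x"
    unfolding continuous_at_sequentially o_def
  proof (intro allI impI)
    fix X assume X: "X \<longlonglongrightarrow> x"
    have Bx: "Bseq X" using X by (intro convergent_imp_Bseq convergentI)
    then obtain K where K: "\<And>m. \<bar>X m\<bar> \<le> K" by (auto simp: Bseq_def)
    define a where "a = - K"
    have a: "a \<le> X m" for m using K[of m] by (auto simp: a_def)
    have wX: "(\<lambda>m. w (X m)) \<longlonglongrightarrow> w x"
      using good_kernelD(2)[OF g] X isCont_tendsto_compose[of x w] by (simp add: continuous_on_eq_continuous_at)
    then have "Bseq (\<lambda>m. w (X m))" by (intro convergent_imp_Bseq convergentI)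
    then obtain W where W: "\<And>m. w (X m) \<le> W" "W > 0" using good_kernelD(3)[OF g] by (auto simp: Bseq_def)
    define D where "D y r = kdet (cut B y) (insert n {..<n}) (r(n := y)) (r(n := y))" for y and r :: "nat \<Rightarrow> real"
    have D: "D y r = (\<Prod>i<n. indicator {y..} (r i)) * kdet B (insert n {..<n}) (r(n := y)) (r(n := y))" for y r
      unfolding D_def by (subst kdet_cut) (auto intro!: prod.cong)
    show "(\<lambda>m. fred_minor_term (cut B (X m)) {..<n} n (X m) (X m)) \<longlonglongrightarrow> fred_minor_term (cut B x) {..<n} n x x"
      unfolding fred_minor_term_def D_def[symmetric]
    proof (rule integral_dominated_convergence[where w = "\<lambda>r. (fact (Suc n) * W\<^sup>2) * (\<Prod>i<n. indicator {a..} (r i) * (w (r i))\<^sup>2)"])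
      show "integrable (LB {..<n}) (\<lambda>r. (fact (Suc n) * W\<^sup>2) * (\<Prod>i<n. indicator {a..} (r i) * (w (r i))\<^sup>2))"
        by (rule LB_prod(1)[OF _ good_kernelD(4)[OF g]]) simp
      have m: "D y \<in> borel_measurable (LB {..<n})" for y
        unfolding D_def by (rule kdet_border_measurable[OF dominated_cut[OF g]]) simp
      show "D x \<in> borel_measurable (LB {..<n})" "\<And>m. D (X m) \<in> borel_measurable (LB {..<n})" by (rule m)+
      show "AE r in LB {..<n}. norm (D (X m) r) \<le> (fact (Suc n) * W\<^sup>2) * (\<Prod>i<n. indicator {a..} (r i) * (w (r i))\<^sup>2)" for m
      proof (rule AE_I2)
        fix r :: "nat \<Rightarrow> real"
        have "\<bar>D (X m) r\<bar> \<le> (fact (Suc n) * (indicator {X m..} (X m) * w (X m)) * w (X m)) * (\<Prod>i<n. (indicator {X m..} (r i) * w (r i)) * w (r i))"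
          using kdet_border_bound[OF dominated_cut[OF g], of "{..<n}" n "X m" r "X m" "X m"] by (simp add: D_def del: fact_Suc)
        also have "\<dots> \<le> (fact (Suc n) * W\<^sup>2) * (\<Prod>i<n. indicator {a..} (r i) * (w (r i))\<^sup>2)"
        proof (rule mult_mono)
          show "(\<Prod>i<n. indicator {X m..} (r i) * w (r i) * w (r i)) \<le> (\<Prod>i<n. indicator {a..} (r i) * (w (r i))\<^sup>2)"
            using a[of m] good_kernelD(3)[OF g] by (intro prod_mono) (auto simp: indicator_def power2_eq_square)
          show "0 \<le> (\<Prod>i<n. indicator {X m..} (r i) * w (r i) * w (r i))"
            using good_kernelD(3)[OF g] by (intro prod_nonneg) auto
          show "0 \<le> fact (Suc n) * W\<^sup>2" by simp
          show "fact (Suc n) * (indicator {X m..} (X m) * w (X m)) * w (X m) \<le> fact (Suc n) * W\<^sup>2"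
            using W(1)[of m] W(2) good_kernelD(3)[OF g, of "X m"] by (auto simp: power2_eq_square mult.assoc intro!: mult_mono simp del: fact_Suc)
        qed
        finally show "norm (D (X m) r) \<le> (fact (Suc n) * W\<^sup>2) * (\<Prod>i<n. indicator {a..} (r i) * (w (r i))\<^sup>2)" by simp
      qed
      have "AE r in LB {..<n}. \<forall>j\<in>{..<n}. r j \<noteq> x" by (intro AE_finite_allI AE_LB_neq) auto
      then show "AE r in LB {..<n}. (\<lambda>m. D (X m) r) \<longlonglongrightarrow> D x r"
      proof eventually_elim
        fix r assume r: "\<forall>j\<in>{..<n}. r j \<noteq> x"
        have "(\<lambda>m. indicat_real {X m..} (r i)) \<longlonglongrightarrow> indicator {x..} (r i)" if "i < n" for i
        proof (rule tendsto_eventually)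
          show "\<forall>\<^sub>F m in sequentially. indicat_real {X m..} (r i) = indicator {x..} (r i)"
          proof (cases "x < r i")
            case True
            have "\<forall>\<^sub>F m in sequentially. X m < r i" using order_tendstoD(2)[OF X True] .
            then show ?thesis by eventually_elim (use True in \<open>auto simp: indicator_def\<close>)
          next
            case False
            then have f: "r i < x" using r that by force
            have "\<forall>\<^sub>F m in sequentially. r i < X m" using order_tendstoD(1)[OF X f] .
            then show ?thesis by eventually_elim (use f in \<open>auto simp: indicator_def\<close>)
          qed
        qed
        moreover have "(\<lambda>m. kdet B (insert n {..<n}) (r(n := X m)) (r(n := X m))) \<longlonglongrightarrow> kdet B (insert n {..<n}) (r(n := x)) (r(n := x))"
          unfolding kdet_def
        proof (intro tendsto_sum tendsto_mult tendsto_const tendsto_prod)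
          fix q i
          have l: "(\<lambda>m. (r(n := X m)) l) \<longlonglongrightarrow> (r(n := x)) l" for l using X by (cases "l = n") auto
          have "(\<lambda>m. (\<lambda>(x, y). B x y) ((r(n := X m)) i, (r(n := X m)) (q i))) \<longlonglongrightarrow> (\<lambda>(x, y). B x y) ((r(n := x)) i, (r(n := x)) (q i))"
            using good_kernelD(1)[OF g] by (intro isCont_tendsto_compose[OF _ tendsto_Pair[OF l l]]) (simp add: continuous_on_eq_continuous_at)
          then show "(\<lambda>m. B ((r(n := X m)) i) ((r(n := X m)) (q i))) \<longlonglongrightarrow> B ((r(n := x)) i) ((r(n := x)) (q i))" by simp
        qed
        ultimately show "(\<lambda>m. D (X m) r) \<longlonglongrightarrow> D x r" unfolding D by (intro tendsto_mult tendsto_prod) auto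
      qed
    qed
  qed
qed

lemma fred_minor_term_cut_le:
  assumes g: "good_kernel B w" and x: "a \<le> x"
  shows "\<bar>fred_minor_term (cut B x) {..<n} n x x / fact n\<bar> \<le> (w x)\<^sup>2 * hadamard_term (tail_mass w a) n"
proof -
  have "\<bar>fred_minor_term (cut B x) {..<n} n x x / fact n\<bar> \<le> (indicator {x..} x * w x) * w x * hadamard_term (tail_mass w x) n"
    using fred_minor_term_le[OF dominated_cut[OF g], of x n x x] unfolding tail_mass_eq .
  also have "\<dots> \<le> (w x)\<^sup>2 * hadamard_term (tail_mass w a) n"
    using hadamard_term_mono[OF tail_mass_nonneg tail_mass_antimono[OF g x], of n] by (auto simp: power2_eq_square intro!: mult_left_mono)
  finally show ?thesis .
qed

lemma continuous_fred_minor_cut: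
  assumes g: "good_kernel B w"
  shows "continuous_on UNIV (\<lambda>x. fred_minor (cut B x) x x)"
proof -
  have "continuous_on {a<..<b} (\<lambda>x. fred_minor (cut B x) x x)" for a b
  proof -
    have "bounded (w ` {a..b})"
      by (intro compact_imp_bounded compact_continuous_image continuous_on_subset[OF good_kernelD(2)[OF g]]) auto
    then obtain W where "\<forall>y\<in>w ` {a..b}. norm y \<le> W" unfolding bounded_iff by blast
    then have W: "\<bar>w x\<bar> \<le> W" if "x \<in> {a..b}" for x using that by auto
    have ul: "uniform_limit {a<..<b} (\<lambda>m x. \<Sum>n<m. fred_minor_term (cut B x) {..<n} n x x / fact n) (\<lambda>x. fred_minor (cut B x) x x) sequentially"
      unfolding fred_minor_def
    proof (rule Weierstrass_m_test)
      show "norm (fred_minor_term (cut B x) {..<n} n x x / fact n) \<le> W\<^sup>2 * hadamard_term (tail_mass w a) n" if "x \<in> {a<..<b}" for n x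
      proof -
        have "(w x)\<^sup>2 \<le> W\<^sup>2" using W[of x] that by (intro abs_le_square_iff[THEN iffD1]) auto
        then have "(w x)\<^sup>2 * hadamard_term (tail_mass w a) n \<le> W\<^sup>2 * hadamard_term (tail_mass w a) n"
          by (intro mult_right_mono hadamard_term_nonneg tail_mass_nonneg)
        then show ?thesis using fred_minor_term_cut_le[OF g, of a x n] that by simp
      qed
      show "summable (\<lambda>n. W\<^sup>2 * hadamard_term (tail_mass w a) n)" by (intro summable_mult summable_hadamard_term tail_mass_nonneg)
    qed
    show ?thesis
      by (rule uniform_limit_theorem[OF _ ul])
         (auto intro!: always_eventually continuous_on_sum continuous_on_divide continuous_on_subset[OF continuous_fred_minor_term_cut[OF g]])
  qed
  then have "continuous_on {x - 1<..<x + 1} (\<lambda>x. fred_minor (cut B x) x x)" for x by blast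
  then have "isCont (\<lambda>x. fred_minor (cut B x) x x) x" for x
    using continuous_on_eq_continuous_at[of "{x - 1<..<x + 1}" "\<lambda>x. fred_minor (cut B x) x x"] by simp
  then show ?thesis by (simp add: continuous_at_imp_continuous_on)
qed

lemma fred_minor_cut_bound:
  assumes g: "good_kernel B w" and x: "a \<le> x"
  shows "\<bar>fred_minor (cut B x) x x\<bar> \<le> (w x)\<^sup>2 * (\<Sum>n. hadamard_term (tail_mass w a) n)"
proof -
  have s: "summable (\<lambda>n. (w x)\<^sup>2 * hadamard_term (tail_mass w a) n)" by (intro summable_mult summable_hadamard_term tail_mass_nonneg)
  have "norm (fred_minor (cut B x) x x) \<le> (\<Sum>n. (w x)\<^sup>2 * hadamard_term (tail_mass w a) n)"
    unfolding fred_minor_def using fred_minor_term_cut_le[OF g x] s by (intro norm_suminf_le) auto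
  then show ?thesis by (subst (asm) suminf_mult) (auto intro!: summable_hadamard_term tail_mass_nonneg)
qed

lemma fred_minor_cut_integrable:
  assumes g: "good_kernel B w"
  shows "integrable lborel (\<lambda>x. indicator {S..} x * fred_minor (cut B x) x x)"
proof (rule Bochner_Integration.integrable_bound)
  show "integrable lborel (\<lambda>x. (\<Sum>n. hadamard_term (tail_mass w S) n) * (indicator {S..} x * (w x)\<^sup>2))"
    by (intro integrable_mult_right good_kernelD(4)[OF g])
  have "(\<lambda>x. fred_minor (cut B x) x x) \<in> borel_measurable borel"
    by (intro borel_measurable_continuous_onI continuous_fred_minor_cut[OF g])
  then show "(\<lambda>x. indicator {S..} x * fred_minor (cut B x) x x) \<in> borel_measurable lborel" by simp
  show "AE x in lborel. norm (indicator {S..} x * fred_minor (cut B x) x x) \<le> norm ((\<Sum>n. hadamard_term (tail_mass w S) n) * (indicator {S..} x * (w x)\<^sup>2))"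
  proof (rule AE_I2)
    fix x
    show "norm (indicator {S..} x * fred_minor (cut B x) x x) \<le> norm ((\<Sum>n. hadamard_term (tail_mass w S) n) * (indicator {S..} x * (w x)\<^sup>2))"
      using order_trans[OF fred_minor_cut_bound[OF g, of S x] abs_ge_self]
      by (auto simp: indicator_def mult.commute)
  qed
qed

lemma fred_det_cut_eq:
  assumes g: "good_kernel B w"
  shows "fred_det (cut B S) = 1 + (LINT x|lborel. indicator {S..} x * fred_minor (cut B x) x x)"
proof -
  define T where "T n x = indicat_real {S..} x * (fred_minor_term (cut B x) {..<n} n x x / fact n)" for n x
  have b: "\<bar>T n x\<bar> \<le> hadamard_term (tail_mass w S) n * (indicator {S..} x * (w x)\<^sup>2)" for n x
    using fred_minor_term_cut_le[OF g, of S x n] by (auto simp: T_def indicator_def mult.commute)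
  have m: "T n \<in> borel_measurable borel" for n
    unfolding T_def by (intro borel_measurable_times borel_measurable_divide borel_measurable_const
        borel_measurable_continuous_onI[OF continuous_fred_minor_term_cut[OF g]]) measurable
  have int: "integrable lborel (T n)" for n
    by (rule Bochner_Integration.integrable_bound[OF integrable_mult_right[OF good_kernelD(4)[OF g], of "hadamard_term (tail_mass w S) n" S]])
       (use m order_trans[OF b abs_ge_self] in auto)
  have hs: "summable (hadamard_term (tail_mass w S))" by (intro summable_hadamard_term tail_mass_nonneg)
  have sumz: "summable (\<lambda>n. norm (T n x))" for x
    by (rule summable_comparison_test_ev[where g = "\<lambda>n. hadamard_term (tail_mass w S) n * (indicator {S..} x * (w x)\<^sup>2)"])
       (use b hs in \<open>auto intro!: summable_mult2\<close>)
  have sumi: "summable (\<lambda>n. LINT x|lborel. norm (T n x))"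
  proof (rule summable_comparison_test_ev[where g = "\<lambda>n. hadamard_term (tail_mass w S) n * tail_mass w S"])
    show "\<forall>\<^sub>F n in sequentially. norm (LINT x|lborel. norm (T n x)) \<le> hadamard_term (tail_mass w S) n * tail_mass w S"
    proof (intro always_eventually allI)
      fix n
      have "(LINT x|lborel. norm (T n x)) \<le> (LINT x|lborel. hadamard_term (tail_mass w S) n * (indicator {S..} x * (w x)\<^sup>2))"
        using b int by (intro integral_mono integrable_norm integrable_mult_right good_kernelD(4)[OF g]) auto
      also have "\<dots> = hadamard_term (tail_mass w S) n * tail_mass w S" unfolding tail_mass_def by (rule integral_mult_right_zero)
      finally show "norm (LINT x|lborel. norm (T n x)) \<le> hadamard_term (tail_mass w S) n * tail_mass w S" by simp
    qed
  qed (intro summable_mult2 hs)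
  have eq: "(\<Sum>n. T n x) = indicator {S..} x * fred_minor (cut B x) x x" for x
    unfolding fred_minor_def T_def by (rule suminf_mult[OF summable_fred_minor_term[OF dominated_cut[OF g]]])
  have TS: "(\<lambda>n. integral\<^sup>L lborel (T n)) sums (LINT x|lborel. indicator {S..} x * fred_minor (cut B x) x x)"
    unfolding eq[symmetric] using int sumz sumi by (intro sums_integral) auto
  have Dn: "fred_det_term (cut B S) {..<Suc n} / fact (Suc n) = integral\<^sup>L lborel (T n)" for n
  proof -
    have "(LINT x|lborel. indicator {S..} x * fred_minor_term (cut B x) {..<n} n x x) = fact n * integral\<^sup>L lborel (T n)"
      unfolding T_def by simp
    then have "fred_det_term (cut B S) {..<Suc n} / fact (Suc n) = real (Suc n) * (fact n * integral\<^sup>L lborel (T n)) / fact (Suc n)"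
      unfolding fred_det_term_cut_eq[OF g] by (simp only:)
    then show ?thesis by simp
  qed
  have "fred_det (cut B S) = (\<Sum>n. fred_det_term (cut B S) {..<Suc n} / fact (Suc n)) + 1"
    unfolding fred_det_def using suminf_split_head[OF summable_fred_det_term[OF dominated_cut[OF g]]] by (simp add: fred_det_term_0)
  then show ?thesis using TS unfolding Dn by (simp add: sums_iff)
qed

lemma tail_integral_deriv:
  fixes f :: "real \<Rightarrow> real"
  assumes c: "continuous_on UNIV f" and i: "\<And>S. integrable lborel (\<lambda>x. indicator {S..} x * f x)"
  shows "((\<lambda>S. LINT x|lborel. indicator {S..} x * f x) has_real_derivative - f S) (at S)"
proof -
  define a b where "a = S - 1" and "b = S + 1"
  define G where "G S = (LINT x|lborel. indicator {S..} x * f x)" for S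
  have eq: "G s = G a - integral {a..s} f" if s: "a \<le> s" for s
  proof -
    have si: "set_integrable lborel {a..s} f"
      unfolding set_integrable_def by (intro borel_integrable_compact continuous_on_subset[OF c]) auto
    have "AE x in lborel. x \<noteq> s" by (rule AE_lborel_singleton)
    then have "AE x in lborel. indicator {a..} x * f x = indicator {a..s} x *\<^sub>R f x + indicator {s..} x * f x"
    proof eventually_elim
      fix x assume "x \<noteq> s"
      then consider "x < a" | "a \<le> x" "x < s" | "s < x" by linarith
      then show "indicator {a..} x * f x = indicator {a..s} x *\<^sub>R f x + indicator {s..} x * f x"
        by cases (use s in \<open>simp_all add: indicator_def\<close>)
    qed
    then have "G a = (LINT x|lborel. indicator {a..s} x *\<^sub>R f x + indicator {s..} x * f x)"
      unfolding G_def by (intro integral_cong_AE borel_measurable_integrable[OF i] borel_measurable_integrable[OF Bochner_Integration.integrable_add[OF si[unfolded set_integrable_def] i]])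
    also have "\<dots> = (LINT x|lborel. indicator {a..s} x *\<^sub>R f x) + G s"
      unfolding G_def using si i by (intro Bochner_Integration.integral_add) (auto simp: set_integrable_def)
    also have "(LINT x|lborel. indicator {a..s} x *\<^sub>R f x) = integral {a..s} f"
      using set_borel_integral_eq_integral(2)[OF si] by (simp add: set_lebesgue_integral_def)
    finally show ?thesis by simp
  qed
  have "((\<lambda>s. integral {a..s} f) has_real_derivative f S) (at S within {a..b})"
    by (rule integral_has_real_derivative) (auto intro: continuous_on_subset[OF c] simp: a_def b_def)
  moreover have "at S within {a..b} = at S" by (rule at_within_Icc_at) (auto simp: a_def b_def)
  ultimately have "((\<lambda>s. integral {a..s} f) has_real_derivative f S) (at S)" by (simp only:)
  from DERIV_diff[OF DERIV_const[of "G a"] this]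
  have "((\<lambda>s. G a - integral {a..s} f) has_real_derivative - f S) (at S)" by simp
  then have "(G has_real_derivative - f S) (at S)"
  proof (rule has_field_derivative_transform_within_open[of _ _ _ "{a<..}"])
    show "S \<in> {a<..}" by (simp add: a_def)
    show "G a - integral {a..s} f = G s" if "s \<in> {a<..}" for s using eq[of s] that by (simp only: greaterThan_iff less_imp_le)
  qed auto
  then show ?thesis unfolding G_def .
qed

text \<open>
  The derivative of \<open>Det (1 + B)\<close> on \<open>[S, \<infinity>)\<close> with respect to the left end point is minus
  the minor at the end point.
\<close>

lemma fred_det_cut_deriv:
  assumes g: "good_kernel B w"
  shows "((\<lambda>S. fred_det (cut B S)) has_real_derivative - fred_minor (cut B S) S S) (at S)"
  unfolding fred_det_cut_eq[OF g]
  using DERIV_add[OF DERIV_const[of 1] tail_integral_deriv[OF continuous_fred_minor_cut[OF g] fred_minor_cut_integrable[OF g]]]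
  by simp

section \<open>Multiplicative statistics of determinantal processes\<close>

lemma kdet_row_scale:
  "kdet (\<lambda>x y. h x * k x y) J r c = (\<Prod>i\<in>J. h (r i)) * kdet k J r c"
  unfolding kdet_def sum_distrib_left by (intro sum.cong refl) (simp add: prod.distrib mult_ac)

lemma kernel_det_eq_kdet: "kernel_det K n x = kdet K {..<n} x x"
  by (simp add: kernel_det_def kdet_def)

text \<open>The \<open>n\<close>-tuples of pairwise distinct indices.\<close>

definition inj_tuples :: "nat \<Rightarrow> (nat \<Rightarrow> nat) set" where
  "inj_tuples n = {j \<in> {..<n} \<rightarrow>\<^sub>E UNIV. inj_on j {..<n}}"

lemma countable_inj_tuples: "countable (inj_tuples n)"
proof -
  have "countable ({..<n} \<rightarrow>\<^sub>E (UNIV :: nat set))" by (intro countable_PiE) auto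
  then show ?thesis unfolding inj_tuples_def by (rule countable_subset[rotated]) auto
qed

text \<open>The \<open>n\<close>-tuples of pairwise distinct indices below \<open>m\<close>.\<close>

definition inj_tuples_below :: "nat \<Rightarrow> nat \<Rightarrow> (nat \<Rightarrow> nat) set" where
  "inj_tuples_below n m = {j \<in> {..<n} \<rightarrow>\<^sub>E {..<m}. inj_on j {..<n}}"

lemma finite_inj_tuples_below: "finite (inj_tuples_below n m)"
  unfolding inj_tuples_below_def by (rule finite_subset[of _ "{..<n} \<rightarrow>\<^sub>E {..<m}"]) (auto intro: finite_PiE)

lemma inj_tuples_below_subset: "inj_tuples_below n m \<subseteq> inj_tuples n"
  by (auto simp: inj_tuples_def inj_tuples_below_def)

text \<open>
  Every set of \<open>n\<close> indices is enumerated by \<open>n!\<close> injective tuples.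
\<close>

lemma sum_inj_tuples_below:
  fixes y :: "nat \<Rightarrow> real"
  shows "(\<Sum>j\<in>inj_tuples_below n m. \<Prod>i<n. y (j i)) = fact n * (\<Sum>A | A \<subseteq> {..<m} \<and> card A = n. prod y A)"
proof -
  define T where "T = {A. A \<subseteq> {..<m} \<and> card A = n}"
  have T: "finite T" unfolding T_def by (rule finite_subset[of _ "Pow {..<m}"]) auto
  have im: "(\<lambda>j. j ` {..<n}) ` inj_tuples_below n m \<subseteq> T"
  proof (rule image_subsetI)
    fix j assume "j \<in> inj_tuples_below n m"
    then have j: "j \<in> {..<n} \<rightarrow>\<^sub>E {..<m}" "inj_on j {..<n}" by (simp_all add: inj_tuples_below_def)
    have "j ` {..<n} \<subseteq> {..<m}" using PiE_mem[OF j(1)] by (rule image_subsetI)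
    moreover have "card (j ` {..<n}) = n" using card_image[OF j(2)] by simp
    ultimately show "j ` {..<n} \<in> T" unfolding T_def by blast
  qed
  have inner: "(\<Sum>j | j \<in> inj_tuples_below n m \<and> j ` {..<n} = A. \<Prod>i<n. y (j i)) = fact n * prod y A" if A: "A \<in> T" for A
  proof -
    have finA: "finite A" and cA: "card A = n" using A finite_subset by (auto simp: T_def)
    have eq: "{j. j \<in> inj_tuples_below n m \<and> j ` {..<n} = A} = {j \<in> {..<n} \<rightarrow>\<^sub>E A. inj_on j {..<n}}"
    proof (intro equalityI subsetI)
      fix j assume "j \<in> {j \<in> {..<n} \<rightarrow>\<^sub>E A. inj_on j {..<n}}"
      then have j: "j \<in> {..<n} \<rightarrow>\<^sub>E A" "inj_on j {..<n}" by auto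
      have "j ` {..<n} \<subseteq> A" using PiE_mem[OF j(1)] by (rule image_subsetI)
      moreover have "card (j ` {..<n}) = card A" using card_image[OF j(2)] cA by simp
      ultimately have im: "j ` {..<n} = A" by (rule card_subset_eq[OF finA])
      have "A \<subseteq> {..<m}" using A by (simp add: T_def)
      then have "j \<in> {..<n} \<rightarrow>\<^sub>E {..<m}" using j(1) by (auto simp: PiE_iff)
      then show "j \<in> {j. j \<in> inj_tuples_below n m \<and> j ` {..<n} = A}"
        using j(2) im by (simp add: inj_tuples_below_def)
    next
      fix j assume "j \<in> {j. j \<in> inj_tuples_below n m \<and> j ` {..<n} = A}"
      then have j: "j \<in> {..<n} \<rightarrow>\<^sub>E {..<m}" "inj_on j {..<n}" "j ` {..<n} = A" by (simp_all add: inj_tuples_below_def)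
      then have "j \<in> {..<n} \<rightarrow>\<^sub>E A" by (auto simp: PiE_iff)
      then show "j \<in> {j \<in> {..<n} \<rightarrow>\<^sub>E A. inj_on j {..<n}}" using j(2) by simp
    qed
    have "(\<Sum>j | j \<in> inj_tuples_below n m \<and> j ` {..<n} = A. \<Prod>i<n. y (j i)) = (\<Sum>j | j \<in> inj_tuples_below n m \<and> j ` {..<n} = A. prod y A)"
    proof (rule sum.cong[OF refl])
      fix j assume "j \<in> {j. j \<in> inj_tuples_below n m \<and> j ` {..<n} = A}"
      then have j: "inj_on j {..<n}" "j ` {..<n} = A" by (simp_all add: inj_tuples_below_def)
      show "(\<Prod>i<n. y (j i)) = prod y A" using prod.reindex[OF j(1), of y] unfolding j(2) by (simp add: o_def)
    qed
    also have "\<dots> = real (card {j \<in> {..<n} \<rightarrow>\<^sub>E A. inj_on j {..<n}}) * prod y A" unfolding eq by simp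
    also have "card {j \<in> {..<n} \<rightarrow>\<^sub>E A. inj_on j {..<n}} = prod ((-) n) {0..<n}"
      using card_inj_on_subset_funcset[of "{..<n}" A "{..<n}"] finA cA by simp
    also have "real (prod ((-) n) {0..<n}) = fact n" unfolding fact_prod_rev by (rule refl)
    finally show ?thesis .
  qed
  have "(\<Sum>j\<in>inj_tuples_below n m. \<Prod>i<n. y (j i)) = (\<Sum>A\<in>T. \<Sum>j | j \<in> inj_tuples_below n m \<and> j ` {..<n} = A. \<Prod>i<n. y (j i))"
    by (rule sum.group[symmetric, OF finite_inj_tuples_below T im])
  also have "\<dots> = fact n * (\<Sum>A\<in>T. prod y A)" using inner by (simp add: sum_distrib_left)
  finally show ?thesis by (simp add: T_def)
qed

lemma prod_one_plus_inj_tuples: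
  fixes y :: "nat \<Rightarrow> real"
  shows "(\<Prod>j<m. 1 + y j) = (\<Sum>n\<le>m. (\<Sum>j\<in>inj_tuples_below n m. \<Prod>i<n. y (j i)) / fact n)"
proof -
  have "(\<Prod>j<m. 1 + y j) = (\<Sum>A\<in>Pow {..<m}. prod y A)"
    using prod_add[of "{..<m}" y "\<lambda>_. 1"] by (simp add: add.commute)
  also have "\<dots> = (\<Sum>n\<le>m. \<Sum>A | A \<in> Pow {..<m} \<and> card A = n. prod y A)"
  proof (rule sum.group[symmetric])
    show "card ` Pow {..<m} \<subseteq> {..m}"
    proof (rule image_subsetI)
      fix A assume "A \<in> Pow {..<m}"
      then have "card A \<le> card {..<m}" by (intro card_mono) auto
      then show "card A \<in> {..m}" by simp
    qed
  qed auto
  also have "\<dots> = (\<Sum>n\<le>m. (\<Sum>j\<in>inj_tuples_below n m. \<Prod>i<n. y (j i)) / fact n)"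
    unfolding sum_inj_tuples_below by simp
  finally show ?thesis .
qed

lemma inj_tuples_below_empty: "m < n \<Longrightarrow> inj_tuples_below n m = {}"
proof (rule ccontr)
  assume mn: "m < n" "inj_tuples_below n m \<noteq> {}"
  then obtain j where j: "j \<in> {..<n} \<rightarrow>\<^sub>E {..<m}" "inj_on j {..<n}" by (auto simp: inj_tuples_below_def)
  have "j ` {..<n} \<subseteq> {..<m}" using PiE_mem[OF j(1)] by (rule image_subsetI)
  then have "card (j ` {..<n}) \<le> card {..<m}" by (rule card_mono[OF finite_lessThan])
  then show False using j(2) mn by (simp add: card_image)
qed

text \<open>An infinite product expanded into sums over tuples of distinct indices.\<close>

lemma prod_one_plus_limit:
  fixes y :: "nat \<Rightarrow> real"
  assumes y: "summable (\<lambda>j. \<bar>y j\<bar>)"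
    and int: "\<And>n. integrable (count_space (inj_tuples n)) (\<lambda>j. \<Prod>i<n. y (j i))"
  shows "(\<lambda>m. \<Prod>j<m. 1 + y j) \<longlonglongrightarrow> (\<Sum>n. (LINT j|count_space (inj_tuples n). (\<Prod>i<n. y (j i))) / fact n)"
proof -
  define Y where "Y = (\<Sum>j. \<bar>y j\<bar>)"
  define I where "I n m = (\<Sum>j\<in>inj_tuples_below n m. \<Prod>i<n. y (j i))" for n m
  define s where "s n = (LINT j|count_space (inj_tuples n). (\<Prod>i<n. y (j i)))" for n
  have Ib: "\<bar>I n m\<bar> \<le> Y ^ n" for n m
  proof -
    have "\<bar>I n m\<bar> \<le> (\<Sum>j\<in>inj_tuples_below n m. \<bar>\<Prod>i<n. y (j i)\<bar>)" unfolding I_def by (rule sum_abs)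
    also have "\<dots> \<le> (\<Sum>j\<in>{..<n} \<rightarrow>\<^sub>E {..<m}. \<bar>\<Prod>i<n. y (j i)\<bar>)"
      by (intro sum_mono2) (auto simp: inj_tuples_below_def intro: finite_PiE)
    also have "\<dots> = (\<Prod>i<n. \<Sum>j<m. \<bar>y j\<bar>)" unfolding abs_prod by (subst prod_sum_PiE) auto
    also have "\<dots> = (\<Sum>j<m. \<bar>y j\<bar>) ^ n" by simp
    also have "\<dots> \<le> Y ^ n" unfolding Y_def by (intro power_mono sum_le_suminf y sum_nonneg) auto
    finally show ?thesis .
  qed
  have lim: "(\<lambda>m. I n m) \<longlonglongrightarrow> s n" for n
  proof -
    have eq: "(LINT j|count_space (inj_tuples n). indicator (inj_tuples_below n m) j * (\<Prod>i<n. y (j i))) = I n m" for m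
    proof -
      define f where "f j = indicat_real (inj_tuples_below n m) j * (\<Prod>i<n. y (j i))" for j
      have sub: "{j \<in> inj_tuples n. f j \<noteq> 0} \<subseteq> inj_tuples_below n m" by (auto simp: f_def indicator_def)
      have "(LINT j|count_space (inj_tuples n). f j) = (\<Sum>j | j \<in> inj_tuples n \<and> f j \<noteq> 0. f j)"
        by (rule lebesgue_integral_count_space_finite_support) (rule finite_subset[OF sub finite_inj_tuples_below])
      also have "\<dots> = (\<Sum>j\<in>inj_tuples_below n m. f j)"
        using inj_tuples_below_subset[of n m] sub
        by (intro sum.mono_neutral_left finite_inj_tuples_below) auto
      also have "\<dots> = I n m" unfolding I_def f_def by (intro sum.cong) auto
      finally show ?thesis by (simp add: f_def)
    qed
    have "(\<lambda>m. LINT j|count_space (inj_tuples n). indicator (inj_tuples_below n m) j * (\<Prod>i<n. y (j i))) \<longlonglongrightarrow> s n"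
      unfolding s_def
    proof (rule integral_dominated_convergence[where w = "\<lambda>j. \<bar>\<Prod>i<n. y (j i)\<bar>"])
      show "integrable (count_space (inj_tuples n)) (\<lambda>j. \<bar>\<Prod>i<n. y (j i)\<bar>)" using int by (rule integrable_abs)
      show "AE j in count_space (inj_tuples n). (\<lambda>m. indicator (inj_tuples_below n m) j * (\<Prod>i<n. y (j i))) \<longlonglongrightarrow> (\<Prod>i<n. y (j i))"
      proof (rule AE_I2)
        fix j assume "j \<in> space (count_space (inj_tuples n))"
        then have j: "j \<in> inj_tuples n" by simp
        have "j \<in> inj_tuples_below n m" if "m > Max (insert 0 (j ` {..<n}))" for m
        proof -
          have "j i < m" if "i < n" for i
          proof -
            have "j i \<le> Max (insert 0 (j ` {..<n}))" using that by (intro Max_ge) auto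
            then show ?thesis using \<open>m > _\<close> by linarith
          qed
          then show ?thesis using j by (auto simp: inj_tuples_def inj_tuples_below_def PiE_iff)
        qed
        then have "\<forall>\<^sub>F m in sequentially. j \<in> inj_tuples_below n m"
          by (rule eventually_mono[OF eventually_gt_at_top[of "Max (insert 0 (j ` {..<n}))"]])
        then have "\<forall>\<^sub>F m in sequentially. indicator (inj_tuples_below n m) j * (\<Prod>i<n. y (j i)) = (\<Prod>i<n. y (j i))"
          by (rule eventually_mono) simp
        then show "(\<lambda>m. indicator (inj_tuples_below n m) j * (\<Prod>i<n. y (j i))) \<longlonglongrightarrow> (\<Prod>i<n. y (j i))"
          by (rule tendsto_eventually)
      qed
    qed (auto simp: indicator_def)
    then show ?thesis unfolding eq .
  qed
  have "(\<lambda>m. \<Sum>n. I n m / fact n) \<longlonglongrightarrow> (\<Sum>n. s n / fact n)"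
  proof -
    have "eventually (\<lambda>(n, m). norm (I n m / fact n) \<le> Y ^ n / fact n) (at_top \<times>\<^sub>F sequentially)"
      using Ib by (intro always_eventually) (auto simp: abs_divide divide_right_mono)
    moreover have "summable (\<lambda>n. Y ^ n / fact n)"
      using summable_exp[of Y] by (simp add: divide_inverse mult.commute)
    moreover have "(\<lambda>m. I n m / fact n) \<longlonglongrightarrow> s n / fact n" for n by (intro tendsto_intros lim) auto
    ultimately show ?thesis using tannerys_theorem[of "\<lambda>n m. I n m / fact n" "\<lambda>n. s n / fact n" sequentially "\<lambda>n. Y ^ n / fact n"] by auto
  qed
  moreover have "(\<Sum>n. I n m / fact n) = (\<Prod>j<m. 1 + y j)" for m
  proof -
    have "(\<Sum>n. I n m / fact n) = (\<Sum>n\<le>m. I n m / fact n)"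
      by (intro suminf_finite) (auto simp: I_def inj_tuples_below_empty)
    then show ?thesis unfolding I_def prod_one_plus_inj_tuples by simp
  qed
  ultimately show ?thesis unfolding s_def by simp
qed

text \<open>
  The correlation functions as image measures: under the product of the probability and
  the counting measure on tuples of distinct indices, the tuple of points has density
  \<open>kernel_det K n\<close>.
\<close>

lemma correlation_distr:
  fixes M :: "'w measure" and X :: "nat \<Rightarrow> 'w \<Rightarrow> real"
  assumes dp: "determinantal_process K M X"
    and K: "(\<lambda>(x, y). K x y) \<in> borel_measurable (borel \<Otimes>\<^sub>M borel)"
  defines "Z (n :: nat) \<equiv> \<lambda>(\<omega> :: 'w, j :: nat \<Rightarrow> nat). \<lambda>i\<in>{..<n}. X (j i) \<omega>"
  shows "Z n \<in> measurable (M \<Otimes>\<^sub>M count_space (inj_tuples n)) (LB {..<n})"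
    "distr (M \<Otimes>\<^sub>M count_space (inj_tuples n)) (LB {..<n}) (Z n) = density (LB {..<n}) (\<lambda>x. ennreal (kernel_det K n x))"
proof -
  interpret C: sigma_finite_measure "count_space (inj_tuples n)"
    by (intro sigma_finite_measure_count_space_countable countable_inj_tuples)
  have X: "\<And>j. X j \<in> borel_measurable M" using dp by (auto simp: determinantal_process_def)
  have "(\<lambda>(j, \<omega>). \<lambda>i\<in>{..<n}. X (j i) \<omega>) \<in> measurable (count_space (inj_tuples n) \<Otimes>\<^sub>M M) (LB {..<n})"
    using X by (intro measurable_pair_measure_countable1 countable_inj_tuples) (auto intro!: measurable_restrict)
  from measurable_pair_swap[OF this]
  show Z: "Z n \<in> measurable (M \<Otimes>\<^sub>M count_space (inj_tuples n)) (LB {..<n})"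
    by (simp add: Z_def)
  have m: "(\<lambda>x. ennreal (kernel_det K n x)) \<in> borel_measurable (LB {..<n})"
    unfolding kernel_det_eq_kdet
    by (intro measurable_compose[OF kdet_measurable[OF K, where f = "\<lambda>i r. r i" and g = "\<lambda>i r. r i"] measurable_ennreal]) auto
  show "distr (M \<Otimes>\<^sub>M count_space (inj_tuples n)) (LB {..<n}) (Z n) = density (LB {..<n}) (\<lambda>x. ennreal (kernel_det K n x))"
  proof (rule measure_eqI)
    fix A assume "A \<in> sets (distr (M \<Otimes>\<^sub>M count_space (inj_tuples n)) (LB {..<n}) (Z n))"
    then have A: "A \<in> sets (LB {..<n})" by simp
    then have iA: "(indicator A :: (nat \<Rightarrow> real) \<Rightarrow> ennreal) \<in> borel_measurable (LB {..<n})" by simp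
    have "emeasure (distr (M \<Otimes>\<^sub>M count_space (inj_tuples n)) (LB {..<n}) (Z n)) A
      = (\<integral>\<^sup>+ x. indicator A x \<partial>distr (M \<Otimes>\<^sub>M count_space (inj_tuples n)) (LB {..<n}) (Z n))"
      using A by simp
    also have "\<dots> = (\<integral>\<^sup>+ p. indicator A (Z n p) \<partial>(M \<Otimes>\<^sub>M count_space (inj_tuples n)))"
      using Z iA by (intro nn_integral_distr) auto
    also have "\<dots> = (\<integral>\<^sup>+ \<omega>. \<integral>\<^sup>+ j. indicator A (Z n (\<omega>, j)) \<partial>count_space (inj_tuples n) \<partial>M)"
      using measurable_compose[OF Z iA] by (intro C.nn_integral_fst[symmetric])
    also have "\<dots> = (\<integral>\<^sup>+ x. indicator A x * ennreal (kernel_det K n x) \<partial>LB {..<n})"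
      using dp iA unfolding determinantal_process_def Z_def inj_tuples_def by simp
    also have "\<dots> = emeasure (density (LB {..<n}) (\<lambda>x. ennreal (kernel_det K n x))) A"
      using A m by (simp add: emeasure_density mult.commute)
    finally show "emeasure (distr (M \<Otimes>\<^sub>M count_space (inj_tuples n)) (LB {..<n}) (Z n)) A
      = emeasure (density (LB {..<n}) (\<lambda>x. ennreal (kernel_det K n x))) A" .
  qed simp
qed

text \<open>
  The expectation of \<open>\<Prod>j. 1 + h (X j)\<close> is the Fredholm determinant of \<open>1 + h K\<close>. The
  product is expanded over tuples of distinct points; the upper bound for the determinants
  makes the expansion absolutely summable. The random variable \<open>Y\<close> stands for the product,
  so that no canonical choice of the limit is needed.
\<close>

lemma det_process_expectation:
  fixes M :: "'w measure" and X :: "nat \<Rightarrow> 'w \<Rightarrow> real"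
  assumes dp: "determinantal_process K M X"
    and K: "(\<lambda>(x, y). K x y) \<in> borel_measurable (borel \<Otimes>\<^sub>M borel)"
    and detb: "\<And>n x. 0 \<le> kernel_det K n x" "\<And>n x. kernel_det K n x \<le> (\<Prod>i<n. K (x i) (x i))"
    and h: "h \<in> borel_measurable borel" and hK: "integrable lborel (\<lambda>x. \<bar>h x\<bar> * K x x)"
  shows "AE \<omega> in M. summable (\<lambda>j. \<bar>h (X j \<omega>)\<bar>)"
    and "Y \<in> borel_measurable M \<Longrightarrow> AE \<omega> in M. (\<lambda>m. \<Prod>j<m. 1 + h (X j \<omega>)) \<longlonglongrightarrow> Y \<omega> \<Longrightarrow> integrable M Y"
    and "Y \<in> borel_measurable M \<Longrightarrow> AE \<omega> in M. (\<lambda>m. \<Prod>j<m. 1 + h (X j \<omega>)) \<longlonglongrightarrow> Y \<omega>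
       \<Longrightarrow> (LINT \<omega>|M. Y \<omega>) = fred_det (\<lambda>x y. h x * K x y)"
proof -
  interpret prob_space M using dp by (simp add: determinantal_process_def)
  have X[measurable]: "\<And>j. X j \<in> borel_measurable M" using dp by (auto simp: determinantal_process_def)
  define Z where "Z n = (\<lambda>(\<omega> :: 'w, j :: nat \<Rightarrow> nat). \<lambda>i\<in>{..<n}. X (j i) \<omega>)" for n :: nat
  note Zm = correlation_distr(1)[OF dp K, folded Z_def] and Zd = correlation_distr(2)[OF dp K, folded Z_def]
  define p where "p n x = (\<Prod>i<n. h (x i))" for n and x :: "nat \<Rightarrow> real"
  define \<kappa> where "\<kappa> = (LINT x|lborel. \<bar>h x\<bar> * K x x)"
  have pm: "p n \<in> borel_measurable (LB {..<n})" for n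
    unfolding p_def by (intro borel_measurable_prod measurable_compose[OF LB_component h]) auto
  have dm: "kernel_det K n \<in> borel_measurable (LB {..<n})" for n
    unfolding kernel_det_eq_kdet by (intro kdet_measurable[OF K, where f = "\<lambda>i r. r i" and g = "\<lambda>i r. r i"]) auto
  have bnd: "\<bar>kernel_det K n x * p n x\<bar> \<le> 1 * (\<Prod>i<n. \<bar>h (x i)\<bar> * K (x i) (x i))" for n x
  proof -
    have "\<bar>kernel_det K n x * p n x\<bar> = kernel_det K n x * (\<Prod>i<n. \<bar>h (x i)\<bar>)"
      using detb(1)[of n x] by (simp add: abs_mult p_def abs_prod)
    also have "\<dots> \<le> (\<Prod>i<n. K (x i) (x i)) * (\<Prod>i<n. \<bar>h (x i)\<bar>)" using detb(2)[of n x] by (intro mult_right_mono prod_nonneg) auto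
    finally show ?thesis by (simp add: prod.distrib mult.commute)
  qed
  have prodint: "integrable (LB {..<n}) (\<lambda>x. 1 * (\<Prod>i<n. \<bar>h (x i)\<bar> * K (x i) (x i)))" for n
    by (rule LB_prod(1)[OF _ hK]) simp
  have int1: "integrable (LB {..<n}) (\<lambda>x. kernel_det K n x * p n x)" for n
    by (rule Bochner_Integration.integrable_bound[OF prodint])
       (use pm dm order_trans[OF bnd abs_ge_self] in \<open>auto intro!: AE_I2\<close>)
  have int2: "integrable (M \<Otimes>\<^sub>M count_space (inj_tuples n)) (\<lambda>q. p n (Z n q))" for n
  proof -
    have "integrable (density (LB {..<n}) (\<lambda>x. ennreal (kernel_det K n x))) (p n)"
      using int1[of n] by (subst integrable_density[OF pm dm]) (auto simp: detb)
    then show ?thesis unfolding Zd[symmetric] by (subst (asm) integrable_distr_eq[OF Zm pm])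
  qed
  have val: "(LINT q|(M \<Otimes>\<^sub>M count_space (inj_tuples n)). p n (Z n q)) = (LINT x|LB {..<n}. kernel_det K n x * p n x)" for n
  proof -
    have "(LINT q|(M \<Otimes>\<^sub>M count_space (inj_tuples n)). p n (Z n q)) = integral\<^sup>L (density (LB {..<n}) (\<lambda>x. ennreal (kernel_det K n x))) (p n)"
      unfolding Zd[symmetric] by (rule integral_distr[OF Zm pm, symmetric])
    also have "\<dots> = (LINT x|LB {..<n}. kernel_det K n x * p n x)"
      by (subst integral_density[OF pm dm]) (auto simp: detb)
    finally show ?thesis .
  qed
  have vala: "(LINT q|(M \<Otimes>\<^sub>M count_space (inj_tuples n)). \<bar>p n (Z n q)\<bar>) \<le> \<kappa> ^ n" for n
  proof -
    have "(LINT q|(M \<Otimes>\<^sub>M count_space (inj_tuples n)). \<bar>p n (Z n q)\<bar>) = integral\<^sup>L (density (LB {..<n}) (\<lambda>x. ennreal (kernel_det K n x))) (\<lambda>x. \<bar>p n x\<bar>)"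
      unfolding Zd[symmetric] using pm by (intro integral_distr[OF Zm, symmetric]) auto
    also have "\<dots> = (LINT x|LB {..<n}. kernel_det K n x * \<bar>p n x\<bar>)"
      using pm dm by (subst integral_density) (auto simp: detb)
    also have "\<dots> \<le> (LINT x|LB {..<n}. 1 * (\<Prod>i<n. \<bar>h (x i)\<bar> * K (x i) (x i)))"
    proof (rule integral_mono)
      show "integrable (LB {..<n}) (\<lambda>x. kernel_det K n x * \<bar>p n x\<bar>)"
        using integrable_abs[OF int1[of n]] by (simp add: abs_mult detb)
      show "kernel_det K n x * \<bar>p n x\<bar> \<le> 1 * (\<Prod>i<n. \<bar>h (x i)\<bar> * K (x i) (x i))" for x
        using bnd[of n x] by (simp add: abs_mult detb)
    qed (rule prodint)
    also have "\<dots> = 1 * \<kappa> ^ card {..<n}" unfolding \<kappa>_def by (rule LB_prod(2)[OF _ hK]) simp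
    finally show ?thesis by simp
  qed
  have pZ: "p n (Z n (\<omega>, j)) = (\<Prod>i<n. h (X (j i) \<omega>))" for n \<omega> j
    by (simp add: p_def Z_def)
  have ps: "pair_sigma_finite M (count_space (inj_tuples n))" for n
    by (intro pair_sigma_finite.intro sigma_finite_measure_axioms sigma_finite_measure_count_space_countable countable_inj_tuples)
  define s where "s n \<omega> = (LINT j|count_space (inj_tuples n). (\<Prod>i<n. h (X (j i) \<omega>)))" for n \<omega>
  have aes: "AE \<omega> in M. \<forall>n. integrable (count_space (inj_tuples n)) (\<lambda>j. \<Prod>i<n. h (X (j i) \<omega>))"
    unfolding AE_all_countable
    using pair_sigma_finite.AE_integrable_fst'[OF ps int2] by (simp add: pZ)
  have sint: "integrable M (s n)" for n
    using pair_sigma_finite.integrable_fst'[OF ps int2, of n] by (simp add: pZ s_def[abs_def])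
  have sval: "integral\<^sup>L M (s n) = fred_det_term (\<lambda>x y. h x * K x y) {..<n}" for n
  proof -
    have "integral\<^sup>L M (s n) = (LINT q|(M \<Otimes>\<^sub>M count_space (inj_tuples n)). p n (Z n q))"
      using pair_sigma_finite.integral_fst'[OF ps int2, of n] by (simp only: pZ s_def[abs_def])
    then show ?thesis
      unfolding val by (simp add: fred_det_term_def kdet_row_scale kernel_det_eq_kdet p_def mult.commute)
  qed
  have sabs: "(LINT \<omega>|M. \<bar>s n \<omega>\<bar>) \<le> \<kappa> ^ n" for n
  proof -
    have i: "integrable (M \<Otimes>\<^sub>M count_space (inj_tuples n)) (\<lambda>q. \<bar>p n (Z n q)\<bar>)" using int2 by (rule integrable_abs)
    have "(LINT \<omega>|M. \<bar>s n \<omega>\<bar>) \<le> (LINT \<omega>|M. LINT j|count_space (inj_tuples n). \<bar>p n (Z n (\<omega>, j))\<bar>)"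
    proof (rule integral_mono)
      show "integrable M (\<lambda>\<omega>. LINT j|count_space (inj_tuples n). \<bar>p n (Z n (\<omega>, j))\<bar>)"
        using pair_sigma_finite.integrable_fst'[OF ps i] by simp
      show "\<bar>s n \<omega>\<bar> \<le> (LINT j|count_space (inj_tuples n). \<bar>p n (Z n (\<omega>, j))\<bar>)" for \<omega>
        unfolding s_def pZ using integral_norm_bound[of "count_space (inj_tuples n)" "\<lambda>j. \<Prod>i<n. h (X (j i) \<omega>)"] by simp
    qed (use sint in auto)
    also have "\<dots> = (LINT q|(M \<Otimes>\<^sub>M count_space (inj_tuples n)). \<bar>p n (Z n q)\<bar>)"
      using pair_sigma_finite.integral_fst'[OF ps i] by simp
    finally show ?thesis using vala[of n] by simp
  qed
  \<comment> \<open>Tuples of length one are indices.\<close>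
  have bij: "bij_betw (\<lambda>m. \<lambda>i\<in>{..<Suc 0}. m) UNIV (inj_tuples 1)"
  proof (rule bij_betw_byWitness[where f' = "\<lambda>j. j 0"])
    show "\<forall>j\<in>inj_tuples 1. (\<lambda>i\<in>{..<Suc 0}. j 0) = j"
      by (auto simp: inj_tuples_def PiE_iff extensional_def fun_eq_iff)
  qed (auto simp: inj_tuples_def PiE_iff extensional_def inj_on_def)
  have summ: "summable (\<lambda>j. \<bar>h (X j \<omega>)\<bar>)"
    if "\<forall>n. integrable (count_space (inj_tuples n)) (\<lambda>j. \<Prod>i<n. h (X (j i) \<omega>))" for \<omega>
  proof -
    have "integrable (count_space (inj_tuples 1)) (\<lambda>j. h (X (j 0) \<omega>))" using that[rule_format, of 1] by (simp add: lessThan_Suc)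
    then have "integrable (count_space (UNIV :: nat set)) (\<lambda>m. h (X ((\<lambda>i\<in>{..<Suc 0}. m) 0) \<omega>))"
      using integrable_bij_count_space[OF bij, of "\<lambda>j. h (X (j 0) \<omega>)"] by blast
    then show ?thesis by (simp add: integrable_count_space_nat_iff)
  qed
  show "AE \<omega> in M. summable (\<lambda>j. \<bar>h (X j \<omega>)\<bar>)"
    using aes by eventually_elim (rule summ)
  have lim: "AE \<omega> in M. (\<lambda>m. \<Prod>j<m. 1 + h (X j \<omega>)) \<longlonglongrightarrow> (\<Sum>n. s n \<omega> / fact n)"
    using aes
  proof eventually_elim
    fix \<omega> assume a: "\<forall>n. integrable (count_space (inj_tuples n)) (\<lambda>j. \<Prod>i<n. h (X (j i) \<omega>))"
    show "(\<lambda>m. \<Prod>j<m. 1 + h (X j \<omega>)) \<longlonglongrightarrow> (\<Sum>n. s n \<omega> / fact n)"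
      unfolding s_def by (rule prod_one_plus_limit[OF summ[OF a]]) (use a in auto)
  qed
  have sint': "integrable M (\<lambda>\<omega>. s n \<omega> / fact n)" for n using sint by simp
  have smeas[measurable]: "s n \<in> borel_measurable M" for n by (rule borel_measurable_integrable[OF sint])
  have sumabs: "(LINT \<omega>|M. norm (s n \<omega> / fact n)) \<le> \<kappa> ^ n / fact n" for n
    using sabs[of n] by (simp add: abs_divide divide_right_mono)
  have sume: "summable (\<lambda>n. \<kappa> ^ n / fact n)"
    using summable_exp[of \<kappa>] by (simp add: divide_inverse mult.commute)
  have sumi: "summable (\<lambda>n. LINT \<omega>|M. norm (s n \<omega> / fact n))"
    by (rule summable_comparison_test_ev[OF _ sume]) (use sumabs in \<open>auto simp: abs_divide\<close>)
  have aesum: "AE \<omega> in M. summable (\<lambda>n. norm (s n \<omega> / fact n))"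
  proof -
    have "(\<integral>\<^sup>+ \<omega>. (\<Sum>n. ennreal (norm (s n \<omega> / fact n))) \<partial>M) = (\<Sum>n. \<integral>\<^sup>+ \<omega>. ennreal (norm (s n \<omega> / fact n)) \<partial>M)"
      by (intro nn_integral_suminf) measurable
    also have "\<dots> = (\<Sum>n. ennreal (LINT \<omega>|M. norm (s n \<omega> / fact n)))"
      using sint' by (intro suminf_cong nn_integral_eq_integral integrable_norm) auto
    also have "\<dots> = ennreal (\<Sum>n. LINT \<omega>|M. norm (s n \<omega> / fact n))"
      using sumi by (intro suminf_ennreal2) auto
    finally have "(\<integral>\<^sup>+ \<omega>. (\<Sum>n. ennreal (norm (s n \<omega> / fact n))) \<partial>M) \<noteq> \<infinity>" by simp
    then have "AE \<omega> in M. (\<Sum>n. ennreal (norm (s n \<omega> / fact n))) \<noteq> \<infinity>"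
      by (intro nn_integral_PInf_AE) measurable
    then show ?thesis
      by eventually_elim (auto intro: summable_suminf_not_top)
  qed
  assume Y: "Y \<in> borel_measurable M" "AE \<omega> in M. (\<lambda>m. \<Prod>j<m. 1 + h (X j \<omega>)) \<longlonglongrightarrow> Y \<omega>"
  have eqY: "AE \<omega> in M. Y \<omega> = (\<Sum>n. s n \<omega> / fact n)"
    using Y(2) lim by eventually_elim (rule LIMSEQ_unique)
  have si: "integrable M (\<lambda>\<omega>. \<Sum>n. s n \<omega> / fact n)" using sint' aesum sumi by (intro integrable_suminf) auto
  then show "integrable M Y" using eqY Y(1) integrable_cong_AE[OF Y(1) borel_measurable_integrable[OF si] eqY] by simp
  have "(LINT \<omega>|M. Y \<omega>) = (LINT \<omega>|M. (\<Sum>n. s n \<omega> / fact n))"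
    by (rule integral_cong_AE[OF Y(1) borel_measurable_integrable[OF si] eqY])
  also have "\<dots> = (\<Sum>n. LINT \<omega>|M. s n \<omega> / fact n)"
    using sint' aesum sumi by (intro integral_suminf) auto
  also have "\<dots> = fred_det (\<lambda>x y. h x * K x y)"
    unfolding fred_det_def using sval by simp
  finally show "(LINT \<omega>|M. Y \<omega>) = fred_det (\<lambda>x y. h x * K x y)" .
qed

section \<open>Convolution of Gaussian kernels on half-lines\<close>

text \<open>Measurable kernels with a Gaussian bound in the difference of the arguments.\<close>

definition gauss_bounded :: "(real \<Rightarrow> real \<Rightarrow> real) \<Rightarrow> bool" where
  "gauss_bounded f \<longleftrightarrow> (\<lambda>(x, y). f x y) \<in> borel_measurable (borel \<Otimes>\<^sub>M borel) \<and>
     (\<exists>C d. 0 \<le> C \<and> 0 < d \<and> (\<forall>x y. \<bar>f x y\<bar> \<le> C * exp (- d * (x - y)\<^sup>2)))"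

text \<open>
  Composition of two kernels with the integration restricted to \<open>[s, \<infinity>)\<close>.
\<close>

definition half_conv :: "real \<Rightarrow> (real \<Rightarrow> real \<Rightarrow> real) \<Rightarrow> (real \<Rightarrow> real \<Rightarrow> real) \<Rightarrow> real \<Rightarrow> real \<Rightarrow> real" where
  "half_conv s f g x y = (LINT w:{s..}|lborel. f x w * g w y)"

lemma gauss_boundedE:
  assumes "gauss_bounded f"
  obtains C d where "0 \<le> C" "0 < d" "\<And>x y. \<bar>f x y\<bar> \<le> C * exp (- d * (x - y)\<^sup>2)"
  using assms by (auto simp: gauss_bounded_def)

lemma gauss_bounded_measurable: "gauss_bounded f \<Longrightarrow> (\<lambda>(x, y). f x y) \<in> borel_measurable (borel \<Otimes>\<^sub>M borel)"
  by (simp add: gauss_bounded_def)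

lemma gauss_bounded_sectionl: "gauss_bounded f \<Longrightarrow> (\<lambda>w. f x w) \<in> borel_measurable borel"
  by (rule measurable_section2[OF gauss_bounded_measurable]) auto

lemma gauss_bounded_sectionr: "gauss_bounded f \<Longrightarrow> (\<lambda>w. f w y) \<in> borel_measurable borel"
  by (rule measurable_section2[OF gauss_bounded_measurable]) auto

lemma gauss_bounded_zero: "gauss_bounded (\<lambda>x y. 0)"
  unfolding gauss_bounded_def by (auto intro!: exI[of _ "0 :: real"] exI[of _ "1 :: real"])

lemma gauss_bounded_add:
  assumes "gauss_bounded f" "gauss_bounded g"
  shows "gauss_bounded (\<lambda>x y. f x y + g x y)"
proof -
  obtain C d where f: "0 \<le> C" "0 < d" "\<And>x y. \<bar>f x y\<bar> \<le> C * exp (- d * (x - y)\<^sup>2)" using gauss_boundedE[OF assms(1)] by metis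
  obtain C' d' where g: "0 \<le> C'" "0 < d'" "\<And>x y. \<bar>g x y\<bar> \<le> C' * exp (- d' * (x - y)\<^sup>2)" using gauss_boundedE[OF assms(2)] by metis
  define e where "e = min d d'"
  have "\<bar>f x y + g x y\<bar> \<le> (C + C') * exp (- e * (x - y)\<^sup>2)" for x y
  proof -
    have "C * exp (- d * (x - y)\<^sup>2) \<le> C * exp (- e * (x - y)\<^sup>2)" "C' * exp (- d' * (x - y)\<^sup>2) \<le> C' * exp (- e * (x - y)\<^sup>2)"
      using f(1) g(1) by (auto intro!: mult_left_mono mult_right_mono simp: e_def)
    moreover have "\<bar>f x y + g x y\<bar> \<le> \<bar>f x y\<bar> + \<bar>g x y\<bar>" by (rule abs_triangle_ineq)
    ultimately show ?thesis unfolding distrib_right using f(3)[of x y] g(3)[of x y] by linarith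
  qed
  moreover have "(\<lambda>p. (\<lambda>(x, y). f x y) p + (\<lambda>(x, y). g x y) p) \<in> borel_measurable (borel \<Otimes>\<^sub>M borel)"
    by (intro borel_measurable_add gauss_bounded_measurable assms)
  ultimately show ?thesis
    unfolding gauss_bounded_def using f(1,2) g(1,2)
    by (intro conjI exI[of _ "C + C'"] exI[of _ e]) (auto simp: e_def case_prod_beta')
qed

lemma gauss_bounded_cmult:
  assumes "gauss_bounded f"
  shows "gauss_bounded (\<lambda>x y. c * f x y)"
proof -
  obtain C d where f: "0 \<le> C" "0 < d" "\<And>x y. \<bar>f x y\<bar> \<le> C * exp (- d * (x - y)\<^sup>2)" using gauss_boundedE[OF assms(1)] by metis
  have "\<bar>c * f x y\<bar> \<le> (\<bar>c\<bar> * C) * exp (- d * (x - y)\<^sup>2)" for x y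
    using mult_left_mono[OF f(3)[of x y], of "\<bar>c\<bar>"] by (simp add: abs_mult mult.assoc)
  moreover have "(\<lambda>p. c * (\<lambda>(x, y). f x y) p) \<in> borel_measurable (borel \<Otimes>\<^sub>M borel)"
    by (intro borel_measurable_times borel_measurable_const gauss_bounded_measurable assms)
  ultimately show ?thesis
    unfolding gauss_bounded_def using f(1,2)
    by (intro conjI exI[of _ "\<bar>c\<bar> * C"] exI[of _ d]) (auto simp: case_prod_beta')
qed

lemma gauss_bounded_diff: "gauss_bounded f \<Longrightarrow> gauss_bounded g \<Longrightarrow> gauss_bounded (\<lambda>x y. f x y - g x y)"
  using gauss_bounded_add[of f "\<lambda>x y. - 1 * g x y"] gauss_bounded_cmult[of g "- 1"] by simp

lemma gauss_bounded_sum: "(\<And>i. i \<in> I \<Longrightarrow> gauss_bounded (f i)) \<Longrightarrow> gauss_bounded (\<lambda>x y. \<Sum>i\<in>I. f i x y)"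
  by (induction I rule: infinite_finite_induct) (auto simp: gauss_bounded_zero intro: gauss_bounded_add)

lemma gauss_bounded_bounded: assumes "gauss_bounded f" obtains C where "0 \<le> C" "\<And>x y. \<bar>f x y\<bar> \<le> C"
proof -
  obtain C d where f: "0 \<le> C" "0 < d" "\<And>x y. \<bar>f x y\<bar> \<le> C * exp (- d * (x - y)\<^sup>2)" using gauss_boundedE[OF assms(1)] by metis
  have "\<bar>f x y\<bar> \<le> C" for x y
    using f(3)[of x y] mult_left_mono[OF _ f(1), of "exp (- d * (x - y)\<^sup>2)" 1] f(2) by simp
  with f(1) show thesis by (rule that)
qed

lemma gauss_bounded_integrable_left:
  assumes f: "gauss_bounded f"
  shows "integrable lborel (\<lambda>w. f x w)"
proof -
  obtain C d where C: "0 \<le> C" "0 < d" "\<And>x y. \<bar>f x y\<bar> \<le> C * exp (- d * (x - y)\<^sup>2)" using gauss_boundedE[OF f] by metis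
  show ?thesis
  proof (rule Bochner_Integration.integrable_bound)
    show "integrable lborel (\<lambda>w. C * exp (- d * (w - x)\<^sup>2))" by (intro integrable_mult_right integrable_gaussian C)
    show "AE w in lborel. norm (f x w) \<le> norm (C * exp (- d * (w - x)\<^sup>2))"
      using C(3)[of x] C(1) by (intro AE_I2) (simp add: power2_commute[of x])
  qed (use gauss_bounded_sectionl[OF f] in simp)
qed

lemma gauss_bounded_integrable_right:
  assumes f: "gauss_bounded f"
  shows "integrable lborel (\<lambda>w. f w y)"
proof -
  obtain C d where C: "0 \<le> C" "0 < d" "\<And>x y. \<bar>f x y\<bar> \<le> C * exp (- d * (x - y)\<^sup>2)" using gauss_boundedE[OF f] by metis
  show ?thesis
  proof (rule Bochner_Integration.integrable_bound)
    show "integrable lborel (\<lambda>w. C * exp (- d * (w - y)\<^sup>2))" by (intro integrable_mult_right integrable_gaussian C)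
    show "AE w in lborel. norm (f w y) \<le> norm (C * exp (- d * (w - y)\<^sup>2))"
      using C(3)[of _ y] C(1) by (intro AE_I2) simp
  qed (use gauss_bounded_sectionr[OF f] in simp)
qed

lemma gauss_bounded_prod_integrable:
  assumes f: "gauss_bounded f" and g: "gauss_bounded g"
  shows "set_integrable lborel {s..} (\<lambda>w. f x w * g w y)"
proof -
  obtain C where C: "0 \<le> C" "\<And>x y. \<bar>g x y\<bar> \<le> C" using gauss_bounded_bounded[OF g] by metis
  have "integrable lborel (\<lambda>w. f x w * g w y)"
  proof (rule Bochner_Integration.integrable_bound)
    show "integrable lborel (\<lambda>w. C * \<bar>f x w\<bar>)" using gauss_bounded_integrable_left[OF f] by (intro integrable_mult_right integrable_abs)
    show "AE w in lborel. norm (f x w * g w y) \<le> norm (C * \<bar>f x w\<bar>)"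
      using C by (intro AE_I2) (simp add: abs_mult mult.commute[of C] mult_left_mono)
  qed (use gauss_bounded_sectionl[OF f] gauss_bounded_sectionr[OF g] in simp)
  then show ?thesis unfolding set_integrable_def by (intro integrable_mult_indicator) auto
qed

text \<open>Gaussian bounds are stable under composition, with a smaller rate.\<close>

lemma gauss_bounded_half_conv:
  assumes f: "gauss_bounded f" and g: "gauss_bounded g"
  shows "gauss_bounded (half_conv s f g)"
proof -
  obtain C d where C: "0 \<le> C" "0 < d" "\<And>x y. \<bar>f x y\<bar> \<le> C * exp (- d * (x - y)\<^sup>2)" using gauss_boundedE[OF f] by metis
  obtain C' d' where C': "0 \<le> C'" "0 < d'" "\<And>x y. \<bar>g x y\<bar> \<le> C' * exp (- d' * (x - y)\<^sup>2)" using gauss_boundedE[OF g] by metis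
  \<comment> \<open>Half of the common rate \<open>e\<close> is used for the decay in \<open>w\<close>, the rest for the decay in
  \<open>x - y\<close>.\<close>
  define e where "e = min d d'"
  have e: "0 < e" "e \<le> d" "e \<le> d'" using C C' by (auto simp: e_def)
  have pb: "\<bar>f x w * g w y\<bar> \<le> (C * C' * exp (- (e / 4) * (x - y)\<^sup>2)) * exp (- (e / 2) * (w - x)\<^sup>2)" for x y w
  proof -
    have "(x - y)\<^sup>2 \<le> 2 * (x - w)\<^sup>2 + 2 * (w - y)\<^sup>2"
      using zero_le_power2[of "(x - w) - (w - y)"] by (simp add: power2_eq_square algebra_simps)
    then have q: "(e / 4) * (x - y)\<^sup>2 + (e / 2) * (w - x)\<^sup>2 \<le> e * (x - w)\<^sup>2 + e * (w - y)\<^sup>2"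
    proof -
      have "(e / 4) * (x - y)\<^sup>2 \<le> (e / 4) * (2 * (x - w)\<^sup>2 + 2 * (w - y)\<^sup>2)"
        using \<open>(x - y)\<^sup>2 \<le> _\<close> e(1) by (intro mult_left_mono) auto
      moreover have "(e / 4) * (2 * (x - w)\<^sup>2 + 2 * (w - y)\<^sup>2) = (e / 2) * (x - w)\<^sup>2 + (e / 2) * (w - y)\<^sup>2"
        by (simp add: field_simps)
      moreover have "(e / 2) * (w - y)\<^sup>2 \<le> e * (w - y)\<^sup>2" using e(1) by (intro mult_right_mono) auto
      moreover have "e * (x - w)\<^sup>2 = (e / 2) * (x - w)\<^sup>2 + (e / 2) * (w - x)\<^sup>2"
        by (simp add: power2_commute[of w x])
      ultimately show ?thesis by linarith
    qed
    have "\<bar>f x w * g w y\<bar> \<le> (C * exp (- d * (x - w)\<^sup>2)) * (C' * exp (- d' * (w - y)\<^sup>2))"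
      unfolding abs_mult using C C' by (intro mult_mono) auto
    also have "\<dots> = C * C' * exp (- (d * (x - w)\<^sup>2 + d' * (w - y)\<^sup>2))"
      by (simp only: minus_add_distrib exp_add mult_minus_left mult_ac)
    also have "\<dots> \<le> C * C' * exp (- ((e / 4) * (x - y)\<^sup>2 + (e / 2) * (w - x)\<^sup>2))"
    proof (intro mult_left_mono, subst exp_le_cancel_iff)
      have "e * (x - w)\<^sup>2 \<le> d * (x - w)\<^sup>2" "e * (w - y)\<^sup>2 \<le> d' * (w - y)\<^sup>2" using e by (auto intro: mult_right_mono)
      then show "- (d * (x - w)\<^sup>2 + d' * (w - y)\<^sup>2) \<le> - ((e / 4) * (x - y)\<^sup>2 + (e / 2) * (w - x)\<^sup>2)" using q by linarith
    qed (use C C' in auto)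
    also have "\<dots> = (C * C' * exp (- (e / 4) * (x - y)\<^sup>2)) * exp (- (e / 2) * (w - x)\<^sup>2)"
      by (simp only: minus_add_distrib exp_add mult.assoc mult_minus_left)
    finally show ?thesis .
  qed
  have b: "\<bar>half_conv s f g x y\<bar> \<le> (C * C' * sqrt (pi / (e / 2))) * exp (- (e / 4) * (x - y)\<^sup>2)" for x y
  proof -
    have gi: "integrable lborel (\<lambda>w. exp (- (e / 2) * (w - x)\<^sup>2))" by (rule integrable_gaussian) (use e in auto)
    have "\<bar>half_conv s f g x y\<bar> \<le> (LINT w|lborel. (C * C' * exp (- (e / 4) * (x - y)\<^sup>2)) * exp (- (e / 2) * (w - x)\<^sup>2))"
      unfolding half_conv_def set_lebesgue_integral_def
    proof (rule norm_integral_le)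
      show "integrable lborel (\<lambda>w. indicat_real {s..} w *\<^sub>R (f x w * g w y))"
        using gauss_bounded_prod_integrable[OF f g] by (simp add: set_integrable_def)
      show "\<bar>indicat_real {s..} w *\<^sub>R (f x w * g w y)\<bar> \<le> (C * C' * exp (- (e / 4) * (x - y)\<^sup>2)) * exp (- (e / 2) * (w - x)\<^sup>2)" for w
        using pb[of x w y] order_trans[OF abs_ge_zero pb[of x w y]] by (simp add: indicator_def)
    qed (intro integrable_mult_right gi)
    also have "\<dots> = (C * C' * exp (- (e / 4) * (x - y)\<^sup>2)) * sqrt (pi / (e / 2))"
      using e gaussian_integral(2)[of "e / 2" x] by (subst integral_mult_right_zero) simp
    finally show ?thesis by (simp add: mult_ac)
  qed
  have m: "(\<lambda>(x, y). half_conv s f g x y) \<in> borel_measurable (borel \<Otimes>\<^sub>M borel)"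
    unfolding half_conv_def set_lebesgue_integral_def case_prod_beta'
  proof (rule lborel.borel_measurable_lebesgue_integral)
    note [measurable] = measurable_section2[OF gauss_bounded_measurable[OF f]] measurable_section2[OF gauss_bounded_measurable[OF g]]
    have [measurable]: "(\<lambda>p. indicat_real {s..} (snd p)) \<in> borel_measurable ((borel \<Otimes>\<^sub>M borel) \<Otimes>\<^sub>M lborel)"
      by (rule measurable_compose[OF measurable_snd]) measurable
    show "(\<lambda>(p, w). indicat_real {s..} w *\<^sub>R (f (fst p) w * g w (snd p))) \<in> borel_measurable ((borel \<Otimes>\<^sub>M borel) \<Otimes>\<^sub>M lborel)"
      unfolding case_prod_beta' by measurable
  qed
  have "C * C' * sqrt (pi / (e / 2)) \<ge> 0" using C C' e by simp
  then show ?thesis unfolding gauss_bounded_def using m b e(1)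
    by (intro conjI exI[of _ "C * C' * sqrt (pi / (e / 2))"] exI[of _ "e / 4"]) auto
qed

lemma half_conv_sum_left:
  assumes "\<And>i. i \<in> I \<Longrightarrow> gauss_bounded (f i)" "gauss_bounded g"
  shows "half_conv s (\<lambda>x y. \<Sum>i\<in>I. f i x y) g = (\<lambda>x y. \<Sum>i\<in>I. half_conv s (f i) g x y)"
proof (intro ext)
  fix x y
  show "half_conv s (\<lambda>x y. \<Sum>i\<in>I. f i x y) g x y = (\<Sum>i\<in>I. half_conv s (f i) g x y)"
    unfolding half_conv_def sum_distrib_right set_lebesgue_integral_def scaleR_sum_right
    by (rule Bochner_Integration.integral_sum)
       (use gauss_bounded_prod_integrable[OF assms(1) assms(2)] in \<open>simp add: set_integrable_def\<close>)
qed

lemma half_conv_sum_right: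
  assumes "\<And>i. i \<in> I \<Longrightarrow> gauss_bounded (g i)" "gauss_bounded f"
  shows "half_conv s f (\<lambda>x y. \<Sum>i\<in>I. g i x y) = (\<lambda>x y. \<Sum>i\<in>I. half_conv s f (g i) x y)"
proof (intro ext)
  fix x y
  show "half_conv s f (\<lambda>x y. \<Sum>i\<in>I. g i x y) x y = (\<Sum>i\<in>I. half_conv s f (g i) x y)"
    unfolding half_conv_def sum_distrib_left set_lebesgue_integral_def scaleR_sum_right
    by (rule Bochner_Integration.integral_sum)
       (use gauss_bounded_prod_integrable[OF assms(2) assms(1)] in \<open>simp add: set_integrable_def\<close>)
qed

lemma half_conv_add_left:
  assumes "gauss_bounded f" "gauss_bounded f'" "gauss_bounded g"
  shows "half_conv s (\<lambda>x y. f x y + f' x y) g = (\<lambda>x y. half_conv s f g x y + half_conv s f' g x y)"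
  unfolding half_conv_def distrib_right
  using gauss_bounded_prod_integrable[OF assms(1,3)] gauss_bounded_prod_integrable[OF assms(2,3)]
  by (intro ext set_integral_add(2)) auto

lemma half_conv_diff_left:
  assumes "gauss_bounded f" "gauss_bounded f'" "gauss_bounded g"
  shows "half_conv s (\<lambda>x y. f x y - f' x y) g = (\<lambda>x y. half_conv s f g x y - half_conv s f' g x y)"
  unfolding half_conv_def left_diff_distrib
  using gauss_bounded_prod_integrable[OF assms(1,3)] gauss_bounded_prod_integrable[OF assms(2,3)]
  by (intro ext set_integral_diff(2)) auto

lemma half_conv_diff_right:
  assumes "gauss_bounded f" "gauss_bounded g" "gauss_bounded g'"
  shows "half_conv s f (\<lambda>x y. g x y - g' x y) = (\<lambda>x y. half_conv s f g x y - half_conv s f g' x y)"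
  unfolding half_conv_def right_diff_distrib
  using gauss_bounded_prod_integrable[OF assms(1,2)] gauss_bounded_prod_integrable[OF assms(1,3)]
  by (intro ext set_integral_diff(2)) auto

lemma half_conv_cmult_left: "half_conv s (\<lambda>x y. c * f x y) g = (\<lambda>x y. c * half_conv s f g x y)"
  unfolding half_conv_def mult.assoc by (intro ext) (rule set_integral_mult_right)

lemma half_conv_zero_left: "half_conv s (\<lambda>x y. 0) g = (\<lambda>x y. 0)"
  by (simp add: half_conv_def fun_eq_iff set_lebesgue_integral_def)

lemma half_conv_zero_right: "half_conv s f (\<lambda>x y. 0) = (\<lambda>x y. 0)"
  by (simp add: half_conv_def fun_eq_iff set_lebesgue_integral_def)

lemma half_conv_assoc:
  assumes f: "gauss_bounded f" and g: "gauss_bounded g" and h: "gauss_bounded h"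
  shows "half_conv s f (half_conv s' g h) = half_conv s' (half_conv s f g) h"
proof (intro ext)
  fix x y
  obtain C where C: "0 \<le> C" "\<And>x y. \<bar>g x y\<bar> \<le> C" using gauss_bounded_bounded[OF g] by metis
  define F where "F w v = indicat_real {s..} w * (f x w * (indicat_real {s'..} v * (g w v * h v y)))" for w v
  have 1: "half_conv s f (half_conv s' g h) x y = (LINT w|lborel. LINT v|lborel. F w v)"
    unfolding half_conv_def set_lebesgue_integral_def F_def by simp
  have 2: "half_conv s' (half_conv s f g) h x y = (LINT v|lborel. LINT w|lborel. F w v)"
  proof -
    have "(LINT w|lborel. F w v) = indicat_real {s'..} v * ((LINT w|lborel. indicat_real {s..} w * (f x w * g w v)) * h v y)" for v
    proof -
      have "F w v = (indicat_real {s'..} v * h v y) * (indicat_real {s..} w * (f x w * g w v))" for w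
        by (simp add: F_def mult_ac)
      then have "(LINT w|lborel. F w v) = (LINT w|lborel. (indicat_real {s'..} v * h v y) * (indicat_real {s..} w * (f x w * g w v)))" by (simp only:)
      also have "\<dots> = (indicat_real {s'..} v * h v y) * (LINT w|lborel. indicat_real {s..} w * (f x w * g w v))"
        by (rule integral_mult_right_zero)
      finally show ?thesis by (simp only: mult_ac)
    qed
    then show ?thesis unfolding half_conv_def set_lebesgue_integral_def by simp
  qed
  have "(LINT v|lborel. LINT w|lborel. F w v) = (LINT w|lborel. LINT v|lborel. F w v)"
  proof (rule lborel_pair.Fubini_integral)
    show "integrable (lborel \<Otimes>\<^sub>M lborel) (\<lambda>(w, v). F w v)"
    proof (rule lborel_pair_bound[where p = "\<lambda>w. C * \<bar>f x w\<bar>" and q = "\<lambda>v. \<bar>h v y\<bar>"])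
      note [measurable] = measurable_section2[OF gauss_bounded_measurable[OF f]] measurable_section2[OF gauss_bounded_measurable[OF g]] measurable_section2[OF gauss_bounded_measurable[OF h]]
      have [measurable]: "(\<lambda>p. indicat_real {s..} (fst p)) \<in> borel_measurable (lborel \<Otimes>\<^sub>M lborel)"
        "(\<lambda>p. indicat_real {s'..} (snd p)) \<in> borel_measurable (lborel \<Otimes>\<^sub>M lborel)"
        by (rule measurable_compose[OF measurable_fst] measurable_compose[OF measurable_snd], measurable)+
      show "(\<lambda>(w, v). F w v) \<in> borel_measurable (lborel \<Otimes>\<^sub>M lborel)"
        unfolding F_def case_prod_beta' by measurable
      show "norm (case (w, v) of (w, v) \<Rightarrow> F w v) \<le> C * \<bar>f x w\<bar> * \<bar>h v y\<bar>" for w v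
      proof -
        have "\<bar>F w v\<bar> \<le> \<bar>f x w * (g w v * h v y)\<bar>" by (auto simp: F_def indicator_def)
        also have "\<dots> = \<bar>g w v\<bar> * (\<bar>f x w\<bar> * \<bar>h v y\<bar>)" by (simp add: abs_mult mult_ac)
        also have "\<dots> \<le> C * (\<bar>f x w\<bar> * \<bar>h v y\<bar>)" using C(2) by (rule mult_right_mono) simp
        finally show ?thesis by (simp add: mult_ac)
      qed
    qed (intro integrable_mult_right integrable_abs gauss_bounded_integrable_left[OF f] gauss_bounded_integrable_right[OF h])+
  qed
  then show "half_conv s f (half_conv s' g h) x y = half_conv s' (half_conv s f g) h x y" unfolding 1 2 by simp
qed

section \<open>Coefficients of the series L\<close>

text \<open>
  The coefficient of \<open>\<sigma>^n\<close> in the Gaussian series, as a kernel.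
\<close>

definition gauss_coeff :: "(nat \<Rightarrow> real) \<Rightarrow> nat \<Rightarrow> real \<Rightarrow> real \<Rightarrow> real" where
  "gauss_coeff a n x y = fps_nth (gauss_series a x y) n"

text \<open>The coefficient of \<open>\<sigma>^n\<close> in \<open>L\<close>, as a kernel.\<close>

definition L_coeff :: "(nat \<Rightarrow> real) \<Rightarrow> nat \<Rightarrow> real \<Rightarrow> real \<Rightarrow> real" where
  "L_coeff a n x y = fps_nth (L_series a x y) n"

lemma gauss_coeff_0: "gauss_coeff a 0 = (\<lambda>x y. 0)"
  by (simp add: gauss_coeff_def gauss_series_def fun_eq_iff)

lemma gauss_coeff_pos: "n > 0 \<Longrightarrow> gauss_coeff a n x y = a n / sqrt (4 * pi * real n) * exp (- ((y - x)\<^sup>2) / (4 * real n))"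
  by (simp add: gauss_coeff_def gauss_series_def)

lemma gauss_coeff_bound:
  assumes "n \<le> N"
  shows "\<bar>gauss_coeff a n x y\<bar> \<le> (\<Sum>i\<le>N. \<bar>a i\<bar>) * exp (- (1 / (4 * real (Suc N))) * (x - y)\<^sup>2)"
proof (cases "n = 0")
  case True
  then show ?thesis by (simp add: gauss_coeff_0 sum_nonneg)
next
  case False
  then have n: "real n \<ge> 1" by simp
  have "4 * pi * real n \<ge> 4 * pi * 1" using n by (intro mult_left_mono) auto
  moreover have "4 * pi * 1 \<ge> (1 :: real)" using pi_gt3 by simp
  ultimately have "4 * pi * real n \<ge> 1" by linarith
  then have s: "sqrt (4 * pi * real n) \<ge> 1" by (subst real_sqrt_ge_1_iff)
  have "\<bar>a n / sqrt (4 * pi * real n)\<bar> \<le> \<bar>a n\<bar>"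
    unfolding abs_divide using s n divide_left_mono[of 1 "sqrt (4 * pi * real n)" "\<bar>a n\<bar>"] by simp
  also have "\<bar>a n\<bar> \<le> (\<Sum>i\<le>N. \<bar>a i\<bar>)" using assms by (intro member_le_sum) auto
  finally have 1: "\<bar>a n / sqrt (4 * pi * real n)\<bar> \<le> (\<Sum>i\<le>N. \<bar>a i\<bar>)" .
  have "(x - y)\<^sup>2 / (4 * real (Suc N)) \<le> (x - y)\<^sup>2 / (4 * real n)" using n assms by (intro divide_left_mono) auto
  then have 2: "exp (- ((y - x)\<^sup>2) / (4 * real n)) \<le> exp (- (1 / (4 * real (Suc N))) * (x - y)\<^sup>2)"
    by (simp add: power2_commute[of y x])
  have "\<bar>gauss_coeff a n x y\<bar> = \<bar>a n / sqrt (4 * pi * real n)\<bar> * exp (- ((y - x)\<^sup>2) / (4 * real n))"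
    using False by (simp add: gauss_coeff_pos abs_mult)
  also have "\<dots> \<le> (\<Sum>i\<le>N. \<bar>a i\<bar>) * exp (- (1 / (4 * real (Suc N))) * (x - y)\<^sup>2)"
    using 1 2 by (rule mult_mono) (auto intro: sum_nonneg)
  finally show ?thesis .
qed

lemma gauss_coeff_measurable: "(\<lambda>(x, y). gauss_coeff a n x y) \<in> borel_measurable (borel \<Otimes>\<^sub>M borel)"
proof (cases "n = 0")
  case False
  then show ?thesis unfolding case_prod_beta' by (simp add: gauss_coeff_pos)
qed (simp add: gauss_coeff_0)

lemma gauss_bounded_gauss_coeff: "gauss_bounded (gauss_coeff a n)"
  unfolding gauss_bounded_def using gauss_coeff_bound[of n n a]
  by (intro conjI gauss_coeff_measurable exI[of _ "\<Sum>i\<le>n. \<bar>a i\<bar>"] exI[of _ "1 / (4 * real (Suc n))"]) (auto intro: sum_nonneg)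

lemma fps_prod_coeff_bound:
  fixes G :: "nat \<Rightarrow> real fps"
  assumes "finite S" "0 \<le> A" "\<And>l. l \<in> S \<Longrightarrow> 0 \<le> e l"
    and "\<And>l n. l \<in> S \<Longrightarrow> n \<le> N \<Longrightarrow> \<bar>fps_nth (G l) n\<bar> \<le> A * e l" and "n \<le> N"
  shows "\<bar>fps_nth (\<Prod>l\<in>S. G l) n\<bar> \<le> (A * real (Suc N)) ^ card S * (\<Prod>l\<in>S. e l)"
  using assms
proof (induction S arbitrary: n rule: finite_induct)
  case empty
  then show ?case by simp
next
  case (insert l S)
  define B where "B = (A * real (Suc N)) ^ card S * (\<Prod>l\<in>S. e l)"
  have B: "0 \<le> B" unfolding B_def using insert.prems by (intro mult_nonneg_nonneg zero_le_power prod_nonneg) auto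
  have IH: "\<bar>fps_nth (\<Prod>l\<in>S. G l) m\<bar> \<le> B" if "m \<le> N" for m
    unfolding B_def using insert.IH insert.prems that by blast
  have "fps_nth (\<Prod>l\<in>insert l S. G l) n = (\<Sum>i=0..n. fps_nth (G l) i * fps_nth (\<Prod>l\<in>S. G l) (n - i))"
    using insert.hyps by (simp add: fps_mult_nth)
  also have "\<bar>\<dots>\<bar> \<le> (\<Sum>i=0..n. \<bar>fps_nth (G l) i * fps_nth (\<Prod>l\<in>S. G l) (n - i)\<bar>)" by (rule sum_abs)
  also have "\<dots> \<le> (\<Sum>i=0..n. (A * e l) * B)"
    unfolding abs_mult using insert.prems B IH by (intro sum_mono mult_mono) auto
  also have "\<dots> = real (Suc n) * ((A * e l) * B)" by simp
  also have "\<dots> \<le> real (Suc N) * ((A * e l) * B)"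
    using insert.prems B by (intro mult_right_mono mult_nonneg_nonneg) auto
  also have "\<dots> = (A * real (Suc N)) ^ card (insert l S) * (\<Prod>l\<in>insert l S. e l)"
    using insert.hyps by (simp add: B_def mult_ac)
  finally show ?case .
qed

lemma fps_prod_coeff_zero:
  fixes G :: "nat \<Rightarrow> real fps"
  assumes "finite S" "\<And>l. l \<in> S \<Longrightarrow> fps_nth (G l) 0 = 0" "n < card S"
  shows "fps_nth (\<Prod>l\<in>S. G l) n = 0"
  using assms
proof (induction S arbitrary: n rule: finite_induct)
  case (insert l S)
  have "fps_nth (\<Prod>l\<in>insert l S. G l) n = (\<Sum>i=0..n. fps_nth (G l) i * fps_nth (\<Prod>l\<in>S. G l) (n - i))"
    using insert.hyps by (simp add: fps_mult_nth)
  also have "\<dots> = 0"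
  proof (rule sum.neutral, rule ballI)
    fix i assume i: "i \<in> {0..n}"
    show "fps_nth (G l) i * fps_nth (\<Prod>l\<in>S. G l) (n - i) = 0"
    proof (cases "i = 0")
      case True
      then show ?thesis using insert.prems(1)[of l] by simp
    next
      case False
      then have "n - i < card S" using insert.prems(2) insert.hyps i by auto
      then have "fps_nth (\<Prod>l\<in>S. G l) (n - i) = 0" using insert.IH insert.prems(1) by blast
      then show ?thesis by simp
    qed
  qed
  finally show ?case .
qed simp

lemma fps_prod_coeff_measurable:
  fixes G :: "nat \<Rightarrow> 'c \<Rightarrow> real fps"
  assumes "finite S" "\<And>l n. l \<in> S \<Longrightarrow> (\<lambda>\<omega>. fps_nth (G l \<omega>) n) \<in> borel_measurable M"
  shows "(\<lambda>\<omega>. fps_nth (\<Prod>l\<in>S. G l \<omega>) n) \<in> borel_measurable M"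
  using assms
proof (induction S arbitrary: n rule: finite_induct)
  case (insert l S)
  have "(\<lambda>\<omega>. \<Sum>i=0..n. fps_nth (G l \<omega>) i * fps_nth (\<Prod>l\<in>S. G l \<omega>) (n - i)) \<in> borel_measurable M"
    using insert by (intro borel_measurable_sum borel_measurable_times) auto
  then show ?case using insert.hyps by (simp add: fps_mult_nth)
qed simp

text \<open>
  The product of \<open>k\<close> Gaussian series along a path from \<open>x\<close> to \<open>y\<close> with intermediate points
  \<open>z 1, \<dots>, z (k - 1)\<close>.
\<close>

definition chain :: "(nat \<Rightarrow> real) \<Rightarrow> nat \<Rightarrow> real \<Rightarrow> real \<Rightarrow> (nat \<Rightarrow> real) \<Rightarrow> real fps" where
  "chain a k x y z = (\<Prod>l=1..k. gauss_series a ((z(0 := x, k := y)) (l - 1)) ((z(0 := x, k := y)) l))"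

text \<open>
  The coefficient of \<open>\<sigma>^N\<close> in the \<open>k\<close>-fold composition of the Gaussian series on \<open>[0, \<infinity>)\<close>,
  up to sign the \<open>k\<close>-th term of \<open>L\<close>.
\<close>

definition L_term :: "(nat \<Rightarrow> real) \<Rightarrow> nat \<Rightarrow> nat \<Rightarrow> real \<Rightarrow> real \<Rightarrow> real" where
  "L_term a k N x y = (LINT z:({1..<k} \<rightarrow>\<^sub>E {0..})|LB {1..<k}. fps_nth (chain a k x y z) N)"

lemma L_coeff_eq: "L_coeff a N x y = (\<Sum>k=1..N. (-1) ^ (k - 1) * L_term a k N x y)"
  by (simp add: L_coeff_def L_series_def L_term_def chain_def)

lemma chain_coeff_zero: "n < k \<Longrightarrow> fps_nth (chain a k x y z) n = 0"
  unfolding chain_def by (rule fps_prod_coeff_zero) (auto simp: gauss_series_def)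

lemma square_sum_le: "(\<Sum>i\<in>S. f i)\<^sup>2 \<le> real (card S) * (\<Sum>i\<in>S. (f i)\<^sup>2)" for f :: "nat \<Rightarrow> real"
  using Cauchy_Schwarz_ineq_sum[of f "\<lambda>_. 1" S] by (simp add: mult.commute)

lemma telescoped_square_le:
  fixes z :: "nat \<Rightarrow> real"
  assumes "l \<le> k"
  shows "(z l - z 0)\<^sup>2 \<le> real k * (\<Sum>i=1..k. (z i - z (i - 1))\<^sup>2)"
proof -
  have "z l - z 0 = (\<Sum>i=1..l. z i - z (i - 1))" by (induction l) auto
  then have "(z l - z 0)\<^sup>2 \<le> real l * (\<Sum>i=1..l. (z i - z (i - 1))\<^sup>2)"
    using square_sum_le[of "\<lambda>i. z i - z (i - 1)" "{1..l}"] by simp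
  also have "\<dots> \<le> real k * (\<Sum>i=1..k. (z i - z (i - 1))\<^sup>2)"
    using assms by (intro mult_mono sum_mono2 sum_nonneg) auto
  finally show ?thesis .
qed

text \<open>
  A Gaussian bound in the end points and in all intermediate points: the squared
  increments of a path control the squared distance of each of its points from \<open>x\<close>.
\<close>

lemma chain_coeff_bound:
  assumes k: "k \<ge> 1"
  obtains C d where "0 \<le> C" "0 < d"
    "\<And>x y z. \<bar>fps_nth (chain a k x y z) N\<bar> \<le> C * exp (- d * (x - y)\<^sup>2) * (\<Prod>l\<in>{1..<k}. exp (- d * (z l - x)\<^sup>2))"
proof -
  define A where "A = (\<Sum>i\<le>N. \<bar>a i\<bar>)"
  define d0 where "d0 = 1 / (4 * real (Suc N))"
  define d where "d = d0 / (real k * real k)"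
  define C where "C = (A * real (Suc N)) ^ k"
  have A: "0 \<le> A" by (simp add: A_def sum_nonneg)
  have d0: "0 < d0" and d: "0 < d" using k by (auto simp: d0_def d_def)
  have "\<bar>fps_nth (chain a k x y z) N\<bar> \<le> C * exp (- d * (x - y)\<^sup>2) * (\<Prod>l\<in>{1..<k}. exp (- d * (z l - x)\<^sup>2))" for x y z
  proof -
    define zz where "zz = z(0 := x, k := y)"
    define D where "D = (\<Sum>i=1..k. (zz i - zz (i - 1))\<^sup>2)"
    have zz: "zz 0 = x" "zz k = y" "\<And>l. l \<in> {1..<k} \<Longrightarrow> zz l = z l" using k by (auto simp: zz_def)
    have "\<bar>fps_nth (chain a k x y z) N\<bar> \<le> (A * real (Suc N)) ^ card {1..k} * (\<Prod>l=1..k. exp (- d0 * (zz (l - 1) - zz l)\<^sup>2))"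
      unfolding chain_def zz_def[symmetric]
      by (rule fps_prod_coeff_bound) (use A gauss_coeff_bound[of _ N a] in \<open>auto simp: A_def d0_def gauss_coeff_def\<close>)
    also have "(\<Prod>l=1..k. exp (- d0 * (zz (l - 1) - zz l)\<^sup>2)) = exp (- d0 * D)"
      unfolding D_def by (simp add: exp_sum[symmetric] sum_distrib_left power2_commute sum_negf)
    also have "exp (- d0 * D) \<le> exp (- d * (\<Sum>l=1..k. (zz l - x)\<^sup>2))"
    proof -
      have "(\<Sum>l=1..k. (zz l - x)\<^sup>2) \<le> (\<Sum>l=1..k. real k * D)"
        using telescoped_square_le[of _ k zz] zz(1) by (intro sum_mono) (auto simp: D_def)
      also have "\<dots> = (real k * real k) * D" by simp
      finally have "d * (\<Sum>l=1..k. (zz l - x)\<^sup>2) \<le> d * ((real k * real k) * D)" using d by (intro mult_left_mono) auto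
      also have "\<dots> = d0 * D" using k by (simp add: d_def)
      finally show ?thesis by simp
    qed
    also have "(\<Sum>l=1..k. (zz l - x)\<^sup>2) = (x - y)\<^sup>2 + (\<Sum>l\<in>{1..<k}. (z l - x)\<^sup>2)"
    proof -
      have "{1..k} = insert k {1..<k}" using k by auto
      then show ?thesis using zz by (simp add: power2_commute)
    qed
    also have "exp (- d * ((x - y)\<^sup>2 + (\<Sum>l\<in>{1..<k}. (z l - x)\<^sup>2))) = exp (- d * (x - y)\<^sup>2) * (\<Prod>l\<in>{1..<k}. exp (- d * (z l - x)\<^sup>2))"
      by (simp only: distrib_left exp_add sum_distrib_left exp_sum finite_atLeastLessThan)
    finally show ?thesis using A by (simp add: C_def mult_left_mono mult.assoc)
  qed
  moreover have "0 \<le> C" using A by (simp add: C_def)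
  ultimately show thesis using d that by blast
qed

lemma chain_coeff_measurable:
  assumes k: "k \<ge> 1" and x: "fx \<in> borel_measurable M" and y: "fy \<in> borel_measurable M"
    and z: "\<And>l. l \<in> {1..<k} \<Longrightarrow> (\<lambda>\<omega>. fz \<omega> l) \<in> borel_measurable M"
  shows "(\<lambda>\<omega>. fps_nth (chain a k (fx \<omega>) (fy \<omega>) (fz \<omega>)) N) \<in> borel_measurable M"
  unfolding chain_def
proof (rule fps_prod_coeff_measurable)
  fix l n assume l: "l \<in> {1..k}"
  have m: "(\<lambda>\<omega>. ((fz \<omega>)(0 := fx \<omega>, k := fy \<omega>)) i) \<in> borel_measurable M" if "i \<le> k" for i
    using that x y z[of i] k by (cases "i = 0"; cases "i = k") auto
  show "(\<lambda>\<omega>. fps_nth (gauss_series a (((fz \<omega>)(0 := fx \<omega>, k := fy \<omega>)) (l - 1)) (((fz \<omega>)(0 := fx \<omega>, k := fy \<omega>)) l)) n) \<in> borel_measurable M"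
  proof -
    have "l - 1 \<le> k" "l \<le> k" using l by auto
    from measurable_section2[OF gauss_coeff_measurable m[OF this(1)] m[OF this(2)], of a n]
    show ?thesis unfolding gauss_coeff_def .
  qed
qed simp

lemma chain_integrable:
  assumes k: "k \<ge> 1"
  shows "set_integrable (LB {1..<k}) ({1..<k} \<rightarrow>\<^sub>E {0..}) (\<lambda>z. fps_nth (chain a k x y z) N)"
proof -
  obtain C d where C: "0 \<le> C" "0 < d"
    "\<And>x y z. \<bar>fps_nth (chain a k x y z) N\<bar> \<le> C * exp (- d * (x - y)\<^sup>2) * (\<Prod>l\<in>{1..<k}. exp (- d * (z l - x)\<^sup>2))"
    using chain_coeff_bound[OF k, of a N] by metis
  have "integrable (LB {1..<k}) (\<lambda>z. fps_nth (chain a k x y z) N)"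
  proof (rule Bochner_Integration.integrable_bound)
    show "integrable (LB {1..<k}) (\<lambda>z. (C * exp (- d * (x - y)\<^sup>2)) * (\<Prod>l\<in>{1..<k}. exp (- d * (z l - x)\<^sup>2)))"
      by (rule LB_prod(1)[OF _ integrable_gaussian[OF C(2)]]) simp
    show "(\<lambda>z. fps_nth (chain a k x y z) N) \<in> borel_measurable (LB {1..<k})"
      by (rule chain_coeff_measurable[OF k]) auto
    show "AE z in LB {1..<k}. norm (fps_nth (chain a k x y z) N) \<le> norm ((C * exp (- d * (x - y)\<^sup>2)) * (\<Prod>l\<in>{1..<k}. exp (- d * (z l - x)\<^sup>2)))"
      using order_trans[OF C(3) abs_ge_self] by (intro AE_I2) simp
  qed
  then show ?thesis unfolding set_integrable_def
    by (intro integrable_mult_indicator sets_PiM_I_finite) auto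
qed

lemma gauss_bounded_L_term:
  assumes k: "k \<ge> 1"
  shows "gauss_bounded (L_term a k N)"
proof -
  obtain C d where C: "0 \<le> C" "0 < d"
    "\<And>x y z. \<bar>fps_nth (chain a k x y z) N\<bar> \<le> C * exp (- d * (x - y)\<^sup>2) * (\<Prod>l\<in>{1..<k}. exp (- d * (z l - x)\<^sup>2))"
    using chain_coeff_bound[OF k, of a N] by metis
  define c where "c = sqrt (pi / d) ^ card {1..<k}"
  have b: "\<bar>L_term a k N x y\<bar> \<le> (C * c) * exp (- d * (x - y)\<^sup>2)" for x y
  proof -
    have gi: "integrable lborel (\<lambda>u. exp (- d * (u - x)\<^sup>2))" by (rule integrable_gaussian[OF C(2)])
    have "\<bar>L_term a k N x y\<bar> \<le> (LINT z|LB {1..<k}. (C * exp (- d * (x - y)\<^sup>2)) * (\<Prod>l\<in>{1..<k}. exp (- d * (z l - x)\<^sup>2)))"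
      unfolding L_term_def set_lebesgue_integral_def
    proof (rule norm_integral_le)
      show "integrable (LB {1..<k}) (\<lambda>z. indicat_real ({1..<k} \<rightarrow>\<^sub>E {0..}) z *\<^sub>R fps_nth (chain a k x y z) N)"
        using chain_integrable[OF k] unfolding set_integrable_def .
      show "integrable (LB {1..<k}) (\<lambda>z. (C * exp (- d * (x - y)\<^sup>2)) * (\<Prod>l\<in>{1..<k}. exp (- d * (z l - x)\<^sup>2)))"
        by (rule LB_prod(1)[OF _ gi]) simp
      show "\<bar>indicat_real ({1..<k} \<rightarrow>\<^sub>E {0..}) z *\<^sub>R fps_nth (chain a k x y z) N\<bar> \<le> (C * exp (- d * (x - y)\<^sup>2)) * (\<Prod>l\<in>{1..<k}. exp (- d * (z l - x)\<^sup>2))" for z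
        using C(3)[of x y z] order_trans[OF abs_ge_zero C(3)[of x y z]] by (simp add: indicator_def)
    qed
    also have "\<dots> = (C * exp (- d * (x - y)\<^sup>2)) * c"
      unfolding c_def gaussian_integral(2)[OF C(2), of x, symmetric] by (rule LB_prod(2)[OF _ gi]) simp
    finally show ?thesis by (simp add: mult_ac)
  qed
  interpret S: sigma_finite_measure "LB {1..<k}" by (rule LB_sigma_finite) simp
  have m: "(\<lambda>(x, y). L_term a k N x y) \<in> borel_measurable (borel \<Otimes>\<^sub>M borel)"
    unfolding L_term_def set_lebesgue_integral_def case_prod_beta'
  proof (rule S.borel_measurable_lebesgue_integral)
    have "(\<lambda>q. fps_nth (chain a k (fst (fst q)) (snd (fst q)) (snd q)) N) \<in> borel_measurable ((borel \<Otimes>\<^sub>M borel) \<Otimes>\<^sub>M LB {1..<k})"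
      by (rule chain_coeff_measurable[OF k]) (auto intro!: measurable_compose[OF measurable_snd LB_component])
    moreover have "(\<lambda>q. indicat_real ({1..<k} \<rightarrow>\<^sub>E {0..}) (snd q)) \<in> borel_measurable ((borel \<Otimes>\<^sub>M borel) \<Otimes>\<^sub>M LB {1..<k})"
      by (intro measurable_compose[OF measurable_snd] borel_measurable_indicator sets_PiM_I_finite) auto
    ultimately show "(\<lambda>(p, z). indicat_real ({1..<k} \<rightarrow>\<^sub>E {0..}) z *\<^sub>R fps_nth (chain a k (fst p) (snd p) z) N) \<in> borel_measurable ((borel \<Otimes>\<^sub>M borel) \<Otimes>\<^sub>M LB {1..<k})"
      unfolding case_prod_beta' by (intro borel_measurable_scaleR) auto
  qed
  have "0 \<le> C * c" using C by (simp add: c_def)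
  then show ?thesis unfolding gauss_bounded_def using m b C(2) by (intro conjI exI[of _ "C * c"] exI[of _ d]) auto
qed

lemma L_term_1: "L_term a 1 N = gauss_coeff a N"
proof (intro ext)
  fix x y
  have "L_term a 1 N x y = (LINT z|LB {}. gauss_coeff a N x y)"
    unfolding L_term_def set_lebesgue_integral_def
  proof (rule Bochner_Integration.integral_cong)
    fix z :: "nat \<Rightarrow> real" assume "z \<in> space (LB {})"
    then show "indicat_real ({1..<1} \<rightarrow>\<^sub>E {0..}) z *\<^sub>R fps_nth (chain a 1 x y z) N = gauss_coeff a N x y"
      by (simp add: chain_def gauss_coeff_def space_PiM)
  qed simp
  also have "\<dots> = gauss_coeff a N x y" using LB_prod(2)[of "{}" "\<lambda>_. 0" "gauss_coeff a N x y"] by simp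
  finally show "L_term a 1 N x y = gauss_coeff a N x y" .
qed

lemma chain_Suc:
  assumes k: "k \<ge> 1"
  shows "chain a (Suc k) x y (r(k := w)) = chain a k x w r * gauss_series a w y"
proof -
  have "(\<Prod>l=1..k. gauss_series a (((r(k := w))(0 := x, Suc k := y)) (l - 1)) (((r(k := w))(0 := x, Suc k := y)) l))
      = (\<Prod>l=1..k. gauss_series a ((r(0 := x, k := w)) (l - 1)) ((r(0 := x, k := w)) l))"
    using k by (intro prod.cong refl) auto
  then show ?thesis
    unfolding chain_def using k by (subst prod.nat_ivl_Suc') (auto simp: mult.commute)
qed

text \<open>The last intermediate point is integrated last.\<close>

lemma L_term_Suc:
  assumes k: "k \<ge> 1"
  shows "L_term a (Suc k) N = (\<lambda>x y. \<Sum>n\<le>N. half_conv 0 (L_term a k n) (gauss_coeff a (N - n)) x y)"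
proof (intro ext)
  fix x y
  define I where "I = {1..<k}"
  have I: "finite I" "k \<notin> I" "{1..<Suc k} = insert k I" using k by (auto simp: I_def)
  define f where "f z = indicat_real ({1..<Suc k} \<rightarrow>\<^sub>E {0..}) z *\<^sub>R fps_nth (chain a (Suc k) x y z) N" for z
  have fi: "integrable (LB (insert k I)) f"
    using chain_integrable[of "Suc k" a x y N] unfolding set_integrable_def f_def I(3) by simp
  have fval: "f (r(k := w)) = indicat_real {0..} w * (\<Sum>n\<le>N. (indicat_real (I \<rightarrow>\<^sub>E {0..}) r * fps_nth (chain a k x w r) n) * gauss_coeff a (N - n) w y)"
    if r: "r \<in> space (LB I)" for r w
  proof -
    have "indicat_real ({1..<Suc k} \<rightarrow>\<^sub>E {0..}) (r(k := w)) = indicat_real (I \<rightarrow>\<^sub>E {0..}) r * indicat_real {0..} w"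
    proof -
      have "r(k := w) \<in> {1..<Suc k} \<rightarrow>\<^sub>E {0..} \<longleftrightarrow> r \<in> I \<rightarrow>\<^sub>E {0..} \<and> 0 \<le> w"
        using r I(2) unfolding I(3) by (auto simp: PiE_iff space_PiM extensional_def)
      then show ?thesis by (simp add: indicator_def)
    qed
    moreover have "fps_nth (chain a (Suc k) x y (r(k := w))) N = (\<Sum>n\<le>N. fps_nth (chain a k x w r) n * gauss_coeff a (N - n) w y)"
      unfolding chain_Suc[OF k] by (simp add: fps_mult_nth gauss_coeff_def atLeast0AtMost)
    ultimately show ?thesis by (simp only: f_def real_scaleR_def sum_distrib_left mult_ac)
  qed
  have inti: "integrable (LB I) (\<lambda>r. indicat_real (I \<rightarrow>\<^sub>E {0..}) r * fps_nth (chain a k x w r) n)" for n w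
    using chain_integrable[OF k, of a x w n] by (simp add: set_integrable_def I_def)
  have "L_term a (Suc k) N x y = integral\<^sup>L (LB (insert k I)) f"
    unfolding L_term_def set_lebesgue_integral_def f_def I(3) ..
  also have "\<dots> = (LINT w|lborel. LINT r|LB I. f (r(k := w)))" by (rule LB_integral_insert[OF I(1,2) fi])
  also have "\<dots> = (LINT w|lborel. (\<Sum>n\<le>N. indicat_real {0..} w * (L_term a k n x w * gauss_coeff a (N - n) w y)))"
  proof (rule Bochner_Integration.integral_cong[OF refl])
    fix w
    have "(LINT r|LB I. f (r(k := w))) = (LINT r|LB I. (\<Sum>n\<le>N. (indicat_real {0..} w * gauss_coeff a (N - n) w y) * (indicat_real (I \<rightarrow>\<^sub>E {0..}) r * fps_nth (chain a k x w r) n)))"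
      by (rule Bochner_Integration.integral_cong[OF refl]) (simp only: fval sum_distrib_left mult_ac)
    also have "\<dots> = (\<Sum>n\<le>N. LINT r|LB I. (indicat_real {0..} w * gauss_coeff a (N - n) w y) * (indicat_real (I \<rightarrow>\<^sub>E {0..}) r * fps_nth (chain a k x w r) n))"
      using inti by (intro Bochner_Integration.integral_sum integrable_mult_right)
    also have "\<dots> = (\<Sum>n\<le>N. indicat_real {0..} w * (L_term a k n x w * gauss_coeff a (N - n) w y))"
    proof (rule sum.cong[OF refl])
      fix n
      have "(LINT r|LB I. (indicat_real {0..} w * gauss_coeff a (N - n) w y) * (indicat_real (I \<rightarrow>\<^sub>E {0..}) r * fps_nth (chain a k x w r) n))
        = (indicat_real {0..} w * gauss_coeff a (N - n) w y) * (LINT r|LB I. indicat_real (I \<rightarrow>\<^sub>E {0..}) r * fps_nth (chain a k x w r) n)"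
        by (rule integral_mult_right_zero)
      also have "(LINT r|LB I. indicat_real (I \<rightarrow>\<^sub>E {0..}) r * fps_nth (chain a k x w r) n) = L_term a k n x w"
        by (simp add: L_term_def set_lebesgue_integral_def I_def)
      finally show "(LINT r|LB I. (indicat_real {0..} w * gauss_coeff a (N - n) w y) * (indicat_real (I \<rightarrow>\<^sub>E {0..}) r * fps_nth (chain a k x w r) n))
        = indicat_real {0..} w * (L_term a k n x w * gauss_coeff a (N - n) w y)" by (simp only: mult_ac)
    qed
    finally show "(LINT r|LB I. f (r(k := w))) = (\<Sum>n\<le>N. indicat_real {0..} w * (L_term a k n x w * gauss_coeff a (N - n) w y))" .
  qed
  also have "\<dots> = (\<Sum>n\<le>N. half_conv 0 (L_term a k n) (gauss_coeff a (N - n)) x y)"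
    unfolding half_conv_def set_lebesgue_integral_def real_scaleR_def
    using gauss_bounded_prod_integrable[OF gauss_bounded_L_term[OF k] gauss_bounded_gauss_coeff, of 0 a _ x a _ y]
    by (intro Bochner_Integration.integral_sum) (simp add: set_integrable_def)
  finally show "L_term a (Suc k) N x y = (\<Sum>n\<le>N. half_conv 0 (L_term a k n) (gauss_coeff a (N - n)) x y)" .
qed

lemma L_term_zero: "n < k \<Longrightarrow> L_term a k n = (\<lambda>x y. 0)"
  by (simp add: L_term_def chain_coeff_zero fun_eq_iff set_lebesgue_integral_def)

lemma gauss_bounded_L_coeff: "gauss_bounded (L_coeff a N)"
proof -
  have "gauss_bounded (\<lambda>x y. \<Sum>k=1..N. (-1) ^ (k - 1) * L_term a k N x y)"
    by (intro gauss_bounded_sum gauss_bounded_cmult gauss_bounded_L_term) auto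
  then show ?thesis by (simp add: L_coeff_eq[abs_def])
qed

lemma L_coeff_0: "L_coeff a 0 = (\<lambda>x y. 0)"
  by (simp add: L_coeff_eq fun_eq_iff)

text \<open>
  The series \<open>L\<close> solves \<open>L = G - L G\<close>, with \<open>G\<close> the Gaussian series and composition on
  \<open>[0, \<infinity>)\<close>.
\<close>

lemma L_coeff_rec:
  "L_coeff a N x y = gauss_coeff a N x y - (\<Sum>n\<le>N. half_conv 0 (L_coeff a n) (gauss_coeff a (N - n)) x y)"
proof (cases "N = 0")
  case True
  then show ?thesis by (simp add: L_coeff_0 gauss_coeff_0 half_conv_zero_left)
next
  case False
  have L: "L_coeff a n = (\<lambda>x y. \<Sum>k=1..<N. (-1) ^ (k - 1) * L_term a k n x y)" if "n < N" for n
  proof (intro ext)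
    fix x y
    show "L_coeff a n x y = (\<Sum>k=1..<N. (-1) ^ (k - 1) * L_term a k n x y)"
      unfolding L_coeff_eq using that by (intro sum.mono_neutral_left) (auto simp: L_term_zero)
  qed
  have H: "half_conv 0 (L_coeff a n) (gauss_coeff a (N - n)) x y = (\<Sum>k=1..<N. (-1) ^ (k - 1) * half_conv 0 (L_term a k n) (gauss_coeff a (N - n)) x y)" if n: "n \<le> N" for n
  proof (cases "n = N")
    case True
    then show ?thesis by (simp add: gauss_coeff_0 half_conv_zero_right)
  next
    case False
    then have "n < N" using n by simp
    then show ?thesis
      unfolding L[OF \<open>n < N\<close>]
      by (subst half_conv_sum_left) (auto intro!: gauss_bounded_cmult gauss_bounded_L_term gauss_bounded_gauss_coeff simp: half_conv_cmult_left)
  qed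
  have "{1..N} = insert 1 {Suc 1..<Suc N}" using False by auto
  then have "L_coeff a N x y = L_term a 1 N x y + (\<Sum>k=Suc 1..<Suc N. (-1) ^ (k - 1) * L_term a k N x y)"
    unfolding L_coeff_eq by simp
  also have "(\<Sum>k=Suc 1..<Suc N. (-1) ^ (k - 1) * L_term a k N x y) = (\<Sum>k=1..<N. (-1) ^ k * L_term a (Suc k) N x y)"
    by (subst sum.shift_bounds_Suc_ivl) simp
  also have "\<dots> = (\<Sum>k=1..<N. - (\<Sum>n\<le>N. (-1) ^ (k - 1) * half_conv 0 (L_term a k n) (gauss_coeff a (N - n)) x y))"
  proof (rule sum.cong[OF refl])
    fix k assume k: "k \<in> {1..<N}"
    then obtain k' where k': "k = Suc k'" by (cases k) auto
    have "L_term a (Suc k) N x y = (\<Sum>n\<le>N. half_conv 0 (L_term a k n) (gauss_coeff a (N - n)) x y)" using k by (subst L_term_Suc) auto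
    then show "(-1) ^ k * L_term a (Suc k) N x y = - (\<Sum>n\<le>N. (-1) ^ (k - 1) * half_conv 0 (L_term a k n) (gauss_coeff a (N - n)) x y)"
      by (simp add: k' sum_distrib_left sum_negf)
  qed
  also have "\<dots> = - (\<Sum>n\<le>N. \<Sum>k=1..<N. (-1) ^ (k - 1) * half_conv 0 (L_term a k n) (gauss_coeff a (N - n)) x y)"
    unfolding sum_negf by (subst sum.swap) simp
  finally show ?thesis using H L_term_1[of a N] by simp
qed

section \<open>Coefficients of the bracket\<close>

text \<open>
  The shift length in total degree \<open>N\<close> when the factors to the left have total degree \<open>n\<close>.
\<close>

definition shift_at :: "real \<Rightarrow> nat \<Rightarrow> nat \<Rightarrow> real" where
  "shift_at t N n = sqrt t * real n * (real N - real n)"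

text \<open>
  The coefficient with exponents \<open>m\<close> after \<open>q\<close> shift quotients, as a kernel in the two
  outer variables. Each quotient is a composition on \<open>[0, \<infinity>)\<close> minus one on \<open>[s, \<infinity>)\<close>, where
  the shift \<open>s\<close> depends on the exponents only through the degree of the left part and the
  total degree \<open>N\<close>.
\<close>

fun shift_chain :: "real \<Rightarrow> nat \<Rightarrow> (nat \<Rightarrow> real) \<Rightarrow> nat \<Rightarrow> (nat \<Rightarrow> nat) \<Rightarrow> real \<Rightarrow> real \<Rightarrow> real" where
  "shift_chain t N a 0 m = L_coeff a (m 0)"
| "shift_chain t N a (Suc q) m = (\<lambda>x y. half_conv 0 (shift_chain t N a q m) (L_coeff a (m (Suc q))) x y
     - half_conv (shift_at t N (\<Sum>i\<le>q. m i)) (shift_chain t N a q m) (L_coeff a (m (Suc q))) x y)"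

lemma gauss_bounded_shift_chain: "gauss_bounded (shift_chain t N a q m)"
  by (induction q) (auto intro: gauss_bounded_L_coeff gauss_bounded_diff gauss_bounded_half_conv)

lemma shift_chain_cong: "(\<And>i. i \<le> q \<Longrightarrow> m i = m' i) \<Longrightarrow> shift_chain t N a q m = shift_chain t N a q m'"
proof (induction q)
  case (Suc q)
  then have "shift_chain t N a q m = shift_chain t N a q m'" "(\<Sum>i\<le>q. m i) = (\<Sum>i\<le>q. m' i)" "m (Suc q) = m' (Suc q)"
    by (auto intro: sum.cong)
  then show ?case by simp
qed simp

text \<open>
  The shift quotients are applied from left to right, so that after \<open>p'\<close> of them the
  factors beyond \<open>p'\<close> are still unintegrated.
\<close>

lemma fold_shift_quotient:
  assumes "p' \<le> p" and N: "(\<Sum>i\<le>p. m i) = N"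
  shows "fold (shift_quotient t p) [1..<Suc p'] (L_product a p) m z
    = shift_chain t N a p' m (z 0) (z (Suc p')) * (\<Prod>j\<in>{p'<..p}. L_coeff a (m j) (z j) (z (Suc j)))"
  using assms(1)
proof (induction p' arbitrary: z)
  case 0
  have "{..p} = insert 0 {0<..p}" by auto
  then show ?case by (simp add: L_product_def L_coeff_def)
next
  case (Suc q)
  define P where "P = (\<Prod>j\<in>{Suc q<..p}. L_coeff a (m j) (z j) (z (Suc j)))"
  have IH: "fold (shift_quotient t p) [1..<Suc q] (L_product a p) m (z(Suc q := w))
     = (shift_chain t N a q m (z 0) w * L_coeff a (m (Suc q)) w (z (Suc (Suc q)))) * P" for w
  proof -
    have ins: "{q<..p} = insert (Suc q) {Suc q<..p}" using Suc.prems by auto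
    have "(\<Prod>j\<in>{Suc q<..p}. L_coeff a (m j) ((z(Suc q := w)) j) ((z(Suc q := w)) (Suc j))) = P"
      unfolding P_def by (intro prod.cong) auto
    then show ?thesis
      using Suc.prems by (subst Suc.IH) (auto simp: ins)
  qed
  have len: "shift_length t p (Suc q) m = shift_at t N (\<Sum>i\<le>q. m i)"
  proof -
    have "{..p} = {..q} \<union> {Suc q..p}" using Suc.prems by auto
    then have "(\<Sum>i\<le>p. m i) = (\<Sum>i\<le>q. m i) + (\<Sum>i=Suc q..p. m i)"
      by (simp add: sum.union_disjoint ivl_disj_int)
    then have "real (\<Sum>i=Suc q..p. m i) = real N - real (\<Sum>i\<le>q. m i)" using N by simp
    then show ?thesis unfolding shift_length_def shift_at_def lessThan_Suc_atMost by (simp only:)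
  qed
  have h: "(LINT w:{s..}|lborel. (shift_chain t N a q m (z 0) w * L_coeff a (m (Suc q)) w (z (Suc (Suc q)))) * P)
     = half_conv s (shift_chain t N a q m) (L_coeff a (m (Suc q))) (z 0) (z (Suc (Suc q))) * P" for s
    unfolding half_conv_def by (rule set_integral_mult_left)
  have "[1..<Suc (Suc q)] = [1..<Suc q] @ [Suc q]" by simp
  then have "fold (shift_quotient t p) [1..<Suc (Suc q)] (L_product a p) m z
     = shift_quotient t p (Suc q) (fold (shift_quotient t p) [1..<Suc q] (L_product a p)) m z"
    by (simp only: fold_append o_apply fold_simps)
  also have "\<dots> = half_conv 0 (shift_chain t N a q m) (L_coeff a (m (Suc q))) (z 0) (z (Suc (Suc q))) * P
     - half_conv (shift_at t N (\<Sum>i\<le>q. m i)) (shift_chain t N a q m) (L_coeff a (m (Suc q))) (z 0) (z (Suc (Suc q))) * P"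
    unfolding shift_quotient_def IH len h ..
  finally show ?case by (simp add: P_def left_diff_distrib)
qed

text \<open>
  The exponents of the monomials of degree \<open>n\<close> in \<open>\<sigma>\<^sub>0, \<dots>, \<sigma>\<^sub>q\<close>.
\<close>

definition compositions :: "nat \<Rightarrow> nat \<Rightarrow> (nat \<Rightarrow> nat) set" where
  "compositions q n = {m. m \<in> {..q} \<rightarrow>\<^sub>E UNIV \<and> (\<Sum>i\<le>q. m i) = n}"

lemma finite_compositions: "finite (compositions q n)"
proof (rule finite_subset)
  show "compositions q n \<subseteq> {..q} \<rightarrow>\<^sub>E {..n}"
  proof
    fix m assume m: "m \<in> compositions q n"
    have "m i \<le> n" if "i \<le> q" for i
      using m member_le_sum[of i "{..q}" m] that by (simp add: compositions_def)
    then show "m \<in> {..q} \<rightarrow>\<^sub>E {..n}" using m by (auto simp: compositions_def PiE_iff)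
  qed
  show "finite ({..q} \<rightarrow>\<^sub>E {..n})" by (intro finite_PiE) auto
qed

text \<open>
  The degree \<open>n\<close> part of the \<open>q\<close>-th summand of the bracket, with the shifts of total
  degree \<open>N\<close> and with the two outer variables left free.
\<close>

definition bracket_term :: "real \<Rightarrow> nat \<Rightarrow> (nat \<Rightarrow> real) \<Rightarrow> nat \<Rightarrow> nat \<Rightarrow> real \<Rightarrow> real \<Rightarrow> real" where
  "bracket_term t N a q n = (\<lambda>x y. \<Sum>m\<in>compositions q n. shift_chain t N a q m x y)"

text \<open>
  The degree \<open>n\<close> part of the bracket with the shifts of total degree \<open>N\<close>. The parameter
  \<open>N\<close> is kept when \<open>n\<close> decreases, which makes a recursion in \<open>n\<close> possible; the coefficient
  of the bracket itself is the case \<open>n = N\<close>.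
\<close>

definition bracket_kernel :: "real \<Rightarrow> nat \<Rightarrow> (nat \<Rightarrow> real) \<Rightarrow> nat \<Rightarrow> real \<Rightarrow> real \<Rightarrow> real" where
  "bracket_kernel t N a n = (\<lambda>x y. \<Sum>q<N. bracket_term t N a q n x y)"

lemma gauss_bounded_bracket_term: "gauss_bounded (bracket_term t N a q n)" unfolding bracket_term_def by (intro gauss_bounded_sum gauss_bounded_shift_chain)

lemma gauss_bounded_bracket_kernel: "gauss_bounded (bracket_kernel t N a n)" unfolding bracket_kernel_def by (intro gauss_bounded_sum gauss_bounded_bracket_term)

lemma bracket_series_nth: "fps_nth (bracket_series t a) N = bracket_kernel t N a N 0 0"
proof -
  have "fps_nth (diagonal_series p (fold (shift_quotient t p) [1..<Suc p] (L_product a p))) N = bracket_term t N a p N 0 0" for p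
  proof -
    have "fold (shift_quotient t p) [1..<Suc p] (L_product a p) m (\<lambda>_. 0) = shift_chain t N a p m 0 0"
      if "(\<Sum>i\<le>p. m i) = N" for m
      using fold_shift_quotient[OF order_refl that, of t a "\<lambda>_. 0"] by simp
    then show ?thesis
      unfolding diagonal_series_def bracket_term_def compositions_def fps_nth_Abs_fps by (intro sum.cong) auto
  qed
  then show ?thesis by (simp add: bracket_series_def bracket_kernel_def)
qed

lemma bracket_term_0: "bracket_term t N a 0 n = L_coeff a n"
proof -
  have "compositions 0 n = {\<lambda>i\<in>{..0}. n}" by (auto simp: compositions_def PiE_iff extensional_def fun_eq_iff)
  then show ?thesis by (simp add: bracket_term_def)
qed

text \<open>
  One shift quotient as an operation on kernels; the left kernel has degree \<open>n\<close>.
\<close>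

definition shift_conv :: "real \<Rightarrow> nat \<Rightarrow> (real \<Rightarrow> real \<Rightarrow> real) \<Rightarrow> nat \<Rightarrow> (real \<Rightarrow> real \<Rightarrow> real) \<Rightarrow> real \<Rightarrow> real \<Rightarrow> real" where
  "shift_conv t N f n g = (\<lambda>x y. half_conv 0 f g x y - half_conv (shift_at t N n) f g x y)"

lemma gauss_bounded_shift_conv: "gauss_bounded f \<Longrightarrow> gauss_bounded g \<Longrightarrow> gauss_bounded (shift_conv t N f n g)"
  unfolding shift_conv_def by (intro gauss_bounded_diff gauss_bounded_half_conv)

lemma shift_conv_zero: "shift_conv t N (\<lambda>x y. 0) n g = (\<lambda>x y. 0)" "shift_conv t N f n (\<lambda>x y. 0) = (\<lambda>x y. 0)"
  by (simp_all add: shift_conv_def half_conv_zero_left half_conv_zero_right)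

lemma shift_conv_sum_left: "(\<And>i. i \<in> I \<Longrightarrow> gauss_bounded (f i)) \<Longrightarrow> gauss_bounded g \<Longrightarrow> shift_conv t N (\<lambda>x y. \<Sum>i\<in>I. f i x y) n g = (\<lambda>x y. \<Sum>i\<in>I. shift_conv t N (f i) n g x y)"
  by (simp add: shift_conv_def half_conv_sum_left sum_subtractf)

lemma shift_conv_sum_right: "(\<And>i. i \<in> I \<Longrightarrow> gauss_bounded (g i)) \<Longrightarrow> gauss_bounded f \<Longrightarrow> shift_conv t N f n (\<lambda>x y. \<Sum>i\<in>I. g i x y) = (\<lambda>x y. \<Sum>i\<in>I. shift_conv t N f n (g i) x y)"
  by (simp add: shift_conv_def half_conv_sum_right sum_subtractf)

lemma shift_conv_diff_right: "gauss_bounded f \<Longrightarrow> gauss_bounded g \<Longrightarrow> gauss_bounded g' \<Longrightarrow> shift_conv t N f n (\<lambda>x y. g x y - g' x y) = (\<lambda>x y. shift_conv t N f n g x y - shift_conv t N f n g' x y)"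
  by (simp add: shift_conv_def half_conv_diff_right fun_eq_iff)

lemma shift_conv_half_conv: "gauss_bounded f \<Longrightarrow> gauss_bounded g \<Longrightarrow> gauss_bounded h \<Longrightarrow> half_conv 0 (shift_conv t N f n g) h = shift_conv t N f n (half_conv 0 g h)"
  by (simp add: shift_conv_def half_conv_diff_left gauss_bounded_half_conv half_conv_assoc)

text \<open>
  The exponents are split into those of the first \<open>q + 1\<close> factors, of total degree \<open>j\<close>,
  and the last one.
\<close>

lemma bracket_term_Suc: "bracket_term t N a (Suc q) n = (\<lambda>x y. \<Sum>j\<le>n. shift_conv t N (bracket_term t N a q j) j (L_coeff a (n - j)) x y)"
proof (intro ext)
  fix x y
  have "bracket_term t N a (Suc q) n x y = (\<Sum>(j, m)\<in>Sigma {..n} (compositions q). shift_conv t N (shift_chain t N a q m) j (L_coeff a (n - j)) x y)"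
    unfolding bracket_term_def
  proof (rule sum.reindex_bij_witness[of _ "\<lambda>(j, m). m(Suc q := n - j)" "\<lambda>m. (\<Sum>i\<le>q. m i, restrict m {..q})"])
    fix m assume "m \<in> compositions (Suc q) n"
    then have m: "m \<in> {..Suc q} \<rightarrow>\<^sub>E UNIV" "(\<Sum>i\<le>q. m i) + m (Suc q) = n" by (auto simp: compositions_def)
    show "(case (\<Sum>i\<le>q. m i, restrict m {..q}) of (j, m) \<Rightarrow> m(Suc q := n - j)) = m"
      using m by (auto simp: fun_eq_iff PiE_iff extensional_def)
    show "(\<Sum>i\<le>q. m i, restrict m {..q}) \<in> Sigma {..n} (compositions q)"
      using m by (auto simp: compositions_def intro: sum.cong)
    have "shift_chain t N a q (restrict m {..q}) = shift_chain t N a q m" by (rule shift_chain_cong) auto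
    moreover have "n - (\<Sum>i\<le>q. m i) = m (Suc q)" using m by auto
    ultimately show "(case (\<Sum>i\<le>q. m i, restrict m {..q}) of (j, m) \<Rightarrow> shift_conv t N (shift_chain t N a q m) j (L_coeff a (n - j)) x y) = shift_chain t N a (Suc q) m x y"
      by (simp add: shift_conv_def)
  next
    fix p assume "p \<in> Sigma {..n} (compositions q)"
    then obtain j m where p: "p = (j, m)" "j \<le> n" "m \<in> {..q} \<rightarrow>\<^sub>E UNIV" "(\<Sum>i\<le>q. m i) = j" by (auto simp: compositions_def)
    have s: "(\<Sum>i\<le>q. (m(Suc q := n - j)) i) = j" using p(4) by (auto intro: sum.cong)
    show "(\<Sum>i\<le>q. (case p of (j, m) \<Rightarrow> m(Suc q := n - j)) i, restrict (case p of (j, m) \<Rightarrow> m(Suc q := n - j)) {..q}) = p"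
      using s p by (auto simp: fun_eq_iff PiE_iff extensional_def)
    show "(case p of (j, m) \<Rightarrow> m(Suc q := n - j)) \<in> compositions (Suc q) n"
      using s p by (auto simp: compositions_def PiE_iff extensional_def)
  qed
  also have "\<dots> = (\<Sum>j\<le>n. \<Sum>m\<in>compositions q j. shift_conv t N (shift_chain t N a q m) j (L_coeff a (n - j)) x y)"
    by (rule sum.Sigma[symmetric]) (auto simp: finite_compositions)
  also have "\<dots> = (\<Sum>j\<le>n. shift_conv t N (bracket_term t N a q j) j (L_coeff a (n - j)) x y)"
    unfolding bracket_term_def by (subst shift_conv_sum_left) (auto intro: gauss_bounded_shift_chain gauss_bounded_L_coeff)
  finally show "bracket_term t N a (Suc q) n x y = (\<Sum>j\<le>n. shift_conv t N (bracket_term t N a q j) j (L_coeff a (n - j)) x y)" .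
qed

lemma bracket_term_zero: "n \<le> q \<Longrightarrow> bracket_term t N a q n = (\<lambda>x y. 0)"
proof (induction q arbitrary: n)
  case 0
  then show ?case by (simp add: bracket_term_0 L_coeff_0)
next
  case (Suc q)
  have "shift_conv t N (bracket_term t N a q j) j (L_coeff a (n - j)) = (\<lambda>x y. 0)" if "j \<le> n" for j
  proof (cases "j \<le> q")
    case True
    then show ?thesis by (simp add: Suc.IH shift_conv_zero)
  next
    case False
    then have "n - j = 0" using that Suc.prems by simp
    then show ?thesis by (simp add: L_coeff_0 shift_conv_zero)
  qed
  then show ?case by (simp add: bracket_term_Suc)
qed

lemma bracket_kernel_rec:
  assumes n: "n \<le> N"
  shows "bracket_kernel t N a n x y = L_coeff a n x y + (\<Sum>j\<le>n. shift_conv t N (bracket_kernel t N a j) j (L_coeff a (n - j)) x y)"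
proof (cases N)
  case 0
  then have "n = 0" using n by simp
  then show ?thesis by (simp add: bracket_kernel_def 0 L_coeff_0 shift_conv_zero)
next
  case (Suc K)
  have "bracket_kernel t N a n x y = bracket_term t N a 0 n x y + (\<Sum>q<K. bracket_term t N a (Suc q) n x y)"
    unfolding bracket_kernel_def Suc by (rule sum.lessThan_Suc_shift)
  also have "(\<Sum>q<K. bracket_term t N a (Suc q) n x y) = (\<Sum>j\<le>n. \<Sum>q<K. shift_conv t N (bracket_term t N a q j) j (L_coeff a (n - j)) x y)"
    unfolding bracket_term_Suc by (rule sum.swap)
  also have "\<dots> = (\<Sum>j\<le>n. shift_conv t N (bracket_kernel t N a j) j (L_coeff a (n - j)) x y)"
  proof (rule sum.cong[OF refl])
    fix j assume j: "j \<in> {..n}"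
    have z: "shift_conv t N (bracket_term t N a K j) j (L_coeff a (n - j)) x y = 0"
    proof (cases "j \<le> K")
      case True
      then show ?thesis by (simp add: bracket_term_zero shift_conv_zero)
    next
      case False
      then have "n - j = 0" using n j Suc by simp
      then show ?thesis by (simp add: L_coeff_0 shift_conv_zero)
    qed
    have "shift_conv t N (bracket_kernel t N a j) j (L_coeff a (n - j)) x y = (\<Sum>q<N. shift_conv t N (bracket_term t N a q j) j (L_coeff a (n - j)) x y)"
      unfolding bracket_kernel_def by (subst shift_conv_sum_left) (auto intro: gauss_bounded_bracket_term gauss_bounded_L_coeff)
    also have "\<dots> = (\<Sum>q<K. shift_conv t N (bracket_term t N a q j) j (L_coeff a (n - j)) x y)"
      unfolding Suc sum.lessThan_Suc using z Suc by simp
    finally show "(\<Sum>q<K. shift_conv t N (bracket_term t N a q j) j (L_coeff a (n - j)) x y) = shift_conv t N (bracket_kernel t N a j) j (L_coeff a (n - j)) x y" by simp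
  qed
  finally show ?thesis by (simp add: bracket_term_0)
qed

text \<open>
  The shift quotients turn the resolvent equation of the Gaussian series on \<open>[0, \<infinity>)\<close> into
  one in which the part of degree \<open>j\<close> is integrated over \<open>[shift_at t N j, \<infinity>)\<close>. To see
  this, compose \<open>bracket_kernel_rec\<close> with the Gaussian series on \<open>[0, \<infinity>)\<close> and eliminate
  \<open>L\<close> by \<open>L_coeff_rec\<close>: all integrals over \<open>[0, \<infinity>)\<close> cancel.
\<close>

lemma bracket_kernel_eq:
  assumes n: "n \<le> N"
  shows "bracket_kernel t N a n x y = gauss_coeff a n x y - (\<Sum>j\<le>n. half_conv (shift_at t N j) (bracket_kernel t N a j) (gauss_coeff a (n - j)) x y)"
proof -
  let ?W = "bracket_kernel t N a" and ?L = "L_coeff a" and ?g = "gauss_coeff a"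
  let ?D = "\<lambda>j g. shift_conv t N (?W j) j g"
  have gD: "gauss_bounded (?D j (?L i))" for i j by (intro gauss_bounded_shift_conv gauss_bounded_bracket_kernel gauss_bounded_L_coeff)
  have 1: "half_conv 0 (?W m) g x y = half_conv 0 (?L m) g x y + (\<Sum>j\<le>m. ?D j (half_conv 0 (?L (m - j)) g) x y)"
    if m: "m \<le> n" and g: "gauss_bounded g" for m g
  proof -
    have "?W m = (\<lambda>x y. ?L m x y + (\<Sum>j\<le>m. ?D j (?L (m - j)) x y))"
      using m n by (intro ext bracket_kernel_rec) simp
    then have "half_conv 0 (?W m) g x y = half_conv 0 (\<lambda>x y. ?L m x y + (\<Sum>j\<le>m. ?D j (?L (m - j)) x y)) g x y" by (simp only:)
    also have "\<dots> = half_conv 0 (?L m) g x y + (\<Sum>j\<le>m. half_conv 0 (?D j (?L (m - j))) g x y)"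
      by (subst half_conv_add_left) (auto intro!: gauss_bounded_L_coeff gauss_bounded_sum gD g simp: half_conv_sum_left[OF gD g])
    finally show ?thesis by (simp add: shift_conv_half_conv[OF gauss_bounded_bracket_kernel gauss_bounded_L_coeff g])
  qed
  have "(\<Sum>m\<le>n. half_conv 0 (?W m) (?g (n - m)) x y)
     = (\<Sum>m\<le>n. half_conv 0 (?L m) (?g (n - m)) x y) + (\<Sum>m\<le>n. \<Sum>j\<le>m. ?D j (half_conv 0 (?L (m - j)) (?g (n - m))) x y)"
    by (simp add: 1 gauss_bounded_gauss_coeff sum.distrib)
  also have "(\<Sum>m\<le>n. \<Sum>j\<le>m. ?D j (half_conv 0 (?L (m - j)) (?g (n - m))) x y)
     = (\<Sum>j\<le>n. \<Sum>k\<le>n - j. ?D j (half_conv 0 (?L k) (?g (n - j - k))) x y)"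
    unfolding sum.Sigma[OF finite_atMost ballI[OF finite_atMost]]
    by (rule sum.reindex_bij_witness[of _ "\<lambda>(j, k). (j + k, j)" "\<lambda>(m, j). (j, m - j)"]) auto
  also have "\<dots> = (\<Sum>j\<le>n. ?D j (?g (n - j)) x y - ?D j (?L (n - j)) x y)"
  proof (rule sum.cong[OF refl])
    fix j
    have "(\<Sum>k\<le>n - j. ?D j (half_conv 0 (?L k) (?g (n - j - k))) x y)
       = ?D j (\<lambda>x y. \<Sum>k\<le>n - j. half_conv 0 (?L k) (?g (n - j - k)) x y) x y"
      by (subst shift_conv_sum_right) (auto intro: gauss_bounded_half_conv gauss_bounded_L_coeff gauss_bounded_gauss_coeff gauss_bounded_bracket_kernel)
    also have "(\<lambda>x y. \<Sum>k\<le>n - j. half_conv 0 (?L k) (?g (n - j - k)) x y) = (\<lambda>x y. ?g (n - j) x y - ?L (n - j) x y)"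
      using L_coeff_rec[of a "n - j"] by (intro ext) (simp add: algebra_simps)
    finally show "(\<Sum>k\<le>n - j. ?D j (half_conv 0 (?L k) (?g (n - j - k))) x y) = ?D j (?g (n - j)) x y - ?D j (?L (n - j)) x y"
      by (simp add: shift_conv_diff_right gauss_bounded_bracket_kernel gauss_bounded_gauss_coeff gauss_bounded_L_coeff)
  qed
  also have "(\<Sum>m\<le>n. half_conv 0 (?L m) (?g (n - m)) x y) = ?g n x y - ?L n x y"
    using L_coeff_rec[of a n x y] by simp
  finally have "(\<Sum>m\<le>n. half_conv 0 (?W m) (?g (n - m)) x y)
     = ?g n x y - (?L n x y + (\<Sum>j\<le>n. ?D j (?L (n - j)) x y)) + (\<Sum>j\<le>n. ?D j (?g (n - j)) x y)"
    by (simp add: sum_subtractf)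
  also have "?L n x y + (\<Sum>j\<le>n. ?D j (?L (n - j)) x y) = ?W n x y" using bracket_kernel_rec[OF n, of t a x y] by simp
  finally show ?thesis by (simp add: shift_conv_def sum_subtractf)
qed

section \<open>Tilting the resolvent recursion\<close>

text \<open>
  The coefficient of \<open>\<sigma>^n\<close> in the formal expansion of the kernel
  \<open>\<integral> p (\<sigma> exp (c x)) Ai (r + x) Ai (s + x) dx\<close>, where \<open>p\<close> has the power series with
  coefficients \<open>a n\<close>, \<open>n \<ge> 1\<close>.
\<close>

definition coeff_kernel :: "(nat \<Rightarrow> real) \<Rightarrow> real \<Rightarrow> nat \<Rightarrow> real \<Rightarrow> real \<Rightarrow> real" where
  "coeff_kernel a c n r s = (if n = 0 then 0 else a n * (exp ((real n * c) ^ 3 / 12 - (real n * c) * (r + s) / 2 - (r - s)\<^sup>2 / (4 * (real n * c)))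
     / sqrt (4 * pi * (real n * c))))"

text \<open>
  The solution of the resolvent equation \<open>\<rho> = b(\<cdot>, 0) - b \<rho>\<close> on \<open>[0, \<infinity>)\<close> in formal power
  series, for a kernel \<open>b\<close> with coefficients \<open>b n\<close>. The sum omits the term with \<open>b 0\<close>,
  which vanishes in the application.
\<close>

fun resolvent_coeff :: "(nat \<Rightarrow> real \<Rightarrow> real \<Rightarrow> real) \<Rightarrow> nat \<Rightarrow> real \<Rightarrow> real" where
  "resolvent_coeff b n r = b n r 0 - (\<Sum>j<n. LINT z:{0..}|lborel. b (n - j) r z * resolvent_coeff b j z)"

declare resolvent_coeff.simps [simp del]

text \<open>
  The exponent of the weight that removes the cubic and the linear terms from the
  recursion for the coefficients of the resolvent. In the application \<open>h = t^(1/6)\<close>, so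
  that \<open>h^3\<close> is the square root of \<open>t\<close>.
\<close>

definition tilt :: "real \<Rightarrow> nat \<Rightarrow> nat \<Rightarrow> real \<Rightarrow> real" where
  "tilt h N n z = h ^ 3 * (real N - 2 * real n) * z / 2
     + h ^ 6 * (real n ^ 3 / 12 - real n * (real N - real n)\<^sup>2 / 4 + (real n)\<^sup>2 * (real N - real n) / 2)"

text \<open>
  The key identity. After the spatial shift by \<open>S n\<close> in degree \<open>n\<close> and multiplication by
  the exponential weight, the kernel of degree \<open>m\<close> becomes the Gaussian kernel. The
  exponent is a quadratic polynomial in \<open>y\<close> and \<open>w\<close> on both sides, and the coefficients
  agree identically.
\<close>

lemma tilt_step:
  fixes N n m :: nat and h y w :: real
  assumes h: "h > 0" and m: "m > 0"
  defines "S \<equiv> \<lambda>n. h ^ 3 * real n * (real N - real n)"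
  shows "coeff_kernel a (h\<^sup>2) m (h * (y - S (n + m))) (h * (w - S n)) * exp (tilt h N n w)
     = (1 / h) * exp (tilt h N (n + m) y) * gauss_coeff a m w y"
proof -
  define \<nu> \<mu> M where "\<nu> = real n" and "\<mu> = real m" and "M = real N"
  have \<mu>: "\<mu> > 0" using m by (simp add: \<mu>_def)
  define s0 s1 where "s0 = h ^ 3 * \<nu> * (M - \<nu>)" and "s1 = h ^ 3 * (\<nu> + \<mu>) * (M - (\<nu> + \<mu>))"
  have S: "S n = s0" "S (n + m) = s1" by (auto simp: S_def s0_def s1_def \<nu>_def \<mu>_def M_def)
  define E where "E = h ^ 3 * (M - 2 * \<nu> - \<mu>)"
  have D: "s1 - s0 = \<mu> * E" by (simp add: s0_def s1_def E_def algebra_simps)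
  have sq: "(h * (y - s1) - h * (w - s0))\<^sup>2 / (4 * (\<mu> * h\<^sup>2)) = (y - w)\<^sup>2 / (4 * \<mu>) - (y - w) * E / 2 + \<mu> * E\<^sup>2 / 4"
  proof -
    have "h * (y - s1) - h * (w - s0) = h * ((y - w) - \<mu> * E)" using D by (simp add: algebra_simps)
    then have "(h * (y - s1) - h * (w - s0))\<^sup>2 / (4 * (\<mu> * h\<^sup>2)) = ((y - w) - \<mu> * E)\<^sup>2 / (4 * \<mu>)"
      using h by (simp add: power_mult_distrib)
    also have "\<dots> = (y - w)\<^sup>2 / (4 * \<mu>) - (y - w) * E / 2 + \<mu> * E\<^sup>2 / 4"
      using \<mu> by (simp add: power2_eq_square field_simps)
    finally show ?thesis .
  qed
  have P0: "tilt h N n w = h ^ 3 * (M - 2 * \<nu>) * w / 2 + h ^ 6 * (\<nu> ^ 3 / 12 - \<nu> * (M - \<nu>)\<^sup>2 / 4 + \<nu>\<^sup>2 * (M - \<nu>) / 2)"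
    by (simp add: tilt_def \<nu>_def M_def)
  have P1: "tilt h N (n + m) y = h ^ 3 * (M - 2 * (\<nu> + \<mu>)) * y / 2 + h ^ 6 * ((\<nu> + \<mu>) ^ 3 / 12 - (\<nu> + \<mu>) * (M - (\<nu> + \<mu>))\<^sup>2 / 4 + (\<nu> + \<mu>)\<^sup>2 * (M - (\<nu> + \<mu>)) / 2)"
    by (simp add: tilt_def \<nu>_def \<mu>_def M_def)
  have e: "(\<mu> * h\<^sup>2) ^ 3 / 12 - (\<mu> * h\<^sup>2) * (h * (y - s1) + h * (w - s0)) / 2 - (h * (y - s1) - h * (w - s0))\<^sup>2 / (4 * (\<mu> * h\<^sup>2)) + tilt h N n w
     = tilt h N (n + m) y + (- ((y - w)\<^sup>2) / (4 * \<mu>))"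
    unfolding sq P0 P1 s0_def s1_def E_def
    using h \<mu> by (simp add: power2_eq_square power3_eq_cube numeral_eq_Suc algebra_simps diff_divide_distrib add_divide_distrib)
  have r: "sqrt (4 * pi * (\<mu> * h\<^sup>2)) = h * sqrt (4 * pi * \<mu>)"
    using h by (simp add: real_sqrt_mult)
  have "coeff_kernel a (h\<^sup>2) m (h * (y - s1)) (h * (w - s0)) * exp (tilt h N n w)
     = a m / (h * sqrt (4 * pi * \<mu>)) * (exp ((\<mu> * h\<^sup>2) ^ 3 / 12 - (\<mu> * h\<^sup>2) * (h * (y - s1) + h * (w - s0)) / 2 - (h * (y - s1) - h * (w - s0))\<^sup>2 / (4 * (\<mu> * h\<^sup>2))) * exp (tilt h N n w))"
    unfolding coeff_kernel_def \<mu>_def[symmetric] r using m by simp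
  also have "\<dots> = a m / (h * sqrt (4 * pi * \<mu>)) * (exp (tilt h N (n + m) y) * exp (- ((y - w)\<^sup>2) / (4 * \<mu>)))"
    by (simp only: exp_add[symmetric] e)
  also have "\<dots> = (1 / h) * exp (tilt h N (n + m) y) * gauss_coeff a m w y"
    unfolding gauss_coeff_pos[OF m] \<mu>_def[symmetric] by simp
  finally show ?thesis unfolding S .
qed

text \<open>
  Under the substitution of \<open>tilt_step\<close> the half-line \<open>[0, \<infinity>)\<close> becomes
  \<open>[shift_at t N n, \<infinity>)\<close>, and the recursion for the resolvent becomes the one in
  \<open>bracket_kernel_eq\<close>.
\<close>

lemma resolvent_coeff_coeff_kernel_eq:
  assumes h: "h > 0" and t: "sqrt t = h ^ 3" and n: "n \<le> N"
  shows "resolvent_coeff (coeff_kernel a (h\<^sup>2)) n r = (1 / h) * exp (tilt h N n (r / h + shift_at t N n)) * bracket_kernel t N a n 0 (r / h + shift_at t N n)"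
  using n
proof (induction n arbitrary: r rule: less_induct)
  case (less n)
  define y where "y = r / h + shift_at t N n"
  have S: "shift_at t N i = h ^ 3 * real i * (real N - real i)" for i by (simp add: shift_at_def t)
  have ry: "r = h * (y - shift_at t N n)" using h by (simp add: y_def)
  \<comment> \<open>Substitution of \<open>z = h (w - shift_at t N j)\<close> in the integral.\<close>
  have int: "(LINT z:{0..}|lborel. coeff_kernel a (h\<^sup>2) (n - j) r z * resolvent_coeff (coeff_kernel a (h\<^sup>2)) j z)
     = (1 / h) * exp (tilt h N n y) * half_conv (shift_at t N j) (bracket_kernel t N a j) (gauss_coeff a (n - j)) 0 y" if j: "j < n" for j
  proof -
    let ?s = "shift_at t N j"
    have "(LINT z:{0..}|lborel. coeff_kernel a (h\<^sup>2) (n - j) r z * resolvent_coeff (coeff_kernel a (h\<^sup>2)) j z)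
       = h * (LINT w|lborel. indicat_real {0..} (- h * ?s + h * w) * (coeff_kernel a (h\<^sup>2) (n - j) r (- h * ?s + h * w) * resolvent_coeff (coeff_kernel a (h\<^sup>2)) j (- h * ?s + h * w)))"
      unfolding set_lebesgue_integral_def real_scaleR_def
      by (subst lborel_integral_real_affine[where c = h and t = "- h * ?s"]) (use h in auto)
    also have "(LINT w|lborel. indicat_real {0..} (- h * ?s + h * w) * (coeff_kernel a (h\<^sup>2) (n - j) r (- h * ?s + h * w) * resolvent_coeff (coeff_kernel a (h\<^sup>2)) j (- h * ?s + h * w)))
       = (LINT w|lborel. ((1 / h) * ((1 / h) * exp (tilt h N n y))) * (indicat_real {?s..} w * (bracket_kernel t N a j 0 w * gauss_coeff a (n - j) w y)))"
    proof (rule Bochner_Integration.integral_cong[OF refl])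
      fix w
      have ind: "indicat_real {0..} (- h * ?s + h * w) = indicat_real {?s..} w"
      proof -
        have "- h * ?s + h * w = h * (w - ?s)" by (simp add: algebra_simps)
        then have "0 \<le> - h * ?s + h * w \<longleftrightarrow> ?s \<le> w" using h by (simp add: zero_le_mult_iff)
        then show ?thesis by (simp add: indicator_def)
      qed
      have v: "resolvent_coeff (coeff_kernel a (h\<^sup>2)) j (- h * ?s + h * w) = (1 / h) * exp (tilt h N j w) * bracket_kernel t N a j 0 w"
      proof -
        have "(- h * ?s + h * w) / h + ?s = w" using h by (simp add: field_simps)
        then show ?thesis using less.IH[OF j, of "- h * ?s + h * w"] j less.prems by simp
      qed
      have "coeff_kernel a (h\<^sup>2) (n - j) (h * (y - shift_at t N (j + (n - j)))) (h * (w - ?s)) * exp (tilt h N j w)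
          = (1 / h) * exp (tilt h N (j + (n - j)) y) * gauss_coeff a (n - j) w y"
        unfolding S using j by (intro tilt_step[OF h]) simp
      then have g: "coeff_kernel a (h\<^sup>2) (n - j) r (- h * ?s + h * w) * exp (tilt h N j w) = (1 / h) * exp (tilt h N n y) * gauss_coeff a (n - j) w y"
      proof -
        have "h * (w - ?s) = - h * ?s + h * w" "j + (n - j) = n" using j by (auto simp: algebra_simps)
        with this[folded ry] \<open>coeff_kernel a (h\<^sup>2) (n - j) _ _ * _ = _\<close> show ?thesis by (simp only: ry[symmetric])
      qed
      have "indicat_real {0..} (- h * ?s + h * w) * (coeff_kernel a (h\<^sup>2) (n - j) r (- h * ?s + h * w) * resolvent_coeff (coeff_kernel a (h\<^sup>2)) j (- h * ?s + h * w))
         = indicat_real {?s..} w * ((1 / h) * (coeff_kernel a (h\<^sup>2) (n - j) r (- h * ?s + h * w) * exp (tilt h N j w)) * bracket_kernel t N a j 0 w)"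
        unfolding ind v by simp
      also have "\<dots> = ((1 / h) * ((1 / h) * exp (tilt h N n y))) * (indicat_real {?s..} w * (bracket_kernel t N a j 0 w * gauss_coeff a (n - j) w y))"
        unfolding g by (simp only: mult_ac)
      finally show "indicat_real {0..} (- h * ?s + h * w) * (coeff_kernel a (h\<^sup>2) (n - j) r (- h * ?s + h * w) * resolvent_coeff (coeff_kernel a (h\<^sup>2)) j (- h * ?s + h * w))
         = ((1 / h) * ((1 / h) * exp (tilt h N n y))) * (indicat_real {?s..} w * (bracket_kernel t N a j 0 w * gauss_coeff a (n - j) w y))" .
    qed
    also have "\<dots> = ((1 / h) * ((1 / h) * exp (tilt h N n y))) * half_conv ?s (bracket_kernel t N a j) (gauss_coeff a (n - j)) 0 y"
      unfolding half_conv_def set_lebesgue_integral_def real_scaleR_def by (rule integral_mult_right_zero)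
    finally show ?thesis using h by simp
  qed
  have b0: "coeff_kernel a (h\<^sup>2) n r 0 = (1 / h) * exp (tilt h N n y) * gauss_coeff a n 0 y"
  proof (cases "n = 0")
    case True
    then show ?thesis by (simp add: coeff_kernel_def gauss_coeff_0)
  next
    case False
    have "coeff_kernel a (h\<^sup>2) n (h * (y - shift_at t N (0 + n))) (h * (0 - shift_at t N 0)) * exp (tilt h N 0 0) = (1 / h) * exp (tilt h N (0 + n) y) * gauss_coeff a n 0 y"
      unfolding S using False by (intro tilt_step[OF h]) simp
    then show ?thesis using ry by (simp add: shift_at_def tilt_def)
  qed
  have "resolvent_coeff (coeff_kernel a (h\<^sup>2)) n r = (1 / h) * exp (tilt h N n y) * (gauss_coeff a n 0 y - (\<Sum>j<n. half_conv (shift_at t N j) (bracket_kernel t N a j) (gauss_coeff a (n - j)) 0 y))"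
    by (subst resolvent_coeff.simps) (simp add: int b0 right_diff_distrib sum_distrib_left)
  also have "(\<Sum>j<n. half_conv (shift_at t N j) (bracket_kernel t N a j) (gauss_coeff a (n - j)) 0 y) = (\<Sum>j\<le>n. half_conv (shift_at t N j) (bracket_kernel t N a j) (gauss_coeff a (n - j)) 0 y)"
    by (simp add: lessThan_Suc_atMost[symmetric] gauss_coeff_0 half_conv_zero_right)
  also have "gauss_coeff a n 0 y - \<dots> = bracket_kernel t N a n 0 y" using bracket_kernel_eq[OF less.prems, of t a 0 y] by simp
  finally show ?case by (simp add: y_def)
qed

text \<open>
  The case \<open>n = N\<close>, where the shift vanishes and only the cubic term remains of the
  weight.
\<close>

lemma resolvent_coeff_bracket:
  assumes h: "h > 0" and t: "sqrt t = h ^ 3"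
  shows "resolvent_coeff (coeff_kernel a (h\<^sup>2)) N 0 = (1 / h) * (exp (h ^ 6 * real N ^ 3 / 12) * fps_nth (bracket_series t a) N)"
  using resolvent_coeff_coeff_kernel_eq[OF h t order_refl, of a N 0] by (simp add: shift_at_def tilt_def bracket_series_nth)

section \<open>Kernels built from Airy functions\<close>

text \<open>
  The growth of \<open>p (\<sigma> exp (c x))\<close> when \<open>p x\<close> is linear at \<open>0\<close> and of degree at most \<open>k\<close> at
  infinity.
\<close>

definition growth_env :: "real \<Rightarrow> nat \<Rightarrow> real \<Rightarrow> real" where
  "growth_env c k x = (if x \<le> 0 then exp (c * x) else exp (real k * c * x))"

text \<open>
  Together with \<open>weight_x\<close> this separates the two variables in a bound for \<open>Ai (r + x)\<close>:
  as \<open>Ai x = O(exp (- v x))\<close> for every \<open>v > 0\<close>, the exponential rate may be chosen as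
  \<open>c / 4\<close> for negative \<open>x\<close> and \<open>k c\<close> for positive \<open>x\<close>, so that two Airy functions beat
  \<open>growth_env\<close> on both sides.
\<close>

definition weight_r :: "real \<Rightarrow> nat \<Rightarrow> real \<Rightarrow> real" where
  "weight_r c k r = exp (- (c / 4) * r) + exp (- (real k * c) * r)"

definition weight_x :: "real \<Rightarrow> nat \<Rightarrow> real \<Rightarrow> real" where
  "weight_x c k x = (if x \<le> 0 then exp (- (c / 4) * x) else exp (- (real k * c) * x))"

lemma growth_env_measurable [measurable]: "growth_env c k \<in> borel_measurable borel"
  unfolding growth_env_def by measurable

lemma weight_x_measurable [measurable]: "weight_x c k \<in> borel_measurable borel"
  unfolding weight_x_def by measurable

lemma weight_pos: "0 < growth_env c k x" "0 < weight_r c k x" "0 < weight_x c k x"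
  by (auto simp: growth_env_def weight_r_def weight_x_def intro: add_pos_pos)

lemma weight_r_continuous: "continuous_on A (weight_r c k)"
  unfolding weight_r_def by (intro continuous_intros)

lemma weight_r_measurable [measurable]: "weight_r c k \<in> borel_measurable borel"
  by (intro borel_measurable_continuous_onI weight_r_continuous)

lemma Airy_weight:
  assumes c: "c > 0" and k: "k \<ge> (1 :: nat)"
  obtains D where "D > 0" "\<And>r x. \<bar>Airy_Ai (r + x)\<bar> \<le> D * weight_r c k r * weight_x c k x"
proof -
  obtain C1 where C1: "C1 > 0" "\<And>x. \<bar>Airy_Ai x\<bar> \<le> C1 * exp (- (c / 4 * x))" using Airy_Ai_bound[of "c / 4"] c by auto
  obtain C2 where C2: "C2 > 0" "\<And>x. \<bar>Airy_Ai x\<bar> \<le> C2 * exp (- (real k * c * x))" using Airy_Ai_bound[of "real k * c"] c k by auto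
  have "\<bar>Airy_Ai (r + x)\<bar> \<le> (C1 + C2) * weight_r c k r * weight_x c k x" for r x
  proof (cases "x \<le> 0")
    case True
    have "\<bar>Airy_Ai (r + x)\<bar> \<le> C1 * exp (- (c / 4 * (r + x)))" by (rule C1(2))
    also have "\<dots> = C1 * exp (- (c / 4) * r) * exp (- (c / 4) * x)"
      by (simp only: distrib_left minus_add_distrib exp_add mult.assoc mult_minus_left)
    also have "\<dots> \<le> (C1 + C2) * weight_r c k r * exp (- (c / 4) * x)"
      using C1(1) C2(1) by (intro mult_mono) (auto simp: weight_r_def)
    finally show ?thesis using True by (simp add: weight_x_def)
  next
    case False
    have "\<bar>Airy_Ai (r + x)\<bar> \<le> C2 * exp (- (real k * c * (r + x)))" by (rule C2(2))
    also have "\<dots> = C2 * exp (- (real k * c) * r) * exp (- (real k * c) * x)"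
      by (simp only: distrib_left minus_add_distrib exp_add mult.assoc mult_minus_left)
    also have "\<dots> \<le> (C1 + C2) * weight_r c k r * exp (- (real k * c) * x)"
      using C1(1) C2(1) by (intro mult_mono) (auto simp: weight_r_def)
    finally show ?thesis using False by (simp add: weight_x_def)
  qed
  then show thesis using that[of "C1 + C2"] C1(1) C2(1) by simp
qed

lemma growth_env_weight_x:
  assumes c: "c > 0" and k: "k \<ge> (1 :: nat)"
  shows "growth_env c k x * (weight_x c k x)\<^sup>2 \<le> exp (- (c / 2) * \<bar>x\<bar>)"
proof (cases "x \<le> 0")
  case True
  have "growth_env c k x * (weight_x c k x)\<^sup>2 = exp (c * x + (- (c / 4) * x + - (c / 4) * x))"
    using True by (simp only: growth_env_def weight_x_def power2_eq_square exp_add if_True)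
  also have "c * x + (- (c / 4) * x + - (c / 4) * x) = - (c / 2) * \<bar>x\<bar>" using True by simp
  finally show ?thesis by simp
next
  case False
  have "growth_env c k x * (weight_x c k x)\<^sup>2 = exp (real k * c * x + (- (real k * c) * x + - (real k * c) * x))"
    using False by (simp only: growth_env_def weight_x_def power2_eq_square exp_add if_False)
  also have "real k * c * x + (- (real k * c) * x + - (real k * c) * x) = - (real k * (c * x))" by simp
  also have "exp (- (real k * (c * x))) \<le> exp (- (c / 2) * \<bar>x\<bar>)"
  proof -
    have "1 * (c * x) \<le> real k * (c * x)" using False c k by (intro mult_right_mono) auto
    moreover have "(c / 2) * \<bar>x\<bar> \<le> c * x" using False c by simp
    ultimately show ?thesis by simp
  qed
  finally show ?thesis .
qed

lemma growth_env_weight_x_integrable: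
  assumes c: "c > 0" and k: "k \<ge> (1 :: nat)"
  shows "integrable lborel (\<lambda>x. growth_env c k x * (weight_x c k x)\<^sup>2)"
proof (rule Bochner_Integration.integrable_bound)
  show "integrable lborel (\<lambda>x. exp (- (c / 2) * \<bar>x\<bar>))" using c by (intro integrable_exp_abs) auto
  show "AE x in lborel. norm (growth_env c k x * (weight_x c k x)\<^sup>2) \<le> norm (exp (- (c / 2) * \<bar>x\<bar>))"
    using growth_env_weight_x[OF c k] weight_pos(1)[of c k] by (intro AE_I2) (simp add: less_imp_le)
qed measurable

lemma tail_exp_integrable:
  assumes d: "(d :: real) > 0"
  shows "integrable lborel (\<lambda>x. indicator {S..} x * exp (- d * x))"
proof (rule Bochner_Integration.integrable_bound)
  show "integrable lborel (\<lambda>x. exp (2 * d * \<bar>S\<bar>) * exp (- d * \<bar>x\<bar>))" by (intro integrable_mult_right integrable_exp_abs d)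
  show "AE x in lborel. norm (indicator {S..} x * exp (- d * x)) \<le> norm (exp (2 * d * \<bar>S\<bar>) * exp (- d * \<bar>x\<bar>))"
  proof (rule AE_I2)
    fix x
    show "norm (indicator {S..} x * exp (- d * x)) \<le> norm (exp (2 * d * \<bar>S\<bar>) * exp (- d * \<bar>x\<bar>))"
    proof (cases "S \<le> x")
      case True
      have "\<bar>x\<bar> - x \<le> 2 * \<bar>S\<bar>" using True by linarith
      then have "d * (\<bar>x\<bar> - x) \<le> d * (2 * \<bar>S\<bar>)" using d by (intro mult_left_mono) auto
      then have "- d * x \<le> 2 * d * \<bar>S\<bar> + - d * \<bar>x\<bar>" by (simp add: algebra_simps)
      then have "exp (- d * x) \<le> exp (2 * d * \<bar>S\<bar>) * exp (- d * \<bar>x\<bar>)" by (simp only: exp_add[symmetric] exp_le_cancel_iff)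
      then show ?thesis using True by (simp add: indicator_def)
    qed (simp add: indicator_def)
  qed
qed measurable

lemma weight_r_tail_integrable:
  assumes c: "c > 0" and k: "k \<ge> (1 :: nat)"
  shows "integrable lborel (\<lambda>x. indicator {S..} x * (weight_r c k x)\<^sup>2)"
proof (rule Bochner_Integration.integrable_bound)
  show "integrable lborel (\<lambda>x. 2 * (indicator {S..} x * exp (- (c / 2) * x)) + 2 * (indicator {S..} x * exp (- (2 * (real k * c)) * x)))"
    using c k by (intro Bochner_Integration.integrable_add integrable_mult_right tail_exp_integrable) auto
  show "AE x in lborel. norm (indicator {S..} x * (weight_r c k x)\<^sup>2)
      \<le> norm (2 * (indicator {S..} x * exp (- (c / 2) * x)) + 2 * (indicator {S..} x * exp (- (2 * (real k * c)) * x)))"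
  proof (rule AE_I2)
    fix x
    define p where "p = exp (- (c / 4) * x)"
    define q where "q = exp (- (real k * c) * x)"
    have "(p + q)\<^sup>2 \<le> 2 * (p * p) + 2 * (q * q)"
      using zero_le_power2[of "p - q"] by (simp add: power2_eq_square algebra_simps)
    moreover have "p * p = exp (- (c / 2) * x)" "q * q = exp (- (2 * (real k * c)) * x)"
      by (simp_all add: p_def q_def mult_exp_exp)
    ultimately have "(weight_r c k x)\<^sup>2 \<le> 2 * exp (- (c / 2) * x) + 2 * exp (- (2 * (real k * c)) * x)"
      by (simp add: weight_r_def p_def q_def)
    then show "norm (indicator {S..} x * (weight_r c k x)\<^sup>2)
      \<le> norm (2 * (indicator {S..} x * exp (- (c / 2) * x)) + 2 * (indicator {S..} x * exp (- (2 * (real k * c)) * x)))"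
      by (simp add: indicator_def)
  qed
qed measurable

lemma lborel_shift: "(LINT x|lborel. f (x - S)) = (LINT x|lborel. f x)" for f :: "real \<Rightarrow> real"
  using lborel_integral_real_affine[of 1 f "- S"] by simp

lemma lborel_shift_integrable: "integrable lborel f \<Longrightarrow> integrable lborel (\<lambda>x. f (x - S))" for f :: "real \<Rightarrow> real"
  using lborel_integrable_real_affine[of f 1 "- S"] by simp

text \<open>
  The threshold \<open>0\<close> in the Airy kernel can be moved to \<open>S\<close> at the expense of a
  translation.
\<close>

lemma Airy_kernel_shift:
  "Airy_kernel x y = (LINT r|lborel. indicator {S..} r * (Airy_Ai (r + (x - S)) * Airy_Ai (r + (y - S))))"
proof -
  have "Airy_kernel x y = (LINT r|lborel. indicator {0..} (r - S) * (Airy_Ai ((r - S) + x) * Airy_Ai ((r - S) + y)))"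
    unfolding Airy_kernel_def set_lebesgue_integral_def real_scaleR_def by (rule lborel_shift[symmetric])
  also have "\<dots> = (LINT r|lborel. indicator {S..} r * (Airy_Ai (r + (x - S)) * Airy_Ai (r + (y - S))))"
    by (intro Bochner_Integration.integral_cong refl) (auto simp: indicator_def algebra_simps)
  finally show ?thesis .
qed

lemma Airy_pair_integrable:
  "integrable lborel (\<lambda>r. indicator {S..} r * (Airy_Ai (r + x) * Airy_Ai (r + y)))"
proof -
  obtain D where D: "D > 0" "\<And>r x. \<bar>Airy_Ai (r + x)\<bar> \<le> D * weight_r 1 1 r * weight_x 1 1 x" using Airy_weight[of 1 1] by auto
  show ?thesis
  proof (rule Bochner_Integration.integrable_bound)
    show "integrable lborel (\<lambda>r. (D * weight_x 1 1 x * (D * weight_x 1 1 y)) * (indicator {S..} r * (weight_r 1 1 r)\<^sup>2))"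
      by (intro integrable_mult_right weight_r_tail_integrable) auto
    show "AE r in lborel. norm (indicator {S..} r * (Airy_Ai (r + x) * Airy_Ai (r + y))) \<le> norm ((D * weight_x 1 1 x * (D * weight_x 1 1 y)) * (indicator {S..} r * (weight_r 1 1 r)\<^sup>2))"
    proof (rule AE_I2)
      fix r
      have "\<bar>Airy_Ai (r + x) * Airy_Ai (r + y)\<bar> \<le> (D * weight_r 1 1 r * weight_x 1 1 x) * (D * weight_r 1 1 r * weight_x 1 1 y)"
        unfolding abs_mult using D weight_pos by (intro mult_mono) (auto simp: less_imp_le)
      also have "\<dots> = (D * weight_x 1 1 x * (D * weight_x 1 1 y)) * (weight_r 1 1 r)\<^sup>2" by (simp add: power2_eq_square mult_ac)
      finally show "norm (indicator {S..} r * (Airy_Ai (r + x) * Airy_Ai (r + y))) \<le> norm ((D * weight_x 1 1 x * (D * weight_x 1 1 y)) * (indicator {S..} r * (weight_r 1 1 r)\<^sup>2))"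
        using order_trans[OF _ abs_ge_self] by (auto simp: indicator_def)
    qed
  qed measurable
qed

lemma Airy_kernel_measurable: "(\<lambda>(x, y). Airy_kernel x y) \<in> borel_measurable (borel \<Otimes>\<^sub>M borel)"
  unfolding Airy_kernel_def set_lebesgue_integral_def case_prod_beta'
proof (rule lborel.borel_measurable_lebesgue_integral)
  have [measurable]: "(\<lambda>q :: (real \<times> real) \<times> real. indicat_real {0..} (snd q)) \<in> borel_measurable ((borel \<Otimes>\<^sub>M borel) \<Otimes>\<^sub>M lborel)"
    by (rule measurable_compose[OF measurable_snd]) measurable
  show "(\<lambda>(p, r). indicat_real {0..} r *\<^sub>R (Airy_Ai (r + fst p) * Airy_Ai (r + snd p))) \<in> borel_measurable ((borel \<Otimes>\<^sub>M borel) \<Otimes>\<^sub>M lborel)"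
    unfolding case_prod_beta' by measurable
qed

text \<open>
  The Airy kernel is positive semidefinite, being \<open>A A\<^sup>T\<close> for \<open>A u r = Ai (u + r)\<close>,
  \<open>r \<ge> 0\<close>.
\<close>

lemma Airy_kernel_det_bounds:
  "0 \<le> kernel_det Airy_kernel n x" "kernel_det Airy_kernel n x \<le> (\<Prod>i<n. Airy_kernel (x i) (x i))"
proof -
  have K: "Airy_kernel u v = (LINT r|lborel. indicator {0..} r * (Airy_Ai (r + u) * Airy_Ai (r + v)))" for u v
    by (simp add: Airy_kernel_def set_lebesgue_integral_def)
  have sym: "Airy_kernel u v = Airy_kernel v u" for u v unfolding K by (simp add: mult.commute)
  have psd: "(\<Sum>i<n. \<Sum>j<n. v i * v j * Airy_kernel (x i) (x j)) \<ge> 0" for v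
  proof -
    have "(\<Sum>i<n. \<Sum>j<n. v i * v j * Airy_kernel (x i) (x j))
      = (\<Sum>i<n. \<Sum>j<n. (LINT r|lborel. v i * v j * (indicator {0..} r * (Airy_Ai (r + x i) * Airy_Ai (r + x j)))))"
      unfolding K by (simp add: integral_mult_right_zero)
    also have "\<dots> = (LINT r|lborel. (\<Sum>i<n. \<Sum>j<n. v i * v j * (indicator {0..} r * (Airy_Ai (r + x i) * Airy_Ai (r + x j)))))"
      by (subst Bochner_Integration.integral_sum, (intro Bochner_Integration.integrable_sum integrable_mult_right Airy_pair_integrable)[1],
          subst Bochner_Integration.integral_sum, (intro integrable_mult_right Airy_pair_integrable)[1], rule refl)
    also have "\<dots> = (LINT r|lborel. indicator {0..} r * (\<Sum>i<n. v i * Airy_Ai (r + x i))\<^sup>2)"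
      by (intro Bochner_Integration.integral_cong refl)
         (simp add: power2_eq_square sum_product sum_distrib_left mult_ac)
    also have "\<dots> \<ge> 0" by (intro Bochner_Integration.integral_nonneg) auto
    finally show ?thesis .
  qed
  show "0 \<le> kernel_det Airy_kernel n x" "kernel_det Airy_kernel n x \<le> (\<Prod>i<n. Airy_kernel (x i) (x i))"
    unfolding kernel_det_eq_kdet by (rule kdet_psd[where K = Airy_kernel and n = n and x = x, OF sym psd])+
qed

text \<open>
  The multiplication operator by \<open>f\<close> conjugated by the operator with kernel \<open>Ai (r + x)\<close>.
\<close>

definition airy_conj :: "(real \<Rightarrow> real) \<Rightarrow> real \<Rightarrow> real \<Rightarrow> real" where
  "airy_conj f r s = (LINT x|lborel. f x * (Airy_Ai (r + x) * Airy_Ai (s + x)))"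

lemma airy_conj_bounds:
  assumes c: "c > 0" and k: "k \<ge> (1 :: nat)" and f[measurable]: "f \<in> borel_measurable borel"
    and A: "0 \<le> A" "\<And>x. \<bar>f x\<bar> \<le> A * growth_env c k x"
    and D: "0 < D" "\<And>r x. \<bar>Airy_Ai (r + x)\<bar> \<le> D * weight_r c k r * weight_x c k x"
  shows "\<bar>f x * (Airy_Ai (r + x) * Airy_Ai (s + x))\<bar> \<le> (A * D\<^sup>2 * weight_r c k r * weight_r c k s) * (growth_env c k x * (weight_x c k x)\<^sup>2)"
    and "integrable lborel (\<lambda>x. f x * (Airy_Ai (r + x) * Airy_Ai (s + x)))"
    and "\<bar>airy_conj f r s\<bar> \<le> (A * D\<^sup>2 * (LINT x|lborel. growth_env c k x * (weight_x c k x)\<^sup>2)) * weight_r c k r * weight_r c k s"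
proof -
  have b: "\<bar>f x * (Airy_Ai (r + x) * Airy_Ai (s + x))\<bar> \<le> (A * D\<^sup>2 * weight_r c k r * weight_r c k s) * (growth_env c k x * (weight_x c k x)\<^sup>2)" for x r s
  proof -
    have "\<bar>f x * (Airy_Ai (r + x) * Airy_Ai (s + x))\<bar> \<le> (A * growth_env c k x) * ((D * weight_r c k r * weight_x c k x) * (D * weight_r c k s * weight_x c k x))"
      unfolding abs_mult using A D weight_pos by (intro mult_mono mult_nonneg_nonneg) (auto simp: less_imp_le)
    then show ?thesis by (simp add: power2_eq_square mult_ac)
  qed
  then show "\<bar>f x * (Airy_Ai (r + x) * Airy_Ai (s + x))\<bar> \<le> (A * D\<^sup>2 * weight_r c k r * weight_r c k s) * (growth_env c k x * (weight_x c k x)\<^sup>2)" .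
  have i: "integrable lborel (\<lambda>x. (A * D\<^sup>2 * weight_r c k r * weight_r c k s) * (growth_env c k x * (weight_x c k x)\<^sup>2))"
    by (intro integrable_mult_right growth_env_weight_x_integrable c k)
  show int: "integrable lborel (\<lambda>x. f x * (Airy_Ai (r + x) * Airy_Ai (s + x)))"
    by (rule Bochner_Integration.integrable_bound[OF i])
       (use order_trans[OF b abs_ge_self] in \<open>auto intro!: AE_I2\<close>)
  have "\<bar>airy_conj f r s\<bar> \<le> (LINT x|lborel. (A * D\<^sup>2 * weight_r c k r * weight_r c k s) * (growth_env c k x * (weight_x c k x)\<^sup>2))"
    unfolding airy_conj_def by (rule norm_integral_le[OF int i]) (rule b)
  also have "\<dots> = (A * D\<^sup>2 * weight_r c k r * weight_r c k s) * (LINT x|lborel. growth_env c k x * (weight_x c k x)\<^sup>2)"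
    by (rule integral_mult_right_zero)
  finally show "\<bar>airy_conj f r s\<bar> \<le> (A * D\<^sup>2 * (LINT x|lborel. growth_env c k x * (weight_x c k x)\<^sup>2)) * weight_r c k r * weight_r c k s"
    by (simp only: mult_ac)
qed

text \<open>
  By \<open>exp_times_Airy_Ai\<close> the function \<open>exp (c x / 2) Ai (x + r)\<close> is the Fourier transform
  of a function whose modulus is Gaussian and whose phase depends on \<open>r\<close> only linearly,
  apart from a factor common to all \<open>r\<close>. Plancherel's identity therefore reduces the
  integral to the Fourier transform of a Gaussian.
\<close>

lemma Airy_product_integral:
  assumes c: "c > 0"
  shows "(LINT x|lborel. exp (c * x) * (Airy_Ai (x + r) * Airy_Ai (x + s)))
     = exp (c ^ 3 / 12 - c * (r + s) / 2 - (r - s)\<^sup>2 / (4 * c)) / sqrt (4 * pi * c)"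
proof -
  obtain D where D: "0 < D" "\<And>r x. \<bar>Airy_Ai (r + x)\<bar> \<le> D * weight_r c 1 r * weight_x c 1 x" using Airy_weight[OF c] by auto
  have int: "integrable lborel (\<lambda>x. exp (c * x) * (Airy_Ai (x + r) * Airy_Ai (x + s)))"
    using airy_conj_bounds(2)[OF c _ _ _ _ D, of "\<lambda>x. exp (c * x)" 1 r s] by (simp add: growth_env_def add.commute)
  define v where "v = c / 2"
  have v: "v > 0" using c by (simp add: v_def)
  define u where "u q \<xi> = iexp (q * \<xi>) * airy_exp 0 (Complex \<xi> v)" for q \<xi>
  have fu: "(LINT \<xi>|lborel. iexp (x * \<xi>) * u q \<xi>) = of_real (2 * pi * exp (v * (x + q)) * Airy_Ai (x + q))" for x q
  proof -
    have "iexp (x * \<xi>) * u q \<xi> = iexp ((x + q) * \<xi>) * airy_exp 0 (Complex \<xi> v)" for \<xi>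
      unfolding u_def by (simp add: distrib_right distrib_left exp_add)
    then show ?thesis using exp_times_Airy_Ai[OF v, of "x + q"] by simp
  qed
  have nu: "norm (u q \<xi>) = exp (- (\<xi>\<^sup>2 * v) + v ^ 3 / 3)" for q \<xi>
    unfolding u_def by (simp add: norm_mult norm_airy_exp)
  have iu: "integrable lborel (u q)" for q
    using integrable_airy_exp[OF v, of 0]
  proof (rule Bochner_Integration.integrable_bound)
    show "u q \<in> borel_measurable lborel"
      unfolding u_def using borel_measurable_continuous_onI[OF continuous_airy_exp[of 0 v]] by measurable
  qed (auto simp: u_def norm_mult)
  define I where "I = (LINT x|lborel. exp (c * x) * (Airy_Ai (x + r) * Airy_Ai (x + s)))"
  define k where "k = 4 * pi\<^sup>2 * exp (v * (r + s))"
  have prod: "(LINT \<xi>|lborel. iexp (x * \<xi>) * u r \<xi>) * cnj (LINT \<xi>|lborel. iexp (x * \<xi>) * u s \<xi>)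
     = of_real (k * (exp (c * x) * (Airy_Ai (x + r) * Airy_Ai (x + s))))" for x
  proof -
    have "exp (v * (x + r)) * exp (v * (x + s)) = exp (v * (r + s)) * exp (c * x)"
      by (simp add: mult_exp_exp v_def field_simps)
    then have "k * (exp (c * x) * (Airy_Ai (x + r) * Airy_Ai (x + s)))
      = 4 * pi\<^sup>2 * (exp (v * (x + r)) * exp (v * (x + s))) * (Airy_Ai (x + r) * Airy_Ai (x + s))"
      by (simp only: k_def mult.assoc)
    also have "\<dots> = (2 * pi * exp (v * (x + r)) * Airy_Ai (x + r)) * (2 * pi * exp (v * (x + s)) * Airy_Ai (x + s))"
      by (simp add: power2_eq_square)
    finally show ?thesis unfolding fu by (simp only: complex_cnj_complex_of_real of_real_mult[symmetric])
  qed
  have "(LINT x|lborel. (LINT \<xi>|lborel. iexp (x * \<xi>) * u r \<xi>) * cnj (LINT \<xi>|lborel. iexp (x * \<xi>) * u s \<xi>))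
      = 2 * pi * (LINT \<xi>|lborel. u r \<xi> * cnj (u s \<xi>))"
  proof (rule plancherel)
    show "continuous_on UNIV (u r)" unfolding u_def
      by (intro continuous_intros continuous_airy_exp)
    show "norm (u r \<xi>) \<le> exp (v ^ 3 / 3)" for \<xi> unfolding nu using v by simp
    show "integrable lborel (\<lambda>x. (LINT \<xi>|lborel. iexp (x * \<xi>) * u r \<xi>) * cnj (LINT \<xi>|lborel. iexp (x * \<xi>) * u s \<xi>))"
      unfolding prod using int by (intro integrable_of_real integrable_mult_right)
  qed (use iu in auto)
  then have 1: "of_real (k * I) = 2 * pi * (LINT \<xi>|lborel. u r \<xi> * cnj (u s \<xi>))"
    unfolding prod I_def integral_complex_of_real by simp
  define e where "e = sqrt (2 * c)"
  have e: "e > 0" "e\<^sup>2 = 2 * c" using c by (auto simp: e_def)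
  have "u r \<xi> * cnj (u s \<xi>) = of_real (exp (c ^ 3 / 12)) * (iexp (\<xi> * (r - s)) * of_real (exp (- (e * \<xi>)\<^sup>2 / 2)))" for \<xi>
  proof -
    have "u r \<xi> * cnj (u s \<xi>) = (iexp (r * \<xi>) * iexp (- (s * \<xi>))) * (airy_exp 0 (Complex \<xi> v) * cnj (airy_exp 0 (Complex \<xi> v)))"
      unfolding u_def by (simp add: exp_cnj)
    also have "airy_exp 0 (Complex \<xi> v) * cnj (airy_exp 0 (Complex \<xi> v)) = of_real ((norm (airy_exp 0 (Complex \<xi> v)))\<^sup>2)"
      by (rule complex_norm_square[symmetric])
    also have "(norm (airy_exp 0 (Complex \<xi> v)))\<^sup>2 = exp (c ^ 3 / 12) * exp (- (e * \<xi>)\<^sup>2 / 2)"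
      unfolding norm_airy_exp power_mult_distrib e
      unfolding v_def exp_add[symmetric] exp_double[symmetric]
      by (simp add: power2_eq_square power3_eq_cube field_simps flip: exp_add)
    also have "iexp (r * \<xi>) * iexp (- (s * \<xi>)) = iexp (\<xi> * (r - s))"
      unfolding mult_exp_exp by (simp add: algebra_simps)
    finally show ?thesis by simp
  qed
  then have "(LINT \<xi>|lborel. u r \<xi> * cnj (u s \<xi>)) = of_real (exp (c ^ 3 / 12)) * (LINT \<xi>|lborel. iexp (\<xi> * (r - s)) * of_real (exp (- (e * \<xi>)\<^sup>2 / 2)))"
    by (simp only: integral_mult_right_zero)
  also have "\<dots> = of_real (exp (c ^ 3 / 12) * (sqrt (2 * pi) / e * exp (- ((r - s) / e)\<^sup>2 / 2)))"
    unfolding gaussian_fourier[OF e(1)] by simp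
  finally have "complex_of_real (k * I) = of_real (2 * pi * (exp (c ^ 3 / 12) * (sqrt (2 * pi) / e * exp (- ((r - s) / e)\<^sup>2 / 2))))"
    unfolding 1 by simp
  then have 2: "k * I = 2 * pi * (exp (c ^ 3 / 12) * (sqrt (2 * pi) / e * exp (- ((r - s) / e)\<^sup>2 / 2)))"
    by (simp only: of_real_eq_iff)
  have 3: "2 * pi * (sqrt (2 * pi) / e) = 4 * pi\<^sup>2 / sqrt (4 * pi * c)"
  proof -
    define S where "S = sqrt (2 * pi)"
    have "4 * pi * c = (2 * pi) * (2 * c)" by simp
    then have a: "sqrt (4 * pi * c) = S * e" by (simp only: real_sqrt_mult e_def S_def)
    have S: "S > 0" "S * S = 2 * pi" by (simp_all add: S_def)
    then have b: "4 * pi\<^sup>2 = 2 * pi * (S * S)" by (simp add: power2_eq_square)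
    have "2 * pi * (S / e) = (2 * pi * (S * S)) / (S * e)" using S(1) by simp
    then show ?thesis by (simp only: a b S_def[symmetric])
  qed
  have 4: "((r - s) / e)\<^sup>2 / 2 = (r - s)\<^sup>2 / (4 * c)" by (simp add: power_divide e)
  have fin: "k * I = k * (exp (c ^ 3 / 12 - c * (r + s) / 2 - (r - s)\<^sup>2 / (4 * c)) / sqrt (4 * pi * c))"
  proof -
    have "k * I = (2 * pi * (sqrt (2 * pi) / e)) * (exp (c ^ 3 / 12) * exp (- ((r - s)\<^sup>2 / (4 * c))))"
      unfolding 2 using 4 by simp
    also have "exp (c ^ 3 / 12) * exp (- ((r - s)\<^sup>2 / (4 * c))) = exp (v * (r + s)) * exp (c ^ 3 / 12 - c * (r + s) / 2 - (r - s)\<^sup>2 / (4 * c))"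
      unfolding mult_exp_exp v_def by (simp add: algebra_simps)
    finally show ?thesis unfolding 3 k_def by simp
  qed
  have k0: "k \<noteq> 0" by (simp add: k_def)
  have "I = exp (c ^ 3 / 12 - c * (r + s) / 2 - (r - s)\<^sup>2 / (4 * c)) / sqrt (4 * pi * c)"
    using mult_left_cancel[THEN iffD1, OF k0 fin] .
  then show ?thesis by (simp only: I_def)
qed

lemma good_kernel_airy_conj:
  assumes c: "c > 0" and k: "k \<ge> (1 :: nat)" and f[measurable]: "f \<in> borel_measurable borel"
    and A: "0 \<le> A" "\<And>x. \<bar>f x\<bar> \<le> A * growth_env c k x"
  obtains E where "0 \<le> E" "good_kernel (airy_conj f) (\<lambda>r. E * weight_r c k r)"
proof -
  obtain D where D: "D > 0" "\<And>r x. \<bar>Airy_Ai (r + x)\<bar> \<le> D * weight_r c k r * weight_x c k x" using Airy_weight[OF c k] by auto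
  define G where "G = A * D\<^sup>2 * (LINT x|lborel. growth_env c k x * (weight_x c k x)\<^sup>2)"
  have G: "0 \<le> G" unfolding G_def using A weight_pos by (intro mult_nonneg_nonneg Bochner_Integration.integral_nonneg) (auto simp: less_imp_le)
  define E where "E = sqrt G"
  have E: "0 \<le> E" "E * E = G" using G by (auto simp: E_def)
  note bb = airy_conj_bounds[OF c k f A D]
  have cont: "isCont (\<lambda>(r, s). airy_conj f r s) p" for p
    unfolding continuous_at_sequentially o_def
  proof (intro allI impI)
    fix X assume X: "X \<longlonglongrightarrow> p"
    have X1: "(\<lambda>n. fst (X n)) \<longlonglongrightarrow> fst p" and X2: "(\<lambda>n. snd (X n)) \<longlonglongrightarrow> snd p" using X by (auto intro: tendsto_intros)
    have wl: "\<exists>W>0. \<forall>n. weight_r c k (Y n) \<le> W" if "Y \<longlonglongrightarrow> y" for Y y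
    proof -
      have "(\<lambda>n. weight_r c k (Y n)) \<longlonglongrightarrow> weight_r c k y"
        using weight_r_continuous[of UNIV c k] that isCont_tendsto_compose[of y "weight_r c k" Y] by (simp add: continuous_on_eq_continuous_at)
      then have "Bseq (\<lambda>n. weight_r c k (Y n))" by (intro convergent_imp_Bseq convergentI)
      then obtain W where "W > 0" "\<And>n. norm (weight_r c k (Y n)) \<le> W" by (auto simp: Bseq_def)
      then show ?thesis using abs_le_D1 by (intro exI[of _ W]) auto
    qed
    obtain W1 where W1: "W1 > 0" "\<And>n. weight_r c k (fst (X n)) \<le> W1" using wl[OF X1] by blast
    obtain W2 where W2: "W2 > 0" "\<And>n. weight_r c k (snd (X n)) \<le> W2" using wl[OF X2] by blast
    have ca: "isCont Airy_Ai y" for y using continuous_Airy_Ai by (simp add: continuous_on_eq_continuous_at)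
    have "(\<lambda>n. LINT x|lborel. f x * (Airy_Ai (fst (X n) + x) * Airy_Ai (snd (X n) + x))) \<longlonglongrightarrow> (LINT x|lborel. f x * (Airy_Ai (fst p + x) * Airy_Ai (snd p + x)))"
    proof (rule integral_dominated_convergence[where w = "\<lambda>x. (A * D\<^sup>2 * W1 * W2) * (growth_env c k x * (weight_x c k x)\<^sup>2)"])
      show "integrable lborel (\<lambda>x. (A * D\<^sup>2 * W1 * W2) * (growth_env c k x * (weight_x c k x)\<^sup>2))"
        by (intro integrable_mult_right growth_env_weight_x_integrable c k)
      show "AE x in lborel. (\<lambda>n. f x * (Airy_Ai (fst (X n) + x) * Airy_Ai (snd (X n) + x))) \<longlonglongrightarrow> f x * (Airy_Ai (fst p + x) * Airy_Ai (snd p + x))"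
        by (intro AE_I2 tendsto_intros isCont_tendsto_compose[OF ca] X1 X2)
      show "AE x in lborel. norm (f x * (Airy_Ai (fst (X n) + x) * Airy_Ai (snd (X n) + x))) \<le> (A * D\<^sup>2 * W1 * W2) * (growth_env c k x * (weight_x c k x)\<^sup>2)" for n
      proof (rule AE_I2)
        fix x
        have "\<bar>f x * (Airy_Ai (fst (X n) + x) * Airy_Ai (snd (X n) + x))\<bar> \<le> (A * D\<^sup>2 * weight_r c k (fst (X n)) * weight_r c k (snd (X n))) * (growth_env c k x * (weight_x c k x)\<^sup>2)" by (rule bb(1))
        also have "\<dots> \<le> (A * D\<^sup>2 * W1 * W2) * (growth_env c k x * (weight_x c k x)\<^sup>2)"
          using A D W1 W2 weight_pos by (intro mult_mono mult_nonneg_nonneg) (auto simp: less_imp_le)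
        finally show "norm (f x * (Airy_Ai (fst (X n) + x) * Airy_Ai (snd (X n) + x))) \<le> (A * D\<^sup>2 * W1 * W2) * (growth_env c k x * (weight_x c k x)\<^sup>2)" by simp
      qed
    qed measurable
    then show "(\<lambda>n. case X n of (r, s) \<Rightarrow> airy_conj f r s) \<longlonglongrightarrow> (case p of (r, s) \<Rightarrow> airy_conj f r s)"
      by (simp add: airy_conj_def case_prod_beta')
  qed
  have "good_kernel (airy_conj f) (\<lambda>r. E * weight_r c k r)"
    unfolding good_kernel_def
  proof (intro conjI allI)
    show "continuous_on UNIV (\<lambda>(x, y). airy_conj f x y)" using cont by (simp add: continuous_at_imp_continuous_on)
    show "continuous_on UNIV (\<lambda>r. E * weight_r c k r)" by (intro continuous_intros weight_r_continuous)
    show "0 \<le> E * weight_r c k x" for x using E weight_pos(2)[of c k x] by simp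
    show "integrable lborel (\<lambda>x. indicator {S..} x * (E * weight_r c k x)\<^sup>2)" for S
      using integrable_mult_right[OF weight_r_tail_integrable[OF c k], of "E\<^sup>2" S] by (simp add: power_mult_distrib mult_ac)
    show "\<bar>airy_conj f x y\<bar> \<le> E * weight_r c k x * (E * weight_r c k y)" for x y
    proof -
      have "\<bar>airy_conj f x y\<bar> \<le> G * weight_r c k x * weight_r c k y" unfolding G_def by (rule bb(3))
      also have "\<dots> = E * weight_r c k x * (E * weight_r c k y)" unfolding E(2)[symmetric] by (simp only: mult_ac)
      finally show ?thesis .
    qed
  qed
  with E(1) show thesis by (rule that)
qed

text \<open>
  The Airy kernel is factored over \<open>[S, \<infinity>)\<close> and the two factors are exchanged. The
  multiplier is translated by \<open>S\<close>, so the dual kernel \<open>airy_conj f\<close> does not depend on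
  \<open>S\<close>, and \<open>S\<close> only enters as the threshold.
\<close>

lemma fred_det_Airy_eq:
  assumes c: "c > 0" and k: "k \<ge> (1 :: nat)" and f[measurable]: "f \<in> borel_measurable borel"
    and A: "0 \<le> A" "\<And>x. \<bar>f x\<bar> \<le> A * growth_env c k x"
  shows "fred_det (\<lambda>x y. f (x - S) * Airy_kernel x y) = fred_det (cut (airy_conj f) S)"
    and "integrable lborel (\<lambda>x. \<bar>f (x - S)\<bar> * Airy_kernel x x)"
proof -
  obtain D where D: "D > 0" "\<And>r x. \<bar>Airy_Ai (r + x)\<bar> \<le> D * weight_r c k r * weight_x c k x" using Airy_weight[OF c k] by auto
  define P where "P x r = f (x - S) * Airy_Ai (r + (x - S))" for x r
  define Q where "Q r y = indicator {S..} r * Airy_Ai (r + (y - S))" for r y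
  define p where "p x = \<bar>f (x - S)\<bar> * weight_x c k (x - S)" for x
  define v where "v r = indicator {S..} r * (D * weight_r c k r)" for r
  define w where "w r = D * weight_r c k r" for r
  define s where "s y = weight_x c k (y - S)" for y
  have Pm: "(\<lambda>(x, r). P x r) \<in> borel_measurable (borel \<Otimes>\<^sub>M borel)" unfolding P_def case_prod_beta' by measurable
  have Qm: "(\<lambda>(r, y). Q r y) \<in> borel_measurable (borel \<Otimes>\<^sub>M borel)"
  proof -
    have [measurable]: "(\<lambda>q. indicat_real {S..} (fst q)) \<in> borel_measurable (borel \<Otimes>\<^sub>M borel)"
      by (rule measurable_compose[OF measurable_fst]) measurable
    show ?thesis unfolding Q_def case_prod_beta' by measurable
  qed
  have Pb: "\<bar>P x r\<bar> \<le> p x * w r" for x r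
    using mult_left_mono[OF D(2)[of r "x - S"], of "\<bar>f (x - S)\<bar>"] by (simp add: P_def p_def w_def abs_mult mult_ac)
  have Qb: "\<bar>Q r y\<bar> \<le> v r * s y" for r y
    using D(2)[of r "y - S"] by (simp add: Q_def v_def s_def indicator_def abs_mult mult_ac)
  have nn: "0 \<le> p x" "0 \<le> w x" "0 \<le> v x" "0 \<le> s x" for x
    using D weight_pos by (auto simp: p_def w_def v_def s_def less_imp_le)
  have ps0: "integrable lborel (\<lambda>x. \<bar>f x\<bar> * (weight_x c k x * weight_x c k x))"
  proof (rule Bochner_Integration.integrable_bound)
    show "integrable lborel (\<lambda>x. A * (growth_env c k x * (weight_x c k x)\<^sup>2))" by (intro integrable_mult_right growth_env_weight_x_integrable c k)
    show "AE x in lborel. norm (\<bar>f x\<bar> * (weight_x c k x * weight_x c k x)) \<le> norm (A * (growth_env c k x * (weight_x c k x)\<^sup>2))"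
    proof (rule AE_I2)
      fix x
      have "\<bar>f x\<bar> * (weight_x c k x * weight_x c k x) \<le> (A * growth_env c k x) * (weight_x c k x * weight_x c k x)"
        by (intro mult_right_mono A) simp
      also have "\<dots> = A * (growth_env c k x * (weight_x c k x)\<^sup>2)" by (simp only: power2_eq_square mult.assoc)
      finally have "\<bar>f x\<bar> * (weight_x c k x * weight_x c k x) \<le> \<bar>A * (growth_env c k x * (weight_x c k x)\<^sup>2)\<bar>" by linarith
      moreover have "\<bar>\<bar>f x\<bar> * (weight_x c k x * weight_x c k x)\<bar> = \<bar>f x\<bar> * (weight_x c k x * weight_x c k x)" by simp
      ultimately show "norm (\<bar>f x\<bar> * (weight_x c k x * weight_x c k x)) \<le> norm (A * (growth_env c k x * (weight_x c k x)\<^sup>2))"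
        unfolding real_norm_def by linarith
    qed
  qed measurable
  have ps: "integrable lborel (\<lambda>x. p x * s x)"
    using lborel_shift_integrable[OF ps0, of S] by (simp add: p_def s_def mult.assoc)
  have wv: "integrable lborel (\<lambda>r. w r * v r)"
    using integrable_mult_right[OF weight_r_tail_integrable[OF c k], of "D\<^sup>2" S] by (simp add: w_def v_def power2_eq_square mult_ac)
  have k1: "(\<lambda>x y. LINT r|lborel. P x r * Q r y) = (\<lambda>x y. f (x - S) * Airy_kernel x y)"
  proof (intro ext)
    fix x y
    have "(LINT r|lborel. P x r * Q r y) = (LINT r|lborel. f (x - S) * (indicator {S..} r * (Airy_Ai (r + (x - S)) * Airy_Ai (r + (y - S)))))"
      unfolding P_def Q_def by (simp only: mult_ac)
    also have "\<dots> = f (x - S) * Airy_kernel x y"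
      unfolding Airy_kernel_shift[of x y S] by (rule integral_mult_right_zero)
    finally show "(LINT r|lborel. P x r * Q r y) = f (x - S) * Airy_kernel x y" .
  qed
  have k2: "(\<lambda>r r'. LINT x|lborel. Q r x * P x r') = cut (airy_conj f) S"
  proof (intro ext)
    fix r r'
    have "(LINT x|lborel. Q r x * P x r') = (LINT x|lborel. indicator {S..} r * (f (x - S) * (Airy_Ai (r + (x - S)) * Airy_Ai (r' + (x - S)))))"
      unfolding P_def Q_def by (simp only: mult_ac)
    also have "\<dots> = indicator {S..} r * (LINT x|lborel. f (x - S) * (Airy_Ai (r + (x - S)) * Airy_Ai (r' + (x - S))))"
      by (rule integral_mult_right_zero)
    also have "(LINT x|lborel. f (x - S) * (Airy_Ai (r + (x - S)) * Airy_Ai (r' + (x - S)))) = airy_conj f r r'"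
      unfolding airy_conj_def by (rule lborel_shift)
    finally show "(LINT x|lborel. Q r x * P x r') = cut (airy_conj f) S r r'" by (simp add: cut_def)
  qed
  have "fred_det_term (\<lambda>x y. f (x - S) * Airy_kernel x y) {..<n} = fred_det_term (cut (airy_conj f) S) {..<n}" for n
    using fred_det_term_commute(3)[OF Pm Qm Pb Qb nn ps wv, of "{..<n}"] unfolding k1 k2 by simp
  then show "fred_det (\<lambda>x y. f (x - S) * Airy_kernel x y) = fred_det (cut (airy_conj f) S)"
    unfolding fred_det_def by simp
  have "dominated (\<lambda>x y. f (x - S) * Airy_kernel x y) (\<lambda>x. p x * (LINT r|lborel. w r * v r)) s"
    using fred_det_term_commute(1)[OF Pm Qm Pb Qb nn ps wv] unfolding k1 .
  note kb = dominatedD[OF this]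
  have K0: "Airy_kernel x x \<ge> 0" for x
    unfolding Airy_kernel_def set_lebesgue_integral_def by (intro Bochner_Integration.integral_nonneg) auto
  show "integrable lborel (\<lambda>x. \<bar>f (x - S)\<bar> * Airy_kernel x x)"
  proof (rule Bochner_Integration.integrable_bound[OF kb(2)])
    have [measurable]: "(\<lambda>x. Airy_kernel x x) \<in> borel_measurable borel"
      by (rule measurable_section2[OF Airy_kernel_measurable]) auto
    show "(\<lambda>x. \<bar>f (x - S)\<bar> * Airy_kernel x x) \<in> borel_measurable lborel" by measurable
    show "AE x in lborel. norm (\<bar>f (x - S)\<bar> * Airy_kernel x x) \<le> norm (p x * (LINT r|lborel. w r * v r) * s x)"
    proof (rule AE_I2)
      fix x
      have "norm (\<bar>f (x - S)\<bar> * Airy_kernel x x) = \<bar>f (x - S) * Airy_kernel x x\<bar>" using K0[of x] by (simp add: abs_mult)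
      then show "norm (\<bar>f (x - S)\<bar> * Airy_kernel x x) \<le> norm (p x * (LINT r|lborel. w r * v r) * s x)"
        using order_trans[OF kb(5)[of x x] abs_ge_self] by (simp only: real_norm_def)
    qed
  qed
qed

section \<open>Expansion of a resolvent on the half-line\<close>

text \<open>
  Measurable functions with an exponential bound on \<open>[0, \<infinity>)\<close>.
\<close>

definition exp_decay :: "real \<Rightarrow> real \<Rightarrow> (real \<Rightarrow> real) \<Rightarrow> bool" where
  "exp_decay d A u \<longleftrightarrow> 0 \<le> A \<and> u \<in> borel_measurable borel \<and> (\<forall>z\<ge>0. \<bar>u z\<bar> \<le> A * exp (- d * z))"

lemma exp_decayD:
  assumes "exp_decay d A u"
  shows "0 \<le> A" "u \<in> borel_measurable borel" "0 \<le> z \<Longrightarrow> \<bar>u z\<bar> \<le> A * exp (- d * z)"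
  using assms by (auto simp: exp_decay_def)

lemma exp_decay_diff:
  assumes "exp_decay d A u" "exp_decay d A' v"
  shows "exp_decay d (A + A') (\<lambda>z. u z - v z)"
  unfolding exp_decay_def
proof (intro conjI allI impI)
  show "(\<lambda>z. u z - v z) \<in> borel_measurable borel" using exp_decayD(2)[OF assms(1)] exp_decayD(2)[OF assms(2)] by measurable
  fix z :: real assume "0 \<le> z"
  with exp_decayD(3)[OF assms(1), of z] exp_decayD(3)[OF assms(2), of z]
  show "\<bar>u z - v z\<bar> \<le> (A + A') * exp (- d * z)" unfolding distrib_right by linarith
qed (use exp_decayD(1)[OF assms(1)] exp_decayD(1)[OF assms(2)] in auto)

lemma exp_decay_scale:
  assumes "exp_decay d A u"
  shows "exp_decay d (\<bar>c\<bar> * A) (\<lambda>z. c * u z)"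
  unfolding exp_decay_def
proof (intro conjI allI impI)
  show "(\<lambda>z. c * u z) \<in> borel_measurable borel" using exp_decayD(2)[OF assms] by measurable
  fix z :: real assume "0 \<le> z"
  with exp_decayD(3)[OF assms, of z] show "\<bar>c * u z\<bar> \<le> (\<bar>c\<bar> * A) * exp (- d * z)"
    unfolding abs_mult mult.assoc by (intro mult_left_mono) auto
qed (use exp_decayD(1)[OF assms] in auto)

lemma exp_decay_sum:
  assumes "\<And>i. i \<in> I \<Longrightarrow> exp_decay d (A i) (u i)"
  shows "exp_decay d (\<Sum>i\<in>I. A i) (\<lambda>z. \<Sum>i\<in>I. u i z)"
  unfolding exp_decay_def
proof (intro conjI allI impI)
  show "0 \<le> (\<Sum>i\<in>I. A i)" using exp_decayD(1)[OF assms] by (intro sum_nonneg) auto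
  show "(\<lambda>z. \<Sum>i\<in>I. u i z) \<in> borel_measurable borel" using exp_decayD(2)[OF assms] by (intro borel_measurable_sum)
  fix z :: real assume "0 \<le> z"
  then show "\<bar>\<Sum>i\<in>I. u i z\<bar> \<le> (\<Sum>i\<in>I. A i) * exp (- d * z)"
    unfolding sum_distrib_right using exp_decayD(3)[OF assms]
    by (intro order_trans[OF sum_abs] sum_mono) auto
qed

text \<open>The pairing of two functions on \<open>[0, \<infinity>)\<close>.\<close>

definition half_int :: "(real \<Rightarrow> real) \<Rightarrow> (real \<Rightarrow> real) \<Rightarrow> real" where
  "half_int u v = (LINT z:{0..}|lborel. u z * v z)"

definition half_int_const :: "real \<Rightarrow> real" where
  "half_int_const d = (LINT z|lborel. indicator {0..} z * exp (- (2 * d) * z))"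

lemma half_int_const_nonneg: "0 \<le> half_int_const d" unfolding half_int_const_def by (intro Bochner_Integration.integral_nonneg) auto

lemma half_int_bound:
  assumes d: "d > 0" and u: "exp_decay d A u" and v: "exp_decay d B v"
  shows "integrable lborel (\<lambda>z. indicator {0..} z * (u z * v z))" and "\<bar>half_int u v\<bar> \<le> A * B * half_int_const d"
proof -
  note [measurable] = exp_decayD(2)[OF u] exp_decayD(2)[OF v]
  have i: "integrable lborel (\<lambda>z. (A * B) * (indicator {0..} z * exp (- (2 * d) * z)))"
    using d by (intro integrable_mult_right tail_exp_integrable) auto
  have b: "\<bar>indicator {0..} z * (u z * v z)\<bar> \<le> (A * B) * (indicator {0..} z * exp (- (2 * d) * z))" for z
  proof (cases "z \<ge> 0")
    case True
    have "\<bar>u z * v z\<bar> \<le> (A * exp (- d * z)) * (B * exp (- d * z))"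
      unfolding abs_mult using exp_decayD(1,3)[OF u] exp_decayD(3)[OF v] True by (intro mult_mono) auto
    also have "\<dots> = (A * B) * exp (- (2 * d) * z)" by (simp add: mult_exp_exp mult_ac)
    finally show ?thesis using True by (simp add: indicator_def)
  qed (simp add: indicator_def)
  show int: "integrable lborel (\<lambda>z. indicator {0..} z * (u z * v z))"
    by (rule Bochner_Integration.integrable_bound[OF i]) (use order_trans[OF b abs_ge_self] in \<open>auto intro!: AE_I2\<close>)
  have "\<bar>half_int u v\<bar> \<le> (LINT z|lborel. (A * B) * (indicator {0..} z * exp (- (2 * d) * z)))"
    unfolding half_int_def set_lebesgue_integral_def real_scaleR_def by (rule norm_integral_le[OF int i]) (rule b)
  also have "\<dots> = A * B * half_int_const d" unfolding half_int_const_def by (rule integral_mult_right_zero)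
  finally show "\<bar>half_int u v\<bar> \<le> A * B * half_int_const d" .
qed

lemma half_int_diff_left:
  assumes d: "d > 0" and u: "exp_decay d A u" "exp_decay d A' u'" and v: "exp_decay d B v"
  shows "half_int (\<lambda>z. u z - u' z) v = half_int u v - half_int u' v"
  using Bochner_Integration.integral_diff[OF half_int_bound(1)[OF d u(1) v] half_int_bound(1)[OF d u(2) v]]
  by (simp add: half_int_def set_lebesgue_integral_def algebra_simps)

lemma half_int_commute: "half_int u v = half_int v u" by (simp add: half_int_def mult.commute)

lemma half_int_sum_left:
  assumes d: "d > 0" and u: "\<And>i. i \<in> I \<Longrightarrow> exp_decay d (A i) (u i)" and v: "exp_decay d B v"
  shows "half_int (\<lambda>z. \<Sum>i\<in>I. c i * u i z) v = (\<Sum>i\<in>I. c i * half_int (u i) v)"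
proof -
  have "(\<lambda>z. indicat_real {0..} z *\<^sub>R ((\<Sum>i\<in>I. c i * u i z) * v z)) = (\<lambda>z. \<Sum>i\<in>I. c i * (indicat_real {0..} z * (u i z * v z)))"
    by (simp add: sum_distrib_left sum_distrib_right mult_ac)
  then have "half_int (\<lambda>z. \<Sum>i\<in>I. c i * u i z) v = (LINT z|lborel. (\<Sum>i\<in>I. c i * (indicat_real {0..} z * (u i z * v z))))"
    by (simp only: half_int_def set_lebesgue_integral_def)
  also have "\<dots> = (\<Sum>i\<in>I. LINT z|lborel. c i * (indicat_real {0..} z * (u i z * v z)))"
    by (intro Bochner_Integration.integral_sum integrable_mult_right half_int_bound(1)[OF d u v])
  also have "\<dots> = (\<Sum>i\<in>I. c i * half_int (u i) v)" by (simp add: half_int_def set_lebesgue_integral_def)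
  finally show ?thesis .
qed

lemma half_int_zero_left: "half_int (\<lambda>z. 0) v = 0" by (simp add: half_int_def)

text \<open>The analogue of \<open>exp_decay\<close> for kernels.\<close>

definition exp_decay2 :: "real \<Rightarrow> real \<Rightarrow> (real \<Rightarrow> real \<Rightarrow> real) \<Rightarrow> bool" where
  "exp_decay2 d A b \<longleftrightarrow> 0 \<le> A \<and> (\<lambda>(y, z). b y z) \<in> borel_measurable (borel \<Otimes>\<^sub>M borel) \<and>
     (\<forall>y\<ge>0. \<forall>z\<ge>0. \<bar>b y z\<bar> \<le> A * exp (- d * y) * exp (- d * z))"

lemma exp_decay2D:
  assumes "exp_decay2 d A b"
  shows "0 \<le> A" "(\<lambda>(y, z). b y z) \<in> borel_measurable (borel \<Otimes>\<^sub>M borel)" "0 \<le> y \<Longrightarrow> exp_decay d (A * exp (- d * y)) (b y)"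
    "exp_decay d A (\<lambda>y. b y 0)"
proof -
  show m: "(\<lambda>(y, z). b y z) \<in> borel_measurable (borel \<Otimes>\<^sub>M borel)" and A: "0 \<le> A" using assms by (auto simp: exp_decay2_def)
  have bd: "\<bar>b y z\<bar> \<le> A * exp (- d * y) * exp (- d * z)" if "0 \<le> y" "0 \<le> z" for y z
    using assms that by (auto simp: exp_decay2_def)
  have "b y \<in> borel_measurable borel" for y by (rule measurable_section2[OF m]) auto
  then show "exp_decay d (A * exp (- d * y)) (b y)" if "0 \<le> y" using A bd[OF that] by (simp add: exp_decay_def)
  have "(\<lambda>y. b y 0) \<in> borel_measurable borel" by (rule measurable_section2[OF m]) auto
  then show "exp_decay d A (\<lambda>y. b y 0)" using A bd[of _ 0] by (simp add: exp_decay_def)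
qed

lemma exp_decay_resolvent_coeff:
  assumes d: "d > 0" and b: "\<And>n. exp_decay2 d (C n) (b n)"
  shows "\<exists>A. exp_decay d A (resolvent_coeff b n)"
proof (induction n rule: less_induct)
  case (less n)
  then have "\<forall>j\<in>{..<n}. \<exists>A. exp_decay d A (resolvent_coeff b j)" by auto
  then obtain A where A: "\<And>j. j < n \<Longrightarrow> exp_decay d (A j) (resolvent_coeff b j)" unfolding bchoice_iff by auto
  have v: "resolvent_coeff b n = (\<lambda>r. b n r 0 - (\<Sum>j<n. half_int (b (n - j) r) (resolvent_coeff b j)))"
    by (intro ext, subst resolvent_coeff.simps) (simp add: half_int_def)
  have "exp_decay d (C n + (\<Sum>j<n. C (n - j) * A j * half_int_const d)) (resolvent_coeff b n)"
    unfolding v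
  proof (intro exp_decay_diff exp_decay_sum exp_decay2D(4)[OF b])
    fix j assume "j \<in> {..<n}"
    then have j: "exp_decay d (A j) (resolvent_coeff b j)" by (intro A) simp
    show "exp_decay d (C (n - j) * A j * half_int_const d) (\<lambda>r. half_int (b (n - j) r) (resolvent_coeff b j))"
      unfolding exp_decay_def
    proof (intro conjI allI impI)
      show "0 \<le> C (n - j) * A j * half_int_const d" using exp_decay2D(1)[OF b] exp_decayD(1)[OF j] half_int_const_nonneg by simp
      have "(\<lambda>(r, z). indicat_real {0..} z * (b (n - j) r z * resolvent_coeff b j z)) \<in> borel_measurable (borel \<Otimes>\<^sub>M lborel)"
      proof -
        have [measurable]: "resolvent_coeff b j \<in> borel_measurable borel" by (rule exp_decayD(2)[OF j])
        have [measurable]: "(\<lambda>p. b (n - j) (fst p) (snd p)) \<in> borel_measurable (borel \<Otimes>\<^sub>M borel)"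
          using exp_decay2D(2)[OF b] by (simp add: case_prod_beta')
        have [measurable]: "(\<lambda>q :: real \<times> real. indicat_real {0..} (snd q)) \<in> borel_measurable (borel \<Otimes>\<^sub>M borel)"
          by (rule measurable_compose[OF measurable_snd]) measurable
        have "(\<lambda>(r, z). indicat_real {0..} z * (b (n - j) r z * resolvent_coeff b j z)) \<in> borel_measurable (borel \<Otimes>\<^sub>M borel)"
          unfolding case_prod_beta' by measurable
        then show ?thesis by simp
      qed
      then show "(\<lambda>r. half_int (b (n - j) r) (resolvent_coeff b j)) \<in> borel_measurable borel"
        unfolding half_int_def set_lebesgue_integral_def real_scaleR_def by (rule lborel.borel_measurable_lebesgue_integral)
      fix y :: real assume "0 \<le> y"
      from half_int_bound(2)[OF d exp_decay2D(3)[OF b[of "n - j"] this] j]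
      show "\<bar>half_int (b (n - j) y) (resolvent_coeff b j)\<bar> \<le> C (n - j) * A j * half_int_const d * exp (- d * y)" by (simp only: mult_ac)
    qed
  qed
  then show ?case by blast
qed

text \<open>
  The products \<open>I n j\<close> with \<open>n + j \<le> M\<close> are those that occur in the recursion for the
  coefficients; the rest has degree greater than \<open>M\<close>.
\<close>

lemma triangle_sum:
  fixes s :: real
  assumes I0: "\<And>j. I 0 j = 0"
  shows "(\<Sum>n\<le>M. s ^ n * (\<Sum>j<n. I (n - j) j)) - (\<Sum>n\<le>M. \<Sum>j<M. s ^ n * (s ^ j * I n j))
     = - (\<Sum>p\<in>{p \<in> {..M} \<times> {..<M}. M < fst p + snd p}. s ^ (fst p + snd p) * I (fst p) (snd p))"
proof -
  define T where "T p = s ^ (fst p + snd p) * I (fst p) (snd p)" for p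
  have "(\<Sum>n\<le>M. s ^ n * (\<Sum>j<n. I (n - j) j)) = (\<Sum>n\<le>M. \<Sum>j<n. T (n - j, j))"
    by (simp add: T_def sum_distrib_left)
  also have "\<dots> = (\<Sum>q\<in>(SIGMA n:{..M}. {..<n}). T (fst q - snd q, snd q))"
    by (subst sum.Sigma) (auto simp: case_prod_beta')
  also have "\<dots> = (\<Sum>p\<in>{p \<in> {..M} \<times> {..<M}. 0 < fst p \<and> fst p + snd p \<le> M}. T p)"
    by (rule sum.reindex_bij_witness[where i = "\<lambda>p. (fst p + snd p, snd p)" and j = "\<lambda>q. (fst q - snd q, snd q)"]) auto
  also have "\<dots> = (\<Sum>p\<in>{p \<in> {..M} \<times> {..<M}. fst p + snd p \<le> M}. T p)"
  proof (rule sum.mono_neutral_left)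
    show "finite {p \<in> {..M} \<times> {..<M}. fst p + snd p \<le> M}" by (rule finite_subset[of _ "{..M} \<times> {..<M}"]) auto
    show "\<forall>p\<in>{p \<in> {..M} \<times> {..<M}. fst p + snd p \<le> M} - {p \<in> {..M} \<times> {..<M}. 0 < fst p \<and> fst p + snd p \<le> M}. T p = 0"
      using I0 by (auto simp: T_def) (metis gr0I I0)
  qed auto
  finally have 1: "(\<Sum>n\<le>M. s ^ n * (\<Sum>j<n. I (n - j) j)) = (\<Sum>p\<in>{p \<in> {..M} \<times> {..<M}. fst p + snd p \<le> M}. T p)" .
  have "(\<Sum>n\<le>M. \<Sum>j<M. s ^ n * (s ^ j * I n j)) = (\<Sum>p\<in>{..M} \<times> {..<M}. T p)"
    by (simp add: sum.cartesian_product T_def power_add mult.assoc case_prod_beta')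
  also have "{..M} \<times> {..<M} = {p \<in> {..M} \<times> {..<M}. fst p + snd p \<le> M} \<union> {p \<in> {..M} \<times> {..<M}. M < fst p + snd p}" by auto
  also have "sum T \<dots> = (\<Sum>p\<in>{p \<in> {..M} \<times> {..<M}. fst p + snd p \<le> M}. T p) + (\<Sum>p\<in>{p \<in> {..M} \<times> {..<M}. M < fst p + snd p}. T p)"
    by (rule sum.union_disjoint) (auto intro: finite_subset[of _ "{..M} \<times> {..<M}"])
  finally show ?thesis unfolding 1 by (simp add: T_def)
qed

text \<open>
  If the kernels \<open>B s\<close> have an asymptotic expansion in powers of \<open>s\<close>, uniformly in the
  exponentially weighted norm, then so has the solution of the resolvent equation, and its
  coefficients are \<open>resolvent_coeff\<close>. No convergence is claimed; in the application the
  expansion diverges in general.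
\<close>

lemma resolvent_asymptotics:
  fixes B :: "real \<Rightarrow> real \<Rightarrow> real \<Rightarrow> real"
  assumes d: "d > 0" and \<Sigma>: "\<And>s. s \<in> \<Sigma> \<Longrightarrow> \<bar>s\<bar> \<le> 1"
    and b: "\<And>n. exp_decay2 d (C n) (b n)" and b0: "b 0 = (\<lambda>y z. 0)"
    and B: "\<And>s y. s \<in> \<Sigma> \<Longrightarrow> 0 \<le> y \<Longrightarrow> B s y \<in> borel_measurable borel"
    and BE: "\<And>N. \<exists>K. \<forall>s\<in>\<Sigma>. \<forall>y\<ge>0. \<forall>z\<ge>0.
       \<bar>B s y z - (\<Sum>n\<le>N. s ^ n * b n y z)\<bar> \<le> K * \<bar>s\<bar> ^ Suc N * exp (- d * y) * exp (- d * z)"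
    and \<rho>: "\<And>s. s \<in> \<Sigma> \<Longrightarrow> exp_decay d R (\<rho> s)"
    and eq: "\<And>s y. s \<in> \<Sigma> \<Longrightarrow> 0 \<le> y \<Longrightarrow> \<rho> s y = B s y 0 - half_int (B s y) (\<rho> s)"
  shows "\<exists>K. \<forall>s\<in>\<Sigma>. \<forall>y\<ge>0. \<bar>\<rho> s y - (\<Sum>n<N. s ^ n * resolvent_coeff b n y)\<bar> \<le> K * \<bar>s\<bar> ^ N * exp (- d * y)"
proof (induction N)
  case 0
  show ?case using exp_decayD(3)[OF \<rho>] by (intro exI[of _ R]) simp
next
  case (Suc N)
  have "\<exists>A. \<forall>n. exp_decay d (A n) (resolvent_coeff b n)" by (intro choice allI exp_decay_resolvent_coeff[OF d b])
  then obtain A where A: "\<And>n. exp_decay d (A n) (resolvent_coeff b n)" by blast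
  obtain K0 where K0: "\<And>s y. s \<in> \<Sigma> \<Longrightarrow> 0 \<le> y \<Longrightarrow> \<bar>\<rho> s y - (\<Sum>n<N. s ^ n * resolvent_coeff b n y)\<bar> \<le> K0 * \<bar>s\<bar> ^ N * exp (- d * y)"
    using Suc by blast
  obtain K1 where K1: "\<And>s y z. s \<in> \<Sigma> \<Longrightarrow> 0 \<le> y \<Longrightarrow> 0 \<le> z \<Longrightarrow>
      \<bar>B s y z - (\<Sum>n\<le>N. s ^ n * b n y z)\<bar> \<le> K1 * \<bar>s\<bar> ^ Suc N * exp (- d * y) * exp (- d * z)"
    using BE[of N] by blast
  define P where "P = {p \<in> {..N} \<times> {..<N}. N < fst p + snd p}"
  define K where "K = \<bar>K1\<bar> + \<bar>K1\<bar> * R * half_int_const d + (\<Sum>n\<le>N. C n) * \<bar>K0\<bar> * half_int_const d + (\<Sum>p\<in>P. C (fst p) * A (snd p) * half_int_const d)"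
  have "\<bar>\<rho> s y - (\<Sum>n<Suc N. s ^ n * resolvent_coeff b n y)\<bar> \<le> K * \<bar>s\<bar> ^ Suc N * exp (- d * y)" if s: "s \<in> \<Sigma>" and y: "0 \<le> y" for s y
  proof -
    define Q where "Q z = (\<Sum>n\<le>N. s ^ n * b n y z)" for z
    define V where "V z = (\<Sum>n<N. s ^ n * resolvent_coeff b n z)" for z
    let ?e = "exp (- d * y)"
    note s1 = \<Sigma>[OF s]
    have bn: "exp_decay d (C n * ?e) (b n y)" for n by (rule exp_decay2D(3)[OF b y])
    have Qd: "exp_decay d (\<Sum>n\<le>N. \<bar>s ^ n\<bar> * (C n * ?e)) Q" unfolding Q_def by (intro exp_decay_sum exp_decay_scale bn)
    have Vd: "exp_decay d (\<Sum>n<N. \<bar>s ^ n\<bar> * A n) V" unfolding V_def by (intro exp_decay_sum exp_decay_scale A)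
    have Qs: "exp_decay d (\<bar>s\<bar> * (\<Sum>n\<le>N. C n) * ?e) Q"
      unfolding exp_decay_def
    proof (intro conjI allI impI)
      show "0 \<le> \<bar>s\<bar> * (\<Sum>n\<le>N. C n) * ?e" using exp_decay2D(1)[OF b] by (intro mult_nonneg_nonneg sum_nonneg) auto
      show "Q \<in> borel_measurable borel" by (rule exp_decayD(2)[OF Qd])
      fix z :: real assume z: "0 \<le> z"
      have "\<bar>s ^ n * b n y z\<bar> \<le> \<bar>s\<bar> * (C n * ?e * exp (- d * z))" for n
      proof (cases "n = 0")
        case True then show ?thesis using exp_decay2D(1)[OF b, of 0] by (simp add: b0)
      next
        case False
        have "\<bar>s\<bar> ^ n \<le> \<bar>s\<bar> ^ 1" using False s1 by (intro power_decreasing) auto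
        then show ?thesis unfolding abs_mult power_abs using exp_decayD(3)[OF bn z, of n] by (intro mult_mono) auto
      qed
      then have "\<bar>Q z\<bar> \<le> (\<Sum>n\<le>N. \<bar>s\<bar> * (C n * ?e * exp (- d * z)))"
        unfolding Q_def by (intro order_trans[OF sum_abs] sum_mono)
      then show "\<bar>Q z\<bar> \<le> \<bar>s\<bar> * (\<Sum>n\<le>N. C n) * ?e * exp (- d * z)" by (simp add: sum_distrib_left sum_distrib_right mult.assoc)
    qed
    have E: "exp_decay d (\<bar>K1\<bar> * \<bar>s\<bar> ^ Suc N * ?e) (\<lambda>z. B s y z - Q z)"
      unfolding exp_decay_def
    proof (intro conjI allI impI)
      show "(\<lambda>z. B s y z - Q z) \<in> borel_measurable borel" using B[OF s y] exp_decayD(2)[OF Qd] by measurable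
      fix z :: real assume z: "0 \<le> z"
      have "K1 * \<bar>s\<bar> ^ Suc N * ?e * exp (- d * z) \<le> \<bar>K1\<bar> * \<bar>s\<bar> ^ Suc N * ?e * exp (- d * z)"
        by (intro mult_right_mono) auto
      then show "\<bar>B s y z - Q z\<bar> \<le> \<bar>K1\<bar> * \<bar>s\<bar> ^ Suc N * ?e * exp (- d * z)"
        using K1[OF s y z] unfolding Q_def by linarith
    qed auto
    have F: "exp_decay d (\<bar>K0\<bar> * \<bar>s\<bar> ^ N) (\<lambda>z. \<rho> s z - V z)"
      unfolding exp_decay_def
    proof (intro conjI allI impI)
      show "(\<lambda>z. \<rho> s z - V z) \<in> borel_measurable borel" using exp_decayD(2)[OF \<rho>[OF s]] exp_decayD(2)[OF Vd] by measurable
      fix z :: real assume z: "0 \<le> z"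
      have "K0 * \<bar>s\<bar> ^ N * exp (- d * z) \<le> \<bar>K0\<bar> * \<bar>s\<bar> ^ N * exp (- d * z)" by (intro mult_right_mono) auto
      then show "\<bar>\<rho> s z - V z\<bar> \<le> \<bar>K0\<bar> * \<bar>s\<bar> ^ N * exp (- d * z)" using K0[OF s z] unfolding V_def by linarith
    qed auto
    have Bd: "exp_decay d (\<bar>K1\<bar> * \<bar>s\<bar> ^ Suc N * ?e + \<bar>s\<bar> * (\<Sum>n\<le>N. C n) * ?e) (B s y)"
    proof -
      have "exp_decay d (\<bar>K1\<bar> * \<bar>s\<bar> ^ Suc N * ?e + \<bar>s\<bar> * (\<Sum>n\<le>N. C n) * ?e) (\<lambda>z. (B s y z - Q z) - - 1 * Q z)"
        using exp_decay_diff[OF E exp_decay_scale[OF Qs, of "- 1"]] by simp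
      then show ?thesis by simp
    qed
    have h1: "half_int (\<lambda>z. B s y z - Q z) (\<rho> s) = half_int (B s y) (\<rho> s) - half_int Q (\<rho> s)" by (rule half_int_diff_left[OF d Bd Qs \<rho>[OF s]])
    have h2: "half_int (\<lambda>z. \<rho> s z - V z) Q = half_int (\<rho> s) Q - half_int V Q" by (rule half_int_diff_left[OF d \<rho>[OF s] Vd Qs])
    define I where "I n j = half_int (b n y) (resolvent_coeff b j)" for n j
    have h3: "half_int V Q = (\<Sum>n\<le>N. \<Sum>j<N. s ^ n * (s ^ j * I n j))"
    proof -
      have "half_int V Q = half_int Q V" by (rule half_int_commute)
      also have "\<dots> = (\<Sum>n\<le>N. s ^ n * half_int (b n y) V)" unfolding Q_def by (rule half_int_sum_left[OF d bn Vd])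
      also have "\<dots> = (\<Sum>n\<le>N. s ^ n * (\<Sum>j<N. s ^ j * I n j))"
      proof (intro sum.cong refl arg_cong2[where f = "(*)"])
        fix n
        have "half_int (b n y) V = half_int V (b n y)" by (rule half_int_commute)
        also have "\<dots> = (\<Sum>j<N. s ^ j * half_int (resolvent_coeff b j) (b n y))" unfolding V_def by (rule half_int_sum_left[OF d A bn])
        finally show "half_int (b n y) V = (\<Sum>j<N. s ^ j * I n j)" by (simp add: I_def half_int_commute)
      qed
      finally show ?thesis by (simp add: sum_distrib_left)
    qed
    have I0: "I 0 j = 0" for j unfolding I_def b0 by (rule half_int_zero_left)
    have v: "resolvent_coeff b n y = b n y 0 - (\<Sum>j<n. I (n - j) j)" for n
      by (subst resolvent_coeff.simps) (simp add: half_int_def I_def)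
    have v2: "(\<Sum>n<Suc N. s ^ n * resolvent_coeff b n y) = Q 0 - (\<Sum>n\<le>N. s ^ n * (\<Sum>j<n. I (n - j) j))"
      by (simp add: lessThan_Suc_atMost v right_diff_distrib sum_subtractf Q_def)
    have tri: "(\<Sum>n\<le>N. s ^ n * (\<Sum>j<n. I (n - j) j)) - half_int V Q = - (\<Sum>p\<in>P. s ^ (fst p + snd p) * I (fst p) (snd p))"
      unfolding h3 P_def by (rule triangle_sum) (rule I0)
    \<comment> \<open>The error of order \<open>N + 1\<close>: the remainder of the kernel, once directly and once
    against \<open>\<rho>\<close>, the previous error against the expansion of the kernel, which starts in
    degree 1, and the products of degree greater than \<open>N\<close>.\<close>
    have split: "\<rho> s y - (\<Sum>n<Suc N. s ^ n * resolvent_coeff b n y) = (B s y 0 - Q 0) - half_int (\<lambda>z. B s y z - Q z) (\<rho> s)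
        - half_int (\<lambda>z. \<rho> s z - V z) Q - (\<Sum>p\<in>P. s ^ (fst p + snd p) * I (fst p) (snd p))"
      unfolding eq[OF s y] v2 h1 h2 using tri half_int_commute[of Q "\<rho> s"] by linarith
    have t1: "\<bar>B s y 0 - Q 0\<bar> \<le> \<bar>K1\<bar> * \<bar>s\<bar> ^ Suc N * ?e" using exp_decayD(3)[OF E, of 0] by simp
    have t2: "\<bar>half_int (\<lambda>z. B s y z - Q z) (\<rho> s)\<bar> \<le> (\<bar>K1\<bar> * \<bar>s\<bar> ^ Suc N * ?e) * R * half_int_const d" by (rule half_int_bound(2)[OF d E \<rho>[OF s]])
    have t3: "\<bar>half_int (\<lambda>z. \<rho> s z - V z) Q\<bar> \<le> (\<bar>K0\<bar> * \<bar>s\<bar> ^ N) * (\<bar>s\<bar> * (\<Sum>n\<le>N. C n) * ?e) * half_int_const d" by (rule half_int_bound(2)[OF d F Qs])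
    have t4: "\<bar>\<Sum>p\<in>P. s ^ (fst p + snd p) * I (fst p) (snd p)\<bar> \<le> (\<Sum>p\<in>P. \<bar>s\<bar> ^ Suc N * (C (fst p) * ?e * A (snd p) * half_int_const d))"
    proof (rule order_trans[OF sum_abs sum_mono])
      fix p assume p: "p \<in> P"
      have "\<bar>s\<bar> ^ (fst p + snd p) \<le> \<bar>s\<bar> ^ Suc N" using p s1 by (intro power_decreasing) (auto simp: P_def)
      moreover have "\<bar>I (fst p) (snd p)\<bar> \<le> C (fst p) * ?e * A (snd p) * half_int_const d" unfolding I_def by (rule half_int_bound(2)[OF d bn A])
      ultimately show "\<bar>s ^ (fst p + snd p) * I (fst p) (snd p)\<bar> \<le> \<bar>s\<bar> ^ Suc N * (C (fst p) * ?e * A (snd p) * half_int_const d)"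
        unfolding abs_mult power_abs by (intro mult_mono) auto
    qed
    have "K * \<bar>s\<bar> ^ Suc N * ?e = \<bar>K1\<bar> * \<bar>s\<bar> ^ Suc N * ?e + (\<bar>K1\<bar> * \<bar>s\<bar> ^ Suc N * ?e) * R * half_int_const d
        + (\<bar>K0\<bar> * \<bar>s\<bar> ^ N) * (\<bar>s\<bar> * (\<Sum>n\<le>N. C n) * ?e) * half_int_const d + (\<Sum>p\<in>P. \<bar>s\<bar> ^ Suc N * (C (fst p) * ?e * A (snd p) * half_int_const d))"
    proof -
      have "(\<Sum>p\<in>P. \<bar>s\<bar> ^ Suc N * (C (fst p) * ?e * A (snd p) * half_int_const d)) = (\<Sum>p\<in>P. C (fst p) * A (snd p) * half_int_const d) * (\<bar>s\<bar> ^ Suc N * ?e)"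
        unfolding sum_distrib_right by (intro sum.cong refl) (simp only: mult_ac)
      moreover have "(k1 + k1 * R * h + c * k0 * h + p) * (x * xN) * e = k1 * (x * xN) * e + (k1 * (x * xN) * e) * R * h
          + (k0 * xN) * (x * c * e) * h + p * ((x * xN) * e)" for k1 h c k0 p x xN e
        by (simp add: algebra_simps)
      ultimately show ?thesis unfolding K_def power_Suc by simp
    qed
    then show ?thesis unfolding split using t1 t2 t3 t4 by linarith
  qed
  then show ?case by blast
qed

section \<open>Expansion of the conjugated kernel\<close>

text \<open>
  Near \<open>0\<close> the remainder is the tail of the power series; away from \<open>0\<close> all terms are
  bounded by a multiple of \<open>\<bar>x\<bar>^K\<close>.
\<close>

lemma power_series_remainder:
  fixes p :: "real \<Rightarrow> real"
  assumes s: "\<forall>\<^sub>F x in at_left 0. (\<lambda>n. a (Suc n) * x ^ Suc n) sums p x"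
    and gr: "\<And>x. x \<le> 0 \<Longrightarrow> \<bar>p x\<bar> \<le> C * (1 + \<bar>x\<bar>) ^ k"
  obtains T K where "0 \<le> T" "Suc N \<le> K"
    "\<And>x. x < 0 \<Longrightarrow> \<bar>p x - (\<Sum>n<N. a (Suc n) * x ^ Suc n)\<bar> \<le> T * (\<bar>x\<bar> ^ Suc N + \<bar>x\<bar> ^ K)"
proof -
  obtain e0 where e0: "e0 < 0" "\<And>x. e0 < x \<Longrightarrow> x < 0 \<Longrightarrow> (\<lambda>n. a (Suc n) * x ^ Suc n) sums p x"
    using s unfolding eventually_at_left_field by blast
  define d where "d = - e0 / 2"
  have d: "d > 0" using e0(1) by (simp add: d_def)
  have "summable (\<lambda>n. a (Suc n) * (- d) ^ Suc n)" using e0(1) by (intro sums_summable[OF e0(2)]) (auto simp: d_def)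
  then have "Bseq (\<lambda>n. a (Suc n) * (- d) ^ Suc n)" by (intro convergent_imp_Bseq convergentI[of _ 0] summable_LIMSEQ_zero)
  then obtain B where B: "B > 0" "\<And>n. norm (a (Suc n) * (- d) ^ Suc n) \<le> B" by (auto simp: Bseq_def)
  have Bn: "\<bar>a (Suc n)\<bar> * d ^ Suc n \<le> B" for n using B(2)[of n] d by (simp add: abs_mult power_abs)
  have near: "\<bar>p x - (\<Sum>n<N. a (Suc n) * x ^ Suc n)\<bar> \<le> (2 * B / d ^ Suc N) * \<bar>x\<bar> ^ Suc N" if x: "x < 0" "\<bar>x\<bar> \<le> d / 2" for x
  proof -
    define q where "q = \<bar>x\<bar> / d"
    have q: "0 \<le> q" "q \<le> 1 / 2" using x d by (auto simp: q_def field_simps)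
    have "(\<lambda>n. a (Suc n) * x ^ Suc n) sums p x" using x d by (intro e0(2)) (auto simp: d_def)
    then have su: "(\<lambda>n. a (Suc (n + N)) * x ^ Suc (n + N)) sums (p x - (\<Sum>n<N. a (Suc n) * x ^ Suc n))"
      by (rule sums_split_initial_segment)
    have tb: "norm (a (Suc (n + N)) * x ^ Suc (n + N)) \<le> (B * q ^ Suc N) * (1 / 2) ^ n" for n
    proof -
      have "norm (a (Suc (n + N)) * x ^ Suc (n + N)) = (\<bar>a (Suc (n + N))\<bar> * d ^ Suc (n + N)) * q ^ Suc (n + N)"
        using d by (simp add: q_def abs_mult power_abs power_divide)
      also have "\<dots> \<le> B * q ^ Suc (n + N)" using Bn[of "n + N"] q by (intro mult_right_mono) auto
      also have "\<dots> = (B * q ^ Suc N) * q ^ n" by (simp add: power_add)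
      also have "\<dots> \<le> (B * q ^ Suc N) * (1 / 2) ^ n" using q B(1) by (intro mult_left_mono power_mono) auto
      finally show ?thesis .
    qed
    have gs: "(\<lambda>n. (B * q ^ Suc N) * (1 / 2) ^ n) sums ((B * q ^ Suc N) * 2)"
      using sums_mult[OF geometric_sums[of "1 / 2 :: real"], of "B * q ^ Suc N"] by simp
    have "norm (p x - (\<Sum>n<N. a (Suc n) * x ^ Suc n)) \<le> (B * q ^ Suc N) * 2"
      unfolding sums_unique[OF su] sums_unique[OF gs] by (rule norm_suminf_le[OF tb sums_summable[OF gs]])
    also have "\<dots> = (2 * B / d ^ Suc N) * \<bar>x\<bar> ^ Suc N" unfolding q_def power_divide by simp
    finally show ?thesis by simp
  qed
  define K where "K = max k (Suc N)"
  define e where "e = d / 2"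
  have e: "e > 0" using d by (simp add: e_def)
  define W where "W = (\<bar>C\<bar> + (\<Sum>n<N. \<bar>a (Suc n)\<bar>)) * (1 / e + 1) ^ K"
  have far: "\<bar>p x - (\<Sum>n<N. a (Suc n) * x ^ Suc n)\<bar> \<le> W * \<bar>x\<bar> ^ K" if x: "x < 0" "e \<le> \<bar>x\<bar>" for x
  proof -
    have m: "(1 + \<bar>x\<bar>) ^ n \<le> (1 + \<bar>x\<bar>) ^ K" if "n \<le> K" for n using that by (intro power_increasing) auto
    have "\<bar>p x\<bar> \<le> C * (1 + \<bar>x\<bar>) ^ k" using x by (intro gr) auto
    also have "\<dots> \<le> \<bar>C\<bar> * (1 + \<bar>x\<bar>) ^ K" using m[of k] by (intro mult_mono) (auto simp: K_def)
    finally have 1: "\<bar>p x\<bar> \<le> \<bar>C\<bar> * (1 + \<bar>x\<bar>) ^ K" .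
    have 2: "\<bar>\<Sum>n<N. a (Suc n) * x ^ Suc n\<bar> \<le> (\<Sum>n<N. \<bar>a (Suc n)\<bar> * (1 + \<bar>x\<bar>) ^ K)"
    proof (rule order_trans[OF sum_abs sum_mono])
      fix n assume n: "n \<in> {..<N}"
      have "\<bar>x\<bar> ^ Suc n \<le> (1 + \<bar>x\<bar>) ^ Suc n" by (intro power_mono) auto
      also have "\<dots> \<le> (1 + \<bar>x\<bar>) ^ K" using n by (intro m) (auto simp: K_def)
      finally show "\<bar>a (Suc n) * x ^ Suc n\<bar> \<le> \<bar>a (Suc n)\<bar> * (1 + \<bar>x\<bar>) ^ K"
        unfolding abs_mult power_abs by (intro mult_left_mono) auto
    qed
    have "1 + \<bar>x\<bar> \<le> (1 / e + 1) * \<bar>x\<bar>" using x e by (simp add: field_simps)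
    then have "(1 + \<bar>x\<bar>) ^ K \<le> ((1 / e + 1) * \<bar>x\<bar>) ^ K" by (intro power_mono) auto
    then have 3: "(\<bar>C\<bar> + (\<Sum>n<N. \<bar>a (Suc n)\<bar>)) * (1 + \<bar>x\<bar>) ^ K \<le> (\<bar>C\<bar> + (\<Sum>n<N. \<bar>a (Suc n)\<bar>)) * ((1 / e + 1) * \<bar>x\<bar>) ^ K"
      by (intro mult_left_mono) (auto intro!: add_nonneg_nonneg sum_nonneg)
    have "\<bar>p x - (\<Sum>n<N. a (Suc n) * x ^ Suc n)\<bar> \<le> \<bar>C\<bar> * (1 + \<bar>x\<bar>) ^ K + (\<Sum>n<N. \<bar>a (Suc n)\<bar> * (1 + \<bar>x\<bar>) ^ K)"
      using 1 2 by linarith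
    also have "\<dots> = (\<bar>C\<bar> + (\<Sum>n<N. \<bar>a (Suc n)\<bar>)) * (1 + \<bar>x\<bar>) ^ K" by (simp only: distrib_right sum_distrib_right)
    also note 3
    finally show ?thesis unfolding W_def power_mult_distrib by (simp only: mult.assoc)
  qed
  have W: "0 \<le> W" unfolding W_def using e by (intro mult_nonneg_nonneg add_nonneg_nonneg sum_nonneg) auto
  define V where "V = 2 * B / d ^ Suc N"
  have V: "0 \<le> V" using B d by (simp add: V_def)
  have "\<bar>p x - (\<Sum>n<N. a (Suc n) * x ^ Suc n)\<bar> \<le> (V + W) * (\<bar>x\<bar> ^ Suc N + \<bar>x\<bar> ^ K)" if x: "x < 0" for x
  proof -
    have nn: "0 \<le> V * \<bar>x\<bar> ^ Suc N" "0 \<le> V * \<bar>x\<bar> ^ K" "0 \<le> W * \<bar>x\<bar> ^ Suc N" "0 \<le> W * \<bar>x\<bar> ^ K"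
      using V W by (auto intro!: mult_nonneg_nonneg)
    show ?thesis
    proof (cases "\<bar>x\<bar> \<le> d / 2")
      case True
      show ?thesis using near[OF x True] nn unfolding V_def[symmetric] distrib_left distrib_right by linarith
    next
      case False
      then have "e \<le> \<bar>x\<bar>" by (simp add: e_def)
      then show ?thesis using far[OF x] nn unfolding distrib_left distrib_right by linarith
    qed
  qed
  then show thesis using V W by (intro that[of "V + W" K]) (auto simp: K_def)
qed

lemma coeff_kernel_airy_conj:
  assumes c: "c > 0"
  shows "coeff_kernel a c n = (if n = 0 then (\<lambda>r s. 0) else airy_conj (\<lambda>x. a n * exp (real n * c * x)))"
proof (cases "n = 0")
  case False
  then have nc: "real n * c > 0" using c by simp
  have "coeff_kernel a c n r s = airy_conj (\<lambda>x. a n * exp (real n * c * x)) r s" for r s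
  proof -
    have "airy_conj (\<lambda>x. a n * exp (real n * c * x)) r s = (LINT x|lborel. a n * (exp (real n * c * x) * (Airy_Ai (x + r) * Airy_Ai (x + s))))"
      unfolding airy_conj_def by (simp only: mult.assoc add.commute)
    also have "\<dots> = a n * (LINT x|lborel. exp (real n * c * x) * (Airy_Ai (x + r) * Airy_Ai (x + s)))"
      by (rule integral_mult_right_zero)
    finally show ?thesis unfolding Airy_product_integral[OF nc] using False by (simp add: coeff_kernel_def)
  qed
  then show ?thesis using False by (auto intro!: ext)
qed (auto simp: coeff_kernel_def intro!: ext)

lemma weight_r_exp:
  assumes "c > 0" "k \<ge> (1 :: nat)" "0 \<le> r"
  shows "weight_r c k r \<le> 2 * exp (- (c / 4) * r)"
proof -
  have "1 * (c * r) \<le> real k * (c * r)" using assms by (intro mult_right_mono) auto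
  moreover have "c / 4 * r \<le> c * r" using assms by simp
  ultimately have "- (real k * c) * r \<le> - (c / 4) * r" by simp
  then have "exp (- (real k * c) * r) \<le> exp (- (c / 4) * r)" by (simp only: exp_le_cancel_iff)
  then show ?thesis by (simp add: weight_r_def)
qed

lemma airy_conj_exp_bound:
  assumes c: "c > 0" and k: "k \<ge> (1 :: nat)"
  obtains G where "0 \<le> G" "\<And>f A r s. f \<in> borel_measurable borel \<Longrightarrow> 0 \<le> A \<Longrightarrow> (\<And>x. \<bar>f x\<bar> \<le> A * growth_env c k x) \<Longrightarrow> 0 \<le> r \<Longrightarrow> 0 \<le> s
     \<Longrightarrow> \<bar>airy_conj f r s\<bar> \<le> G * A * exp (- (c / 4) * r) * exp (- (c / 4) * s)"
proof -
  obtain D where D: "D > 0" "\<And>r x. \<bar>Airy_Ai (r + x)\<bar> \<le> D * weight_r c k r * weight_x c k x" using Airy_weight[OF c k] by auto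
  define J where "J = (LINT x|lborel. growth_env c k x * (weight_x c k x)\<^sup>2)"
  have J: "0 \<le> J" unfolding J_def using weight_pos by (intro Bochner_Integration.integral_nonneg mult_nonneg_nonneg) (auto simp: less_imp_le)
  show thesis
  proof (rule that[of "4 * D\<^sup>2 * J"])
    fix f :: "real \<Rightarrow> real" and A r s :: real
    assume f: "f \<in> borel_measurable borel" "0 \<le> A" "\<And>x. \<bar>f x\<bar> \<le> A * growth_env c k x" and rs: "0 \<le> r" "0 \<le> s"
    have "\<bar>airy_conj f r s\<bar> \<le> (A * D\<^sup>2 * J) * weight_r c k r * weight_r c k s" unfolding J_def by (rule airy_conj_bounds(3)[OF c k f D])
    also have "\<dots> \<le> (A * D\<^sup>2 * J) * (2 * exp (- (c / 4) * r)) * (2 * exp (- (c / 4) * s))"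
      using f(2) J weight_pos(2)[of c k] by (intro mult_mono weight_r_exp c k rs mult_nonneg_nonneg) (auto simp: less_imp_le)
    also have "\<dots> = (4 * D\<^sup>2 * J) * A * exp (- (c / 4) * r) * exp (- (c / 4) * s)" by (simp only: mult_ac)
    finally show "\<bar>airy_conj f r s\<bar> \<le> (4 * D\<^sup>2 * J) * A * exp (- (c / 4) * r) * exp (- (c / 4) * s)" .
  qed (use J in simp)
qed

lemma exp_decay2_airy_conj:
  assumes c: "c > 0" and k: "k \<ge> (1 :: nat)" and f: "f \<in> borel_measurable borel"
    and A: "0 \<le> A" "\<And>x. \<bar>f x\<bar> \<le> A * growth_env c k x"
  shows "\<exists>C. exp_decay2 (c / 4) C (airy_conj f)"
proof -
  obtain G where G: "0 \<le> G" "\<And>f A r s. f \<in> borel_measurable borel \<Longrightarrow> 0 \<le> A \<Longrightarrow> (\<And>x. \<bar>f x\<bar> \<le> A * growth_env c k x) \<Longrightarrow> 0 \<le> r \<Longrightarrow> 0 \<le> s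
     \<Longrightarrow> \<bar>airy_conj f r s\<bar> \<le> G * A * exp (- (c / 4) * r) * exp (- (c / 4) * s)" using airy_conj_exp_bound[OF c k] by blast
  obtain E where E: "0 \<le> E" "good_kernel (airy_conj f) (\<lambda>r. E * weight_r c k r)" using good_kernel_airy_conj[OF c k f A] by blast
  have "(\<lambda>(x, y). airy_conj f x y) \<in> borel_measurable (borel \<Otimes>\<^sub>M borel)"
    using borel_measurable_continuous_onI[OF good_kernelD(1)[OF E(2)]] by (simp add: borel_prod)
  then have "exp_decay2 (c / 4) (G * A) (airy_conj f)" unfolding exp_decay2_def using G(1) A(1) G(2)[OF f A] by auto
  then show ?thesis by blast
qed

lemma growth_env_exp:
  assumes c: "c > 0" and n: "1 \<le> n" "n \<le> k"
  shows "exp (real n * c * x) \<le> growth_env c k x"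
proof (cases "x \<le> 0")
  case True
  have "real n * (c * x) \<le> 1 * (c * x)" using True c n by (intro mult_right_mono_neg) (auto simp: mult_le_0_iff)
  then show ?thesis using True by (simp add: growth_env_def mult.assoc)
next
  case False
  have "real n * (c * x) \<le> real k * (c * x)" using False c n by (intro mult_right_mono) auto
  then show ?thesis using False by (simp add: growth_env_def mult.assoc)
qed

lemma exp_decay2_coeff_kernel:
  assumes c: "c > 0"
  shows "\<exists>C. exp_decay2 (c / 4) C (coeff_kernel a c n)"
proof (cases "n = 0")
  case True
  have "exp_decay2 (c / 4) 0 (\<lambda>r s. 0)" by (simp add: exp_decay2_def)
  then show ?thesis using True by (auto simp: coeff_kernel_airy_conj[OF c])
next
  case False
  have "\<exists>C. exp_decay2 (c / 4) C (airy_conj (\<lambda>x. a n * exp (real n * c * x)))"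
  proof (rule exp_decay2_airy_conj[OF c, of n])
    show "\<bar>a n * exp (real n * c * x)\<bar> \<le> \<bar>a n\<bar> * growth_env c n x" for x
      using growth_env_exp[OF c, of n n x] False by (simp add: abs_mult mult_left_mono)
  qed (use False in auto)
  then show ?thesis using False by (simp add: coeff_kernel_airy_conj[OF c])
qed

lemma airy_conj_shift: "airy_conj f (S + y) (S + z) = airy_conj (\<lambda>x. f (x - S)) y z"
proof -
  have "airy_conj (\<lambda>x. f (x - S)) y z = (LINT x|lborel. f (x - S) * (Airy_Ai ((S + y) + (x - S)) * Airy_Ai ((S + z) + (x - S))))"
    unfolding airy_conj_def by (simp add: algebra_simps)
  also have "\<dots> = airy_conj f (S + y) (S + z)" unfolding airy_conj_def by (rule lborel_shift)
  finally show ?thesis by simp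
qed

lemma tail_mass_tendsto_0:
  assumes g: "good_kernel B w"
  shows "((\<lambda>S. tail_mass w S) \<longlongrightarrow> 0) at_top"
proof -
  have "((\<lambda>S. LINT x|lborel. indicator {S..} x * (w x)\<^sup>2) \<longlongrightarrow> (LINT x|(lborel :: real measure). 0 :: real)) at_top"
  proof (rule integral_dominated_convergence_at_top[where w = "\<lambda>x. indicator {0..} x * (w x)\<^sup>2"])
    have w: "w \<in> borel_measurable borel" by (rule borel_measurable_continuous_onI[OF good_kernelD(2)[OF g]])
    then show "(\<lambda>x. indicator {S..} x * (w x)\<^sup>2) \<in> borel_measurable lborel" for S :: real by measurable
    show "integrable lborel (\<lambda>x. indicator {0..} x * (w x)\<^sup>2)" by (rule good_kernelD(4)[OF g])
    show "AE x in lborel. ((\<lambda>S. indicator {S..} x * (w x)\<^sup>2) \<longlongrightarrow> 0) at_top"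
    proof (intro AE_I2 tendsto_eventually)
      fix x :: real
      show "\<forall>\<^sub>F S in at_top. indicator {S..} x * (w x)\<^sup>2 = 0"
        using eventually_gt_at_top[of x] by eventually_elim (simp add: indicator_def)
    qed
    show "\<forall>\<^sub>F S in at_top. AE x in lborel. norm (indicator {S..} x * (w x)\<^sup>2) \<le> indicator {0..} x * (w x)\<^sup>2"
      using eventually_ge_at_top[of 0] by eventually_elim (auto simp: indicator_def)
  qed simp
  then show ?thesis by (simp add: tail_mass_def)
qed

lemma fred_det_cut_near_1:
  assumes g: "good_kernel B w"
  shows "\<exists>S0\<ge>0. \<forall>S\<ge>S0. \<bar>fred_det (cut B S) - 1\<bar> \<le> 1 / 2"
proof -
  define H where "H = (\<Sum>n. hadamard_term (tail_mass w 0) n)"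
  have H: "0 \<le> H" unfolding H_def by (intro suminf_nonneg summable_hadamard_term hadamard_term_nonneg tail_mass_nonneg)
  have "\<forall>\<^sub>F S in at_top. tail_mass w S < 1 / (2 * (H + 1))"
    using H by (intro order_tendstoD(2)[OF tail_mass_tendsto_0[OF g]]) simp
  then obtain S1 where S1: "\<And>S. S1 \<le> S \<Longrightarrow> tail_mass w S < 1 / (2 * (H + 1))" by (auto simp: eventually_at_top_linorder)
  have "\<bar>fred_det (cut B S) - 1\<bar> \<le> 1 / 2" if S: "max S1 0 \<le> S" for S
  proof -
    have "\<bar>fred_det (cut B S) - 1\<bar> \<le> tail_mass w S * (\<Sum>n. hadamard_term (tail_mass w S) n)"
      using fred_det_minus_1[OF dominated_cut[OF g, of S]] unfolding tail_mass_eq .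
    also have "\<dots> \<le> tail_mass w S * H"
      unfolding H_def using S
      by (intro mult_left_mono suminf_le hadamard_term_mono summable_hadamard_term tail_mass_nonneg tail_mass_antimono[OF g]) auto
    also have "\<dots> \<le> (1 / (2 * (H + 1))) * H" using S1[of S] S H by (intro mult_right_mono) auto
    also have "\<dots> \<le> 1 / 2" using H by (simp add: field_simps)
    finally show ?thesis .
  qed
  then show ?thesis by (intro exI[of _ "max S1 0"]) auto
qed

text \<open>The resolvent equation after translation by the threshold.\<close>

lemma fred_minor_resolvent_eq:
  assumes g: "good_kernel B w" and F: "fred_det (cut B S) \<noteq> 0" and y: "0 \<le> y"
  defines "\<rho> \<equiv> (\<lambda>y. fred_minor (cut B S) (S + y) S / fred_det (cut B S))"
  shows "\<rho> y = B (S + y) S - half_int (\<lambda>z. B (S + y) (S + z)) \<rho>"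
proof -
  let ?k = "cut B S" and ?F = "fred_det (cut B S)"
  \<comment> \<open>The minor vanishes for the first argument below the threshold.\<close>
  have z0: "fred_minor ?k z S = 0" if "z < S" for z
    using fred_minor_bound[OF dominated_cut[OF g, of S], of z S] that by (simp add: indicator_def)
  have "fred_minor ?k (S + y) S = ?k (S + y) S * ?F - (LINT z|lborel. ?k (S + y) z * fred_minor ?k z S)"
    by (rule fred_minor_eq(1)[OF dominated_cut[OF g]])
  also have "?k (S + y) S = B (S + y) S" using y by (simp add: cut_def)
  also have "(LINT z|lborel. ?k (S + y) z * fred_minor ?k z S) = (LINT z|lborel. ?k (S + y) (S + z) * fred_minor ?k (S + z) S)"
    using lborel_integral_real_affine[of 1 "\<lambda>z. ?k (S + y) z * fred_minor ?k z S" S] by simp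
  also have "\<dots> = (LINT z|lborel. ?F * (indicator {0..} z * (B (S + y) (S + z) * \<rho> z)))"
  proof (rule Bochner_Integration.integral_cong[OF refl])
    fix z
    show "?k (S + y) (S + z) * fred_minor ?k (S + z) S = ?F * (indicator {0..} z * (B (S + y) (S + z) * \<rho> z))"
      using y F z0[of "S + z"] by (auto simp: indicator_def cut_def \<rho>_def)
  qed
  also have "\<dots> = ?F * half_int (\<lambda>z. B (S + y) (S + z)) \<rho>"
    unfolding half_int_def set_lebesgue_integral_def real_scaleR_def by (rule integral_mult_right_zero)
  finally show ?thesis using F unfolding \<rho>_def by (simp add: field_simps)
qed

lemma fred_minor_exp_decay:
  assumes c: "c > 0" and k: "k \<ge> (1 :: nat)" and E: "0 \<le> E" and g: "good_kernel B (\<lambda>r. E * weight_r c k r)"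
  shows "\<exists>R. \<forall>S\<ge>0. \<bar>fred_det (cut B S) - 1\<bar> \<le> 1 / 2 \<longrightarrow> exp_decay (c / 4) R (\<lambda>y. fred_minor (cut B S) (S + y) S / fred_det (cut B S))"
proof -
  let ?w = "\<lambda>r. E * weight_r c k r"
  define H where "H = (\<Sum>n. hadamard_term (tail_mass ?w 0) n)"
  have H: "0 \<le> H" unfolding H_def by (intro suminf_nonneg summable_hadamard_term hadamard_term_nonneg tail_mass_nonneg)
  define R where "R = (2 * E) * (2 * E) * H * 2"
  have "exp_decay (c / 4) R (\<lambda>y. fred_minor (cut B S) (S + y) S / fred_det (cut B S))" if S: "0 \<le> S" and F: "\<bar>fred_det (cut B S) - 1\<bar> \<le> 1 / 2" for S
    unfolding exp_decay_def
  proof (intro conjI allI impI)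
    show "0 \<le> R" using E H by (simp add: R_def)
    note kb = dominated_cut[OF g, of S]
    have "(\<lambda>y. fred_minor (cut B S) y S) \<in> borel_measurable borel"
      unfolding fred_minor_def using fred_minor_term_measurable[OF kb] by (intro borel_measurable_suminf borel_measurable_divide) auto
    then show "(\<lambda>y. fred_minor (cut B S) (S + y) S / fred_det (cut B S)) \<in> borel_measurable borel" by measurable
    fix y :: real assume y: "0 \<le> y"
    have wb: "?w (S + z) \<le> 2 * E * exp (- (c / 4) * z)" if "0 \<le> z" for z
    proof -
      have "weight_r c k (S + z) \<le> 2 * exp (- (c / 4) * (S + z))" using S that by (intro weight_r_exp c k) auto
      also have "\<dots> \<le> 2 * exp (- (c / 4) * z)" using S c by (simp add: mult_left_mono)
      finally have "E * weight_r c k (S + z) \<le> E * (2 * exp (- (c / 4) * z))" using E by (rule mult_left_mono)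
      then show ?thesis by (simp only: mult_ac)
    qed
    have hS: "(\<Sum>n. hadamard_term (tail_mass ?w S) n) \<le> H"
      unfolding H_def using S by (intro suminf_le hadamard_term_mono summable_hadamard_term tail_mass_nonneg tail_mass_antimono[OF g]) auto
    have "\<bar>fred_minor (cut B S) (S + y) S\<bar> \<le> (indicator {S..} (S + y) * ?w (S + y)) * ?w S * (\<Sum>n. hadamard_term (tail_mass ?w S) n)"
      using fred_minor_bound[OF kb] unfolding tail_mass_eq .
    also have "\<dots> \<le> (2 * E * exp (- (c / 4) * y)) * (2 * E * exp (- (c / 4) * 0)) * H"
    proof (intro mult_mono[OF mult_mono hS])
      show "indicator {S..} (S + y) * ?w (S + y) \<le> 2 * E * exp (- (c / 4) * y)" using wb[OF y] y by simp
      show "?w S \<le> 2 * E * exp (- (c / 4) * 0)" using wb[of 0] by simp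
      show "0 \<le> (\<Sum>n. hadamard_term (tail_mass ?w S) n)" by (intro suminf_nonneg summable_hadamard_term hadamard_term_nonneg tail_mass_nonneg)
    qed (use E weight_pos(2)[of c k S] in auto)
    finally have b: "\<bar>fred_minor (cut B S) (S + y) S\<bar> \<le> (2 * E) * (2 * E) * H * exp (- (c / 4) * y)" by (simp add: mult_ac)
    have "\<bar>fred_minor (cut B S) (S + y) S / fred_det (cut B S)\<bar> \<le> \<bar>fred_minor (cut B S) (S + y) S\<bar> / (1 / 2)"
    proof -
      have "1 / 2 \<le> \<bar>fred_det (cut B S)\<bar>" using F by linarith
      then show ?thesis unfolding abs_divide by (intro divide_left_mono) auto
    qed
    also have "\<dots> \<le> R * exp (- (c / 4) * y)" using b by (simp add: R_def)
    finally show "\<bar>fred_minor (cut B S) (S + y) S / fred_det (cut B S)\<bar> \<le> R * exp (- (c / 4) * y)" .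
  qed
  then show ?thesis by blast
qed

text \<open>
  The threshold \<open>S\<close> with \<open>s = - exp (- c S)\<close>, for negative \<open>s\<close>.
\<close>

definition log_shift :: "real \<Rightarrow> real \<Rightarrow> real" where "log_shift c s = - (ln (- s) / c)"

lemma log_shift: "c > 0 \<Longrightarrow> s < 0 \<Longrightarrow> - exp (c * (x - log_shift c s)) = s * exp (c * x)"
  by (simp add: log_shift_def right_diff_distrib exp_diff exp_add distrib_left)

text \<open>
  The kernel is \<open>airy_conj\<close> of \<open>p (s exp (c x))\<close>; the remainder of the power series of \<open>p\<close>
  is integrated against the Airy functions.
\<close>

lemma kernel_expansion:
  assumes c: "c > 0" and p[measurable]: "p \<in> borel_measurable borel"
    and s: "\<forall>\<^sub>F x in at_left 0. (\<lambda>n. a (Suc n) * x ^ Suc n) sums p x"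
    and gr: "\<And>x. x \<le> 0 \<Longrightarrow> \<bar>p x\<bar> \<le> C * (1 + \<bar>x\<bar>) ^ k"
  shows "\<exists>K. \<forall>s\<in>{-1..<0}. \<forall>y\<ge>0. \<forall>z\<ge>0.
    \<bar>airy_conj (\<lambda>x. p (s * exp (c * x))) y z - (\<Sum>n\<le>N. s ^ n * coeff_kernel a c n y z)\<bar> \<le> K * \<bar>s\<bar> ^ Suc N * exp (- (c / 4) * y) * exp (- (c / 4) * z)"
proof -
  obtain T k' where T: "0 \<le> T" "Suc N \<le> k'"
    "\<And>x. x < 0 \<Longrightarrow> \<bar>p x - (\<Sum>n<N. a (Suc n) * x ^ Suc n)\<bar> \<le> T * (\<bar>x\<bar> ^ Suc N + \<bar>x\<bar> ^ k')"
    using power_series_remainder[OF s gr, of N] by blast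
  have k1: "1 \<le> k'" using T(2) by simp
  obtain G where G: "0 \<le> G" "\<And>f A r s. f \<in> borel_measurable borel \<Longrightarrow> 0 \<le> A \<Longrightarrow> (\<And>x. \<bar>f x\<bar> \<le> A * growth_env c k' x) \<Longrightarrow> 0 \<le> r \<Longrightarrow> 0 \<le> s
     \<Longrightarrow> \<bar>airy_conj f r s\<bar> \<le> G * A * exp (- (c / 4) * r) * exp (- (c / 4) * s)" using airy_conj_exp_bound[OF c k1] by blast
  obtain D where D: "D > 0" "\<And>r x. \<bar>Airy_Ai (r + x)\<bar> \<le> D * weight_r c k' r * weight_x c k' x" using Airy_weight[OF c k1] by auto
  have "\<bar>airy_conj (\<lambda>x. p (s * exp (c * x))) y z - (\<Sum>n\<le>N. s ^ n * coeff_kernel a c n y z)\<bar> \<le> (G * (2 * T)) * \<bar>s\<bar> ^ Suc N * exp (- (c / 4) * y) * exp (- (c / 4) * z)"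
    if s: "s \<in> {-1..<0}" and y: "0 \<le> y" and z: "0 \<le> z" for s y z
  proof -
    define f where "f x = p (s * exp (c * x)) - (\<Sum>n<N. s ^ Suc n * (a (Suc n) * exp (real (Suc n) * c * x)))" for x
    have fm: "f \<in> borel_measurable borel" unfolding f_def by measurable
    have fb: "\<bar>f x\<bar> \<le> (2 * T * \<bar>s\<bar> ^ Suc N) * growth_env c k' x" for x
    proof -
      have pw: "(s * exp (c * x)) ^ n = s ^ n * exp (real n * c * x)" for n
        by (simp add: power_mult_distrib exp_of_nat_mult[symmetric] mult.assoc)
      have "f x = p (s * exp (c * x)) - (\<Sum>n<N. a (Suc n) * (s * exp (c * x)) ^ Suc n)"
        unfolding f_def pw by (simp only: mult_ac)
      also have "\<bar>\<dots>\<bar> \<le> T * (\<bar>s * exp (c * x)\<bar> ^ Suc N + \<bar>s * exp (c * x)\<bar> ^ k')"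
        using s by (intro T(3)) (simp add: mult_neg_pos)
      also have "\<dots> \<le> T * (\<bar>s\<bar> ^ Suc N * growth_env c k' x + \<bar>s\<bar> ^ Suc N * growth_env c k' x)"
      proof -
        have "\<bar>s\<bar> ^ k' \<le> \<bar>s\<bar> ^ Suc N" using s T(2) by (intro power_decreasing) auto
        then show ?thesis unfolding power_abs[symmetric] pw unfolding abs_mult power_abs abs_exp_cancel
          using T(1,2) growth_env_exp[OF c, of "Suc N" k' x] growth_env_exp[OF c, of k' k' x] by (intro mult_left_mono add_mono mult_mono) auto
      qed
      also have "\<dots> = (2 * T * \<bar>s\<bar> ^ Suc N) * growth_env c k' x" by simp
      finally show ?thesis .
    qed
    have fi: "integrable lborel (\<lambda>x. f x * (Airy_Ai (y + x) * Airy_Ai (z + x)))"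
      using T(1) by (intro airy_conj_bounds(2)[OF c k1 fm _ fb D]) auto
    have ei: "integrable lborel (\<lambda>x. (a (Suc n) * exp (real (Suc n) * c * x)) * (Airy_Ai (y + x) * Airy_Ai (z + x)))" if "n < N" for n
    proof (rule airy_conj_bounds(2)[OF c k1 _ _ _ D])
      show "\<bar>a (Suc n) * exp (real (Suc n) * c * x)\<bar> \<le> \<bar>a (Suc n)\<bar> * growth_env c k' x" for x
        unfolding abs_mult abs_exp_cancel using that T(2) by (intro mult_left_mono growth_env_exp[OF c]) auto
    qed auto
    have "airy_conj (\<lambda>x. p (s * exp (c * x))) y z = (LINT x|lborel. f x * (Airy_Ai (y + x) * Airy_Ai (z + x))
        + (\<Sum>n<N. s ^ Suc n * ((a (Suc n) * exp (real (Suc n) * c * x)) * (Airy_Ai (y + x) * Airy_Ai (z + x)))))"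
      unfolding airy_conj_def f_def by (intro Bochner_Integration.integral_cong refl) (simp add: left_diff_distrib sum_distrib_right mult.assoc)
    also have "\<dots> = airy_conj f y z + (\<Sum>n<N. s ^ Suc n * airy_conj (\<lambda>x. a (Suc n) * exp (real (Suc n) * c * x)) y z)"
      unfolding airy_conj_def using fi ei
      by (subst Bochner_Integration.integral_add)
         (auto intro!: Bochner_Integration.integrable_sum integrable_mult_right simp: Bochner_Integration.integral_sum)
    also have "(\<Sum>n<N. s ^ Suc n * airy_conj (\<lambda>x. a (Suc n) * exp (real (Suc n) * c * x)) y z) = (\<Sum>n\<le>N. s ^ n * coeff_kernel a c n y z)"
    proof -
      have "(\<Sum>n\<le>N. s ^ n * coeff_kernel a c n y z) = (\<Sum>n<Suc N. s ^ n * coeff_kernel a c n y z)" by (simp only: lessThan_Suc_atMost)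
      also have "\<dots> = (\<Sum>n<N. s ^ Suc n * coeff_kernel a c (Suc n) y z)" unfolding sum.lessThan_Suc_shift by (simp add: coeff_kernel_def)
      finally show ?thesis by (simp only: coeff_kernel_airy_conj[OF c] nat.simps if_False)
    qed
    finally have "airy_conj (\<lambda>x. p (s * exp (c * x))) y z - (\<Sum>n\<le>N. s ^ n * coeff_kernel a c n y z) = airy_conj f y z" by simp
    moreover have "\<bar>airy_conj f y z\<bar> \<le> G * (2 * T * \<bar>s\<bar> ^ Suc N) * exp (- (c / 4) * y) * exp (- (c / 4) * z)"
      using T(1) by (intro G(2) fm fb y z) auto
    ultimately show ?thesis by (simp only: mult.assoc)
  qed
  then show ?thesis by blast
qed

lemma growth_env_bound:
  assumes c: "c > 0" and s: "\<forall>\<^sub>F x in at_left 0. (\<lambda>n. a (Suc n) * x ^ Suc n) sums p x"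
    and gr: "\<And>x. x \<le> 0 \<Longrightarrow> \<bar>p x\<bar> \<le> C * (1 + \<bar>x\<bar>) ^ k"
  obtains A k' where "0 \<le> A" "1 \<le> k'" "\<And>x. \<bar>p (- exp (c * x))\<bar> \<le> A * growth_env c k' x"
proof -
  obtain T k' where T: "0 \<le> T" "Suc 0 \<le> k'" "\<And>x. x < 0 \<Longrightarrow> \<bar>p x - (\<Sum>n<0. a (Suc n) * x ^ Suc n)\<bar> \<le> T * (\<bar>x\<bar> ^ Suc 0 + \<bar>x\<bar> ^ k')"
    using power_series_remainder[OF s gr, of 0] by blast
  have "\<bar>p (- exp (c * x))\<bar> \<le> (2 * T) * growth_env c k' x" for x
  proof -
    have "\<bar>p (- exp (c * x))\<bar> \<le> T * (exp (real 1 * c * x) + exp (real k' * c * x))"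
      using T(3)[of "- exp (c * x)"] by (simp add: exp_of_nat_mult[symmetric] mult.assoc)
    also have "\<dots> \<le> T * (growth_env c k' x + growth_env c k' x)" using T by (intro mult_left_mono add_mono growth_env_exp c) auto
    finally show ?thesis by simp
  qed
  then show thesis using T(1,2) by (intro that[of "2 * T" k']) auto
qed

text \<open>
  The negative logarithmic derivative of the Fredholm determinant with respect to the
  threshold is \<open>\<rho> 0\<close>, where \<open>\<rho>\<close> solves a resolvent equation on \<open>[0, \<infinity>)\<close> whose kernel
  depends on \<open>s\<close> through \<open>p (s exp (c x))\<close>.
\<close>

lemma fred_minor_ratio_asymptotics:
  assumes c: "c > 0" and p: "p \<in> borel_measurable borel"
    and s: "\<forall>\<^sub>F x in at_left 0. (\<lambda>n. a (Suc n) * x ^ Suc n) sums p x"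
    and gr: "\<And>x. x \<le> 0 \<Longrightarrow> \<bar>p x\<bar> \<le> C * (1 + \<bar>x\<bar>) ^ k"
  defines "B \<equiv> airy_conj (\<lambda>x. p (- exp (c * x)))"
  shows "\<exists>s0<0. \<forall>N. \<exists>K. \<forall>s\<in>{s0..<0}.
    \<bar>fred_minor (cut B (log_shift c s)) (log_shift c s) (log_shift c s) / fred_det (cut B (log_shift c s)) - (\<Sum>n<N. s ^ n * resolvent_coeff (coeff_kernel a c) n 0)\<bar> \<le> K * \<bar>s\<bar> ^ N"
proof -
  obtain A k' where A: "0 \<le> A" "1 \<le> k'" "\<And>x. \<bar>p (- exp (c * x))\<bar> \<le> A * growth_env c k' x" using growth_env_bound[OF c s gr] by blast
  have pm: "(\<lambda>x. p (- exp (c * x))) \<in> borel_measurable borel" using p by measurable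
  obtain E where E: "0 \<le> E" and g: "good_kernel B (\<lambda>r. E * weight_r c k' r)"
    unfolding B_def using good_kernel_airy_conj[OF c A(2) pm A(1,3)] by blast
  obtain S0 where S0: "0 \<le> S0" "\<And>S. S0 \<le> S \<Longrightarrow> \<bar>fred_det (cut B S) - 1\<bar> \<le> 1 / 2" using fred_det_cut_near_1[OF g] by blast
  obtain R where R: "\<And>S. 0 \<le> S \<Longrightarrow> \<bar>fred_det (cut B S) - 1\<bar> \<le> 1 / 2 \<Longrightarrow> exp_decay (c / 4) R (\<lambda>y. fred_minor (cut B S) (S + y) S / fred_det (cut B S))"
    using fred_minor_exp_decay[OF c A(2) E g] by blast
  define s0 where "s0 = - exp (- c * S0)"
  have s0: "- 1 \<le> s0" "s0 < 0" using S0(1) c by (auto simp: s0_def)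
  have sb: "S0 \<le> log_shift c s" if "s \<in> {s0..<0}" for s
  proof -
    have "- s \<le> exp (- c * S0)" using that by (simp add: s0_def)
    then have "ln (- s) \<le> ln (exp (- c * S0))" using that by (intro ln_mono) auto
    then show ?thesis using c by (simp add: log_shift_def field_simps)
  qed
  have "\<exists>C. \<forall>n. exp_decay2 (c / 4) (C n) (coeff_kernel a c n)" by (intro choice allI exp_decay2_coeff_kernel c)
  then obtain C' where C': "\<And>n. exp_decay2 (c / 4) (C' n) (coeff_kernel a c n)" by blast
  define Bs where "Bs s = airy_conj (\<lambda>x. p (s * exp (c * x)))" for s
  define \<rho> where "\<rho> s y = fred_minor (cut B (log_shift c s)) (log_shift c s + y) (log_shift c s) / fred_det (cut B (log_shift c s))" for s y
  have BB: "B (log_shift c s + y) (log_shift c s + z) = Bs s y z" if "s < 0" for s y z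
    unfolding B_def airy_conj_shift Bs_def log_shift[OF c that] ..
  have *: "\<exists>K. \<forall>s\<in>{s0..<0}. \<forall>y\<ge>0. \<bar>\<rho> s y - (\<Sum>n<N. s ^ n * resolvent_coeff (coeff_kernel a c) n y)\<bar> \<le> K * \<bar>s\<bar> ^ N * exp (- (c / 4) * y)" for N
  proof (rule resolvent_asymptotics[where B = Bs and C = C' and R = R])
    show "0 < c / 4" using c by simp
    show "\<bar>s\<bar> \<le> 1" if "s \<in> {s0..<0}" for s using that s0 by auto
    show "exp_decay2 (c / 4) (C' n) (coeff_kernel a c n)" for n by (rule C')
    show "coeff_kernel a c 0 = (\<lambda>y z. 0)" by (simp add: coeff_kernel_airy_conj[OF c])
    show "Bs s y \<in> borel_measurable borel" if "s \<in> {s0..<0}" for s y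
    proof -
      have Bm: "(\<lambda>(x, y). B x y) \<in> borel_measurable (borel \<Otimes>\<^sub>M borel)"
        using borel_measurable_continuous_onI[OF good_kernelD(1)[OF g]] by (simp add: borel_prod)
      have "(\<lambda>z. B (log_shift c s + y) (log_shift c s + z)) \<in> borel_measurable borel" by (rule measurable_section2[OF Bm]) auto
      then show ?thesis using that by (simp add: BB)
    qed
    show "\<exists>K. \<forall>s\<in>{s0..<0}. \<forall>y\<ge>0. \<forall>z\<ge>0. \<bar>Bs s y z - (\<Sum>n\<le>N. s ^ n * coeff_kernel a c n y z)\<bar> \<le> K * \<bar>s\<bar> ^ Suc N * exp (- (c / 4) * y) * exp (- (c / 4) * z)" for N
    proof -
      obtain K where K: "\<forall>s\<in>{-1..<0}. \<forall>y\<ge>0. \<forall>z\<ge>0.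
        \<bar>Bs s y z - (\<Sum>n\<le>N. s ^ n * coeff_kernel a c n y z)\<bar> \<le> K * \<bar>s\<bar> ^ Suc N * exp (- (c / 4) * y) * exp (- (c / 4) * z)"
        unfolding Bs_def using kernel_expansion[OF c p s gr, of N] by blast
      have "{s0..<0} \<subseteq> {-1..<0}" using s0 by auto
      then show ?thesis using K by blast
    qed
    show "exp_decay (c / 4) R (\<rho> s)" if "s \<in> {s0..<0}" for s
      unfolding \<rho>_def using sb[OF that] S0 by (intro R) auto
    show "\<rho> s y = Bs s y 0 - half_int (Bs s y) (\<rho> s)" if s: "s \<in> {s0..<0}" and y: "0 \<le> y" for s y
    proof -
      have "fred_det (cut B (log_shift c s)) \<noteq> 0" using S0(2)[OF sb[OF s]] by auto
      from fred_minor_resolvent_eq[OF g this y]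
      have "\<rho> s y = B (log_shift c s + y) (log_shift c s) - half_int (\<lambda>z. B (log_shift c s + y) (log_shift c s + z)) (\<rho> s)" unfolding \<rho>_def .
      then show ?thesis using BB[of s y 0] BB[of s y] s by simp
    qed
  qed
  have "\<exists>K. \<forall>s\<in>{s0..<0}. \<bar>\<rho> s 0 - (\<Sum>n<N. s ^ n * resolvent_coeff (coeff_kernel a c) n 0)\<bar> \<le> K * \<bar>s\<bar> ^ N" for N
  proof -
    obtain K where "\<And>s y. s \<in> {s0..<0} \<Longrightarrow> 0 \<le> y \<Longrightarrow> \<bar>\<rho> s y - (\<Sum>n<N. s ^ n * resolvent_coeff (coeff_kernel a c) n y)\<bar> \<le> K * \<bar>s\<bar> ^ N * exp (- (c / 4) * y)"
      using * by blast
    from this[of _ 0] show ?thesis by (intro exI[of _ K]) simp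
  qed
  then show ?thesis unfolding \<rho>_def add_0_right using s0(2) by blast
qed

section \<open>The logarithm of the expectation\<close>

text \<open>
  For \<open>\<beta> \<ge> 0\<close> the function \<open>exp (\<beta> g)\<close> is even bounded on the negative half-line, since
  \<open>g\<close> is bounded above there.
\<close>

lemma exp_minus_1_growth:
  fixes g :: "real \<Rightarrow> real"
  assumes g_bdd: "\<And>r. bdd_above (g ` {r..0})"
    and g_lim: "((\<lambda>x. ereal (g x)) \<longlongrightarrow> g_inf) at_bot" and g_inf: "g_inf < 0"
    and g_growth: "\<beta> < 0 \<Longrightarrow> \<exists>C k. \<forall>x\<le>0. exp (\<beta> * g x) \<le> C * (1 + \<bar>x\<bar>) ^ k"
  obtains C k where "\<And>x. x \<le> 0 \<Longrightarrow> \<bar>exp (\<beta> * g x) - 1\<bar> \<le> C * (1 + \<bar>x\<bar>) ^ k"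
proof -
  have "\<exists>C k. \<forall>x\<le>0. exp (\<beta> * g x) \<le> C * (1 + \<bar>x\<bar>) ^ k"
  proof (cases "\<beta> < 0")
    case False
    have "\<forall>\<^sub>F x in at_bot. ereal (g x) < 0" by (rule order_tendstoD(2)[OF g_lim g_inf])
    then obtain r where r: "\<And>x. x \<le> r \<Longrightarrow> g x < 0" by (auto simp: eventually_at_bot_linorder)
    obtain G where G: "\<And>x. r \<le> x \<Longrightarrow> x \<le> 0 \<Longrightarrow> g x \<le> G" using bdd_above.E[OF g_bdd[of r]] by (metis atLeastAtMost_iff imageI)
    have "g x \<le> \<bar>G\<bar>" if "x \<le> 0" for x using r[of x] G[of x] that by linarith
    then have "exp (\<beta> * g x) \<le> exp (\<beta> * \<bar>G\<bar>) * (1 + \<bar>x\<bar>) ^ 0" if "x \<le> 0" for x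
      using that False by (simp add: mult_left_mono)
    then show ?thesis by blast
  qed (use g_growth in blast)
  then obtain C k where Ck: "\<And>x. x \<le> 0 \<Longrightarrow> exp (\<beta> * g x) \<le> C * (1 + \<bar>x\<bar>) ^ k" by blast
  have "\<bar>exp (\<beta> * g x) - 1\<bar> \<le> (C + 1) * (1 + \<bar>x\<bar>) ^ k" if x: "x \<le> 0" for x
  proof -
    have "1 \<le> (1 + \<bar>x\<bar>) ^ k" by (rule one_le_power) simp
    then show ?thesis using Ck[OF x] exp_gt_zero[of "\<beta> * g x"] unfolding distrib_right by (intro abs_leI) linarith+
  qed
  then show thesis by (rule that)
qed

text \<open>
  Summability of \<open>exp (\<beta> u) - 1\<close> gives summability of \<open>\<beta> u\<close>, since the logarithm is
  Lipschitz near \<open>1\<close>. For \<open>\<beta> = 0\<close> the series of \<open>u\<close> may diverge, but both sides are \<open>1\<close>.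
\<close>

lemma prod_exp_tendsto:
  fixes u :: "nat \<Rightarrow> real"
  assumes s: "summable (\<lambda>j. \<bar>exp (\<beta> * u j) - 1\<bar>)"
  shows "(\<lambda>m. \<Prod>j<m. 1 + (exp (\<beta> * u j) - 1)) \<longlonglongrightarrow> exp (\<beta> * (\<Sum>j. u j))"
proof (cases "\<beta> = 0")
  case False
  have "(\<lambda>j. \<bar>exp (\<beta> * u j) - 1\<bar>) \<longlonglongrightarrow> 0" by (rule summable_LIMSEQ_zero[OF s])
  then have "\<forall>\<^sub>F j in sequentially. \<bar>exp (\<beta> * u j) - 1\<bar> < 1 / 2" by (rule order_tendstoD) simp
  then have "\<forall>\<^sub>F j in sequentially. norm (\<beta> * u j) \<le> 2 * \<bar>exp (\<beta> * u j) - 1\<bar>"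
  proof eventually_elim
    case (elim j)
    let ?y = "exp (\<beta> * u j) - 1"
    have "\<bar>ln (1 + ?y) - ?y\<bar> \<le> 2 * ?y\<^sup>2" using elim by (intro abs_ln_one_plus_x_minus_x_bound) simp
    also have "2 * ?y\<^sup>2 = 2 * \<bar>?y\<bar> * \<bar>?y\<bar>" by (simp add: power2_eq_square)
    also have "\<dots> \<le> 1 * \<bar>?y\<bar>" using elim by (intro mult_right_mono) auto
    finally have "\<bar>\<beta> * u j - ?y\<bar> \<le> \<bar>?y\<bar>" by simp
    moreover have "\<bar>b - y\<bar> \<le> \<bar>y\<bar> \<Longrightarrow> \<bar>b\<bar> \<le> 2 * \<bar>y\<bar>" for b y :: real by linarith
    ultimately show ?case unfolding real_norm_def by blast
  qed
  then have "summable (\<lambda>j. \<beta> * u j)" by (rule summable_comparison_test_ev) (intro summable_mult s)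
  then have "summable u" using False by (simp add: summable_cmult_iff)
  then have "(\<lambda>m. \<Sum>j<m. u j) \<longlonglongrightarrow> (\<Sum>j. u j)" by (rule summable_LIMSEQ)
  then have "(\<lambda>m. exp (\<beta> * (\<Sum>j<m. u j))) \<longlonglongrightarrow> exp (\<beta> * (\<Sum>j. u j))" by (intro tendsto_intros)
  then show ?thesis by (simp add: sum_distrib_left exp_sum)
qed simp

lemma airy_q_eq:
  assumes airy: "airy_point_process M X" and t: "t > 0"
    and g[measurable]: "g \<in> borel_measurable borel"
    and k: "1 \<le> k" and A: "0 \<le> A" "\<And>x. \<bar>exp (\<beta> * g (- exp (root 3 t * x))) - 1\<bar> \<le> A * growth_env (root 3 t) k x"
    and s: "s < 0"
  defines "F \<equiv> fred_det (cut (airy_conj (\<lambda>x. exp (\<beta> * g (- exp (root 3 t * x))) - 1)) (log_shift (root 3 t) s))"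
  shows "airy_q M X g t \<beta> s = ln F" and "F > 0"
proof -
  define c where "c = root 3 t"
  have c: "c > 0" using t by (simp add: c_def)
  define S where "S = log_shift c s"
  define f where "f x = exp (\<beta> * g (- exp (c * x))) - 1" for x
  have fm: "f \<in> borel_measurable borel" unfolding f_def by measurable
  have fb: "\<bar>f x\<bar> \<le> A * growth_env c k x" for x using A(2)[of x] by (simp add: f_def c_def)
  have fS: "f (x - S) = exp (\<beta> * g (s * exp (c * x))) - 1" for x unfolding f_def S_def log_shift[OF c s] ..
  have hm: "(\<lambda>x. f (x - S)) \<in> borel_measurable borel" using fm by measurable
  define Y where "Y \<omega> = exp (\<beta> * (\<Sum>j. g (s * exp (c * X j \<omega>))))" for \<omega>
  have dp: "determinantal_process Airy_kernel M X" using airy by (simp add: airy_point_process_def)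
  then interpret prob_space M by (simp add: determinantal_process_def)
  have [measurable]: "X j \<in> borel_measurable M" for j using dp by (simp add: determinantal_process_def)
  have Ym: "Y \<in> borel_measurable M" unfolding Y_def by measurable
  note dpe = det_process_expectation[OF dp Airy_kernel_measurable Airy_kernel_det_bounds hm fred_det_Airy_eq(2)[OF c k fm A(1) fb]]
  have lim: "AE \<omega> in M. (\<lambda>m. \<Prod>j<m. 1 + f (X j \<omega> - S)) \<longlonglongrightarrow> Y \<omega>"
    using dpe(1) by eventually_elim (unfold Y_def fS, rule prod_exp_tendsto)
  have int: "integrable M Y" by (rule dpe(2)[OF Ym lim])
  have F: "(LINT \<omega>|M. Y \<omega>) = F"
    using trans[OF dpe(3)[OF Ym lim] fred_det_Airy_eq(1)[OF c k fm A(1) fb]] by (simp add: F_def S_def f_def[abs_def] c_def)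
  then show "airy_q M X g t \<beta> s = ln F" unfolding airy_q_def Y_def c_def by simp
  \<comment> \<open>The integrand is strictly positive.\<close>
  have "(LINT \<omega>|M. Y \<omega>) \<noteq> 0"
  proof
    assume "(LINT \<omega>|M. Y \<omega>) = 0"
    then have "AE \<omega> in M. Y \<omega> = 0" using int by (subst (asm) integral_nonneg_eq_0_iff_AE) (auto simp: Y_def)
    then show False by (simp add: Y_def)
  qed
  moreover have "0 \<le> (LINT \<omega>|M. Y \<omega>)" by (intro Bochner_Integration.integral_nonneg) (simp add: Y_def)
  ultimately show "F > 0" unfolding F by simp
qed

lemma q_deriv_series_nth:
  assumes t: "t > 0"
  shows "fps_nth (q_deriv_series t a) n = resolvent_coeff (coeff_kernel a (root 3 t)) (Suc n) 0 / root 3 t"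
proof -
  define c where "c = root 3 t"
  \<comment> \<open>The sixth root of \<open>t\<close>.\<close>
  define h where "h = sqrt c"
  have c: "c > 0" using t by (simp add: c_def)
  have h: "h > 0" "h\<^sup>2 = c" using c by (auto simp: h_def)
  have c3: "c ^ 3 = t" using t by (simp add: c_def)
  have h6: "h ^ 6 = t" using power_mult[of h 2 3] c3 h(2) by simp
  have h3: "sqrt t = h ^ 3" using h(1) power_mult[of h 3 2] h6 by (intro real_sqrt_unique) auto
  have "fps_nth (q_deriv_series t a) n = (1 / sqrt t) * (exp (t * real (Suc n) ^ 3 / 12) * fps_nth (bracket_series t a) (Suc n))"
    by (simp add: q_deriv_series_def exp_cubic_euler_def)
  moreover have "resolvent_coeff (coeff_kernel a c) (Suc n) 0 = (1 / h) * (exp (t * real (Suc n) ^ 3 / 12) * fps_nth (bracket_series t a) (Suc n))"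
    using resolvent_coeff_bracket[OF h(1) h3, of a "Suc n"] unfolding h h6 .
  moreover have "sqrt t = h * c" unfolding h3 h(2)[symmetric] by (simp add: power2_eq_square power3_eq_cube)
  ultimately show ?thesis unfolding c_def[symmetric] by simp
qed

theorem mainTheorem2:
  fixes M :: "'w measure" and X :: "nat \<Rightarrow> 'w \<Rightarrow> real"
    and g :: "real \<Rightarrow> real" and a :: "nat \<Rightarrow> real" and t \<beta> :: real and g_inf :: ereal
  assumes airy: "airy_point_process M X"
    and t: "t > 0"
    and g_meas: "g \<in> borel_measurable borel"
    and g_bdd: "\<And>r. bdd_above (g ` {r..0})"
    and g_0: "g 0 = 0"
    and g_lim: "((\<lambda>x. ereal (g x)) \<longlongrightarrow> g_inf) at_bot"
    and g_inf: "g_inf < 0"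
    and g_growth: "\<beta> < 0 \<Longrightarrow> \<exists>C k. \<forall>x\<le>0. exp (\<beta> * g x) \<le> C * (1 + \<bar>x\<bar>) ^ k"
    and a: "\<forall>\<^sub>F x in at_left 0. (\<lambda>n. a (Suc n) * x ^ Suc n) sums (exp (\<beta> * g x) - 1)"
  shows "(\<forall>\<sigma><0. airy_q M X g t \<beta> differentiable (at \<sigma>)) \<and>
    (\<forall>N. (\<lambda>\<sigma>. deriv (airy_q M X g t \<beta>) \<sigma>
              - (\<Sum>n<N. fps_nth (q_deriv_series t a) n * \<sigma> ^ n))
          \<in> O[at_left 0](\<lambda>\<sigma>. \<sigma> ^ N))"
proof -
  define c where "c = root 3 t"
  have c: "c > 0" using t by (simp add: c_def)
  define p where "p x = exp (\<beta> * g x) - 1" for x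
  have pm: "p \<in> borel_measurable borel" unfolding p_def using g_meas by measurable
  obtain C k where gr: "\<And>x. x \<le> 0 \<Longrightarrow> \<bar>p x\<bar> \<le> C * (1 + \<bar>x\<bar>) ^ k"
    unfolding p_def using exp_minus_1_growth[OF g_bdd g_lim g_inf g_growth] by blast
  have s: "\<forall>\<^sub>F x in at_left 0. (\<lambda>n. a (Suc n) * x ^ Suc n) sums p x" using a by (simp add: p_def)
  obtain A k' where A: "0 \<le> A" "1 \<le> k'" "\<And>x. \<bar>p (- exp (c * x))\<bar> \<le> A * growth_env c k' x" using growth_env_bound[OF c s gr] by blast
  define B where "B = airy_conj (\<lambda>x. p (- exp (c * x)))"
  have "(\<lambda>x. p (- exp (c * x))) \<in> borel_measurable borel" using pm by measurable
  then obtain E where g: "good_kernel B (\<lambda>r. E * weight_r c k' r)"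
    unfolding B_def using good_kernel_airy_conj[OF c A(2) _ A(1,3)] by blast
  define F where "F S = fred_det (cut B S)" for S
  define R where "R S = fred_minor (cut B S) S S" for S
  let ?q = "airy_q M X g t \<beta>"
  have q: "?q s = ln (F (log_shift c s))" "F (log_shift c s) > 0" if "s < 0" for s
    using airy_q_eq[OF airy t g_meas A(2,1) _ that, of \<beta>] A(3) unfolding p_def c_def F_def B_def by auto
  have dF: "(F has_real_derivative - R S) (at S)" for S unfolding F_def[abs_def] R_def by (rule fred_det_cut_deriv[OF g])
  have dq: "(?q has_real_derivative (R (log_shift c s) / F (log_shift c s)) / (c * s)) (at s)" if s: "s < 0" for s
  proof (rule has_field_derivative_transform_within_open[of "\<lambda>s. ln (F (log_shift c s))" _ _ "{..<0}"])
    have "(log_shift c has_real_derivative - 1 / (c * s)) (at s)"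
      unfolding log_shift_def[abs_def] using s c by (auto intro!: derivative_eq_intros simp: field_simps)
    then have "((\<lambda>s. F (log_shift c s)) has_real_derivative - R (log_shift c s) * (- 1 / (c * s))) (at s)" by (rule DERIV_chain2[OF dF])
    then show "((\<lambda>s. ln (F (log_shift c s))) has_real_derivative (R (log_shift c s) / F (log_shift c s)) / (c * s)) (at s)"
      using q(2)[OF s] s c by (auto intro!: derivative_eq_intros simp: field_simps)
  qed (use s q(1) in auto)
  obtain s0 where s0: "s0 < 0" "\<And>N. \<exists>K. \<forall>s\<in>{s0..<0}. \<bar>R (log_shift c s) / F (log_shift c s) - (\<Sum>n<N. s ^ n * resolvent_coeff (coeff_kernel a c) n 0)\<bar> \<le> K * \<bar>s\<bar> ^ N"
    using fred_minor_ratio_asymptotics[OF c pm s gr] unfolding B_def[symmetric] F_def[symmetric] R_def[symmetric] by blast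
  show ?thesis
  proof (intro conjI allI impI)
    fix s :: real assume "s < 0"
    then show "?q differentiable (at s)" using dq real_differentiable_def by blast
  next
    fix N
    obtain K where K: "\<And>s. s \<in> {s0..<0} \<Longrightarrow> \<bar>R (log_shift c s) / F (log_shift c s) - (\<Sum>n<Suc N. s ^ n * resolvent_coeff (coeff_kernel a c) n 0)\<bar> \<le> K * \<bar>s\<bar> ^ Suc N"
      using s0(2) by blast
    have "\<bar>deriv ?q s - (\<Sum>n<N. fps_nth (q_deriv_series t a) n * s ^ n)\<bar> \<le> (K / c) * \<bar>s ^ N\<bar>" if s: "s \<in> {s0..<0}" for s
    proof -
      \<comment> \<open>The coefficient of degree 0 vanishes, so that division by \<open>c s\<close> lowers all
      degrees by one.\<close>
      have "(\<Sum>n<Suc N. s ^ n * resolvent_coeff (coeff_kernel a c) n 0) = (\<Sum>n<N. s ^ Suc n * resolvent_coeff (coeff_kernel a c) (Suc n) 0)"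
        unfolding sum.lessThan_Suc_shift by (simp add: resolvent_coeff.simps[of _ 0] coeff_kernel_def)
      also have "\<dots> = (c * s) * (\<Sum>n<N. fps_nth (q_deriv_series t a) n * s ^ n)"
        unfolding q_deriv_series_nth[OF t] c_def[symmetric] using c by (simp add: sum_distrib_left mult_ac)
      finally have su: "(\<Sum>n<Suc N. s ^ n * resolvent_coeff (coeff_kernel a c) n 0) = (c * s) * (\<Sum>n<N. fps_nth (q_deriv_series t a) n * s ^ n)" .
      have "deriv ?q s - (\<Sum>n<N. fps_nth (q_deriv_series t a) n * s ^ n)
          = (R (log_shift c s) / F (log_shift c s) - (\<Sum>n<Suc N. s ^ n * resolvent_coeff (coeff_kernel a c) n 0)) / (c * s)"
        using s c DERIV_imp_deriv[OF dq[of s]] unfolding su by (simp add: diff_divide_distrib)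
      also have "\<bar>\<dots>\<bar> \<le> (K * \<bar>s\<bar> ^ Suc N) / \<bar>c * s\<bar>" unfolding abs_divide by (intro divide_right_mono K s) simp
      also have "\<dots> = (K / c) * \<bar>s ^ N\<bar>" using s c by (simp add: abs_mult power_abs)
      finally show ?thesis .
    qed
    then have "\<forall>\<^sub>F s in at_left 0. norm (deriv ?q s - (\<Sum>n<N. fps_nth (q_deriv_series t a) n * s ^ n)) \<le> (K / c) * norm (s ^ N)"
      using s0(1) unfolding eventually_at_left_field by (intro exI[of _ s0]) auto
    then show "(\<lambda>s. deriv ?q s - (\<Sum>n<N. fps_nth (q_deriv_series t a) n * s ^ n)) \<in> O[at_left 0](\<lambda>s. s ^ N)"
      by (rule bigoI)
  qed
qed

end
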